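(* Let $B,C\subset\mathbb{P}^2$ be integral curves over $\mathbb{C}$, each of degree at least $2$, such that $B\cap C=\{q\}$ for a single point $q$. Assume that $q$ is a $(1,l)$-point for $B$ and an $(m,n)$-point for $C$. Then $n=lm$, and the $\delta$-invariant of $q$ on $C$ satisfies $$\delta_C(q)\geq \frac{(m-1)(\deg B\cdot\deg C-m)}{2}.$$
   Context: We work over $\mathbb{C}$; a curve is integral if it is reduced and irreducible. For an integral curve $C$ with normalization $\nu_C:C^\nu\to C$, a point $q\in C$ is unibranch if $|\nu_C^{-1}(q)|=1$; $\mathrm{mult}_q(C)$ is the multiplicity of $C$ at $q$, and $(C\cdot D)_q$ is the intersection multiplicity at $q$. For an integral plane curve $C$ of degree at least $2$, a point $q\in C$ is an $(m,n)$-point of $C$ if $q$ is a unibranch point of $C$, $m=\mathrm{mult}_q(C)$, and $n=(C\cdot L)_q$, where $L$ is the (well-defined) tangent line to $C$ at $q$. The $\delta$-invariant is $\delta_C(q)=p_a(C)-p_a(C^\nu_q)$, where $C^\nu_q$ is the partial normalization of $C$ at $q$ and $p_a$ denotes arithmetic genus. *)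

theory Defs
  imports
    "HOL-Analysis.Cartesian_Space"
    "HOL-Computational_Algebra.Polynomial_Factorial"
    "HOL-Computational_Algebra.Fraction_Field"
    "HOL-Algebra.QuotRing"
    "HOL-Algebra.Ideal_Product"
    "HOL-Algebra.Polynomials"
    "HOL-Algebra.Module"
begin

section \<open>The projective plane and forms in three variables\<close>

type_synonym tpoly = "complex poly poly poly"

text \<open>The three coordinates are ordered from the outermost polynomial variable to the innermost.\<close>

definition teval :: "tpoly \<Rightarrow> complex ^ 3 \<Rightarrow> complex" where
  "teval P v = poly (poly (poly P [:[:v $ 1:]:]) [:v $ 2:]) (v $ 3)"

definition tconst :: "complex \<Rightarrow> tpoly" where
  "tconst c = [:[:[:c:]:]:]"

definition homogeneous :: "nat \<Rightarrow> tpoly \<Rightarrow> bool" where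
  "homogeneous d P \<longleftrightarrow>
     (\<forall>i j k. poly.coeff (poly.coeff (poly.coeff P i) j) k \<noteq> 0 \<longrightarrow> i + j + k = d)"

typedef proj_plane = "{U :: (complex ^ 3) set. vec.subspace U \<and> vec.dim U = 1}"
  morphisms line_of Abs_proj_plane
proof -
  have "vec.dim (vec.span {axis 1 1 :: complex ^ 3}) = 1"
    by (subst vec.dim_span, subst vec.dim_eq_card_independent)
       (auto simp: vec.independent_insert axis_eq_0_iff)
  then show ?thesis by (blast intro: vec.subspace_span)
qed

text \<open>Only used for homogeneous polynomials; for these, vanishing on the line is the same as
  vanishing at any one nonzero vector of the line.\<close>

definition vanishes :: "tpoly \<Rightarrow> proj_plane \<Rightarrow> bool" where
  "vanishes P p \<longleftrightarrow> (\<forall>v \<in> line_of p. teval P v = 0)"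

section \<open>Plane curves and local rings of the plane\<close>

text \<open>A curve of degree \<open>d\<close> is the zero scheme of a form of degree \<open>d\<close>, which is determined up to
  a nonzero constant; the curve is reduced and irreducible iff the form is irreducible. (An
  irreducible polynomial is not a constant, so the degree is positive.)\<close>

definition integral_plane_curve :: "nat \<Rightarrow> tpoly \<Rightarrow> bool" where
  "integral_plane_curve d F \<longleftrightarrow> homogeneous d F \<and> Factorial_Ring.irreducible F"

definition points :: "tpoly \<Rightarrow> proj_plane set" where
  "points F = {p. vanishes F p}"

text \<open>Rational functions on the plane are the degree-zero fractions in the following algebra.
  HOL-Algebra's \<open>module\<close> records contain the ring operations, so they also serve as
  records for complex algebras.\<close>

definition fractions :: "(complex, tpoly fract) module" where
  "fractions = \<lparr>carrier = UNIV, mult = (*), one = 1, zero = 0, add = (+),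
                smult = (\<lambda>c x. Fract (tconst c) 1 * x)\<rparr>"

text \<open>The local ring of the plane at a point, and its maximal ideal.\<close>

definition local_ring :: "proj_plane \<Rightarrow> (complex, tpoly fract) module" where
  "local_ring p = fractions\<lparr>carrier :=
     {Fract P Q |P Q d. homogeneous d P \<and> homogeneous d Q \<and> \<not> vanishes Q p}\<rparr>"

definition max_ideal :: "proj_plane \<Rightarrow> tpoly fract set" where
  "max_ideal p =
     {Fract P Q |P Q d. homogeneous d P \<and> homogeneous d Q \<and> \<not> vanishes Q p \<and> vanishes P p}"

text \<open>The ideal of \<open>local_ring p\<close> generated by a local equation of the curve \<open>F\<close>.\<close>

definition ideal_at :: "tpoly \<Rightarrow> proj_plane \<Rightarrow> tpoly fract set" where
  "ideal_at F p =
     {Fract P Q |P Q d. homogeneous d P \<and> homogeneous d Q \<and> \<not> vanishes Q p \<and> F dvd P}"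

definition max_ideal_pow :: "proj_plane \<Rightarrow> nat \<Rightarrow> tpoly fract set" where
  "max_ideal_pow p r = max_ideal p [^]\<^bsub>ideals_set (local_ring p)\<^esub> r"

section \<open>Dimensions of quotient spaces\<close>

text \<open>The dimension of \<open>M / W\<close> over the complex numbers, as the length of a basis of \<open>M\<close> modulo
  the subspace \<open>W\<close>. It is only applied to finite-dimensional quotients.\<close>

definition quotient_dim :: "(complex, 'v) module \<Rightarrow> 'v set \<Rightarrow> nat" where
  "quotient_dim M W = (THE n. \<exists>b \<in> {..<n} \<rightarrow> carrier M. \<forall>v \<in> carrier M.
     \<exists>!c. c \<in> {..<n} \<rightarrow>\<^sub>E UNIV \<and> v \<ominus>\<^bsub>M\<^esub> (\<Oplus>\<^bsub>M\<^esub>i \<in> {..<n}. c i \<odot>\<^bsub>M\<^esub> b i) \<in> W)"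

section \<open>Multiplicity, intersection multiplicity and tangent lines\<close>

definition curve_mult :: "tpoly \<Rightarrow> proj_plane \<Rightarrow> nat" where
  "curve_mult F p = (GREATEST r. ideal_at F p \<subseteq> max_ideal_pow p r)"

definition int_mult :: "tpoly \<Rightarrow> tpoly \<Rightarrow> proj_plane \<Rightarrow> nat" where
  "int_mult F G p =
     quotient_dim (local_ring p) (ideal_at F p <+>\<^bsub>local_ring p\<^esub> ideal_at G p)"

text \<open>A line through \<open>p\<close> is tangent to \<open>F\<close> if it is a component of the tangent cone: in the
  associated graded ring of \<open>local_ring p\<close>, the initial form of a local equation of \<open>L\<close> divides
  that of a local equation of \<open>F\<close>. The latter has degree \<open>r\<close>, the multiplicity.\<close>

definition tangent_line :: "tpoly \<Rightarrow> proj_plane \<Rightarrow> tpoly \<Rightarrow> bool" where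
  "tangent_line F p L \<longleftrightarrow> L \<noteq> 0 \<and> homogeneous 1 L \<and> vanishes L p \<and>
     (let R = local_ring p; r = curve_mult F p in
       ideal_at F p \<subseteq> ideal_prod R (ideal_at L p) (max_ideal_pow p (r - 1))
                         <+>\<^bsub>R\<^esub> max_ideal_pow p (r + 1))"

section \<open>The function field and the normalization\<close>

text \<open>The local ring of the plane at the generic point of the curve \<open>F\<close>, its maximal ideal, and its
  residue field, which is the function field of the curve.\<close>

definition generic_ring :: "tpoly \<Rightarrow> (complex, tpoly fract) module" where
  "generic_ring F = fractions\<lparr>carrier :=
     {Fract P Q |P Q d. homogeneous d P \<and> homogeneous d Q \<and> \<not> F dvd Q}\<rparr>"

definition generic_ideal :: "tpoly \<Rightarrow> tpoly fract set" where
  "generic_ideal F =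
     {Fract P Q |P Q d. homogeneous d P \<and> homogeneous d Q \<and> \<not> F dvd Q \<and> F dvd P}"

definition function_field :: "tpoly \<Rightarrow> (complex, tpoly fract set) module" where
  "function_field F =
     (let R = generic_ring F; I = generic_ideal F; K = R Quot I in
      \<lparr>carrier = carrier K, mult = mult K, one = one K, zero = zero K, add = add K,
       smult = (\<lambda>c x. (I +>\<^bsub>R\<^esub> (c \<odot>\<^bsub>R\<^esub> \<one>\<^bsub>R\<^esub>)) \<otimes>\<^bsub>K\<^esub> x)\<rparr>)"

text \<open>The local ring of the curve \<open>F\<close> at \<open>p\<close>, as a subring of its function field.\<close>

definition stalk :: "tpoly \<Rightarrow> proj_plane \<Rightarrow> tpoly fract set set" where
  "stalk F p = (\<lambda>x. generic_ideal F +>\<^bsub>generic_ring F\<^esub> x) ` carrier (local_ring p)"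

definition integral_closure :: "('a, 'b) ring_scheme \<Rightarrow> 'a set \<Rightarrow> 'a set" where
  "integral_closure K A = {x \<in> carrier K.
     \<exists>p. polynomial\<^bsub>K\<^esub> A p \<and> p \<noteq> [] \<and> hd p = \<one>\<^bsub>K\<^esub> \<and> ring.eval K p x = \<zero>\<^bsub>K\<^esub>}"

definition localization :: "('a, 'b) ring_scheme \<Rightarrow> 'a set \<Rightarrow> 'a set \<Rightarrow> 'a set" where
  "localization K A M = {a \<otimes>\<^bsub>K\<^esub> inv\<^bsub>K\<^esub> s |a s. a \<in> A \<and> s \<in> A - M}"

text \<open>Integral curves with function field \<open>K\<close> are given by the sets of local rings, inside \<open>K\<close>, of
  their closed points. The points of the normalization over \<open>p\<close> correspond to the maximal ideals of
  the integral closure of \<open>stalk F p\<close>, all of which lie over the maximal ideal of \<open>stalk F p\<close>.\<close>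

definition normalization_fibre :: "tpoly \<Rightarrow> proj_plane \<Rightarrow> tpoly fract set set set" where
  "normalization_fibre F p =
     (let K = function_field F; A = integral_closure K (stalk F p) in
      {localization K A M |M. maximalideal M (K\<lparr>carrier := A\<rparr>)})"

definition curve_model :: "tpoly \<Rightarrow> tpoly fract set set set" where
  "curve_model F = stalk F ` points F"

definition partial_normalization :: "tpoly \<Rightarrow> proj_plane \<Rightarrow> tpoly fract set set set" where
  "partial_normalization F q = stalk F ` (points F - {q}) \<union> normalization_fibre F q"

definition unibranch :: "tpoly \<Rightarrow> proj_plane \<Rightarrow> bool" where
  "unibranch F q \<longleftrightarrow> vanishes F q \<and> card (normalization_fibre F q) = 1"

definition mn_point :: "tpoly \<Rightarrow> proj_plane \<Rightarrow> nat \<Rightarrow> nat \<Rightarrow> bool" where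
  "mn_point F q m n \<longleftrightarrow> unibranch F q \<and> m = curve_mult F q \<and>
     (\<exists>L. tangent_line F q L \<and> n = int_mult F L q)"

section \<open>Arithmetic genus and the delta invariant\<close>

text \<open>For an integral complete curve \<open>T\<close> with function field \<open>K\<close>, the structure sheaf has the
  flasque resolution by the constant sheaf \<open>K\<close> and the direct sum of the skyscraper sheaves
  \<open>K / A\<close>, where \<open>A\<close> ranges over the local rings of \<open>T\<close>. Hence \<open>H^0\<close> is the intersection of the
  local rings, and \<open>H^1\<close> is the space of repartitions modulo the sum of the subspaces of everywhere
  regular and of constant repartitions.\<close>

definition repartitions ::
    "(complex, 'a) module \<Rightarrow> 'a set set \<Rightarrow> (complex, 'a set \<Rightarrow> 'a) module" where
  "repartitions K T =
     \<lparr>carrier = {r \<in> T \<rightarrow>\<^sub>E carrier K. finite {A \<in> T. r A \<notin> A}},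
      mult = (\<lambda>r s. \<lambda>A\<in>T. r A \<otimes>\<^bsub>K\<^esub> s A), one = (\<lambda>A\<in>T. \<one>\<^bsub>K\<^esub>),
      zero = (\<lambda>A\<in>T. \<zero>\<^bsub>K\<^esub>), add = (\<lambda>r s. \<lambda>A\<in>T. r A \<oplus>\<^bsub>K\<^esub> s A),
      smult = (\<lambda>c r. \<lambda>A\<in>T. c \<odot>\<^bsub>K\<^esub> r A)\<rparr>"

definition h0 :: "(complex, 'a) module \<Rightarrow> 'a set set \<Rightarrow> nat" where
  "h0 K T = quotient_dim (K\<lparr>carrier := carrier K \<inter> \<Inter>T\<rparr>) {\<zero>\<^bsub>K\<^esub>}"

definition h1 :: "(complex, 'a) module \<Rightarrow> 'a set set \<Rightarrow> nat" where
  "h1 K T = quotient_dim (repartitions K T)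
     {r \<in> carrier (repartitions K T). \<exists>f \<in> carrier K. \<forall>A \<in> T. r A \<ominus>\<^bsub>K\<^esub> f \<in> A}"

text \<open>One minus the Euler characteristic of the structure sheaf.\<close>

definition arithmetic_genus :: "(complex, 'a) module \<Rightarrow> 'a set set \<Rightarrow> int" where
  "arithmetic_genus K T = 1 - (int (h0 K T) - int (h1 K T))"

definition delta_invariant :: "tpoly \<Rightarrow> proj_plane \<Rightarrow> int" where
  "delta_invariant F q =
     arithmetic_genus (function_field F) (curve_model F) -
     arithmetic_genus (function_field F) (partial_normalization F q)"

end

theory Submission
  imports Defs "HOL-Algebra.Algebraic_Closure_Type"
begin

text \<open>
  Let \<open>O\<close> be the local ring of \<open>C\<close> at \<open>q\<close>, \<open>A\<close> its integral closure, and \<open>g \<in> O\<close> a local equation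
  of \<open>B\<close>. As \<open>B\<close> and \<open>C\<close> meet only in \<open>q\<close>, comparing dimensions of spaces of forms gives the
  Bezout inequality \<open>N = dim O/gO \<ge> deg B \<cdot> deg C\<close>, and by the exact sequence comparing repartitions
  of \<open>C\<close> and of its partial normalization, \<open>\<delta> = dim A/O\<close>. Since \<open>q\<close> is unibranch, \<open>A\<close> is a discrete
  valuation ring, so that \<open>dim O/aO = dim A/aA\<close> is a multiple of the valuation of \<open>a\<close>.

  The curve \<open>B\<close> is smooth at \<open>q\<close> and has contact \<open>l \<ge> 2\<close> with its tangent \<open>L\<close>. Therefore
  \<open>g = x^l e\<^sub>1 + L e\<^sub>2\<close> with units \<open>e\<^sub>1\<close>, \<open>e\<^sub>2\<close>, for every line \<open>x \<noteq> L\<close> through \<open>q\<close>. As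
  \<open>dim O/LO \<le> deg C < N\<close>, the two terms on the right have the same valuation, that is
  \<open>(C \<cdot> L)\<^sub>q = l (C \<cdot> x)\<^sub>q\<close>. So all these lines \<open>x\<close> have contact \<open>m\<close> with \<open>C\<close>, hence \<open>L\<close> is the
  tangent of \<open>C\<close> and \<open>n = l m\<close>.

  Finally, \<open>1, g, \<dots>, g\<^bsup>m-1\<^esup>\<close> is a basis of \<open>O/xO\<close> because \<open>g\<close> vanishes to order one along \<open>x\<close>. Up to
  elements of high valuation \<open>O\<close> is thus spanned by the \<open>x^i g^j\<close> with \<open>j < m\<close>, whose valuations are
  \<open>i m + j N\<close>. Counting dimensions, \<open>\<delta> \<ge> \<Sum>j<m. \<lfloor>j N / m\<rfloor> \<ge> (m - 1) (N - m) / 2\<close>.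
\<close>

section \<open>Relative dimensions\<close>

text \<open>The obstacle is the finiteness of \<open>A/O\<close>. It is obtained together with the
  genus comparison: counting forms bounds \<open>K/(O + \<Gamma>)\<close>, where
  \<open>\<Gamma>\<close> is the ring of functions regular away from \<open>q\<close>, and
  \<open>A\<close> meets \<open>\<Gamma>\<close> in constants only, so that \<open>A/O\<close>
  embeds into this quotient. Here too it matters that \<open>q\<close> is the only common point:
  powers of the equation of B are denominators of \<open>\<Gamma>\<close>. The Bezout inequality
  rests on Noether's theorem that a form lying locally in the ideal of B along C lies in it
  globally; this is the one place where the depth of the coordinate ring is used. Dimensions are
  always those of one subspace modulo another inside an ambient space, so no quotients are formed.
  Functions live in an abstract field that receives the homogeneous coordinate ring of C; it is
  built from a root of the equation of C in an algebraic closure. The residue field of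
  \<open>A\<close> is never identified: \<open>dim A/aA\<close> is a fixed multiple \<open>f\<close>
  of the valuation, and \<open>f\<close> cancels in every comparison. The inequality for
  \<open>N\<close> is enough, as the final bound increases with \<open>N\<close>.\<close>

locale rel_space = vector_space scale
  for scale :: "'a::field \<Rightarrow> 'b::ab_group_add \<Rightarrow> 'b" (infixr "\<star>" 75)
begin

text \<open>Linear algebra in a quotient is phrased inside the ambient space, so that many
  overlapping subspaces can be compared without changing types.\<close>

definition indm :: "'b set \<Rightarrow> 'b set \<Rightarrow> bool" where
  "indm W S \<longleftrightarrow> finite S \<and> (\<forall>c. (\<Sum>s\<in>S. c s \<star> s) \<in> W \<longrightarrow> (\<forall>s\<in>S. c s = 0))"

definition spnm :: "'b set \<Rightarrow> 'b set \<Rightarrow> 'b \<Rightarrow> bool" where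
  "spnm W S v \<longleftrightarrow> (\<exists>c. v - (\<Sum>s\<in>S. c s \<star> s) \<in> W)"

text \<open>A relation instead of a function, because it also asserts finiteness. For a subspace
  \<open>V\<close> it is the dimension of \<open>V / (V \<inter> W)\<close>, so \<open>W\<close> may
  stick out of \<open>V\<close>.\<close>

definition hdim :: "'b set \<Rightarrow> 'b set \<Rightarrow> nat \<Rightarrow> bool" where
  "hdim V W n \<longleftrightarrow> (\<exists>S. S \<subseteq> V \<and> card S = n \<and> indm W S \<and> (\<forall>v\<in>V. spnm W S v))"

lemma lincomb_diff: "(\<Sum>s\<in>S. c s \<star> f s) - (\<Sum>s\<in>S. d s \<star> f s) = (\<Sum>s\<in>S. (c s - d s) \<star> f s)"
  by (simp add: sum_subtractf scale_left_diff_distrib)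

lemma lincomb_add: "(\<Sum>s\<in>S. c s \<star> f s) + (\<Sum>s\<in>S. d s \<star> f s) = (\<Sum>s\<in>S. (c s + d s) \<star> f s)"
  by (simp add: sum.distrib scale_left_distrib)

lemma lincomb_scale: "k \<star> (\<Sum>s\<in>S. c s \<star> f s) = (\<Sum>s\<in>S. (k * c s) \<star> f s)"
  by (simp add: scale_sum_right)

lemma spnmI: "v - (\<Sum>s\<in>S. c s \<star> s) \<in> W \<Longrightarrow> spnm W S v"
  by (auto simp: spnm_def)

lemma spnm_base:
  assumes "subspace W" "finite S" "v \<in> S"
  shows "spnm W S v"
proof -
  have "(\<Sum>s\<in>S. (if s = v then 1 else 0) \<star> s) = (\<Sum>s\<in>S. if s = v then v else 0)"
    by (rule sum.cong) auto
  also have "\<dots> = v" using assms by simp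
  finally have "v - (\<Sum>s\<in>S. (if s = v then 1 else 0) \<star> s) \<in> W"
    using assms subspace_0 by simp
  then show ?thesis by (rule spnmI)
qed

text \<open>Exchange argument in which the modulus absorbs the spanning vectors one by one:
  adjoining \<open>a\<close> to \<open>W\<close> costs at most one element of
  \<open>T\<close>.\<close>

lemma steinitz_mod:
  assumes "finite S" "subspace W" "indm W T" "\<forall>t\<in>T. spnm W S t"
  shows "card T \<le> card S"
  using assms
proof (induction S arbitrary: W T rule: finite_induct)
  case empty
  have "t \<in> W" if "t \<in> T" for t using empty that by (auto simp: spnm_def)
  moreover have "t \<notin> W" if "t \<in> T" for t
  proof
    assume "t \<in> W"
    have fT: "finite T" using empty by (simp add: indm_def)
    have "(\<Sum>s\<in>T. (if s = t then 1 else 0) \<star> s) = (\<Sum>s\<in>T. if s = t then t else 0)"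
      by (rule sum.cong) auto
    also have "\<dots> = t" using fT that by simp
    finally have "\<forall>s\<in>T. (if s = t then (1::'a) else 0) = 0"
      using empty(2) \<open>t \<in> W\<close> unfolding indm_def
      by (elim conjE allE[of _ "\<lambda>s. if s = t then 1 else 0"]) auto
    with that show False by auto
  qed
  ultimately have "T = {}" by blast
  then show ?case by simp
next
  case (insert a S)
  define W' where "W' = {w + k \<star> a | w k. w \<in> W}"
  have subW': "subspace W'"
    unfolding subspace_def W'_def
  proof (intro conjI ballI allI)
    show "0 \<in> {w + k \<star> a |w k. w \<in> W}"
      using subspace_0[OF insert.prems(1)] by (auto intro!: exI[of _ 0])
  next
    fix x y assume "x \<in> {w + k \<star> a |w k. w \<in> W}" "y \<in> {w + k \<star> a |w k. w \<in> W}"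
    then obtain w k w' k' where "x = w + k \<star> a" "y = w' + k' \<star> a" "w \<in> W" "w' \<in> W" by auto
    then have "x + y = (w + w') + (k + k') \<star> a" "w + w' \<in> W"
      using subspace_add[OF insert.prems(1)] by (auto simp: scale_left_distrib)
    then show "x + y \<in> {w + k \<star> a |w k. w \<in> W}" by blast
  next
    fix c x assume "x \<in> {w + k \<star> a |w k. w \<in> W}"
    then obtain w k where "x = w + k \<star> a" "w \<in> W" by auto
    then have "c \<star> x = c \<star> w + (c * k) \<star> a" "c \<star> w \<in> W"
      using subspace_scale[OF insert.prems(1)] by (auto simp: scale_right_distrib)
    then show "c \<star> x \<in> {w + k \<star> a |w k. w \<in> W}" by blast
  qed
  have sp: "spnm W' S t" if "t \<in> T" for t
  proof -
    obtain c where "t - (\<Sum>s\<in>insert a S. c s \<star> s) \<in> W"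
      using insert.prems(3) \<open>t \<in> T\<close> by (auto simp: spnm_def)
    then have "t - (\<Sum>s\<in>S. c s \<star> s) = (t - (\<Sum>s\<in>insert a S. c s \<star> s)) + c a \<star> a"
      "(t - (\<Sum>s\<in>insert a S. c s \<star> s)) \<in> W"
      using insert.hyps by auto
    then have "t - (\<Sum>s\<in>S. c s \<star> s) \<in> W'" unfolding W'_def by blast
    then show ?thesis unfolding spnm_def by blast
  qed
  have fT: "finite T" using insert.prems(2) by (simp add: indm_def)
  show ?case
  proof (cases "indm W' T")
    case True
    then have "card T \<le> card S" using insert.IH[OF subW' True] sp by blast
    then show ?thesis using insert.hyps by simp
  next
    case False
    then obtain c t0 where c: "(\<Sum>s\<in>T. c s \<star> s) \<in> W'" and t0: "t0 \<in> T" "c t0 \<noteq> 0"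
      unfolding indm_def using fT by blast
    from c obtain w k where wk: "(\<Sum>s\<in>T. c s \<star> s) = w + k \<star> a" "w \<in> W" unfolding W'_def by blast
    have k0: "k \<noteq> 0"
    proof
      assume "k = 0"
      then have "(\<Sum>s\<in>T. c s \<star> s) \<in> W" using wk by simp
      then show False using insert.prems(2) t0 unfolding indm_def by blast
    qed
    \<comment> \<open>A second relation modulo \<open>W'\<close> can be corrected by the first one
      to a relation modulo \<open>W\<close>, because \<open>k\<close> is nonzero; the coefficient at
      \<open>t0\<close> then shows that the correction was zero.\<close>
    have "indm W' (T - {t0})"
      unfolding indm_def
    proof (intro conjI allI impI)
      show "finite (T - {t0})" using fT by simp
      fix d assume "(\<Sum>s\<in>T - {t0}. d s \<star> s) \<in> W'"
      then obtain w' k' where w'k': "(\<Sum>s\<in>T - {t0}. d s \<star> s) = w' + k' \<star> a" "w' \<in> W"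
        unfolding W'_def by blast
      define d' where "d' = d(t0 := 0)"
      have "(\<Sum>s\<in>T - {t0}. d s \<star> s) = (\<Sum>s\<in>T. d' s \<star> s)"
        using fT t0 by (simp add: d'_def sum.remove)
      then have "(\<Sum>s\<in>T. (d' s - (k'/k) * c s) \<star> s) = (w' + k' \<star> a) - (k'/k) \<star> (w + k \<star> a)"
        using lincomb_diff[of d' "\<lambda>s. s" T "\<lambda>s. (k'/k) * c s"] lincomb_scale[of "k'/k" c "\<lambda>s. s" T]
      w'k'(1) wk(1) by simp
      also have "\<dots> = w' - (k'/k) \<star> w" using k0 by (simp add: scale_right_distrib)
      also have "\<dots> \<in> W" using w'k' wk insert.prems(1) by (simp add: subspace_diff subspace_scale)
      finally have z: "\<forall>s\<in>T. d' s - (k'/k) * c s = 0"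
        using insert.prems(2) unfolding indm_def by (elim conjE allE[of _ "\<lambda>s. d' s - (k'/k) * c s"]) auto
      with t0 have "k'/k = 0" by (auto simp: d'_def)
      with z have "\<forall>s\<in>T. d' s = 0" by auto
      then show "\<forall>s\<in>T - {t0}. d s = 0" by (auto simp: d'_def split: if_splits)
    qed
    then have "card (T - {t0}) \<le> card S" using insert.IH[OF subW'] sp by blast
    then show ?thesis using insert.hyps fT t0 by (simp add: card_Diff_singleton)
  qed
qed

lemma hdim_bound:
  assumes "subspace W" "hdim V W n" "T \<subseteq> V" "indm W T"
  shows "card T \<le> n"
proof -
  obtain S where S: "card S = n" "indm W S" "\<forall>v\<in>V. spnm W S v"
    using assms(2) by (auto simp: hdim_def)
  have "\<forall>t\<in>T. spnm W S t" using S assms by blast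
  with steinitz_mod[of S W T] S assms show ?thesis by (auto simp: indm_def)
qed

lemma hdim_unique:
  assumes "subspace W" "hdim V W n" "hdim V W m"
  shows "n = m"
proof (rule antisym)
  show "n \<le> m" using hdim_bound[OF assms(1,3)] assms(2) by (auto simp: hdim_def)
  show "m \<le> n" using hdim_bound[OF assms(1,2)] assms(3) by (auto simp: hdim_def)
qed

lemma indm_insert:
  assumes W: "subspace W" and S: "indm W S" and v: "\<not> spnm W S v"
  shows "indm W (insert v S)"
  unfolding indm_def
proof (intro conjI allI impI)
  have fS: "finite S" using S by (simp add: indm_def)
  then show "finite (insert v S)" by simp
  have vS: "v \<notin> S" using spnm_base[OF W fS] v by blast
  fix c assume c: "(\<Sum>s\<in>insert v S. c s \<star> s) \<in> W"
  then have c': "c v \<star> v + (\<Sum>s\<in>S. c s \<star> s) \<in> W" using fS vS by simp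
  have cv: "c v = 0"
  proof (rule ccontr)
    assume nz: "c v \<noteq> 0"
    have "inverse (c v) \<star> (c v \<star> v + (\<Sum>s\<in>S. c s \<star> s)) \<in> W"
      using c' W subspace_scale by blast
    then have "v - (\<Sum>s\<in>S. (- inverse (c v) * c s) \<star> s) \<in> W"
      using nz by (simp add: scale_right_distrib lincomb_scale sum_negf)
    then have "spnm W S v" by (rule spnmI)
    then show False using v by blast
  qed
  with c' S show "\<forall>s\<in>insert v S. c s = 0" by (auto simp: indm_def)
qed

text \<open>An independent set of maximal size spans. Finiteness enters the development in this
  form, as a bound on independent sets.\<close>

lemma hdim_exists:
  assumes W: "subspace W" and b: "\<And>T. T \<subseteq> V \<Longrightarrow> indm W T \<Longrightarrow> card T \<le> N"
  shows "\<exists>n\<le>N. hdim V W n"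
proof -
  let ?P = "\<lambda>k. \<exists>T. T \<subseteq> V \<and> indm W T \<and> card T = k"
  have "?P 0" using W by (auto intro!: exI[of _ "{}"] simp: indm_def)
  then obtain k where k: "?P k" "\<And>j. ?P j \<Longrightarrow> j \<le> k"
    using GreatestI_nat[of ?P 0 N] Greatest_le_nat[of ?P _ N] b by blast
  then obtain T where T: "T \<subseteq> V" "indm W T" "card T = k" by blast
  have "spnm W T v" if "v \<in> V" for v
  proof (rule ccontr)
    assume n: "\<not> spnm W T v"
    have fT: "finite T" using T by (simp add: indm_def)
    then have "v \<notin> T" using spnm_base[OF W fT] n by blast
    then have "card (insert v T) = Suc k" using T fT by simp
    moreover have "insert v T \<subseteq> V" using T that by simp
    ultimately show False using k(2)[of "Suc k"] indm_insert[OF W T(2) n] by fastforce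
  qed
  then have "hdim V W k" using T unfolding hdim_def by blast
  then show ?thesis using b T by blast
qed

lemma hdim_exists_span:
  assumes W: "subspace W" "finite S" "\<And>v. v \<in> V \<Longrightarrow> spnm W S v"
  shows "\<exists>n\<le>card S. hdim V W n"
proof (rule hdim_exists[OF W(1)])
  fix T assume "T \<subseteq> V" "indm W T"
  then show "card T \<le> card S" using steinitz_mod[of S W T] W by blast
qed

lemma hdim_add:
  assumes V: "subspace V" and W: "subspace W" and U: "subspace U"
    and UW: "U \<subseteq> W" "W \<subseteq> V" and a: "hdim V W a" and b: "hdim W U b"
  shows "hdim V U (a + b)"
proof -
  obtain S where S: "S \<subseteq> V" "card S = a" "indm W S" "\<forall>v\<in>V. spnm W S v"
    using a unfolding hdim_def by blast
  obtain T where T: "T \<subseteq> W" "card T = b" "indm U T" "\<forall>v\<in>W. spnm U T v"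
    using b unfolding hdim_def by blast
  have fS: "finite S" and fT: "finite T" using S T by (simp_all add: indm_def)
  have ST: "S \<inter> T = {}"
  proof (rule ccontr)
    assume "S \<inter> T \<noteq> {}"
    then obtain x where x: "x \<in> S" "x \<in> T" by blast
    have "(\<Sum>s\<in>S. (if s = x then 1 else 0) \<star> s) = (\<Sum>s\<in>S. if s = x then x else 0)"
      by (rule sum.cong) auto
    also have "\<dots> = x" using fS x by simp
    also have "x \<in> W" using x T by blast
    finally have "\<forall>s\<in>S. (if s = x then (1::'a) else 0) = 0" using S(3)
      unfolding indm_def by (elim conjE allE[of _ "\<lambda>s. if s = x then 1 else 0"]) auto
    with x show False by auto
  qed
  have sum_un: "(\<Sum>s\<in>S \<union> T. c s \<star> s) = (\<Sum>s\<in>S. c s \<star> s) + (\<Sum>s\<in>T. c s \<star> s)" for c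
    using fS fT ST by (simp add: sum.union_disjoint)
  have "indm U (S \<union> T)"
    unfolding indm_def
  proof (intro conjI allI impI)
    show "finite (S \<union> T)" using fS fT by simp
    fix c assume c: "(\<Sum>s\<in>S \<union> T. c s \<star> s) \<in> U"
    have tW: "(\<Sum>s\<in>T. c s \<star> s) \<in> W" using T W by (intro subspace_sum) (auto intro: subspace_scale)
    have "(\<Sum>s\<in>S. c s \<star> s) = (\<Sum>s\<in>S \<union> T. c s \<star> s) - (\<Sum>s\<in>T. c s \<star> s)"
      by (simp add: sum_un)
    also have "\<dots> \<in> W" using c tW UW W subspace_diff by blast
    finally have s0: "\<forall>s\<in>S. c s = 0" using S(3) by (auto simp: indm_def)
    then have "(\<Sum>s\<in>T. c s \<star> s) \<in> U" using c by (simp add: sum_un)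
    then have "\<forall>s\<in>T. c s = 0" using T(3) by (auto simp: indm_def)
    with s0 show "\<forall>s\<in>S \<union> T. c s = 0" by blast
  qed
  moreover have "spnm U (S \<union> T) v" if "v \<in> V" for v
  proof -
    obtain c where c: "v - (\<Sum>s\<in>S. c s \<star> s) \<in> W" using S(4) \<open>v \<in> V\<close> by (auto simp: spnm_def)
    then obtain d where d: "v - (\<Sum>s\<in>S. c s \<star> s) - (\<Sum>s\<in>T. d s \<star> s) \<in> U"
      using T(4) by (auto simp: spnm_def)
    have "(\<Sum>s\<in>T. (if s \<in> S then c s else d s) \<star> s) = (\<Sum>s\<in>T. d s \<star> s)"
      "(\<Sum>s\<in>S. (if s \<in> S then c s else d s) \<star> s) = (\<Sum>s\<in>S. c s \<star> s)"
      using ST by (auto intro!: sum.cong)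
    then have "v - (\<Sum>s\<in>S \<union> T. (if s \<in> S then c s else d s) \<star> s) \<in> U"
      using d by (simp only: sum_un diff_diff_eq)
    then show ?thesis by (rule spnmI)
  qed
  moreover have "S \<union> T \<subseteq> V" using S T UW by blast
  moreover have "card (S \<union> T) = a + b" using S T fS fT ST by (simp add: card_Un_disjoint)
  ultimately show ?thesis unfolding hdim_def by blast
qed

lemma indm_mono:
  assumes "indm W T" "U \<subseteq> W"
  shows "indm U T"
  using assms by (auto simp: indm_def)

text \<open>Additivity in the direction in which it is mostly used: finiteness of the two steps is a
  conclusion.\<close>

lemma hdim_split:
  assumes V: "subspace V" and W: "subspace W" and U: "subspace U"
    and UW: "U \<subseteq> W" "W \<subseteq> V" and n: "hdim V U n"
  obtains a b where "hdim V W a" "hdim W U b" "n = a + b"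
proof -
  obtain a where a: "hdim V W a"
    using hdim_exists[OF W, of V n] hdim_bound[OF U n] indm_mono[OF _ UW(1)] by metis
  obtain b where b: "hdim W U b"
    using hdim_exists[OF U, of W n] hdim_bound[OF U n] UW by (metis subset_trans)
  have "n = a + b" using hdim_unique[OF U n hdim_add[OF V W U UW a b]] .
  with a b that show ?thesis by blast
qed

lemma hdim_self: "subspace W \<Longrightarrow> hdim W W 0"
  unfolding hdim_def by (intro exI[of _ "{}"]) (auto simp: indm_def spnm_def)

lemma hdim_0_imp: "hdim V W 0 \<Longrightarrow> V \<subseteq> W"
  unfolding hdim_def by (auto simp: indm_def spnm_def)

lemma subspace_set_plus:
  assumes "subspace V" "subspace W"
  shows "subspace {a + b | a b. a \<in> V \<and> b \<in> W}"
  using subspace_sums[OF assms] .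

end

section \<open>Comparison of relative dimensions along linear maps\<close>

locale rel_space_pair = vs1: rel_space s1 + vs2: rel_space s2
  for s1 :: "'a::field \<Rightarrow> 'b::ab_group_add \<Rightarrow> 'b" and s2 :: "'a \<Rightarrow> 'c::ab_group_add \<Rightarrow> 'c"
begin

text \<open>The isomorphism from \<open>V\<close> modulo \<open>W1\<close> to \<open>V2\<close>
  modulo \<open>W2\<close> induced by \<open>f\<close>. Linearity is asked for on \<open>V\<close>
  alone, since the expansion map used later is a homomorphism only on a local ring.\<close>

lemma hdim_transfer:
  assumes V: "vs1.subspace V" and W1: "vs1.subspace W1" and W2: "vs2.subspace W2"
    and add: "\<And>x y. x \<in> V \<Longrightarrow> y \<in> V \<Longrightarrow> f (x + y) = f x + f y"
    and scl: "\<And>c x. x \<in> V \<Longrightarrow> f (s1 c x) = s2 c (f x)"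
    and im: "\<And>x. x \<in> V \<Longrightarrow> f x \<in> V2"
    and srj: "\<And>y. y \<in> V2 \<Longrightarrow> \<exists>x\<in>V. y - f x \<in> W2"
    and ker: "\<And>x. x \<in> V \<Longrightarrow> f x \<in> W2 \<longleftrightarrow> x \<in> W1"
  shows "vs1.hdim V W1 n \<longleftrightarrow> vs2.hdim V2 W2 n"
proof -
  have f0: "f 0 = 0" using add[of 0 0] vs1.subspace_0[OF V] by simp
  have sumf: "f (\<Sum>s\<in>S. s1 (c s) (g s)) = (\<Sum>s\<in>S. s2 (c s) (f (g s)))" if "g ` S \<subseteq> V" for S c and g :: "'d \<Rightarrow> 'b"
    using that
  proof (induction S rule: infinite_finite_induct)
    case (insert x F)
    have "f (s1 (c x) (g x) + (\<Sum>s\<in>F. s1 (c s) (g s))) = f (s1 (c x) (g x)) + f (\<Sum>s\<in>F. s1 (c s) (g s))"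
      using insert V by (intro add vs1.subspace_sum vs1.subspace_scale) auto
    then show ?case using insert scl by simp
  qed (auto simp: f0)
  have dif: "f (x - y) = f x - f y" if "x \<in> V" "y \<in> V" for x y
    using add[of "x - y" y] that vs1.subspace_diff[OF V] by (simp add: algebra_simps)
  have injS: "inj_on f S" if S: "S \<subseteq> V" "vs1.indm W1 S" for S
  proof (rule inj_onI, rule ccontr)
    fix x y assume xy: "x \<in> S" "y \<in> S" "f x = f y" "x \<noteq> y"
    have "f (x - y) = 0" using dif[of x y] xy S(1) by (simp add: subset_iff)
    then have "x - y \<in> W1" using ker[of "x - y"] xy S vs1.subspace_diff[OF V] vs2.subspace_0[OF W2] by auto
    moreover have "(\<Sum>s\<in>S. s1 (if s = x then 1 else if s = y then - 1 else 0) s) = x - y"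
    proof -
      have "(\<Sum>s\<in>S. s1 (if s = x then 1 else if s = y then - 1 else 0) s)
        = (\<Sum>s\<in>S. (if s = x then x else 0) + (if s = y then - y else 0))"
        using xy by (intro sum.cong) auto
      also have "\<dots> = x - y" using S xy by (simp add: sum.distrib vs1.indm_def)
      finally show ?thesis .
    qed
    ultimately have "\<forall>s\<in>S. (if s = x then (1::'a) else if s = y then - 1 else 0) = 0"
      using S(2) unfolding vs1.indm_def
      by (elim conjE allE[of _ "\<lambda>s. if s = x then 1 else if s = y then - 1 else 0"]) simp
    with xy show False by auto
  qed
  have indS: "vs2.indm W2 (f ` S)" if S: "S \<subseteq> V" "vs1.indm W1 S" for S
    unfolding vs2.indm_def
  proof (intro conjI allI impI)
    show "finite (f ` S)" using S by (simp add: vs1.indm_def)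
    fix c assume c: "(\<Sum>s\<in>f ` S. s2 (c s) s) \<in> W2"
    have "(\<Sum>s\<in>f ` S. s2 (c s) s) = (\<Sum>s\<in>S. s2 (c (f s)) (f s))"
      using injS[OF S] by (simp add: sum.reindex)
    also have "\<dots> = f (\<Sum>s\<in>S. s1 (c (f s)) s)" using sumf[of id S] S by simp
    finally have "f (\<Sum>s\<in>S. s1 (c (f s)) s) \<in> W2" using c by simp
    then have "(\<Sum>s\<in>S. s1 (c (f s)) s) \<in> W1" using ker S V
      by (metis (no_types, lifting) subsetD vs1.subspace_scale vs1.subspace_sum)
    then have "\<forall>s\<in>S. c (f s) = 0"
      using S(2) unfolding vs1.indm_def by (elim conjE allE[of _ "\<lambda>s. c (f s)"]) auto
    then show "\<forall>s\<in>f ` S. c s = 0" by blast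
  qed
  have fwd: "vs2.hdim V2 W2 k" if h: "vs1.hdim V W1 k" for k
  proof -
    obtain S where S: "S \<subseteq> V" "card S = k" "vs1.indm W1 S" "\<forall>v\<in>V. vs1.spnm W1 S v"
      using h unfolding vs1.hdim_def by blast
    have "vs2.spnm W2 (f ` S) y" if y: "y \<in> V2" for y
    proof -
      obtain x where x: "x \<in> V" "y - f x \<in> W2" using srj[OF y] by blast
      obtain c where c: "x - (\<Sum>s\<in>S. s1 (c s) s) \<in> W1" using S x by (auto simp: vs1.spnm_def)
      have sV: "(\<Sum>s\<in>S. s1 (c s) s) \<in> V" using S V
        by (metis (no_types, lifting) subsetD vs1.subspace_scale vs1.subspace_sum)
      have "f (x - (\<Sum>s\<in>S. s1 (c s) s)) \<in> W2"
        using ker c x sV vs1.subspace_diff[OF V] by blast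
      then have "f x - (\<Sum>s\<in>S. s2 (c s) (f s)) \<in> W2"
        using dif[OF x(1) sV] sumf[of id S] S by simp
      moreover have "(\<Sum>s\<in>f ` S. s2 (c (the_inv_into S f s)) s) = (\<Sum>s\<in>S. s2 (c s) (f s))"
        using injS[OF S(1,3)] by (simp add: sum.reindex the_inv_into_f_f)
      ultimately have "y - (\<Sum>s\<in>f ` S. s2 (c (the_inv_into S f s)) s) \<in> W2"
        using x vs2.subspace_add[OF W2, of "y - f x"] by fastforce
      then show ?thesis by (rule vs2.spnmI)
    qed
    moreover have "f ` S \<subseteq> V2" using S im by blast
    moreover have "card (f ` S) = k" using card_image[OF injS[OF S(1,3)]] S by simp
    ultimately show ?thesis using indS[OF S(1,3)] unfolding vs2.hdim_def by blast
  qed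
  show ?thesis
  proof
    assume h2: "vs2.hdim V2 W2 n"
    \<comment> \<open>Images of independent sets stay independent, which bounds their size; the
      forward direction and uniqueness then identify the dimension.\<close>
    have "\<exists>k\<le>n. vs1.hdim V W1 k"
    proof (rule vs1.hdim_exists[OF W1])
      fix T assume T: "T \<subseteq> V" "vs1.indm W1 T"
      have "card (f ` T) \<le> n"
        using vs2.hdim_bound[OF W2 h2 _ indS[OF T]] T im by blast
      then show "card T \<le> n" using card_image[OF injS[OF T]] by simp
    qed
    then show "vs1.hdim V W1 n" using fwd vs2.hdim_unique[OF W2 h2] by blast
  qed (rule fwd)
qed

end

unbundle no fps_syntax

section \<open>Ternary forms\<close>

abbreviation coef3 :: "tpoly \<Rightarrow> nat \<Rightarrow> nat \<Rightarrow> nat \<Rightarrow> complex" where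
  "coef3 P i j k \<equiv> poly.coeff (poly.coeff (poly.coeff P i) j) k"

definition X1 :: tpoly where "X1 = [:0, 1:]"
definition X2 :: tpoly where "X2 = [:[:0, 1:]:]"
definition X3 :: tpoly where "X3 = [:[:[:0, 1:]:]:]"

lemma tpoly_eqI: "(\<And>i j k. coef3 P i j k = coef3 Q i j k) \<Longrightarrow> P = Q"
  by (simp add: poly_eq_iff)

lemma coef3_mult:
  "coef3 (P * Q) i j k =
     (\<Sum>a\<le>i. \<Sum>b\<le>j. \<Sum>e\<le>k. coef3 P a b e * coef3 Q (i - a) (j - b) (k - e))"
  by (simp add: coeff_mult coeff_sum)

lemma coef3_tconst: "coef3 (tconst c) i j k = (if i = 0 \<and> j = 0 \<and> k = 0 then c else 0)"
  by (auto simp: tconst_def coeff_pCons split: nat.splits)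

lemma tconst_0 [simp]: "tconst 0 = 0" and tconst_1 [simp]: "tconst 1 = 1"
  by (simp_all add: tconst_def one_pCons)

lemma tconst_add: "tconst (a + b) = tconst a + tconst b"
  and tconst_mult: "tconst (a * b) = tconst a * tconst b"
  and tconst_minus: "tconst (- a) = - tconst a"
  and tconst_diff: "tconst (a - b) = tconst a - tconst b"
  by (simp_all add: tconst_def)

lemma tconst_eq_0_iff [simp]: "tconst c = 0 \<longleftrightarrow> c = 0"
  by (simp add: tconst_def)

lemma coef3_tconst_mult: "coef3 (tconst c * P) i j k = c * coef3 P i j k"
  by (simp add: tconst_def)

lemma teval_simps [simp]:
  "teval 0 v = 0" "teval 1 v = 1" "teval (P + Q) v = teval P v + teval Q v"
  "teval (P * Q) v = teval P v * teval Q v" "teval (P - Q) v = teval P v - teval Q v"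
  "teval (- P) v = - teval P v"
  "teval (P ^ n) v = teval P v ^ n" "teval (tconst c) v = c"
  "teval X1 v = v $ 1" "teval X2 v = v $ 2" "teval X3 v = v $ 3"
  by (simp_all add: teval_def tconst_def X1_def X2_def X3_def)

lemma teval_sum: "teval (sum f A) v = (\<Sum>a\<in>A. teval (f a) v)"
  by (induction A rule: infinite_finite_induct) auto

interpretation tp: rel_space "\<lambda>c P. tconst c * P"
  by unfold_locales (simp_all add: algebra_simps tconst_add tconst_mult)

lemma hom_0 [simp]: "homogeneous d 0"
  by (simp add: homogeneous_def)

lemma hom_add: "homogeneous d P \<Longrightarrow> homogeneous d Q \<Longrightarrow> homogeneous d (P + Q)"
  by (force simp: homogeneous_def)

lemma hom_tconst_mult: "homogeneous d P \<Longrightarrow> homogeneous d (tconst c * P)"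
  by (auto simp: homogeneous_def coef3_tconst_mult)

lemma hom_uminus: "homogeneous d P \<Longrightarrow> homogeneous d (- P)"
  by (auto simp: homogeneous_def)

lemma hom_diff: "homogeneous d P \<Longrightarrow> homogeneous d Q \<Longrightarrow> homogeneous d (P - Q)"
  using hom_add[of d P "- Q"] hom_uminus[of d Q] by simp

lemma hom_sum: "(\<And>a. a \<in> A \<Longrightarrow> homogeneous d (f a)) \<Longrightarrow> homogeneous d (sum f A)"
  by (induction A rule: infinite_finite_induct) (auto intro: hom_add)

lemma coef3_mult_nz:
  assumes "coef3 (P * Q) i j k \<noteq> 0"
  obtains a b e where "a \<le> i" "b \<le> j" "e \<le> k" "coef3 P a b e \<noteq> 0"
    "coef3 Q (i - a) (j - b) (k - e) \<noteq> 0"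
proof -
  from assms obtain a where a: "a \<le> i"
    "(\<Sum>b\<le>j. \<Sum>e\<le>k. coef3 P a b e * coef3 Q (i - a) (j - b) (k - e)) \<noteq> 0"
    unfolding coef3_mult by (metis (no_types, lifting) atMost_iff sum.not_neutral_contains_not_neutral)
  then obtain b where b: "b \<le> j" "(\<Sum>e\<le>k. coef3 P a b e * coef3 Q (i - a) (j - b) (k - e)) \<noteq> 0"
    by (metis (no_types, lifting) atMost_iff sum.not_neutral_contains_not_neutral)
  then obtain e where e: "e \<le> k" "coef3 P a b e * coef3 Q (i - a) (j - b) (k - e) \<noteq> 0"
    by (metis (no_types, lifting) atMost_iff sum.not_neutral_contains_not_neutral)
  with a b that show ?thesis by auto
qed

lemma hom_mult:
  assumes "homogeneous d P" "homogeneous e Q"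
  shows "homogeneous (d + e) (P * Q)"
  unfolding homogeneous_def
proof (intro allI impI)
  fix i j k assume "coef3 (P * Q) i j k \<noteq> 0"
  then obtain a b e' where "a \<le> i" "b \<le> j" "e' \<le> k" "coef3 P a b e' \<noteq> 0"
    "coef3 Q (i - a) (j - b) (k - e') \<noteq> 0" by (rule coef3_mult_nz)
  moreover from this have "a + b + e' = d" "(i - a) + (j - b) + (k - e') = e"
    using assms unfolding homogeneous_def by blast+
  ultimately show "i + j + k = d + e" by linarith
qed

lemma hom_tconst [simp]: "homogeneous 0 (tconst c)"
  by (auto simp: homogeneous_def coef3_tconst)

lemma hom_1 [simp]: "homogeneous 0 1"
  using hom_tconst[of 1] by simp

lemma hom_power: "homogeneous d P \<Longrightarrow> homogeneous (d * n) (P ^ n)"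
  by (induction n) (auto intro: hom_mult)

lemma hom_power1: "homogeneous 1 P \<Longrightarrow> homogeneous n (P ^ n)"
  using hom_power[of 1 P n] by simp

lemma hom_X [simp]: "homogeneous (Suc 0) X1" "homogeneous (Suc 0) X2" "homogeneous (Suc 0) X3"
  by (auto simp: homogeneous_def X1_def X2_def X3_def coeff_pCons split: nat.splits)

lemma hom0_const:
  assumes "homogeneous 0 P"
  shows "P = tconst (coef3 P 0 0 0)"
  using assms by (intro tpoly_eqI) (auto simp: coef3_tconst homogeneous_def)

lemma hom_Suc_decomp:
  assumes "homogeneous (Suc d) P"
  obtains A B C where "homogeneous d A" "homogeneous d B" "homogeneous d C"
    "P = X1 * A + X2 * B + X3 * C"
proof -
  obtain c A where P: "P = pCons c A" by (cases P)
  obtain c' B where c: "c = pCons c' B" by (cases c)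
  obtain c'' C where c': "c' = pCons c'' C" by (cases c')
  have "coef3 P 0 0 0 = 0" using assms unfolding homogeneous_def by force
  then have z: "c'' = 0" by (simp add: P c c')
  have eq: "P = X1 * A + X2 * [:B:] + X3 * [:[:C:]:]"
    by (simp add: P c c' z X1_def X2_def X3_def)
  have "homogeneous d A"
    unfolding homogeneous_def
  proof (intro allI impI)
    fix i j k assume "coef3 A i j k \<noteq> 0"
    then have "coef3 P (Suc i) j k \<noteq> 0" by (simp add: P)
    then show "i + j + k = d" using assms unfolding homogeneous_def by fastforce
  qed
  moreover have "homogeneous d [:B:]"
    unfolding homogeneous_def
  proof (intro allI impI)
    fix i j k assume "coef3 [:B:] i j k \<noteq> 0"
    then have "i = 0" "coef3 P 0 (Suc j) k \<noteq> 0" by (auto simp: P c coeff_pCons split: nat.splits)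
    then show "i + j + k = d" using assms unfolding homogeneous_def by fastforce
  qed
  moreover have "homogeneous d [:[:C:]:]"
    unfolding homogeneous_def
  proof (intro allI impI)
    fix i j k assume "coef3 [:[:C:]:] i j k \<noteq> 0"
    then have "i = 0" "j = 0" "coef3 P 0 0 (Suc k) \<noteq> 0"
      by (auto simp: P c c' coeff_pCons split: nat.splits)
    then show "i + j + k = d" using assms unfolding homogeneous_def by fastforce
  qed
  ultimately show ?thesis using that eq by blast
qed

text \<open>Facts about forms are reduced to linear combinations of the coordinates, which replaces
  monomial expansions.\<close>

lemma form_induct [consumes 1, case_names const step]:
  assumes "homogeneous d P"
    and "\<And>c. R 0 (tconst c)"
    and "\<And>d A B C. homogeneous d A \<Longrightarrow> homogeneous d B \<Longrightarrow> homogeneous d C \<Longrightarrow>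
           R d A \<Longrightarrow> R d B \<Longrightarrow> R d C \<Longrightarrow> R (Suc d) (X1 * A + X2 * B + X3 * C)"
  shows "R d P"
  using assms(1)
proof (induction d arbitrary: P)
  case 0
  then show ?case using hom0_const[of P] assms(2) by metis
next
  case (Suc d)
  then show ?case using hom_Suc_decomp[OF Suc.prems] assms(3) by metis
qed

lemma teval_scale:
  assumes "homogeneous d P"
  shows "teval P (c *s v) = c ^ d * teval P v"
  using assms by (induction rule: form_induct) (simp_all add: algebra_simps)

section \<open>Homogeneous components and division of forms\<close>

definition hcomp :: "nat \<Rightarrow> tpoly \<Rightarrow> tpoly" where
  "hcomp e P = (\<Sum>i\<le>e. \<Sum>j\<le>e. Polynomial.monom (Polynomial.monom (Polynomial.monom (if i + j \<le> e then coef3 P i j (e - i - j) else 0)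
     (e - i - j)) j) i)"

lemma coef3_hcomp: "coef3 (hcomp e P) i j k = (if i + j + k = e then coef3 P i j k else 0)"
proof -
  have "coef3 (hcomp e P) i j k = (\<Sum>a\<le>e. \<Sum>b\<le>e. if a = i then if b = j then
      if e - i - j = k then if i + j \<le> e then coef3 P i j k else 0 else 0 else 0 else 0)"
    unfolding hcomp_def by (simp add: coeff_sum if_distrib[of "\<lambda>p. poly.coeff p _"] cong: if_cong)
  also have "\<dots> = (\<Sum>a\<le>e. if a = i then (\<Sum>b\<le>e. if b = j then
      if e - i - j = k then if i + j \<le> e then coef3 P i j k else 0 else 0 else 0) else 0)"
    by (intro sum.cong) auto
  also have "\<dots> = (if i + j + k = e then coef3 P i j k else 0)" by (auto simp: sum.delta)
  finally show ?thesis .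
qed

lemma hom_hcomp: "homogeneous e (hcomp e P)"
  by (auto simp: homogeneous_def coef3_hcomp)

lemma hcomp_id: "homogeneous e P \<Longrightarrow> hcomp e P = P"
  by (intro tpoly_eqI) (auto simp: coef3_hcomp homogeneous_def)

lemma hcomp_mult:
  assumes "homogeneous c P"
  shows "hcomp (c + e) (P * Q) = P * hcomp e Q"
proof (rule tpoly_eqI)
  fix i j k
  have *: "coef3 P a b f * coef3 (hcomp e Q) (i - a) (j - b) (k - f) =
      (if i + j + k = c + e then coef3 P a b f * coef3 Q (i - a) (j - b) (k - f) else 0)"
    if "a \<le> i" "b \<le> j" "f \<le> k" for a b f
  proof (cases "coef3 P a b f = 0")
    case False
    then have "a + b + f = c" using assms by (auto simp: homogeneous_def)
    then have "i - a + (j - b) + (k - f) = e \<longleftrightarrow> i + j + k = c + e" using that by auto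
    then show ?thesis by (simp add: coef3_hcomp)
  qed simp
  have "coef3 (P * hcomp e Q) i j k = (\<Sum>a\<le>i. \<Sum>b\<le>j. \<Sum>f\<le>k.
      (if i + j + k = c + e then coef3 P a b f * coef3 Q (i - a) (j - b) (k - f) else 0))"
    unfolding coef3_mult by (intro sum.cong refl) (use * in auto)
  also have "\<dots> = coef3 (hcomp (c + e) (P * Q)) i j k"
    by (auto simp: coef3_hcomp coef3_mult)
  finally show "coef3 (hcomp (c + e) (P * Q)) i j k = coef3 (P * hcomp e Q) i j k" by simp
qed

text \<open>\<open>R\<close> is the component of degree \<open>e\<close> of the cofactor. The
  equation is stated with \<open>P\<close> still in place, so that nothing has to be
  cancelled.\<close>

lemma hom_dvd_quot:
  assumes "homogeneous c P" "homogeneous (c + e) (P * Q)"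
  obtains R where "homogeneous e R" "P * Q = P * R"
  using hcomp_mult[OF assms(1), of e Q] hcomp_id[OF assms(2)] hom_hcomp by metis

lemma hom_dvd_degree:
  assumes "homogeneous c P" "homogeneous d Q" "P dvd Q" "Q \<noteq> 0"
  shows "c \<le> d"
proof -
  obtain R where R: "Q = P * R" using assms by blast
  obtain i j k where nz: "coef3 Q i j k \<noteq> 0" using assms(4) tpoly_eqI by (metis coeff_0)
  then obtain a b e where "a \<le> i" "b \<le> j" "e \<le> k" "coef3 P a b e \<noteq> 0"
    unfolding R by (rule coef3_mult_nz)
  then have "a + b + e = c" "i + j + k = d" using nz assms by (auto simp: homogeneous_def)
  then show ?thesis using \<open>a \<le> i\<close> \<open>b \<le> j\<close> \<open>e \<le> k\<close> by linarith
qed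

lemma hom_dvdE:
  assumes "homogeneous c P" "homogeneous d Q" "P dvd Q" "c \<le> d"
  obtains R where "homogeneous (d - c) R" "Q = P * R"
proof -
  obtain R where R: "Q = P * R" using assms by blast
  then show ?thesis using hom_dvd_quot[of c P "d - c" R] assms that by auto
qed

lemma subspace_forms: "tp.subspace {P. homogeneous d P}"
  by (auto simp: tp.subspace_def hom_add hom_tconst_mult)

text \<open>The basis consists of the monomials, indexed by their first two exponents; the binomial
  coefficient is doubled to avoid division.\<close>

lemma hdim_forms: "\<exists>n. 2 * n = (d + 1) * (d + 2) \<and> tp.hdim {P. homogeneous d P} {0} n"
proof -
  define I where "I = Sigma {..d} (\<lambda>i. {..d - i})"
  define m :: "nat \<times> nat \<Rightarrow> tpoly" where "m = (\<lambda>(i, j). Polynomial.monom (Polynomial.monom (Polynomial.monom 1 (d - i - j)) j) i)"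
  have cm: "coef3 (m (a, b)) i j k = (if a = i \<and> b = j \<and> d - a - b = k then 1 else 0)" for a b i j k
    by (simp add: m_def)
  have injm: "inj_on m I"
  proof (rule inj_onI)
    fix p p' assume "p \<in> I" "p' \<in> I" and eq: "m p = m p'"
    obtain i j i' j' where p: "p = (i, j)" "p' = (i', j')" by (cases p, cases p') auto
    have "coef3 (m p) i j (d - i - j) = coef3 (m p') i j (d - i - j)" using eq by simp
    then show "p = p'" by (auto simp: p cm split: if_splits)
  qed
  have fin: "finite I" by (simp add: I_def)
  have coefsum: "coef3 (\<Sum>s\<in>m ` I. tconst (c s) * s) i j k =
      (if i + j + k = d then c (m (i, j)) else 0)" for c i j k
  proof -
    have "coef3 (\<Sum>s\<in>m ` I. tconst (c s) * s) i j k = (\<Sum>p\<in>I. c (m p) * coef3 (m p) i j k)"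
      using injm by (simp add: sum.reindex coeff_sum coef3_tconst_mult)
    also have "\<dots> = (\<Sum>p\<in>I. if p = (i, j) then if d - i - j = k then c (m (i, j)) else 0 else 0)"
      by (intro sum.cong refl) (auto simp: cm split: if_splits)
    also have "\<dots> = (if i + j + k = d then c (m (i, j)) else 0)"
      using fin by (auto simp: sum.delta I_def)
    finally show ?thesis .
  qed
  have "m ` I \<subseteq> {P. homogeneous d P}" by (auto simp: homogeneous_def cm I_def split: if_splits)
  moreover have "tp.indm {0} (m ` I)"
    unfolding tp.indm_def
  proof (intro conjI allI impI ballI)
    fix c s assume c: "(\<Sum>s\<in>m ` I. tconst (c s) * s) \<in> {0}" and "s \<in> m ` I"
    then obtain i j where ij: "(i, j) \<in> I" "s = m (i, j)" by auto
    have "coef3 (\<Sum>s\<in>m ` I. tconst (c s) * s) i j (d - i - j) = 0" using c by simp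
    then show "c s = 0" using ij unfolding coefsum by (auto simp: I_def)
  qed (simp add: fin)
  moreover have "tp.spnm {0} (m ` I) P" if P: "homogeneous d P" for P
  proof (rule tp.spnmI)
    define c where "c = (\<lambda>s. (let (i, j) = the_inv_into I m s in coef3 P i j (d - i - j)))"
    have cI: "c (m (i, j)) = coef3 P i j (d - i - j)" if "(i, j) \<in> I" for i j
      unfolding c_def by (simp add: the_inv_into_f_f[OF injm that])
    have "P = (\<Sum>s\<in>m ` I. tconst (c s) * s)"
    proof (rule tpoly_eqI)
      fix i j k
      show "coef3 P i j k = coef3 (\<Sum>s\<in>m ` I. tconst (c s) * s) i j k"
        unfolding coefsum using P by (auto simp: homogeneous_def cI I_def)
    qed
    then show "P - (\<Sum>s\<in>m ` I. tconst (c s) * s) \<in> {0}" by simp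
  qed
  ultimately have "tp.hdim {P. homogeneous d P} {0} (card I)"
    unfolding tp.hdim_def using card_image[OF injm] by (intro exI[of _ "m ` I"]) auto
  moreover have "2 * card I = (d + 1) * (d + 2)"
  proof -
    have "card I = (\<Sum>i\<le>d. Suc (d - i))" unfolding I_def by simp
    also have "\<dots> = (\<Sum>i\<le>d. Suc i)"
      using sum.atLeastAtMost_rev[of "\<lambda>i. Suc (d - i)" 0 d] by (simp add: atMost_atLeast0)
    also have "2 * \<dots> = (d + 1) * (d + 2)" by (induction d) auto
    finally show ?thesis .
  qed
  ultimately show ?thesis by blast
qed

subsection \<open>Restriction to lines and adapted coordinates\<close>

text \<open>The coefficient of index \<open>d\<close> belongs to the point at infinity
  \<open>u\<close> of the line. It may vanish, hence a bound on the degree and not its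
  value.\<close>

lemma ex_lpoly:
  assumes "homogeneous d P"
  shows "\<exists>p. Polynomial.degree p \<le> d \<and> poly.coeff p d = teval P u \<and> (\<forall>s. poly p s = teval P (w + s *s u))"
  using assms
proof (induction rule: form_induct)
  case (const c)
  then show ?case by (intro exI[of _ "[:c:]"]) simp
next
  case (step d A B C)
  then obtain a b c where a: "Polynomial.degree a \<le> d" "poly.coeff a d = teval A u" "\<And>s. poly a s = teval A (w + s *s u)"
    and b: "Polynomial.degree b \<le> d" "poly.coeff b d = teval B u" "\<And>s. poly b s = teval B (w + s *s u)"
    and c: "Polynomial.degree c \<le> d" "poly.coeff c d = teval C u" "\<And>s. poly c s = teval C (w + s *s u)"
    by blast
  let ?p = "[:w$1, u$1:] * a + [:w$2, u$2:] * b + [:w$3, u$3:] * c"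
  have "Polynomial.degree ?p \<le> Suc d"
    using a(1) b(1) c(1)
    by (intro degree_add_le order.trans[OF degree_mult_le]) (auto split: if_splits)
  moreover have "poly.coeff ?p (Suc d) = teval (X1 * A + X2 * B + X3 * C) u"
    using a b c by (simp add: coeff_eq_0)
  moreover have "\<forall>s. poly ?p s = teval (X1 * A + X2 * B + X3 * C) (w + s *s u)"
    using a b c by (simp add: algebra_simps)
  ultimately show ?case by blast
qed

definition lpoly :: "tpoly \<Rightarrow> complex ^ 3 \<Rightarrow> complex ^ 3 \<Rightarrow> complex poly" where
  "lpoly P w u = (THE p. \<forall>s. poly p s = teval P (w + s *s u))"

lemma poly_ext: "(\<And>s. poly p s = poly q s) \<Longrightarrow> p = (q :: complex poly)"
  by (simp add: poly_eq_poly_eq_iff[symmetric] fun_eq_iff)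

lemma lpoly_eqI: "(\<And>s. poly p s = teval P (w + s *s u)) \<Longrightarrow> lpoly P w u = p"
  unfolding lpoly_def by (rule the_equality) (auto intro: poly_ext)

lemma lpoly:
  assumes "homogeneous d P"
  shows "Polynomial.degree (lpoly P w u) \<le> d" "poly.coeff (lpoly P w u) d = teval P u"
    "poly (lpoly P w u) s = teval P (w + s *s u)"
  using ex_lpoly[OF assms, of u w] lpoly_eqI[of _ P w u] by auto

lemma lpoly_mult:
  assumes "homogeneous d P" "homogeneous e Q"
  shows "lpoly (P * Q) w u = lpoly P w u * lpoly Q w u"
  by (rule lpoly_eqI) (simp add: lpoly[OF assms(1)] lpoly[OF assms(2)])

lemma lpoly_add:
  assumes "homogeneous d P" "homogeneous d Q"
  shows "lpoly (P + Q) w u = lpoly P w u + lpoly Q w u"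
  by (rule lpoly_eqI) (simp add: lpoly[OF assms(1)] lpoly[OF assms(2)])

lemma lpoly_coeff0: "homogeneous d P \<Longrightarrow> poly.coeff (lpoly P w u) 0 = teval P w"
  using lpoly(3)[of d P w u 0] by (simp add: poly_0_coeff_0)

text \<open>Linear coordinates with their dual basis. When \<open>w\<close> represents the point
  under study, \<open>x / z\<close> and \<open>y / z\<close> are local coordinates there, and the
  line \<open>y = 0\<close> is parametrized by \<open>w + s *s u\<close> with \<open>x\<close> as
  parameter. Thus \<open>lpoly P w u\<close> is the restriction of \<open>P\<close> to the line
  \<open>y = 0\<close>.\<close>

definition frame :: "tpoly \<Rightarrow> tpoly \<Rightarrow> tpoly \<Rightarrow> complex ^ 3 \<Rightarrow> complex ^ 3 \<Rightarrow> complex ^ 3 \<Rightarrow> bool" where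
  "frame x y z u v w \<longleftrightarrow> homogeneous 1 x \<and> homogeneous 1 y \<and> homogeneous 1 z \<and>
     teval x u = 1 \<and> teval x v = 0 \<and> teval x w = 0 \<and>
     teval y u = 0 \<and> teval y v = 1 \<and> teval y w = 0 \<and>
     teval z u = 0 \<and> teval z v = 0 \<and> teval z w = 1 \<and>
     (\<forall>p. p = teval x p *s u + teval y p *s v + teval z p *s w)"

lemma frameD:
  assumes "frame x y z u v w"
  shows "homogeneous 1 x" "homogeneous 1 y" "homogeneous 1 z"
    "homogeneous (Suc 0) x" "homogeneous (Suc 0) y" "homogeneous (Suc 0) z"
    "teval x u = 1" "teval x v = 0" "teval x w = 0"
    "teval y u = 0" "teval y v = 1" "teval y w = 0"
    "teval z u = 0" "teval z v = 0" "teval z w = 1"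
    "p = teval x p *s u + teval y p *s v + teval z p *s w"
  using assms unfolding frame_def by auto

lemma form1_lin:
  assumes "homogeneous 1 P"
  shows "P = tconst (teval P (axis 1 1)) * X1 + tconst (teval P (axis 2 1)) * X2 + tconst (teval P (axis 3 1)) * X3"
proof -
  obtain A B C where ABC: "homogeneous 0 A" "homogeneous 0 B" "homogeneous 0 C" "P = X1 * A + X2 * B + X3 * C"
    using hom_Suc_decomp[of 0 P] assms by auto
  obtain a b c where "A = tconst a" "B = tconst b" "C = tconst c" using hom0_const ABC by metis
  then show ?thesis by (simp add: ABC(4) axis_def)
qed

lemma form1_add: "homogeneous 1 P \<Longrightarrow> teval P (v + w) = teval P v + teval P w"
  by (subst (1 2 3) form1_lin, assumption) (simp add: algebra_simps)

lemma form1_scale: "homogeneous 1 P \<Longrightarrow> teval P (c *s w) = c * teval P w"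
  using teval_scale[of 1 P c w] by simp

lemma form1_diff: "homogeneous 1 P \<Longrightarrow> teval P (v - w) = teval P v - teval P w"
  by (subst (1 2 3) form1_lin, assumption) (simp add: algebra_simps)

lemma form1_ext: "homogeneous 1 P \<Longrightarrow> homogeneous 1 Q \<Longrightarrow> (\<And>v. teval P v = teval Q v) \<Longrightarrow> P = Q"
  using form1_lin by metis

lemma frame_form1:
  assumes fr: "frame x y z u v w" and P: "homogeneous 1 P"
  shows "P = tconst (teval P u) * x + tconst (teval P v) * y + tconst (teval P w) * z"
proof (rule form1_ext[OF P])
  show "homogeneous 1 (tconst (teval P u) * x + tconst (teval P v) * y + tconst (teval P w) * z)"
    using frameD(1-3)[OF fr] by (intro hom_add hom_tconst_mult)
  fix p
  have "teval P p = teval P (teval x p *s u + teval y p *s v + teval z p *s w)"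
    using frameD(16)[OF fr, of p] by simp
  also have "\<dots> = teval (tconst (teval P u) * x + tconst (teval P v) * y + tconst (teval P w) * z) p"
    by (simp add: form1_add[OF P] form1_scale[OF P])
  finally show "teval P p = \<dots>" .
qed

lemma frame_exists:
  assumes "w \<noteq> 0"
  obtains x y z u v where "frame x y z u v w"
proof -
  have h: "homogeneous (Suc 0) X1" "homogeneous (Suc 0) X2" "homogeneous (Suc 0) X3" by simp_all
  have h': "homogeneous d (P * tconst c)" if "homogeneous d P" for d P c
    using hom_tconst_mult[OF that, of c] by (simp add: mult.commute)
  note hh = h h' hom_diff hom_tconst_mult
  from assms consider "w $ 1 \<noteq> 0" | "w $ 2 \<noteq> 0" | "w $ 3 \<noteq> 0" by (auto simp: vec_eq_iff forall_3)
  then show ?thesis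
  proof cases
    case 1
    have "frame (X2 - tconst (w$2 / w$1) * X1) (X3 - tconst (w$3 / w$1) * X1) (tconst (1 / w$1) * X1)
      (axis 2 1) (axis 3 1) w"
      unfolding frame_def using 1 by (auto intro!: hh simp: vec_eq_iff forall_3 axis_def field_simps)
    then show ?thesis by (rule that)
  next
    case 2
    have "frame (X1 - tconst (w$1 / w$2) * X2) (X3 - tconst (w$3 / w$2) * X2) (tconst (1 / w$2) * X2)
      (axis 1 1) (axis 3 1) w"
      unfolding frame_def using 2 by (auto intro!: hh simp: vec_eq_iff forall_3 axis_def field_simps)
    then show ?thesis by (rule that)
  next
    case 3
    have "frame (X1 - tconst (w$1 / w$3) * X3) (X2 - tconst (w$2 / w$3) * X3) (tconst (1 / w$3) * X3)
      (axis 1 1) (axis 2 1) w"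
      unfolding frame_def using 3 by (auto intro!: hh simp: vec_eq_iff forall_3 axis_def field_simps)
    then show ?thesis by (rule that)
  qed
qed

lemma frame_swap: "frame x y z u v w \<Longrightarrow> frame y x z v u w"
  unfolding frame_def by (auto simp: ac_simps)

text \<open>Keeping \<open>x\<close> and \<open>z\<close> forces the new dual basis:
  \<open>u\<close> is moved along \<open>v\<close> until \<open>l\<close> vanishes on it, and
  \<open>v\<close> is rescaled.\<close>

lemma frame_change_aux:
  assumes fr: "frame x y z u v w" and l: "homogeneous 1 l" "teval l w = 0" "teval l v \<noteq> 0"
  shows "frame x l z (u - (teval l u / teval l v) *s v) ((1 / teval l v) *s v) w"
proof -
  define a b where "a = teval l u" and "b = teval l v"
  have le: "l = tconst a * x + tconst b * y" using frame_form1[OF fr l(1)] l(2) by (simp add: a_def b_def)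
  have b0: "b \<noteq> 0" using l by (simp add: b_def)
  note d = frameD[OF fr]
  have t: "teval f (u - (a / b) *s v) = teval f u - (a / b) * teval f v"
    "teval f ((1 / b) *s v) = (1 / b) * teval f v" if "homogeneous 1 f" for f
    by (simp_all only: form1_diff[OF that] form1_scale[OF that])
  have dec: "p = teval x p *s (u - (a/b) *s v) + teval l p *s ((1/b) *s v) + teval z p *s w" for p
  proof -
    have lp: "teval l p = a * teval x p + b * teval y p" by (simp only: le teval_simps)
    have e: "teval x p *s (u - (a/b) *s v) + teval l p *s ((1/b) *s v) + teval z p *s w =
       teval x p *s u + teval y p *s v + teval z p *s w"
      using b0 by (simp add: lp vec_eq_iff right_diff_distrib distrib_right add_divide_distrib)
    show ?thesis by (rule trans[OF d(16)[of p] e[symmetric]])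
  qed
  show ?thesis unfolding frame_def a_def[symmetric] b_def[symmetric]
  proof (intro conjI allI)
    fix p show "p = teval x p *s (u - (a/b) *s v) + teval l p *s ((1/b) *s v) + teval z p *s w" by (rule dec)
  qed (use d(1-15) l b0 in \<open>simp_all add: t\<close>, simp_all add: a_def b_def)
qed

lemma frame_change:
  assumes "frame x y z u v w" "homogeneous 1 l" "teval l w = 0" "l \<noteq> 0"
  obtains x' u' v' where "frame x' l z u' v' w"
proof (cases "teval l v = 0")
  case False
  then show ?thesis using frame_change_aux[OF assms(1-3)] that by blast
next
  case True
  then have "teval l u \<noteq> 0" using frame_form1[OF assms(1,2)] assms(3,4) by auto
  then show ?thesis using frame_change_aux[OF frame_swap[OF assms(1)] assms(2,3)] that by blast
qed

lemma frame_exists_line: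
  assumes "homogeneous 1 l" "l \<noteq> 0" "w \<noteq> 0" "teval l w = 0"
  obtains x z u v where "frame x l z u v w"
  using frame_exists[OF assms(3)] frame_change assms by metis

lemma ex_line_point:
  assumes "homogeneous 1 l"
  obtains w where "w \<noteq> 0" "teval l w = 0"
proof -
  obtain x y z u v where fr: "frame x y z u v (axis 3 1 :: complex^3)"
    by (rule frame_exists[of "axis 3 1 :: complex^3"]) (simp add: axis_eq_0_iff)
  note d = frameD[OF fr]
  have "u \<noteq> 0" using d(7) teval_scale[OF d(1), of 0 u] by auto
  show ?thesis
  proof (cases "teval l u = 0")
    case True
    then show ?thesis using that \<open>u \<noteq> 0\<close> by blast
  next
    case False
    let ?w = "teval l u *s v - teval l v *s u"
    have "teval l ?w = 0" by (simp add: form1_diff[OF assms] form1_scale[OF assms])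
    moreover have "teval y ?w = teval l u"
      by (simp add: form1_diff[OF d(2)] form1_scale[OF d(2)] d)
    then have "?w \<noteq> 0" using False teval_scale[OF d(2), of 0 u] by auto
    ultimately show ?thesis using that by blast
  qed
qed

lemma frame_decomp:
  assumes fr: "frame x y z u v w" and P: "homogeneous (Suc d) P"
  obtains A B C where "homogeneous d A" "homogeneous d B" "homogeneous d C" "P = x * A + y * B + z * C"
proof -
  obtain A B C where ABC: "homogeneous d A" "homogeneous d B" "homogeneous d C" "P = X1 * A + X2 * B + X3 * C"
    using hom_Suc_decomp[OF P] .
  have e: "X1 = tconst (u$1) * x + tconst (v$1) * y + tconst (w$1) * z"
    "X2 = tconst (u$2) * x + tconst (v$2) * y + tconst (w$2) * z"
    "X3 = tconst (u$3) * x + tconst (v$3) * y + tconst (w$3) * z"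
    using frame_form1[OF fr, of X1] frame_form1[OF fr, of X2] frame_form1[OF fr, of X3] by simp_all
  let ?c = "\<lambda>u :: complex ^ 3. tconst (u$1) * A + tconst (u$2) * B + tconst (u$3) * C"
  have "P = x * ?c u + y * ?c v + z * ?c w"
    unfolding ABC(4) by (subst e(1), subst e(2), subst e(3)) (simp add: algebra_simps)
  moreover have "homogeneous d (?c p)" for p using ABC by (intro hom_add hom_tconst_mult)
  ultimately show ?thesis using that by blast
qed

text \<open>Modulo the ideal of \<open>x\<close> and \<open>y\<close> only a multiple of
  \<open>z ^ d\<close> survives, and evaluation at \<open>w\<close> determines it.\<close>

lemma frame_point:
  assumes fr: "frame x y z u v w" and P: "homogeneous d P"
  obtains A B where "homogeneous (d - 1) A" "homogeneous (d - 1) B"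
    "P = tconst (teval P w) * z ^ d + x * A + y * B"
proof -
  \<comment> \<open>The clause for \<open>d = 0\<close> compensates for the truncated
    \<open>d - 1\<close>: without it \<open>z * A'\<close> would have degree 1 instead of 0 in the
    induction step.\<close>
  have "\<exists>A B. homogeneous (d - 1) A \<and> homogeneous (d - 1) B \<and> (d = 0 \<longrightarrow> A = 0 \<and> B = 0) \<and>
    P = tconst (teval P w) * z ^ d + x * A + y * B"
    using P
  proof (induction d arbitrary: P)
    case 0
    then show ?case using hom0_const[of P] by (metis hom_0 mult_zero_right power_0 mult.right_neutral teval_simps(8) add.right_neutral)
  next
    case (Suc d)
    obtain A B C where ABC: "homogeneous d A" "homogeneous d B" "homogeneous d C" "P = x * A + y * B + z * C"
      using frame_decomp[OF fr Suc.prems] .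
    obtain A' B' where C: "homogeneous (d - 1) A'" "homogeneous (d - 1) B'" "d = 0 \<longrightarrow> A' = 0 \<and> B' = 0"
      "C = tconst (teval C w) * z ^ d + x * A' + y * B'"
      using Suc.IH[OF ABC(3)] by blast
    have "teval P w = teval C w" using ABC frameD[OF fr] by simp
    moreover have "z * C = z * (tconst (teval C w) * z ^ d + x * A' + y * B')"
      by (rule arg_cong[OF C(4)])
    ultimately have "P = tconst (teval P w) * z ^ Suc d + x * (A + z * A') + y * (B + z * B')"
      unfolding ABC(4) by (simp only: algebra_simps power_Suc)
    moreover have "homogeneous d (z * A')" "homogeneous d (z * B')"
      using hom_mult[OF frameD(3)[OF fr] C(1)] hom_mult[OF frameD(3)[OF fr] C(2)] C(3)
      by (cases d; simp)+
    ultimately show ?case using hom_add[OF ABC(1), of "z * A'"] hom_add[OF ABC(2), of "z * B'"]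
      by (intro exI[of _ "A + z * A'"] exI[of _ "B + z * B'"]) simp
  qed
  then show ?thesis using that by blast
qed

section \<open>Binary forms and restriction to a line\<close>

definition binform :: "tpoly \<Rightarrow> tpoly \<Rightarrow> nat \<Rightarrow> complex poly \<Rightarrow> tpoly" where
  "binform x z d p = (\<Sum>i\<le>d. tconst (poly.coeff p i) * (x ^ i * z ^ (d - i)))"

lemma hom_binform:
  assumes "homogeneous 1 x" "homogeneous 1 z"
  shows "homogeneous d (binform x z d p)"
  unfolding binform_def
proof (intro hom_sum hom_tconst_mult)
  fix i assume "i \<in> {..d}"
  then show "homogeneous d (x ^ i * z ^ (d - i))"
    using hom_mult[OF hom_power1[OF assms(1), of i] hom_power1[OF assms(2), of "d - i"]] by simp
qed

lemma binform_add: "binform x z d (p + q) = binform x z d p + binform x z d q"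
  by (simp add: binform_def tconst_add algebra_simps sum.distrib)

lemma binform_pCons: "binform x z (Suc d) (pCons 0 p) = x * binform x z d p"
proof -
  have "binform x z (Suc d) (pCons 0 p) =
      (\<Sum>i\<le>d. tconst (poly.coeff p i) * (x ^ Suc i * z ^ (d - i)))"
    unfolding binform_def by (subst sum.atMost_Suc_shift) simp
  then show ?thesis by (simp add: binform_def sum_distrib_left algebra_simps)
qed

lemma binform_mult_z:
  assumes "Polynomial.degree p \<le> d"
  shows "binform x z (Suc d) p = z * binform x z d p"
  using assms unfolding binform_def
  by (simp add: coeff_eq_0 sum_distrib_left Suc_diff_le algebra_simps)

lemma teval_binform:
  assumes "Polynomial.degree p \<le> d" "teval z v = 1"
  shows "teval (binform x z d p) v = poly p (teval x v)"
proof -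
  have "teval (binform x z d p) v = (\<Sum>i\<le>d. poly.coeff p i * teval x v ^ i)"
    using assms(2) by (simp add: binform_def teval_sum)
  also have "\<dots> = poly p (teval x v)"
    unfolding poly_altdef using assms(1)
    by (intro sum.mono_neutral_right) (auto simp: coeff_eq_0)
  finally show ?thesis .
qed

lemma frame_eval_line:
  assumes fr: "frame x y z u v w"
  shows "teval z (w + s *s u) = 1" "teval x (w + s *s u) = s" "teval y (w + s *s u) = 0"
  using frameD[OF fr] form1_add form1_scale by simp_all

text \<open>Modulo \<open>y\<close> a form is the homogenization of its restriction to the line
  \<open>y = 0\<close>, so restricting loses exactly the multiples of \<open>y\<close>.\<close>

lemma frame_line:
  assumes fr: "frame x y z u v w" and P: "homogeneous d P"
  obtains A where "homogeneous (d - 1) A" "P = binform x z d (lpoly P w u) + y * A"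
proof -
  note fd = frameD[OF fr]
  have "\<exists>p A. Polynomial.degree p \<le> d \<and> homogeneous (d - 1) A \<and> (d = 0 \<longrightarrow> A = 0) \<and> P = binform x z d p + y * A"
    using P
  proof (induction d arbitrary: P)
    case 0
    then have "P = binform x z 0 [:coef3 P 0 0 0:]" using hom0_const[of P] by (simp add: binform_def)
    then show ?case by (intro exI[of _ "[:coef3 P 0 0 0:]"] exI[of _ 0]) simp
  next
    case (Suc d)
    obtain A B C where ABC: "homogeneous d A" "homogeneous d B" "homogeneous d C" "P = x * A + y * B + z * C"
      using frame_decomp[OF fr Suc.prems] .
    obtain a A' where a: "Polynomial.degree a \<le> d" "homogeneous (d - 1) A'" "d = 0 \<longrightarrow> A' = 0" "A = binform x z d a + y * A'"
      using Suc.IH[OF ABC(1)] by blast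
    obtain c C' where c: "Polynomial.degree c \<le> d" "homogeneous (d - 1) C'" "d = 0 \<longrightarrow> C' = 0" "C = binform x z d c + y * C'"
      using Suc.IH[OF ABC(3)] by blast
    have "P = binform x z (Suc d) (pCons 0 a + c) + y * (x * A' + z * C' + B)"
      by (simp add: ABC(4) a(4) c(4) binform_add binform_pCons binform_mult_z[OF c(1)] algebra_simps)
    moreover have "homogeneous d (x * A')" "homogeneous d (z * C')"
      using hom_mult[OF fd(1) a(2)] hom_mult[OF fd(3) c(2)] a(3) c(3) by (cases d; simp)+
    moreover have "Polynomial.degree (pCons 0 a + c) \<le> Suc d"
      using a(1) c(1) by (intro degree_add_le) (auto simp: degree_pCons_le intro: order.trans[OF degree_pCons_le])
    ultimately show ?case using ABC hom_add
      by (intro exI[of _ "pCons 0 a + c"] exI[of _ "x * A' + z * C' + B"]) auto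
  qed
  then obtain p A where p: "Polynomial.degree p \<le> d" "homogeneous (d - 1) A" "P = binform x z d p + y * A" by blast
  have lp: "lpoly P w u = p"
  proof (rule lpoly_eqI)
    fix s
    note ev = frame_eval_line[OF fr, of s]
    have "teval (binform x z d p + y * A) (w + s *s u) = poly p s"
      by (simp only: teval_simps teval_binform[OF p(1) ev(1)] ev(2,3)) simp
    then show "poly p s = teval P (w + s *s u)" by (simp only: p(3))
  qed
  show ?thesis using that[OF p(2), unfolded lp] p(3) by blast
qed

lemma frame_lpoly_0:
  assumes fr: "frame x y z u v w" and P: "homogeneous d P" and "lpoly P w u = 0"
  obtains A where "homogeneous (d - 1) A" "P = y * A"
  using frame_line[OF fr P] assms(3) by (auto simp: binform_def)

text \<open>Induction on the degree: a form that vanishes everywhere vanishes on a line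
  \<open>y = 0\<close> and so equals \<open>y * A\<close>. Along every line in direction
  \<open>v\<close> the factor \<open>y\<close> restricts to a nonzero polynomial, so
  \<open>A\<close> vanishes everywhere too.\<close>

lemma ex_nonzero_point:
  assumes "homogeneous d P" "P \<noteq> 0"
  obtains v where "v \<noteq> 0" "teval P v \<noteq> 0"
proof -
  have "\<exists>v. teval P v \<noteq> 0"
  proof (rule ccontr)
    assume "\<nexists>v. teval P v \<noteq> 0"
    then have z: "teval P v = 0" for v by blast
    obtain p0 :: "complex^3" where "p0 \<noteq> 0" by (metis axis_eq_0_iff zero_neq_one)
    from z assms show False
    proof (induction d arbitrary: P)
      case 0
      then show ?case using hom0_const by (metis teval_simps(8) tconst_0)
    next
      case (Suc d)
      obtain x y z u v where fr: "frame x y z u v p0" using frame_exists[OF \<open>p0 \<noteq> 0\<close>] .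
      have "lpoly P p0 u = 0" using Suc.prems by (intro lpoly_eqI) simp
      then obtain A where A: "homogeneous d A" "P = y * A"
        using frame_lpoly_0[OF fr Suc.prems(2)] by auto
      have "teval A p = 0" for p
      proof -
        let ?q = "lpoly y p v * lpoly A p v"
        have "?q = lpoly P p v"
          using lpoly_mult[OF frameD(2)[OF fr] A(1)] A by simp
        also have "\<dots> = 0" using Suc.prems(1) by (intro lpoly_eqI) simp
        finally have "lpoly y p v = 0 \<or> lpoly A p v = 0" by simp
        moreover have "lpoly y p v \<noteq> 0"
          using lpoly(2)[OF frameD(2)[OF fr], of p v] frameD[OF fr] by auto
        ultimately have "lpoly A p v = 0" by blast
        then show ?thesis using lpoly(3)[OF A(1), of p v 0] by simp
      qed
      then show False using Suc.IH[of A] A Suc.prems by auto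
    qed
  qed
  then obtain v where v: "teval P v \<noteq> 0" by blast
  show ?thesis
  proof (cases "v = 0")
    case False
    then show ?thesis using v that by blast
  next
    case True
    have "d = 0"
    proof (rule ccontr)
      assume "d \<noteq> 0"
      then have "teval P (0 *s v) = 0" using teval_scale[OF assms(1), of 0 v] by simp
      then show False using v True by simp
    qed
    then obtain c where "P = tconst c" using hom0_const assms by blast
    then show ?thesis using that[of "axis 1 1"] assms by (simp add: axis_eq_0_iff)
  qed
qed

section \<open>Quotient dimensions in module records\<close>

context rel_space
begin

text \<open>The shape used by \<open>quotient_dim\<close>: an indexed family with unique
  coefficients in place of an independent set.\<close>

definition fdim :: "'b set \<Rightarrow> 'b set \<Rightarrow> nat \<Rightarrow> bool" where
  "fdim V W n \<longleftrightarrow> (\<exists>b \<in> {..<n} \<rightarrow> V. \<forall>v \<in> V.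
     \<exists>!c. c \<in> {..<n} \<rightarrow>\<^sub>E UNIV \<and> v - (\<Sum>i<n. c i \<star> b i) \<in> W)"

lemma hdim_iff_fdim:
  assumes V: "subspace V" and W: "subspace W"
  shows "hdim V W n \<longleftrightarrow> fdim V W n"
proof
  assume "hdim V W n"
  then obtain S where S: "S \<subseteq> V" "card S = n" "indm W S" "\<forall>v\<in>V. spnm W S v"
    unfolding hdim_def by blast
  then have "finite S" by (simp add: indm_def)
  then obtain b where b: "bij_betw b {..<n} S"
    using S(2) ex_bij_betw_nat_finite[of S] by (auto simp: atLeast0LessThan)
  have reidx: "(\<Sum>s\<in>S. c s \<star> s) = (\<Sum>i<n. c (b i) \<star> b i)" for c
    using sum.reindex_bij_betw[OF b, of "\<lambda>s. c s \<star> s"] by simp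
  define bi where "bi = the_inv_into {..<n} b"
  have bi: "bi (b i) = i" if "i < n" for i
    using b that unfolding bi_def by (simp add: the_inv_into_f_f bij_betw_def)
  have bS: "b i \<in> S" if "i < n" for i using b that by (auto simp: bij_betw_def)
  have "\<exists>!c. c \<in> {..<n} \<rightarrow>\<^sub>E UNIV \<and> v - (\<Sum>i<n. c i \<star> b i) \<in> W" if v: "v \<in> V" for v
  proof (rule ex_ex1I)
    obtain c where "v - (\<Sum>s\<in>S. c s \<star> s) \<in> W" using S v by (auto simp: spnm_def)
    then show "\<exists>c. c \<in> {..<n} \<rightarrow>\<^sub>E UNIV \<and> v - (\<Sum>i<n. c i \<star> b i) \<in> W"
      by (intro exI[of _ "restrict (c \<circ> b) {..<n}"]) (simp add: reidx)
  next
    fix c d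
    assume c: "c \<in> {..<n} \<rightarrow>\<^sub>E UNIV \<and> v - (\<Sum>i<n. c i \<star> b i) \<in> W"
      and d: "d \<in> {..<n} \<rightarrow>\<^sub>E UNIV \<and> v - (\<Sum>i<n. d i \<star> b i) \<in> W"
    have "(\<Sum>i<n. (c i - d i) \<star> b i) = (v - (\<Sum>i<n. d i \<star> b i)) - (v - (\<Sum>i<n. c i \<star> b i))"
      by (simp add: lincomb_diff[symmetric])
    also have "\<dots> \<in> W" using c d subspace_diff[OF W] by blast
    also have "(\<Sum>i<n. (c i - d i) \<star> b i) = (\<Sum>s\<in>S. (c (bi s) - d (bi s)) \<star> s)"
      unfolding reidx by (intro sum.cong) (auto simp: bi)
    finally have cd: "\<forall>s\<in>S. c (bi s) - d (bi s) = 0"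
      using S(3) unfolding indm_def by (elim conjE allE[of _ "\<lambda>s. c (bi s) - d (bi s)"]) auto
    have "c i = d i" if "i < n" for i
    proof -
      have "c (bi (b i)) - d (bi (b i)) = 0" using cd bS[OF that] by (rule bspec)
      then show ?thesis unfolding bi[OF that] by simp
    qed
    then show "c = d" by (intro PiE_ext[OF conjunct1[OF c] conjunct1[OF d]]) (simp only: lessThan_iff)
  qed
  moreover have "b \<in> {..<n} \<rightarrow> V" using bS S(1) by (simp add: Pi_iff subset_iff)
  ultimately show "fdim V W n" unfolding fdim_def by (intro bexI[of _ b] ballI)
next
  assume "fdim V W n"
  then obtain b where b: "b \<in> {..<n} \<rightarrow> V"
    and bu': "\<forall>v\<in>V. \<exists>!c. c \<in> {..<n} \<rightarrow>\<^sub>E UNIV \<and> v - (\<Sum>i<n. c i \<star> b i) \<in> W"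
    unfolding fdim_def by (rule bexE)
  note bu = bspec[OF bu']
  have zero: "c i = 0" if c: "(\<Sum>i<n. c i \<star> b i) \<in> W" and i: "i < n" for c i
  proof -
    have "restrict c {..<n} = restrict (\<lambda>_. 0) {..<n}"
    proof (rule ex1E[OF bu[OF subspace_0[OF V]]])
      fix e assume u: "\<forall>y. y \<in> {..<n} \<rightarrow>\<^sub>E UNIV \<and> 0 - (\<Sum>i<n. y i \<star> b i) \<in> W \<longrightarrow> y = e"
      have "restrict c {..<n} = e" using c subspace_neg[OF W c] by (intro u[rule_format]) simp
      moreover have "restrict (\<lambda>_. 0) {..<n} = e" using subspace_0[OF W] by (intro u[rule_format]) simp
      ultimately show ?thesis by simp
    qed
    then show ?thesis using i by (metis lessThan_iff restrict_apply')
  qed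
  have inj: "inj_on b {..<n}"
  proof (rule inj_onI, rule ccontr)
    fix i j assume ij: "i \<in> {..<n}" "j \<in> {..<n}" "b i = b j" "i \<noteq> j"
    have "(\<Sum>k<n. (if k = i then 1 else if k = j then - 1 else 0) \<star> b k)
      = (\<Sum>k<n. (if k = i then b i else 0) + (if k = j then - b j else 0))"
      using ij by (intro sum.cong) auto
    also have "\<dots> = 0" using ij by (simp add: sum.distrib)
    finally have "(if i = i then (1::'a) else if i = j then - 1 else 0) = 0"
      using ij subspace_0[OF W] by (intro zero[of "\<lambda>k. if k = i then 1 else if k = j then - 1 else 0"]) auto
    then show False by simp
  qed
  have reidx: "(\<Sum>s\<in>b ` {..<n}. c s \<star> s) = (\<Sum>i<n. c (b i) \<star> b i)" for c
    using inj by (simp add: sum.reindex)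
  have "indm W (b ` {..<n})"
    unfolding indm_def
  proof (intro conjI allI impI ballI)
    fix c s assume "(\<Sum>s\<in>b ` {..<n}. c s \<star> s) \<in> W" "s \<in> b ` {..<n}"
    then show "c s = 0" using zero[of "\<lambda>i. c (b i)"] by (auto simp: reidx)
  qed simp
  moreover have "spnm W (b ` {..<n}) v" if vV: "v \<in> V" for v
  proof -
    obtain c where c: "v - (\<Sum>i<n. c i \<star> b i) \<in> W" using bu[OF vV] by (elim ex1E conjE)
    have "(\<Sum>s\<in>b ` {..<n}. c (the_inv_into {..<n} b s) \<star> s) = (\<Sum>i<n. c i \<star> b i)"
      unfolding reidx using inj by (intro sum.cong) (auto simp: the_inv_into_f_f)
    then have "v - (\<Sum>s\<in>b ` {..<n}. c (the_inv_into {..<n} b s) \<star> s) \<in> W" using c by simp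
    then show ?thesis by (rule spnmI)
  qed
  moreover have "b ` {..<n} \<subseteq> V" using b by auto
  moreover have "card (b ` {..<n}) = n" using card_image[OF inj] by simp
  ultimately show "hdim V W n" unfolding hdim_def by blast
qed

end

locale complex_space = rel_space scale
  for scale :: "complex \<Rightarrow> 'b::ab_group_add \<Rightarrow> 'b" (infixr "\<star>" 75)
begin

text \<open>\<open>V / W'\<close> is identified with \<open>M / W\<close> by a linear map \<open>j\<close>.\<close>

lemma quotient_dim_eqI:
  fixes M :: "(complex, 'm) module"
  assumes M: "abelian_group M" and V: "subspace V" and W': "subspace W'"
    and j: "\<And>x. x \<in> V \<Longrightarrow> j x \<in> carrier M"
    and jadd: "\<And>x y. x \<in> V \<Longrightarrow> y \<in> V \<Longrightarrow> j (x + y) = j x \<oplus>\<^bsub>M\<^esub> j y"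
    and jscl: "\<And>c x. x \<in> V \<Longrightarrow> j (c \<star> x) = c \<odot>\<^bsub>M\<^esub> j x"
    and scl: "\<And>c a. a \<in> carrier M \<Longrightarrow> c \<odot>\<^bsub>M\<^esub> a \<in> carrier M"
    and sadd: "\<And>c a b. a \<in> carrier M \<Longrightarrow> b \<in> carrier M \<Longrightarrow>
       c \<odot>\<^bsub>M\<^esub> (a \<oplus>\<^bsub>M\<^esub> b) = c \<odot>\<^bsub>M\<^esub> a \<oplus>\<^bsub>M\<^esub> c \<odot>\<^bsub>M\<^esub> b"
    and Wsub: "W \<subseteq> carrier M"
    and Wadd: "\<And>a b. a \<in> W \<Longrightarrow> b \<in> W \<Longrightarrow> a \<oplus>\<^bsub>M\<^esub> b \<in> W"
    and Wneg: "\<And>a. a \<in> W \<Longrightarrow> \<ominus>\<^bsub>M\<^esub> a \<in> W"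
    and Wscl: "\<And>c a. a \<in> W \<Longrightarrow> c \<odot>\<^bsub>M\<^esub> a \<in> W"
    and srj: "\<And>r. r \<in> carrier M \<Longrightarrow> \<exists>v\<in>V. r \<ominus>\<^bsub>M\<^esub> j v \<in> W"
    and ker: "\<And>v. v \<in> V \<Longrightarrow> j v \<in> W \<longleftrightarrow> v \<in> W'"
    and n: "hdim V W' n"
  shows "quotient_dim M W = n"
proof -
  interpret M: abelian_group M by (rule M)
  have j0: "j 0 = \<zero>\<^bsub>M\<^esub>"
  proof -
    have "j 0 \<oplus>\<^bsub>M\<^esub> j 0 = j 0" using jadd[of 0 0] subspace_0[OF V] by simp
    then show ?thesis using j[OF subspace_0[OF V]] by (metis M.add.l_cancel_one')
  qed
  have W0: "\<zero>\<^bsub>M\<^esub> \<in> W" using ker[OF subspace_0[OF V]] j0 subspace_0[OF W'] by simp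
  have jsum: "j (\<Sum>i\<in>I. g i) = (\<Oplus>\<^bsub>M\<^esub>i\<in>I. j (g i))" if "\<And>i. i \<in> I \<Longrightarrow> g i \<in> V" "finite I" for g and I :: "nat set"
    using that(2,1)
  proof (induction I rule: finite_induct)
    case (insert x F)
    then have "(\<lambda>i. j (g i)) \<in> F \<rightarrow> carrier M" "j (g x) \<in> carrier M" using j by auto
    with insert show ?case using subspace_sum[OF V, of F g] jadd[of "g x" "sum g F"] by simp
  qed (simp add: j0)
  have Wsum: "(\<Oplus>\<^bsub>M\<^esub>i\<in>I. g i) \<in> W" if "\<And>i. i \<in> I \<Longrightarrow> g i \<in> W" "finite I" for g and I :: "nat set"
    using that(2,1)
  proof (induction I rule: finite_induct)
    case (insert x F)
    then have "g \<in> F \<rightarrow> carrier M" "g x \<in> carrier M" using Wsub by auto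
    with insert show ?case by (simp add: Wadd)
  qed (simp add: W0)
  \<comment> \<open>Changing \<open>r\<close> and the \<open>b i\<close> by elements of
    \<open>W\<close> changes the difference by an element of \<open>W\<close>, so the condition can
    be tested on representatives in \<open>V\<close>.\<close>
  have key: "r \<ominus>\<^bsub>M\<^esub> (\<Oplus>\<^bsub>M\<^esub>i\<in>{..<k}. c i \<odot>\<^bsub>M\<^esub> b i) \<in> W \<longleftrightarrow> v - (\<Sum>i<k. c i \<star> b' i) \<in> W'"
    if r: "r \<in> carrier M" "v \<in> V" "r \<ominus>\<^bsub>M\<^esub> j v \<in> W"
      and b: "\<And>i. i < k \<Longrightarrow> b i \<in> carrier M \<and> b' i \<in> V \<and> b i \<ominus>\<^bsub>M\<^esub> j (b' i) \<in> W"
    for r v c b b' and k :: nat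
  proof -
    define S where "S = (\<Sum>i<k. c i \<star> b' i)"
    have SV: "S \<in> V" using b V unfolding S_def by (intro subspace_sum) (auto intro: subspace_scale)
    define D where "D = (\<Oplus>\<^bsub>M\<^esub>i\<in>{..<k}. c i \<odot>\<^bsub>M\<^esub> (b i \<ominus>\<^bsub>M\<^esub> j (b' i)))"
    have DW: "D \<in> W" unfolding D_def by (rule Wsum) (use b in \<open>auto intro: Wscl\<close>)
    have jS: "j S = (\<Oplus>\<^bsub>M\<^esub>i\<in>{..<k}. c i \<odot>\<^bsub>M\<^esub> j (b' i))"
    proof -
      have "j S = (\<Oplus>\<^bsub>M\<^esub>i\<in>{..<k}. j (c i \<star> b' i))"
        unfolding S_def by (rule jsum) (use b V in \<open>auto intro: subspace_scale\<close>)
      also have "\<dots> = (\<Oplus>\<^bsub>M\<^esub>i\<in>{..<k}. c i \<odot>\<^bsub>M\<^esub> j (b' i))"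
        using b j by (intro M.finsum_cong') (auto simp: jscl scl)
      finally show ?thesis .
    qed
    have c1: "(\<lambda>i. c i \<odot>\<^bsub>M\<^esub> (b i \<ominus>\<^bsub>M\<^esub> j (b' i))) \<in> {..<k} \<rightarrow> carrier M"
      "(\<lambda>i. c i \<odot>\<^bsub>M\<^esub> j (b' i)) \<in> {..<k} \<rightarrow> carrier M"
      using b j by (auto intro!: scl)
    have "(\<Oplus>\<^bsub>M\<^esub>i\<in>{..<k}. c i \<odot>\<^bsub>M\<^esub> b i) =
      (\<Oplus>\<^bsub>M\<^esub>i\<in>{..<k}. c i \<odot>\<^bsub>M\<^esub> (b i \<ominus>\<^bsub>M\<^esub> j (b' i)) \<oplus>\<^bsub>M\<^esub> c i \<odot>\<^bsub>M\<^esub> j (b' i))"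
    proof (rule M.finsum_cong'[OF refl])
      show "(\<lambda>i. c i \<odot>\<^bsub>M\<^esub> (b i \<ominus>\<^bsub>M\<^esub> j (b' i)) \<oplus>\<^bsub>M\<^esub> c i \<odot>\<^bsub>M\<^esub> j (b' i)) \<in> {..<k} \<rightarrow> carrier M"
        using c1 by auto
      fix i assume "i \<in> {..<k}"
      then have bi: "b i \<in> carrier M" "j (b' i) \<in> carrier M" using b j by auto
      have "b i = (b i \<ominus>\<^bsub>M\<^esub> j (b' i)) \<oplus>\<^bsub>M\<^esub> j (b' i)"
        using bi by (simp add: a_minus_def M.add.m_assoc M.l_neg)
      then show "c i \<odot>\<^bsub>M\<^esub> b i = c i \<odot>\<^bsub>M\<^esub> (b i \<ominus>\<^bsub>M\<^esub> j (b' i)) \<oplus>\<^bsub>M\<^esub> c i \<odot>\<^bsub>M\<^esub> j (b' i)"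
        using sadd[of "b i \<ominus>\<^bsub>M\<^esub> j (b' i)" "j (b' i)"] bi by simp
    qed
    also have "\<dots> = D \<oplus>\<^bsub>M\<^esub> j S" unfolding D_def jS using c1 by (rule M.finsum_addf)
    finally have eq: "(\<Oplus>\<^bsub>M\<^esub>i\<in>{..<k}. c i \<odot>\<^bsub>M\<^esub> b i) = D \<oplus>\<^bsub>M\<^esub> j S" .
    define E where "E = (r \<ominus>\<^bsub>M\<^esub> j v) \<oplus>\<^bsub>M\<^esub> \<ominus>\<^bsub>M\<^esub> D"
    have EW: "E \<in> W" unfolding E_def using r DW by (intro Wadd Wneg)
    have cr: "D \<in> carrier M" "E \<in> carrier M" "j v \<in> carrier M" "j S \<in> carrier M"
      using DW EW Wsub j r SV by auto
    have jd: "j v = j (v - S) \<oplus>\<^bsub>M\<^esub> j S" using jadd[of "v - S" S] SV r subspace_diff[OF V] by simp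
    have vS: "v - S \<in> V" using SV r subspace_diff[OF V] by blast
    have jvS: "j (v - S) \<in> carrier M" using j[OF vS] .
    have gen: "(p \<oplus>\<^bsub>M\<^esub> (q \<oplus>\<^bsub>M\<^esub> s)) \<ominus>\<^bsub>M\<^esub> (d \<oplus>\<^bsub>M\<^esub> s) = (p \<oplus>\<^bsub>M\<^esub> \<ominus>\<^bsub>M\<^esub> d) \<oplus>\<^bsub>M\<^esub> q"
      if "p \<in> carrier M" "q \<in> carrier M" "s \<in> carrier M" "d \<in> carrier M" for p q s d
    proof -
      have "(p \<oplus>\<^bsub>M\<^esub> (q \<oplus>\<^bsub>M\<^esub> s)) \<ominus>\<^bsub>M\<^esub> (d \<oplus>\<^bsub>M\<^esub> s) = ((p \<oplus>\<^bsub>M\<^esub> \<ominus>\<^bsub>M\<^esub> d) \<oplus>\<^bsub>M\<^esub> q) \<oplus>\<^bsub>M\<^esub> (s \<oplus>\<^bsub>M\<^esub> \<ominus>\<^bsub>M\<^esub> s)"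
        using that by (simp add: a_minus_def M.minus_add M.a_ac del: M.r_neg)
      then show ?thesis using that by (simp add: M.r_neg)
    qed
    have "r \<ominus>\<^bsub>M\<^esub> (D \<oplus>\<^bsub>M\<^esub> j S) = E \<oplus>\<^bsub>M\<^esub> j (v - S)"
    proof -
      have "r = (r \<ominus>\<^bsub>M\<^esub> j v) \<oplus>\<^bsub>M\<^esub> j v" using r cr by (simp add: a_minus_def M.add.m_assoc M.l_neg)
      then have "r \<ominus>\<^bsub>M\<^esub> (D \<oplus>\<^bsub>M\<^esub> j S) =
          ((r \<ominus>\<^bsub>M\<^esub> j v) \<oplus>\<^bsub>M\<^esub> (j (v - S) \<oplus>\<^bsub>M\<^esub> j S)) \<ominus>\<^bsub>M\<^esub> (D \<oplus>\<^bsub>M\<^esub> j S)"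
        using jd by simp
      also have "\<dots> = E \<oplus>\<^bsub>M\<^esub> j (v - S)"
        unfolding E_def by (rule gen) (use r cr jvS in auto)
      finally show ?thesis .
    qed
    moreover have "E \<oplus>\<^bsub>M\<^esub> j (v - S) \<in> W \<longleftrightarrow> j (v - S) \<in> W"
    proof
      assume "E \<oplus>\<^bsub>M\<^esub> j (v - S) \<in> W"
      then have "\<ominus>\<^bsub>M\<^esub> E \<oplus>\<^bsub>M\<^esub> (E \<oplus>\<^bsub>M\<^esub> j (v - S)) \<in> W" by (rule Wadd[OF Wneg[OF EW]])
      then show "j (v - S) \<in> W" using cr jvS by (simp add: M.r_neg1)
    qed (use EW in \<open>auto intro: Wadd\<close>)
    ultimately show ?thesis using eq ker[OF vS] by (simp add: S_def)
  qed
  let ?P = "\<lambda>n :: nat. \<exists>b \<in> {..<n} \<rightarrow> carrier M. \<forall>v \<in> carrier M.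
     \<exists>!c. c \<in> {..<n} \<rightarrow>\<^sub>E UNIV \<and> v \<ominus>\<^bsub>M\<^esub> (\<Oplus>\<^bsub>M\<^esub>i \<in> {..<n}. c i \<odot>\<^bsub>M\<^esub> b i) \<in> W"
  have jself: "j x \<ominus>\<^bsub>M\<^esub> j x \<in> W" if "x \<in> V" for x using j[OF that] W0 by (simp add: a_minus_def M.r_neg)
  \<comment> \<open>Every basis of \<open>M\<close> modulo \<open>W\<close> lifts along
    \<open>j\<close>, so all of them have the length of a basis of \<open>V\<close> modulo
    \<open>W'\<close>. This uniqueness is required by the definite description in
    \<open>quotient_dim\<close>.\<close>
  have P_imp: "fdim V W' k" if Pk: "?P k" for k
  proof -
    obtain b where b: "b \<in> {..<k} \<rightarrow> carrier M"
      and bu': "\<forall>v\<in>carrier M. \<exists>!c. c \<in> {..<k} \<rightarrow>\<^sub>E UNIV \<and> v \<ominus>\<^bsub>M\<^esub> (\<Oplus>\<^bsub>M\<^esub>i \<in> {..<k}. c i \<odot>\<^bsub>M\<^esub> b i) \<in> W"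
      using Pk by (rule bexE)
    note bu = bspec[OF bu']
    obtain b' where b': "\<And>i. i < k \<Longrightarrow> b' i \<in> V \<and> b i \<ominus>\<^bsub>M\<^esub> j (b' i) \<in> W"
    proof -
      have "\<forall>i. \<exists>x. i < k \<longrightarrow> x \<in> V \<and> b i \<ominus>\<^bsub>M\<^esub> j x \<in> W"
        using srj b by (auto simp: Pi_iff)
      then have "\<exists>f. \<forall>i. i < k \<longrightarrow> f i \<in> V \<and> b i \<ominus>\<^bsub>M\<^esub> j (f i) \<in> W" by (rule choice)
      then show thesis using that by blast
    qed
    have "\<exists>!c. c \<in> {..<k} \<rightarrow>\<^sub>E UNIV \<and> v - (\<Sum>i<k. c i \<star> b' i) \<in> W'" if v: "v \<in> V" for v
    proof -
      have "j v \<ominus>\<^bsub>M\<^esub> (\<Oplus>\<^bsub>M\<^esub>i \<in> {..<k}. c i \<odot>\<^bsub>M\<^esub> b i) \<in> W \<longleftrightarrow> v - (\<Sum>i<k. c i \<star> b' i) \<in> W'" for c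
        by (rule key[OF j[OF v] v jself[OF v]]) (use b b' in \<open>auto simp: Pi_iff\<close>)
      then show ?thesis using bu[OF j[OF v]] by simp
    qed
    then show ?thesis unfolding fdim_def by (intro bexI[of _ b'] ballI) (use b' in \<open>auto simp: Pi_iff\<close>)
  qed
  have P_n: "?P n"
  proof -
    obtain b where b: "b \<in> {..<n} \<rightarrow> V"
      and bu': "\<forall>v\<in>V. \<exists>!c. c \<in> {..<n} \<rightarrow>\<^sub>E UNIV \<and> v - (\<Sum>i<n. c i \<star> b i) \<in> W'"
      using n unfolding hdim_iff_fdim[OF V W'] fdim_def by (rule bexE)
    note bu = bspec[OF bu']
    have "\<exists>!c. c \<in> {..<n} \<rightarrow>\<^sub>E UNIV \<and> r \<ominus>\<^bsub>M\<^esub> (\<Oplus>\<^bsub>M\<^esub>i\<in>{..<n}. c i \<odot>\<^bsub>M\<^esub> j (b i)) \<in> W"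
      if r: "r \<in> carrier M" for r
    proof -
      obtain v where v: "v \<in> V" "r \<ominus>\<^bsub>M\<^esub> j v \<in> W" using srj[OF r] by blast
      have "r \<ominus>\<^bsub>M\<^esub> (\<Oplus>\<^bsub>M\<^esub>i \<in> {..<n}. c i \<odot>\<^bsub>M\<^esub> j (b i)) \<in> W \<longleftrightarrow> v - (\<Sum>i<n. c i \<star> b i) \<in> W'" for c
        by (rule key[OF r v]) (use b j jself in \<open>auto simp: Pi_iff\<close>)
      then show ?thesis using bu[OF v(1)] by simp
    qed
    then show ?thesis by (intro bexI[of _ "\<lambda>i. j (b i)"] ballI) (use b j in \<open>auto simp: Pi_iff\<close>)
  qed
  show ?thesis
    unfolding quotient_dim_def
  proof (rule the_equality)
    fix k assume "?P k"
    then have "hdim V W' k" using P_imp hdim_iff_fdim[OF V W'] by blast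
    then show "k = n" using hdim_unique[OF W'] n by blast
  qed (rule P_n)
qed

end

lemma abelian_group_typeI:
  assumes "add M = (+)" "zero M = (0 :: 'v :: ab_group_add)"
    "0 \<in> carrier M" "\<And>x y. x \<in> carrier M \<Longrightarrow> y \<in> carrier M \<Longrightarrow> x + y \<in> carrier M"
    "\<And>x. x \<in> carrier M \<Longrightarrow> - x \<in> carrier M"
  shows "abelian_group M"
proof (rule abelian_groupI)
  fix x assume "x \<in> carrier M"
  then show "\<exists>y\<in>carrier M. y \<oplus>\<^bsub>M\<^esub> x = \<zero>\<^bsub>M\<^esub>"
    using assms by (intro bexI[of _ "- x"]) auto
qed (use assms in \<open>auto simp: algebra_simps\<close>)

lemma a_inv_typeI:
  assumes M: "abelian_group M" and "add M = (+)" "zero M = (0 :: 'v :: ab_group_add)"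
    and x: "x \<in> carrier M" "- x \<in> carrier M"
  shows "\<ominus>\<^bsub>M\<^esub> x = - x"
proof -
  interpret abelian_group M by (rule M)
  have "- x \<oplus>\<^bsub>M\<^esub> x = \<zero>\<^bsub>M\<^esub>" using assms by simp
  then show ?thesis using x minus_equality by blast
qed

section \<open>Points and local rings of the plane\<close>

lemma Fract_add1: "Fract (p + q) 1 = Fract p 1 + Fract (q :: 'a :: idom) 1"
  by simp

lemma Fract_mult1: "Fract (p * q) 1 = Fract p 1 * Fract (q :: 'a :: idom) 1"
  by simp

interpretation fr: complex_space "\<lambda>c x. Fract (tconst c) 1 * (x :: tpoly fract)"
  by unfold_locales
    (simp_all only: tconst_add tconst_mult Fract_add1 Fract_mult1 algebra_simps tconst_1 One_fract_def[symmetric]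
      mult_1_right mult_1_left)

definition vec_of :: "proj_plane \<Rightarrow> complex ^ 3" where
  "vec_of p = (SOME v. v \<in> line_of p \<and> v \<noteq> 0)"

lemma line_of_props: "vec.subspace (line_of p)" "vec.dim (line_of p) = 1"
  using line_of[of p] by auto

lemma vec_of: "vec_of p \<in> line_of p" "vec_of p \<noteq> 0"
proof -
  have "\<exists>v. v \<in> line_of p \<and> v \<noteq> 0"
    using line_of_props[of p] vec.dim_eq_0[of "line_of p"] by auto
  from someI_ex[OF this] show "vec_of p \<in> line_of p" "vec_of p \<noteq> 0" by (simp_all add: vec_of_def)
qed

lemma line_of_eq: "line_of p = range (\<lambda>c. c *s vec_of p)"
proof -
  have "vec.independent {vec_of p}" using vec_of[of p] by simp
  then have "line_of p \<subseteq> vec.span {vec_of p}"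
    using vec_of[of p] line_of_props[of p] by (intro vec.card_ge_dim_independent) auto
  moreover have "vec.span {vec_of p} \<subseteq> line_of p"
    using vec_of[of p] line_of_props[of p] by (intro vec.span_minimal) auto
  ultimately show ?thesis by (simp add: vec.span_singleton)
qed

lemma ex_point:
  assumes "v \<noteq> 0"
  obtains p c where "v = c *s vec_of p" "c \<noteq> 0"
proof -
  have "vec.dim (vec.span {v}) = 1" using assms by (simp add: vec.dim_eq_card_independent)
  then have "line_of (Abs_proj_plane (vec.span {v})) = vec.span {v}"
    by (intro Abs_proj_plane_inverse) auto
  then have "v \<in> line_of (Abs_proj_plane (vec.span {v}))" by (simp add: vec.span_base)
  then obtain c where "v = c *s vec_of (Abs_proj_plane (vec.span {v}))" by (auto simp: line_of_eq)
  moreover from this have "c \<noteq> 0" using assms by auto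
  ultimately show ?thesis by (rule that)
qed

lemma vanishes_iff:
  assumes "homogeneous d P"
  shows "vanishes P p \<longleftrightarrow> teval P (vec_of p) = 0"
proof
  assume "vanishes P p"
  then show "teval P (vec_of p) = 0" using vec_of unfolding vanishes_def by blast
next
  assume "teval P (vec_of p) = 0"
  then show "vanishes P p" using teval_scale[OF assms] by (auto simp: vanishes_def line_of_eq)
qed

lemma point_eqI:
  assumes "vec_of p = c *s vec_of q"
  shows "p = q"
proof -
  have c0: "c \<noteq> 0" using assms vec_of(2)[of p] by auto
  have "line_of p = line_of q"
    unfolding line_of_eq assms
  proof (intro equalityI subsetI)
    fix x assume "x \<in> range (\<lambda>d. d *s vec_of q)"
    then obtain d where "x = d *s vec_of q" by blast
    then have "x = (d / c) *s (c *s vec_of q)" using c0 by (simp add: vector_smult_assoc)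
    then show "x \<in> range (\<lambda>d. d *s (c *s vec_of q))" by blast
  qed (auto simp: vector_smult_assoc)
  then show ?thesis by (simp add: line_of_inject)
qed

definition loc :: "complex ^ 3 \<Rightarrow> tpoly fract set" where
  "loc w = {Fract P Q |P Q d. homogeneous d P \<and> homogeneous d Q \<and> teval Q w \<noteq> 0}"

lemma locI: "homogeneous d P \<Longrightarrow> homogeneous d Q \<Longrightarrow> teval Q w \<noteq> 0 \<Longrightarrow> Fract P Q \<in> loc w"
  unfolding loc_def by blast

lemma teval_nz: "teval Q w \<noteq> 0 \<Longrightarrow> Q \<noteq> 0"
  by auto

lemma locE:
  assumes "k \<in> loc w"
  obtains P Q d where "homogeneous d P" "homogeneous d Q" "teval Q w \<noteq> 0" "Q \<noteq> 0" "k = Fract P Q"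
  using assms teval_nz unfolding loc_def by blast

lemma loc_add: assumes "a \<in> loc w" "b \<in> loc w" shows "a + b \<in> loc w"
proof -
  obtain P Q d where a: "homogeneous d P" "homogeneous d Q" "teval Q w \<noteq> 0" "Q \<noteq> 0" "a = Fract P Q"
    using assms(1) by (rule locE)
  obtain R S e where b: "homogeneous e R" "homogeneous e S" "teval S w \<noteq> 0" "S \<noteq> 0" "b = Fract R S"
    using assms(2) by (rule locE)
  have "homogeneous (d + e) (P * S + R * Q)"
    using hom_add[OF hom_mult[OF a(1) b(2)], of "R * Q"] hom_mult[OF b(1) a(2)] by (simp add: add.commute)
  from locI[OF this hom_mult[OF a(2) b(2)], of w] a b show ?thesis by simp
qed

lemma loc_mult: assumes "a \<in> loc w" "b \<in> loc w" shows "a * b \<in> loc w"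
proof -
  obtain P Q d where a: "homogeneous d P" "homogeneous d Q" "teval Q w \<noteq> 0" "Q \<noteq> 0" "a = Fract P Q"
    using assms(1) by (rule locE)
  obtain R S e where b: "homogeneous e R" "homogeneous e S" "teval S w \<noteq> 0" "S \<noteq> 0" "b = Fract R S"
    using assms(2) by (rule locE)
  from locI[OF hom_mult[OF a(1) b(1)] hom_mult[OF a(2) b(2)], of w] a b show ?thesis by simp
qed

lemma loc_const: "Fract (tconst c) 1 \<in> loc w"
  by (rule locI[of 0]) auto

lemma loc_0: "0 \<in> loc w" and loc_1: "1 \<in> loc w"
  using loc_const[of 0 w] loc_const[of 1 w] by (simp_all add: Zero_fract_def One_fract_def)

lemma loc_uminus: "a \<in> loc w \<Longrightarrow> - a \<in> loc w"
  using loc_mult[OF loc_const[of "-1" w], of a]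
  by (simp add: tconst_minus minus_fract[symmetric] One_fract_def[symmetric] del: minus_fract)

lemma loc_diff: "a \<in> loc w \<Longrightarrow> b \<in> loc w \<Longrightarrow> a - b \<in> loc w"
  using loc_add[of a w "- b"] loc_uminus by simp

lemma loc_power: "a \<in> loc w \<Longrightarrow> a ^ n \<in> loc w"
  by (induction n) (auto intro: loc_mult loc_1)

lemma loc_sum: "(\<And>i. i \<in> I \<Longrightarrow> f i \<in> loc w) \<Longrightarrow> sum f I \<in> loc w"
  by (induction I rule: infinite_finite_induct) (auto intro: loc_add loc_0)

lemma subspace_loc: "fr.subspace (loc w)"
  unfolding fr.subspace_def using loc_0 loc_add loc_mult[OF loc_const] by blast

lemma carrier_local_ring: "carrier (local_ring p) = loc (vec_of p)"
  using vanishes_iff[of _ _ p] unfolding local_ring_def loc_def by simp blast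

lemma local_ring_ops [simp]:
  "add (local_ring p) = (+)" "zero (local_ring p) = 0" "mult (local_ring p) = (*)" "one (local_ring p) = 1"
  "module.smult (local_ring p) = (\<lambda>c x. Fract (tconst c) 1 * x)"
  by (simp_all add: local_ring_def fractions_def)

lemma max_ideal_eq:
  "max_ideal p = {Fract P Q |P Q d. homogeneous d P \<and> homogeneous d Q \<and>
     teval Q (vec_of p) \<noteq> 0 \<and> teval P (vec_of p) = 0}"
  unfolding max_ideal_def using vanishes_iff by blast

lemma ideal_at_eq:
  "ideal_at F p = {Fract P Q |P Q d. homogeneous d P \<and> homogeneous d Q \<and> teval Q (vec_of p) \<noteq> 0 \<and> F dvd P}"
  unfolding ideal_at_def using vanishes_iff by blast

lemma ideal_atI:
  assumes "homogeneous d P" "homogeneous d Q" "teval Q (vec_of p) \<noteq> 0" "F dvd P"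
  shows "Fract P Q \<in> ideal_at F p"
  unfolding ideal_at_eq mem_Collect_eq using assms by (intro exI conjI) (rule refl)

subsection \<open>Expansion along a line\<close>

definition flp :: "complex ^ 3 \<Rightarrow> complex ^ 3 \<Rightarrow> tpoly \<Rightarrow> complex fps" where
  "flp w u P = fps_of_poly (lpoly P w u)"

lemma flp_mult: "homogeneous d P \<Longrightarrow> homogeneous e Q \<Longrightarrow> flp w u (P * Q) = flp w u P * flp w u Q"
  by (simp add: flp_def lpoly_mult fps_of_poly_mult)

lemma flp_add: "homogeneous d P \<Longrightarrow> homogeneous d Q \<Longrightarrow> flp w u (P + Q) = flp w u P + flp w u Q"
  by (simp add: flp_def lpoly_add fps_of_poly_add)

lemma flp_0: "homogeneous d P \<Longrightarrow> fps_nth (flp w u P) 0 = teval P w"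
  by (simp add: flp_def lpoly_coeff0)

lemma lpoly_tconst: "lpoly (tconst c) w u = [:c:]"
  by (rule lpoly_eqI) simp

lemma lpoly_form1: "homogeneous 1 l \<Longrightarrow> lpoly l w u = [:teval l w, teval l u:]"
  by (rule lpoly_eqI) (simp add: form1_add form1_scale)

text \<open>Expansion of a germ in the parameter of the line \<open>w + s *s u\<close>, a ring
  homomorphism from the local ring to power series.\<close>

definition rho :: "complex ^ 3 \<Rightarrow> complex ^ 3 \<Rightarrow> tpoly fract \<Rightarrow> complex fps" where
  "rho w u k = (let (P, Q) = (SOME (P, Q). \<exists>d. homogeneous d P \<and> homogeneous d Q \<and> teval Q w \<noteq> 0 \<and>
     k = Fract P Q) in flp w u P * inverse (flp w u Q))"

text \<open>Two representations of a germ have equal cross products, and the series of a denominator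
  is invertible because its constant term is the value at \<open>w\<close>. Multiplying by the
  denominator makes the choice in the definition irrelevant.\<close>

lemma rho_Fract:
  assumes "homogeneous d P" "homogeneous d Q" "teval Q w \<noteq> 0"
  shows "rho w u (Fract P Q) * flp w u Q = flp w u P"
proof -
  let ?R = "\<lambda>(P', Q'). \<exists>d. homogeneous d P' \<and> homogeneous d Q' \<and> teval Q' w \<noteq> 0 \<and> Fract P Q = Fract P' Q'"
  have ex: "?R (P, Q)" using assms by auto
  obtain P' Q' where sel: "(SOME x. ?R x) = (P', Q')" by (cases "SOME x. ?R x")
  have "?R (SOME x. ?R x)" using ex by (rule someI)
  then obtain d' where h: "homogeneous d' P'" "homogeneous d' Q'" "teval Q' w \<noteq> 0" "Fract P Q = Fract P' Q'"
    unfolding sel by auto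
  have "P * Q' = P' * Q" using h assms teval_nz by (simp add: eq_fract)
  then have "flp w u P * flp w u Q' = flp w u P' * flp w u Q"
    using flp_mult[OF assms(1) h(2)] flp_mult[OF h(1) assms(2)] by simp
  moreover have "inverse (flp w u Q') * flp w u Q' = 1"
    using h by (intro inverse_mult_eq_1) (simp add: flp_0[OF h(2)])
  moreover have "rho w u (Fract P Q) = flp w u P' * inverse (flp w u Q')"
    unfolding rho_def sel by simp
  ultimately show ?thesis by (metis (no_types, lifting) mult.assoc mult.commute mult.right_neutral)
qed

lemma flp_cancel:
  assumes "homogeneous d Q" "teval Q w \<noteq> 0" "f * flp w u Q = g * flp w u Q"
  shows "f = g"
proof -
  have "flp w u Q \<noteq> 0" using flp_0[OF assms(1), of w u] assms(2) by auto
  then show ?thesis using assms(3) by simp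
qed

lemma rho_mult: assumes "a \<in> loc w" "b \<in> loc w" shows "rho w u (a * b) = rho w u a * rho w u b"
proof -
  obtain P Q d where a: "homogeneous d P" "homogeneous d Q" "teval Q w \<noteq> 0" "Q \<noteq> 0" "a = Fract P Q"
    using assms(1) by (rule locE)
  obtain R S e where b: "homogeneous e R" "homogeneous e S" "teval S w \<noteq> 0" "S \<noteq> 0" "b = Fract R S"
    using assms(2) by (rule locE)
  note h = hom_mult[OF a(2) b(2)]
  have nz: "teval (Q * S) w \<noteq> 0" using a(3) b(3) by simp
  have "rho w u (a * b) * flp w u (Q * S) = flp w u (P * R)"
    using rho_Fract[OF hom_mult[OF a(1) b(1)] h, of w u] a b by simp
  also have "\<dots> = (rho w u a * flp w u Q) * (rho w u b * flp w u S)"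
    using rho_Fract[OF a(1,2,3), of u] rho_Fract[OF b(1,2,3), of u] a b by (simp add: flp_mult)
  also have "\<dots> = (rho w u a * rho w u b) * flp w u (Q * S)"
    using flp_mult[OF a(2) b(2), of w u] by (simp add: algebra_simps)
  finally show ?thesis by (rule flp_cancel[OF h nz])
qed

lemma rho_add: assumes "a \<in> loc w" "b \<in> loc w" shows "rho w u (a + b) = rho w u a + rho w u b"
proof -
  obtain P Q d where a: "homogeneous d P" "homogeneous d Q" "teval Q w \<noteq> 0" "Q \<noteq> 0" "a = Fract P Q"
    using assms(1) by (rule locE)
  obtain R S e where b: "homogeneous e R" "homogeneous e S" "teval S w \<noteq> 0" "S \<noteq> 0" "b = Fract R S"
    using assms(2) by (rule locE)
  note h = hom_mult[OF a(2) b(2)]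
  have nz: "teval (Q * S) w \<noteq> 0" using a(3) b(3) by simp
  have h1: "homogeneous (d + e) (P * S)" "homogeneous (d + e) (R * Q)"
    using hom_mult[OF a(1) b(2)] hom_mult[OF b(1) a(2)] by (simp_all add: add.commute)
  have "rho w u (a + b) * flp w u (Q * S) = flp w u (P * S + R * Q)"
    using rho_Fract[OF hom_add[OF h1] h, of w u] a b by simp
  also have "\<dots> = flp w u P * flp w u S + flp w u R * flp w u Q"
    using h1 flp_add flp_mult[OF a(1) b(2)] flp_mult[OF b(1) a(2)] by metis
  also have "\<dots> = (rho w u a * flp w u Q) * flp w u S + (rho w u b * flp w u S) * flp w u Q"
    using rho_Fract[OF a(1,2,3), of u] rho_Fract[OF b(1,2,3), of u] a b by simp
  also have "\<dots> = (rho w u a + rho w u b) * flp w u (Q * S)"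
    using flp_mult[OF a(2) b(2), of w u] by (simp add: algebra_simps)
  finally show ?thesis by (rule flp_cancel[OF h nz])
qed

lemma rho_const: "rho w u (Fract (tconst c) 1) = fps_const c"
  using rho_Fract[of 0 "tconst c" 1 w u] lpoly_tconst[of c w u] lpoly_tconst[of 1 w u]
  by (simp add: flp_def)

lemma rho_0: "rho w u 0 = 0" and rho_1: "rho w u 1 = 1"
  using rho_const[of w u 0] rho_const[of w u 1] by (simp_all add: Zero_fract_def One_fract_def)

lemma rho_power: "a \<in> loc w \<Longrightarrow> rho w u (a ^ n) = rho w u a ^ n"
  by (induction n) (auto simp: rho_1 rho_mult loc_power)

lemma rho_sum: "(\<And>i. i \<in> I \<Longrightarrow> f i \<in> loc w) \<Longrightarrow> rho w u (sum f I) = (\<Sum>i\<in>I. rho w u (f i))"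
  by (induction I rule: infinite_finite_induct) (auto simp: rho_0 rho_add loc_sum)

lemma fps_low_mult:
  fixes f g :: "complex fps"
  assumes "\<forall>i<r. fps_nth f i = 0"
  shows "\<forall>i<r. fps_nth (f * g) i = 0"
  using assms by (auto simp: fps_mult_nth)

lemma fps_low_mult2:
  fixes f g :: "complex fps"
  assumes "\<forall>i<r. fps_nth f i = 0" "\<forall>i<s. fps_nth g i = 0"
  shows "\<forall>i<r+s. fps_nth (f * g) i = 0"
proof (intro allI impI)
  fix i assume i: "i < r + s"
  have "fps_nth f j * fps_nth g (i - j) = 0" if "j \<le> i" for j
  proof (cases "j < r")
    case False
    then have "i - j < s" using i that by linarith
    then show ?thesis using assms(2) by simp
  qed (use assms(1) in simp)
  then show "fps_nth (f * g) i = 0" unfolding fps_mult_nth by (intro sum.neutral) simp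
qed

lemma fps_low_unit:
  fixes f g :: "complex fps"
  assumes "fps_nth g 0 \<noteq> 0"
  shows "(\<forall>i<r. fps_nth (f * g) i = 0) \<longleftrightarrow> (\<forall>i<r. fps_nth f i = 0)"
proof
  assume "\<forall>i<r. fps_nth (f * g) i = 0"
  from fps_low_mult[OF this, of "inverse g"] show "\<forall>i<r. fps_nth f i = 0"
    using inverse_mult_eq_1'[OF assms] by (simp add: mult.assoc)
qed (rule fps_low_mult)

section \<open>Powers of the maximal ideal, described by vanishing along lines\<close>

definition ordg :: "complex ^ 3 \<Rightarrow> nat \<Rightarrow> tpoly fract set" where
  "ordg w r = {k \<in> loc w. \<forall>u. \<forall>i<r. fps_nth (rho w u k) i = 0}"

lemma max_ideal_pow_0: "max_ideal_pow p 0 = loc (vec_of p)"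
  by (simp add: max_ideal_pow_def nat_pow_def ideals_set_def carrier_local_ring)

lemma max_ideal_pow_Suc:
  "max_ideal_pow p (Suc r) = ideal_prod (local_ring p) (max_ideal_pow p r) (max_ideal p)"
  by (simp add: max_ideal_pow_def nat_pow_def ideals_set_def)

lemma val_0_decomp:
  assumes fr: "frame x y z u v w" and k: "k \<in> loc w" "fps_nth (rho w u' k) 0 = 0"
  obtains a b where "a \<in> loc w" "b \<in> loc w" "k = Fract x z * a + Fract y z * b"
proof -
  note fd = frameD[OF fr]
  obtain P Q d where a: "homogeneous d P" "homogeneous d Q" "teval Q w \<noteq> 0" "Q \<noteq> 0" "k = Fract P Q"
    using k(1) by (rule locE)
  have P0: "teval P w = 0"
    using arg_cong[OF rho_Fract[OF a(1,2,3), of u'], of "\<lambda>f. fps_nth f 0"] k(2) a(5)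
    by (simp add: flp_0[OF a(1)])
  obtain A B where AB: "homogeneous (d - 1) A" "homogeneous (d - 1) B" "P = x * A + y * B"
    using frame_point[OF fr a(1)] P0 by auto
  have z0: "z \<noteq> 0" using fd(15) by auto
  show ?thesis
  proof (cases "d = 0")
    case True
    then have "P = 0" using hom0_const a(1) P0 by (metis tconst_0 teval_simps(8))
    then show ?thesis using that[of 0 0] loc_0 a by (simp add: Zero_fract_def[symmetric] fract_collapse)
  next
    case False
    have "Fract (z * A) Q \<in> loc w" "Fract (z * B) Q \<in> loc w"
      using hom_mult[OF fd(3) AB(1)] hom_mult[OF fd(3) AB(2)] False a by (auto intro!: locI[of d])
    moreover have "k = Fract x z * Fract (z * A) Q + Fract y z * Fract (z * B) Q"
      using z0 a AB by (simp add: eq_fract algebra_simps)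
    ultimately show ?thesis by (rule that)
  qed
qed

lemma frame_rho:
  assumes fr: "frame x y z u v w"
  shows "rho w (a *s u + b *s v) (Fract x z) = fps_const a * fps_X"
    "rho w (a *s u + b *s v) (Fract y z) = fps_const b * fps_X"
    "Fract x z \<in> loc w" "Fract y z \<in> loc w"
proof -
  note fd = frameD[OF fr]
  have z: "flp w (a *s u + b *s v) z = 1"
    using fd by (simp add: flp_def lpoly_form1 form1_add form1_scale flip: pCons_one)
  have *: "flp w (a *s u + b *s v) l = fps_const (teval l (a *s u + b *s v)) * fps_X"
    if "homogeneous 1 l" "teval l w = 0" for l
    using that by (simp add: flp_def lpoly_form1 fps_of_poly_pCons mult.commute)
  show "rho w (a *s u + b *s v) (Fract x z) = fps_const a * fps_X"
    using rho_Fract[OF fd(1,3), of w "a *s u + b *s v"] z *[OF fd(1)] fd by (simp add: form1_add form1_scale)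
  show "rho w (a *s u + b *s v) (Fract y z) = fps_const b * fps_X"
    using rho_Fract[OF fd(2,3), of w "a *s u + b *s v"] z *[OF fd(2)] fd by (simp add: form1_add form1_scale)
  show "Fract x z \<in> loc w" "Fract y z \<in> loc w"
    using fd by (auto intro!: locI[of 1])
qed

text \<open>Along the direction \<open>t *s u + v\<close> the coefficient of index \<open>r\<close>
  is a polynomial in \<open>t\<close> whose coefficients are the values of the
  \<open>\<kappa> a\<close> at the point. Vanishing for all \<open>t\<close> forces each
  \<open>\<kappa> a\<close> into the maximal ideal, which yields one more factor.\<close>

lemma ordg_decomp:
  assumes fr: "frame x y z u v w"
  shows "k \<in> ordg w r \<Longrightarrow> \<exists>\<kappa>. (\<forall>a\<le>r. \<kappa> a \<in> loc w) \<and> k = (\<Sum>a\<le>r. Fract x z ^ a * Fract y z ^ (r - a) * \<kappa> a)"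
proof (induction r)
  case 0
  then show ?case by (intro exI[of _ "\<lambda>_. k"]) (simp add: ordg_def)
next
  case (Suc r)
  note fro = frame_rho[OF fr]
  define \<xi> \<eta> where "\<xi> = Fract x z" and "\<eta> = Fract y z"
  have xl: "\<xi> \<in> loc w" "\<eta> \<in> loc w" using fro by (simp_all add: \<xi>_def \<eta>_def)
  have "k \<in> ordg w r" using Suc.prems by (simp add: ordg_def)
  then obtain \<kappa> where \<kappa>: "\<forall>a\<le>r. \<kappa> a \<in> loc w" "k = (\<Sum>a\<le>r. \<xi> ^ a * \<eta> ^ (r - a) * \<kappa> a)"
    using Suc.IH unfolding \<xi>_def \<eta>_def by blast
  \<comment> \<open>The constant term is the value of the germ at the point, hence independent of
    the direction.\<close>
  have v0: "fps_nth (rho w u' g) 0 = fps_nth (rho w u'' g) 0" if gl: "g \<in> loc w" for g u' u''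
  proof -
    obtain P Q d where a: "homogeneous d P" "homogeneous d Q" "teval Q w \<noteq> 0" "Q \<noteq> 0" "g = Fract P Q"
      using gl by (rule locE)
    show ?thesis
      using arg_cong[OF rho_Fract[OF a(1,2,3), of u'], of "\<lambda>f. fps_nth f 0"]
        arg_cong[OF rho_Fract[OF a(1,2,3), of u''], of "\<lambda>f. fps_nth f 0"] a(3,5)
      by (simp add: flp_0[OF a(1)] flp_0[OF a(2)]) (metis mult_cancel_right)
  qed
  define c where "c = (\<lambda>a. fps_nth (rho w u (\<kappa> a)) 0)"
  have lead: "(\<Sum>a\<le>r. c a * t ^ a) = 0" for t
  proof -
    let ?u = "t *s u + 1 *s v"
    have "rho w ?u k = (\<Sum>a\<le>r. rho w ?u (\<xi> ^ a * \<eta> ^ (r - a) * \<kappa> a))"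
      unfolding \<kappa>(2) using \<kappa>(1) xl by (intro rho_sum) (auto intro!: loc_mult loc_power)
    also have "\<dots> = (\<Sum>a\<le>r. fps_X ^ r * (fps_const (t ^ a) * rho w ?u (\<kappa> a)))"
    proof (rule sum.cong[OF refl])
      fix a assume "a \<in> {..r}"
      then have a: "a \<le> r" by simp
      have "rho w ?u (\<xi> ^ a * \<eta> ^ (r - a) * \<kappa> a) =
          (fps_const t * fps_X) ^ a * (fps_const 1 * fps_X) ^ (r - a) * rho w ?u (\<kappa> a)"
        using \<kappa>(1) xl a fro(1,2)[of t 1] unfolding \<xi>_def[symmetric] \<eta>_def[symmetric]
        by (simp add: rho_mult rho_power loc_mult loc_power)
      also have "\<dots> = fps_X ^ (a + (r - a)) * (fps_const (t ^ a) * rho w ?u (\<kappa> a))"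
        by (simp add: power_mult_distrib power_add fps_const_power algebra_simps)
      finally show "rho w ?u (\<xi> ^ a * \<eta> ^ (r - a) * \<kappa> a) = fps_X ^ r * (fps_const (t ^ a) * rho w ?u (\<kappa> a))"
        using a by simp
    qed
    finally have "fps_nth (rho w ?u k) r = (\<Sum>a\<le>r. t ^ a * fps_nth (rho w ?u (\<kappa> a)) 0)"
      by (simp add: fps_sum_nth fps_X_power_mult_nth)
    also have "\<dots> = (\<Sum>a\<le>r. c a * t ^ a)"
      using v0 \<kappa>(1) unfolding c_def by (intro sum.cong) auto
    finally show ?thesis using Suc.prems by (simp add: ordg_def)
  qed
  have c0: "c a = 0" if "a \<le> r" for a
  proof -
    have "(\<Sum>a\<le>r. Polynomial.monom (c a) a) = 0"
      by (rule poly_ext) (simp add: poly_sum poly_monom lead)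
    then have "poly.coeff (\<Sum>a\<le>r. Polynomial.monom (c a) a) a = 0" by simp
    then show ?thesis using that by (simp add: coeff_sum)
  qed
  have "\<exists>\<alpha> \<beta>. a \<le> r \<longrightarrow> \<alpha> \<in> loc w \<and> \<beta> \<in> loc w \<and> \<kappa> a = \<xi> * \<alpha> + \<eta> * \<beta>" for a
    using val_0_decomp[OF fr, of "\<kappa> a" u] \<kappa>(1) c0[of a] unfolding c_def \<xi>_def \<eta>_def by metis
  then obtain \<alpha> \<beta> where ab: "\<And>a. a \<le> r \<Longrightarrow> \<alpha> a \<in> loc w \<and> \<beta> a \<in> loc w \<and> \<kappa> a = \<xi> * \<alpha> a + \<eta> * \<beta> a"
    by metis
  \<comment> \<open>Each monomial of degree \<open>Suc r\<close> arises from two neighbours of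
    degree \<open>r\<close>, except for the two pure powers, where one contribution is
    absent.\<close>
  define \<kappa>' where "\<kappa>' = (\<lambda>a. (if a = 0 then 0 else \<alpha> (a - 1)) + (if a = Suc r then 0 else \<beta> a))"
  have "k = (\<Sum>a\<le>r. \<xi> ^ Suc a * \<eta> ^ (Suc r - Suc a) * \<alpha> a) + (\<Sum>a\<le>r. \<xi> ^ a * \<eta> ^ (Suc r - a) * \<beta> a)"
    unfolding \<kappa>(2) sum.distrib[symmetric]
    by (intro sum.cong refl) (auto simp: ab Suc_diff_le algebra_simps)
  also have "(\<Sum>a\<le>r. \<xi> ^ Suc a * \<eta> ^ (Suc r - Suc a) * \<alpha> a) =
      (\<Sum>a\<le>Suc r. \<xi> ^ a * \<eta> ^ (Suc r - a) * (if a = 0 then 0 else \<alpha> (a - 1)))"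
    by (subst sum.atMost_Suc_shift) simp
  also have "(\<Sum>a\<le>r. \<xi> ^ a * \<eta> ^ (Suc r - a) * \<beta> a) =
      (\<Sum>a\<le>Suc r. \<xi> ^ a * \<eta> ^ (Suc r - a) * (if a = Suc r then 0 else \<beta> a))"
    by (simp add: sum.atMost_Suc)
  finally have "k = (\<Sum>a\<le>Suc r. \<xi> ^ a * \<eta> ^ (Suc r - a) * \<kappa>' a)"
    unfolding \<kappa>'_def by (simp only: distrib_left sum.distrib)
  moreover have "\<kappa>' a \<in> loc w" if "a \<le> Suc r" for a
    using ab[of "a - 1"] ab[of a] that unfolding \<kappa>'_def by (auto intro!: loc_add loc_0)
  ultimately show ?case unfolding \<xi>_def \<eta>_def by blast
qed

text \<open>Multiplicity and tangent lines are defined by ideal powers; from here on they are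
  conditions on coefficients of restrictions to lines.\<close>

lemma max_ideal_pow_eq: "max_ideal_pow p r = ordg (vec_of p) r"
proof (intro equalityI subsetI)
  let ?w = "vec_of p"
  have m1: "max_ideal p \<subseteq> ordg ?w 1"
  proof
    fix k assume "k \<in> max_ideal p"
    then obtain P Q d where h: "homogeneous d P" "homogeneous d Q" "teval Q ?w \<noteq> 0" "teval P ?w = 0" "k = Fract P Q"
      unfolding max_ideal_eq by blast
    have "fps_nth (rho ?w u k) 0 = 0" for u
      using arg_cong[OF rho_Fract[OF h(1,2,3), of u], of "\<lambda>f. fps_nth f 0"] h
      by (simp add: flp_0[OF h(1)] flp_0[OF h(2)])
    then show "k \<in> ordg ?w 1" using h by (auto simp: ordg_def intro: locI)
  qed
  show "k \<in> ordg ?w r" if "k \<in> max_ideal_pow p r" for k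
    using that
  proof (induction r arbitrary: k)
    case 0
    then show ?case by (simp add: max_ideal_pow_0 ordg_def)
  next
    case (Suc r)
    from Suc.prems have "k \<in> ideal_prod (local_ring p) (max_ideal_pow p r) (max_ideal p)"
      by (simp add: max_ideal_pow_Suc)
    then show ?case
    proof (induction rule: ideal_prod.induct)
      case (prod i j)
      then have ij: "i \<in> ordg ?w r" "j \<in> ordg ?w 1" using Suc.IH m1 by auto
      then have l: "i \<in> loc ?w" "j \<in> loc ?w" by (simp_all add: ordg_def)
      have "\<forall>a<r + 1. fps_nth (rho ?w u i * rho ?w u j) a = 0" for u
        using ij unfolding ordg_def by (intro fps_low_mult2) auto
      then show ?case using l by (simp add: ordg_def rho_mult loc_mult)
    next
      case (sum s1 s2)
      then show ?case by (simp add: ordg_def rho_add loc_add)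
    qed
  qed
  fix k assume k: "k \<in> ordg ?w r"
  obtain x y z u v where fr: "frame x y z u v ?w" using frame_exists[OF vec_of(2)] .
  note fd = frameD[OF fr]
  have mem: "Fract x z \<in> max_ideal p" "Fract y z \<in> max_ideal p"
    unfolding max_ideal_eq using fd(1-3,9,12,15) by (force+)
  have mono: "Fract x z ^ a * Fract y z ^ b * g \<in> max_ideal_pow p (a + b)" if g: "g \<in> loc ?w" for a b g
  proof (induction a)
    case 0
    show ?case
    proof (induction b)
      case 0
      then show ?case using g by (simp add: max_ideal_pow_0)
    next
      case (Suc b)
      then show ?case
        using ideal_prod.prod[OF Suc mem(2), of "local_ring p"] by (simp add: max_ideal_pow_Suc mult_ac)
    qed
  next
    case (Suc a)
    then show ?case
      using ideal_prod.prod[OF Suc mem(1), of "local_ring p"] by (simp add: max_ideal_pow_Suc mult_ac)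
  qed
  have add: "a + b \<in> max_ideal_pow p r" if "a \<in> max_ideal_pow p r" "b \<in> max_ideal_pow p r" for a b
    using that by (cases r) (auto simp: max_ideal_pow_0 max_ideal_pow_Suc loc_add dest: ideal_prod.sum)
  have sum: "sum f I \<in> max_ideal_pow p r" if "finite I" "I \<noteq> {}" "\<And>i. i \<in> I \<Longrightarrow> f i \<in> max_ideal_pow p r" for f and I :: "nat set"
    using that by (induction I rule: finite_ne_induct) (auto intro: add)
  obtain \<kappa> where \<kappa>: "\<forall>a\<le>r. \<kappa> a \<in> loc ?w" "k = (\<Sum>a\<le>r. Fract x z ^ a * Fract y z ^ (r - a) * \<kappa> a)"
    using ordg_decomp[OF fr k] by blast
  show "k \<in> max_ideal_pow p r"
    unfolding \<kappa>(2)
  proof (rule sum)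
    fix a assume "a \<in> {..r}"
    then show "Fract x z ^ a * Fract y z ^ (r - a) * \<kappa> a \<in> max_ideal_pow p r"
      using mono[of "\<kappa> a" a "r - a"] \<kappa>(1) by simp
  qed auto
qed


subsection \<open>Multiplicities along lines\<close>

definition vord :: "tpoly \<Rightarrow> complex ^ 3 \<Rightarrow> complex ^ 3 \<Rightarrow> nat \<Rightarrow> bool" where
  "vord F w u r \<longleftrightarrow> (\<forall>i<r. poly.coeff (lpoly F w u) i = 0)"

lemma low_Fract:
  assumes "homogeneous d P" "homogeneous d Q" "teval Q w \<noteq> 0"
  shows "(\<forall>i<r. fps_nth (rho w u (Fract P Q)) i = 0) \<longleftrightarrow> vord P w u r"
proof -
  have "fps_nth (flp w u Q) 0 \<noteq> 0" using flp_0[OF assms(2)] assms(3) by simp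
  from fps_low_unit[OF this, of r "rho w u (Fract P Q)"] rho_Fract[OF assms, of u]
  show ?thesis by (simp add: vord_def flp_def fps_of_poly_nth)
qed

lemma vord_mult:
  assumes "homogeneous c F" "homogeneous e R" "vord F w u r"
  shows "vord (F * R) w u r"
proof -
  have "\<forall>i<r. fps_nth (flp w u F) i = 0" using assms(3) by (simp add: vord_def flp_def fps_of_poly_nth)
  from fps_low_mult[OF this, of "flp w u R"] show ?thesis
    unfolding flp_mult[OF assms(1,2), symmetric] by (simp add: vord_def flp_def fps_of_poly_nth)
qed

lemma vord_0: "vord 0 w u r"
  using lpoly_tconst[of 0 w u] by (simp add: vord_def)

lemma vord_dvd:
  assumes "homogeneous c F" "homogeneous d P" "F dvd P" "vord F w u r"
  shows "vord P w u r"
proof (cases "P = 0")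
  case False
  then obtain R where "homogeneous (d - c) R" "P = F * R"
    using hom_dvdE[OF assms(1-3) hom_dvd_degree[OF assms(1-3)]] by blast
  then show ?thesis using vord_mult assms by blast
qed (simp add: vord_0)

lemma ideal_at_le_iff:
  assumes F: "homogeneous c F"
  shows "ideal_at F p \<subseteq> max_ideal_pow p r \<longleftrightarrow> (\<forall>u. vord F (vec_of p) u r)"
proof
  assume le: "ideal_at F p \<subseteq> max_ideal_pow p r"
  obtain x y z u v where fr: "frame x y z u v (vec_of p)" using frame_exists[OF vec_of(2)] .
  note zc = hom_power1[OF frameD(3)[OF fr], of c]
  have nz: "teval (z ^ c) (vec_of p) \<noteq> 0" using frameD(15)[OF fr] by simp
  have "Fract F (z ^ c) \<in> ideal_at F p" by (rule ideal_atI[OF F zc nz dvd_refl])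
  then have "Fract F (z ^ c) \<in> ordg (vec_of p) r" using le max_ideal_pow_eq by blast
  then show "\<forall>u. vord F (vec_of p) u r" using low_Fract[OF F zc nz] unfolding ordg_def by blast
next
  assume v: "\<forall>u. vord F (vec_of p) u r"
  show "ideal_at F p \<subseteq> max_ideal_pow p r"
  proof
    fix k assume "k \<in> ideal_at F p"
    then obtain P Q d where h: "homogeneous d P" "homogeneous d Q" "teval Q (vec_of p) \<noteq> 0" "F dvd P" "k = Fract P Q"
      unfolding ideal_at_eq by blast
    then have "\<forall>u. vord P (vec_of p) u r" using vord_dvd[OF F h(1,4)] v by blast
    then have "k \<in> ordg (vec_of p) r"
      unfolding ordg_def using low_Fract[OF h(1-3)] locI[OF h(1-3)] h(5) by blast
    then show "k \<in> max_ideal_pow p r" by (simp add: max_ideal_pow_eq)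
  qed
qed

text \<open>The multiplicity is the least contact with a line through the point. The orders are
  bounded by the degree, because in a direction \<open>u0\<close> with
  \<open>teval F u0 \<noteq> 0\<close> the coefficient of index \<open>c\<close> is that
  value.\<close>

lemma curve_mult:
  assumes F: "homogeneous c F" "F \<noteq> 0"
  shows "vord F (vec_of p) u (curve_mult F p)"
    "\<exists>u. \<not> vord F (vec_of p) u (Suc (curve_mult F p))"
proof -
  obtain u0 where u0: "teval F u0 \<noteq> 0" using ex_nonzero_point[OF F] by blast
  let ?R = "\<lambda>r. \<forall>u. vord F (vec_of p) u r"
  have bound: "r \<le> c" if "?R r" for r
  proof (rule ccontr)
    assume "\<not> r \<le> c"
    then have "poly.coeff (lpoly F (vec_of p) u0) c = 0" using that by (auto simp: vord_def)
    then show False using lpoly(2)[OF F(1)] u0 by simp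
  qed
  have cm: "curve_mult F p = (GREATEST r. ?R r)"
    unfolding curve_mult_def ideal_at_le_iff[OF F(1)] ..
  have "?R 0" by (simp add: vord_def)
  then have "?R (curve_mult F p)" unfolding cm using bound by (rule GreatestI_nat)
  then show "vord F (vec_of p) u (curve_mult F p)" by blast
  show "\<exists>u. \<not> vord F (vec_of p) u (Suc (curve_mult F p))"
  proof (rule ccontr)
    assume "\<nexists>u. \<not> vord F (vec_of p) u (Suc (curve_mult F p))"
    then have "?R (Suc (curve_mult F p))" by blast
    then have "Suc (curve_mult F p) \<le> (GREATEST r. ?R r)" using bound by (rule Greatest_le_nat)
    then show False using cm by simp
  qed
qed

lemma curve_mult_pos:
  assumes F: "homogeneous c F" "F \<noteq> 0" and "vanishes F p"
  shows "curve_mult F p \<ge> 1"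
proof -
  have "vord F (vec_of p) u 1" for u
    using lpoly_coeff0[OF F(1)] assms(3) vanishes_iff[OF F(1)] by (simp add: vord_def)
  then show ?thesis using curve_mult(2)[OF F, of p] by (metis One_nat_def less_one linorder_not_less)
qed

text \<open>\<open>L\<close> vanishes identically on the line of direction \<open>u\<close>, so the
  expansion kills the product ideal in the definition of a tangent, and only the part of order
  \<open>r + 1\<close> survives.\<close>

lemma tangent_vord:
  assumes F: "homogeneous c F" "F \<noteq> 0" and van: "vanishes F p"
    and tan: "tangent_line F p L" and fr: "frame x L z u v (vec_of p)"
  shows "vord F (vec_of p) u (Suc (curve_mult F p))"
proof -
  let ?w = "vec_of p"
  define r where "r = curve_mult F p"
  have r1: "r \<ge> 1" using curve_mult_pos[OF F van] by (simp add: r_def)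
  have L: "homogeneous 1 L" using tan by (simp add: tangent_line_def)
  have L0: "lpoly L ?w u = 0" using lpoly_form1[OF L] frameD[OF fr] by simp
  have kill: "rho ?w u k = 0" if "k \<in> ideal_prod (local_ring p) (ideal_at L p) J" "J \<subseteq> loc ?w" for k J
  proof -
    have "k \<in> loc ?w \<and> rho ?w u k = 0" using that(1)
    proof (induction rule: ideal_prod.induct)
      case (prod i j)
      then obtain P Q d where h: "homogeneous d P" "homogeneous d Q" "teval Q ?w \<noteq> 0" "L dvd P" "i = Fract P Q"
        unfolding ideal_at_eq by blast
      have "vord P ?w u s" for s by (rule vord_dvd[OF L h(1,4)]) (simp add: vord_def L0)
      then have "fps_nth (rho ?w u i) s = 0" for s
        using low_Fract[OF h(1-3), of "Suc s" u] h(5) by blast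
      then have "rho ?w u i = 0" by (simp add: fps_eq_iff)
      moreover have "i \<in> loc ?w" "j \<in> loc ?w" using locI[OF h(1-3)] h(5) prod that(2) by auto
      ultimately show ?case by (simp add: rho_mult loc_mult)
    next
      case (sum s1 s2)
      then show ?case by (simp add: rho_add loc_add)
    qed
    then show ?thesis ..
  qed
  note zc = hom_power1[OF frameD(3)[OF fr], of c]
  have nz: "teval (z ^ c) ?w \<noteq> 0" using frameD(15)[OF fr] by simp
  have "Fract F (z ^ c) \<in> ideal_at F p" by (rule ideal_atI[OF F(1) zc nz dvd_refl])
  then have "Fract F (z ^ c) \<in> ideal_prod (local_ring p) (ideal_at L p) (max_ideal_pow p (r - 1))
      <+>\<^bsub>local_ring p\<^esub> max_ideal_pow p (r + 1)"
    using tan unfolding tangent_line_def Let_def r_def by blast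
  then obtain a b where ab: "a \<in> ideal_prod (local_ring p) (ideal_at L p) (max_ideal_pow p (r - 1))"
      "b \<in> max_ideal_pow p (r + 1)" "Fract F (z ^ c) = a + b"
    unfolding set_add_def' by auto
  have b: "b \<in> ordg ?w (r + 1)" using ab(2) by (simp add: max_ideal_pow_eq)
  have sub: "max_ideal_pow p (r - 1) \<subseteq> loc ?w" by (auto simp: max_ideal_pow_eq ordg_def)
  have a: "rho ?w u a = 0" using kill[OF ab(1) sub] .
  have "a = Fract F (z ^ c) - b" using ab(3) by simp
  then have al: "a \<in> loc ?w" using b locI[OF F(1) zc nz] by (auto simp: ordg_def intro: loc_diff)
  have "rho ?w u (Fract F (z ^ c)) = rho ?w u b"
    using ab(3) a al b by (simp add: rho_add ordg_def)
  then have "\<forall>i<r+1. fps_nth (rho ?w u (Fract F (z ^ c))) i = 0" using b by (simp add: ordg_def)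
  then show ?thesis using low_Fract[OF F(1) zc nz] by (simp add: r_def)
qed

text \<open>Modulo \<open>L\<close> the forms \<open>F\<close> and \<open>P\<close> are
  \<open>x ^ n * F1\<close> and \<open>x ^ n * P1\<close>, so that \<open>P * F1 - F * P1\<close> is
  a multiple of \<open>L\<close>. As \<open>F1\<close> does not vanish at \<open>w\<close>, the form
  \<open>P\<close> lies in the local ideal of \<open>F\<close> and \<open>L\<close>.\<close>

lemma line_division:
  assumes fr: "frame x L z u v w" and F: "homogeneous c F" and P: "homogeneous d P"
    and n: "vord F w u n" "poly.coeff (lpoly F w u) n \<noteq> 0" and v: "vord P w u n"
  obtains F1 P1 R where "homogeneous (c - n) F1" "teval F1 w \<noteq> 0"
    "P * F1 = F * P1 + L * R" "homogeneous (d + (c - n)) (F * P1)" "homogeneous (d + (c - n)) (L * R)"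
proof -
  note fd = frameD[OF fr]
  have shift: "\<exists>p1. Polynomial.degree p1 \<le> d - n \<and> poly.coeff p1 0 = poly.coeff (lpoly P w u) n \<and>
      (\<exists>A. P = x ^ n * binform x z (d - n) p1 + L * A)"
    if P: "homogeneous d P" and v: "vord P w u n" and nd: "n \<le> d" for P d
  proof -
    obtain A where A: "P = binform x z d (lpoly P w u) + L * A" using frame_line[OF fr P] .
    define p1 where "p1 = poly_shift n (lpoly P w u)"
    have c1: "poly.coeff p1 i = poly.coeff (lpoly P w u) (n + i)" for i by (simp add: p1_def coeff_poly_shift add.commute)
    have dg: "Polynomial.degree p1 \<le> d - n"
    proof (rule degree_le, intro allI impI)
      fix i assume "d - n < i"
      then show "poly.coeff p1 i = 0" unfolding c1 using lpoly(1)[OF P, of w u] by (intro coeff_eq_0) linarith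
    qed
    have "binform x z d (lpoly P w u) = (\<Sum>i\<in>{n..d}. tconst (poly.coeff (lpoly P w u) i) * (x ^ i * z ^ (d - i)))"
      unfolding binform_def using v by (intro sum.mono_neutral_right) (auto simp: vord_def)
    also have "\<dots> = (\<Sum>i\<le>d - n. tconst (poly.coeff p1 i) * (x ^ (n + i) * z ^ (d - n - i)))"
      unfolding c1 using nd by (intro sum.reindex_bij_witness[of _ "\<lambda>i. n + i" "\<lambda>i. i - n"]) auto
    also have "\<dots> = x ^ n * binform x z (d - n) p1"
      unfolding binform_def by (simp add: sum_distrib_left power_add algebra_simps)
    finally show ?thesis using A dg c1[of 0] by (intro exI[of _ p1]) auto
  qed
  have nc: "n \<le> c"
  proof (rule ccontr)
    assume "\<not> n \<le> c"
    then have "poly.coeff (lpoly F w u) n = 0" using lpoly(1)[OF F, of w u] by (intro coeff_eq_0) linarith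
    then show False using n(2) by simp
  qed
  obtain f1 F' where f1: "Polynomial.degree f1 \<le> c - n" "poly.coeff f1 0 \<noteq> 0"
      "F = x ^ n * binform x z (c - n) f1 + L * F'"
    using shift[OF F n(1) nc] n(2) by metis
  define F1 where "F1 = binform x z (c - n) f1"
  have F1: "homogeneous (c - n) F1" unfolding F1_def using fd by (intro hom_binform) auto
  have F1w: "teval F1 w \<noteq> 0"
    unfolding F1_def using f1 fd by (simp add: teval_binform poly_0_coeff_0)
  show ?thesis
  proof (cases "n \<le> d")
    case True
    obtain p1 P' where p1: "P = x ^ n * binform x z (d - n) p1 + L * P'" using shift[OF P v True] by blast
    define P1 where "P1 = binform x z (d - n) p1"
    have P1: "homogeneous (d - n) P1" unfolding P1_def using fd by (intro hom_binform) auto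
    have eq: "P * F1 = F * P1 + L * (P' * F1 - F' * P1)"
    proof -
      have "P * F1 = (x ^ n * P1 + L * P') * F1" by (simp only: p1 P1_def)
      also have "\<dots> = (x ^ n * F1 + L * F') * P1 + L * (P' * F1 - F' * P1)" by (simp add: algebra_simps)
      also have "x ^ n * F1 + L * F' = F" by (simp only: f1(3) F1_def)
      finally show ?thesis .
    qed
    have h1: "homogeneous (d + (c - n)) (F * P1)"
      using hom_mult[OF F P1] True nc by (simp add: add.commute)
    have "L * (P' * F1 - F' * P1) = P * F1 - F * P1" using eq by simp
    then have "homogeneous (d + (c - n)) (L * (P' * F1 - F' * P1))"
      using hom_diff[OF hom_mult[OF P F1] h1] by simp
    then show ?thesis using that F1 F1w eq h1 by blast
  next
    case False
    \<comment> \<open>A form of degree below \<open>n\<close> that vanishes to order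
      \<open>n\<close> at a point of the line vanishes on the whole line.\<close>
    then have "lpoly P w u = 0"
      using v lpoly(1)[OF P, of w u] by (intro poly_eqI) (metis coeff_0 coeff_eq_0 le_less_trans linorder_not_less vord_def)
    then obtain A where A: "P = L * A" using frame_lpoly_0[OF fr P] by blast
    show ?thesis
    proof (rule that[OF F1 F1w, of 0 "A * F1"])
      show "P * F1 = F * 0 + L * (A * F1)" using A by (simp add: mult.assoc)
      show "homogeneous (d + (c - n)) (L * (A * F1))"
        using hom_mult[OF P F1] A by (simp add: mult.assoc)
    qed simp
  qed
qed

section \<open>Intersection multiplicity with a line\<close>

interpretation fp: complex_space "\<lambda>c f. fps_const c * (f :: complex fps)"
  by unfold_locales (simp_all add: algebra_simps flip: fps_const_add fps_const_mult)

lemma hdim_fps: "fp.hdim UNIV {f. \<forall>i<n. fps_nth f i = 0} n"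
proof -
  have sub: "fp.subspace {f. \<forall>i<n. fps_nth f i = 0}" by (auto simp: fp.subspace_def)
  have nth: "fps_nth (\<Sum>i<n. fps_const (c i) * fps_X ^ i) j = (if j < n then c j else 0)" for c :: "nat \<Rightarrow> complex" and j
  proof -
    have "fps_nth (\<Sum>i<n. fps_const (c i) * fps_X ^ i) j = (\<Sum>i<n. if i = j then c j else 0)"
      unfolding fps_sum_nth by (intro sum.cong) (auto simp: fps_X_power_nth)
    then show ?thesis by simp
  qed
  have "\<exists>!c. c \<in> {..<n} \<rightarrow>\<^sub>E UNIV \<and> f - (\<Sum>i<n. fps_const (c i) * fps_X ^ i) \<in> {f. \<forall>i<n. fps_nth f i = 0}" for f :: "complex fps"
  proof (rule ex1I[of _ "restrict (fps_nth f) {..<n}"])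
    fix c assume c: "c \<in> {..<n} \<rightarrow>\<^sub>E UNIV \<and> f - (\<Sum>i<n. fps_const (c i) * fps_X ^ i) \<in> {f. \<forall>i<n. fps_nth f i = 0}"
    show "c = restrict (fps_nth f) {..<n}"
    proof (rule PiE_ext[OF conjunct1[OF c]])
      fix i assume "i \<in> {..<n}"
      then show "c i = restrict (fps_nth f) {..<n} i" using c nth[of c i] by simp
    qed simp
  qed (simp add: nth)
  then have "fp.fdim UNIV {f. \<forall>i<n. fps_nth f i = 0} n"
    unfolding fp.fdim_def by (intro bexI[of _ "\<lambda>i. fps_X ^ i"]) auto
  then show ?thesis using fp.hdim_iff_fdim[OF fp.subspace_UNIV sub] by blast
qed

interpretation frp: rel_space_pair "\<lambda>c x. Fract (tconst c) 1 * (x :: tpoly fract)" "\<lambda>c f. fps_const c * (f :: complex fps)"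
  by unfold_locales

text \<open>The ideal of \<open>F\<close> and \<open>L\<close> is the preimage, under expansion
  along \<open>L\<close>, of the series of order at least \<open>n\<close>: one inclusion is
  divisibility, the other is \<open>line_division\<close>.\<close>

lemma int_mult_line:
  assumes fr: "frame x L z u v (vec_of q)" and F: "homogeneous c F"
    and n: "vord F (vec_of q) u n" "poly.coeff (lpoly F (vec_of q) u) n \<noteq> 0"
  shows "int_mult F L q = n"
proof -
  let ?w = "vec_of q"
  note fd = frameD[OF fr]
  define W where "W = {k \<in> loc ?w. \<forall>i<n. fps_nth (rho ?w u k) i = 0}"
  have L0: "lpoly L ?w u = 0" using lpoly_form1[OF fd(2)] fd by simp
  have W: "ideal_at F q <+>\<^bsub>local_ring q\<^esub> ideal_at L q = W"
  proof (intro equalityI subsetI)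
    fix k assume "k \<in> ideal_at F q <+>\<^bsub>local_ring q\<^esub> ideal_at L q"
    then obtain a b where ab: "a \<in> ideal_at F q" "b \<in> ideal_at L q" "k = a + b"
      unfolding set_add_def' by auto
    have aW: "g \<in> W" if h: "g \<in> ideal_at G q" "homogeneous e G" "vord G ?w u n" for g G e
    proof -
      obtain P Q d where h': "homogeneous d P" "homogeneous d Q" "teval Q ?w \<noteq> 0" "G dvd P" "g = Fract P Q"
        using h(1) unfolding ideal_at_eq by blast
      have "vord P ?w u n" by (rule vord_dvd[OF h(2) h'(1,4) h(3)])
      then show ?thesis using low_Fract[OF h'(1-3)] locI[OF h'(1-3)] h'(5) by (simp add: W_def)
    qed
    have "a \<in> W" "b \<in> W" using aW[OF ab(1) F n(1)] aW[OF ab(2) fd(2)] L0 by (simp_all add: vord_def)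
    then show "k \<in> W" unfolding ab(3) by (simp add: W_def rho_add loc_add)
  next
    fix k assume k: "k \<in> W"
    then obtain P Q d where h: "homogeneous d P" "homogeneous d Q" "teval Q ?w \<noteq> 0" "Q \<noteq> 0" "k = Fract P Q"
      unfolding W_def by (auto elim: locE)
    have "vord P ?w u n" using k low_Fract[OF h(1-3)] h(5) by (simp add: W_def)
    then obtain F1 P1 R where d: "homogeneous (c - n) F1" "teval F1 ?w \<noteq> 0"
      "P * F1 = F * P1 + L * R" "homogeneous (d + (c - n)) (F * P1)" "homogeneous (d + (c - n)) (L * R)"
      using line_division[OF fr F h(1) n] by blast
    note hq = hom_mult[OF h(2) d(1)]
    have nz: "teval (Q * F1) ?w \<noteq> 0" using h d by simp
    have "k = Fract (P * F1) (Q * F1)" using h(4,5) teval_nz[OF d(2)] by (simp add: eq_fract)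
    also have "\<dots> = Fract (F * P1) (Q * F1) + Fract (L * R) (Q * F1)"
      using teval_nz[OF nz] unfolding d(3) by (simp add: eq_fract algebra_simps)
    finally have "k = Fract (F * P1) (Q * F1) + Fract (L * R) (Q * F1)" .
    moreover have "Fract (F * P1) (Q * F1) \<in> ideal_at F q" "Fract (L * R) (Q * F1) \<in> ideal_at L q"
      using ideal_atI[OF d(4) hq nz] ideal_atI[OF d(5) hq nz] by simp_all
    ultimately show "k \<in> ideal_at F q <+>\<^bsub>local_ring q\<^esub> ideal_at L q"
      unfolding set_add_def' by auto
  qed
  have WV: "W \<subseteq> loc ?w" by (auto simp: W_def)
  have Wm: "g * k \<in> W" if "g \<in> loc ?w" "k \<in> W" for g k
    using that fps_low_mult[of n "rho ?w u k" "rho ?w u g"] by (simp add: W_def loc_mult rho_mult mult.commute)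
  have Wa: "a + b \<in> W" if "a \<in> W" "b \<in> W" for a b
    using that by (simp add: W_def loc_add rho_add)
  have W0: "0 \<in> W" by (simp add: W_def loc_0 rho_0)
  have Wn: "- a \<in> W" if "a \<in> W" for a
    using Wm[OF loc_uminus[OF loc_1] that] by simp
  have subW: "fr.subspace W" unfolding fr.subspace_def using W0 Wa Wm[OF loc_const] by blast
  have "fr.hdim (loc ?w) W n \<longleftrightarrow> fp.hdim UNIV {f. \<forall>i<n. fps_nth f i = 0} n"
  proof (rule frp.hdim_transfer[where f = "rho ?w u"])
    show "fp.subspace {f. \<forall>i<n. fps_nth f i = 0}" by (auto simp: fp.subspace_def)
    show "rho ?w u (Fract (tconst c) 1 * x) = fps_const c * rho ?w u x" if "x \<in> loc ?w" for c x
      using that by (simp add: rho_mult loc_const rho_const)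
    fix f :: "complex fps"
    let ?k = "\<Sum>i<n. Fract (tconst (fps_nth f i)) 1 * Fract x z ^ i"
    have rX: "rho ?w u (Fract x z) = fps_X" "Fract x z \<in> loc ?w"
      using frame_rho(1)[OF fr, of 1 0] frame_rho(3)[OF fr] by simp_all
    have kl: "?k \<in> loc ?w" by (intro loc_sum loc_mult loc_const loc_power rX)
    have "rho ?w u ?k = (\<Sum>i<n. fps_const (fps_nth f i) * fps_X ^ i)"
      by (subst rho_sum) (auto intro!: loc_mult loc_const loc_power rX sum.cong
        simp: rho_mult loc_const loc_power rX rho_const rho_power)
    moreover have "fps_nth (\<Sum>i<n. fps_const (fps_nth f i) * fps_X ^ i) j = fps_nth f j" if "j < n" for j
    proof -
      have "fps_nth (\<Sum>i<n. fps_const (fps_nth f i) * fps_X ^ i) j = (\<Sum>i<n. if i = j then fps_nth f j else 0)"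
        unfolding fps_sum_nth by (intro sum.cong) (auto simp: fps_X_power_nth)
      then show ?thesis using that by simp
    qed
    ultimately show "\<exists>k\<in>loc ?w. f - rho ?w u k \<in> {f. \<forall>i<n. fps_nth f i = 0}"
      using kl by (intro bexI[of _ ?k]) auto
  qed (auto simp: subspace_loc subW[unfolded W_def] rho_add W_def)
  then have hd: "fr.hdim (loc ?w) W n" using hdim_fps by blast
  have ab: "abelian_group (local_ring q)"
    by (rule abelian_group_typeI) (auto simp: carrier_local_ring loc_0 loc_add loc_uminus)
  have inv: "\<ominus>\<^bsub>local_ring q\<^esub> a = - a" if "a \<in> loc ?w" for a
    using that by (intro a_inv_typeI[OF ab]) (auto simp: carrier_local_ring loc_uminus)
  have Wc: "Fract (tconst a) 1 * k \<in> W" if "k \<in> W" for a k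
    by (rule Wm[OF loc_const that])
  show ?thesis
    unfolding int_mult_def W
  proof (rule fr.quotient_dim_eqI[OF ab subspace_loc subW, where j = id])
    show "fr.hdim (loc ?w) W n" by (rule hd)
    show "\<exists>v\<in>loc ?w. r \<ominus>\<^bsub>local_ring q\<^esub> id v \<in> W" if "r \<in> carrier (local_ring q)" for r
      using that W0 by (intro bexI[of _ r]) (auto simp: carrier_local_ring a_minus_def inv)
  qed (use WV Wa Wn Wc in \<open>auto simp: carrier_local_ring loc_mult loc_const inv distrib_left subset_iff\<close>)
qed

section \<open>The homogeneous coordinate ring of a curve inside a field\<close>

text \<open>The pigeonhole behind the counting arguments. A family in place of a set may repeat
  values, which spares a proof that the chosen powers or monomials are distinct.\<close>

lemma (in rel_space) dependent_family:
  assumes W: "subspace W" and h: "hdim V W m" and I: "finite I" "m < card I"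
    and f: "\<And>i. i \<in> I \<Longrightarrow> f i \<in> V"
  obtains c i where "i \<in> I" "c i \<noteq> 0" "(\<Sum>i\<in>I. c i \<star> f i) \<in> W"
proof (cases "inj_on f I")
  case False
  then obtain i j where ij: "i \<in> I" "j \<in> I" "i \<noteq> j" "f i = f j" unfolding inj_on_def by blast
  have "(\<Sum>k\<in>I. (if k = i then 1 else if k = j then - 1 else 0) \<star> f k)
      = (\<Sum>k\<in>I. (if k = i then f i else 0) + (if k = j then - f j else 0))"
    using ij by (intro sum.cong) auto
  also have "\<dots> = 0" using ij I by (simp add: sum.distrib)
  finally show ?thesis using that[of i "\<lambda>k. if k = i then 1 else if k = j then - 1 else 0"] ij subspace_0[OF W]
    by simp
next
  case True
  then have "card (f ` I) = card I" by (rule card_image)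
  then have "\<not> indm W (f ` I)" using hdim_bound[OF W h, of "f ` I"] f I by fastforce
  then obtain c s where c: "(\<Sum>s\<in>f ` I. c s \<star> s) \<in> W" "s \<in> f ` I" "c s \<noteq> 0"
    unfolding indm_def using I by blast
  then obtain i where "i \<in> I" "s = f i" by blast
  moreover have "(\<Sum>s\<in>f ` I. c s \<star> s) = (\<Sum>i\<in>I. c (f i) \<star> f i)" using True by (simp add: sum.reindex)
  ultimately show ?thesis using that[of i "\<lambda>i. c (f i)"] c by simp
qed

lemma binform_smult: "binform x z d (Polynomial.smult a p) = tconst a * binform x z d p"
  unfolding binform_def sum_distrib_left
  by (rule sum.cong) (simp_all only: coeff_smult tconst_mult mult.assoc)

lemma binform_root:
  assumes "Polynomial.degree p \<le> d"
  shows "binform x z (Suc d) ([:- a, 1:] * p) = (x - tconst a * z) * binform x z d p"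
proof -
  have "[:- a, 1:] * p = pCons 0 p + Polynomial.smult (- a) p" by simp
  then have "binform x z (Suc d) ([:- a, 1:] * p) =
      x * binform x z d p + tconst (- a) * (z * binform x z d p)"
    by (simp only: binform_add binform_smult binform_pCons binform_mult_z[OF assms])
  then show ?thesis by (simp add: tconst_minus algebra_simps)
qed

lemma binform_0: "Polynomial.degree p = 0 \<Longrightarrow> binform x z 0 p = tconst (poly.coeff p 0)"
  by (simp add: binform_def)

lemma tp_subspace_scaled: "tp.subspace V \<Longrightarrow> tp.subspace ((\<lambda>x. a * x) ` V)"
  unfolding tp.subspace_def
proof (intro conjI ballI allI)
  assume V: "0 \<in> V \<and> (\<forall>x\<in>V. \<forall>y\<in>V. x + y \<in> V) \<and> (\<forall>b. \<forall>x\<in>V. tconst b * x \<in> V)"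
  then show "0 \<in> (*) a ` V" by (intro image_eqI[of _ _ 0]) auto
  show "x + y \<in> (*) a ` V" if "x \<in> (*) a ` V" "y \<in> (*) a ` V" for x y
    using that V by (auto simp: distrib_left[symmetric])
  show "tconst b * x \<in> (*) a ` V" if "x \<in> (*) a ` V" for b x
    using that V by (auto simp: mult.left_commute)
qed

text \<open>The image of \<open>Phi\<close> is the homogeneous coordinate ring of the curve, inside
  a field; quotients of images of forms of equal degree are its rational functions. The field stays
  abstract until \<open>ex_curve\<close> provides one.\<close>

locale curve =
  fixes F :: tpoly and c :: nat and Phi :: "tpoly \<Rightarrow> 'k :: field"
  assumes F: "homogeneous c F" and c2: "c \<ge> 2" and F0: "F \<noteq> 0"
    and Phi_add: "Phi (P + Q) = Phi P + Phi Q"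
    and Phi_mult: "Phi (P * Q) = Phi P * Phi Q"
    and Phi_1: "Phi 1 = 1"
    and Phi_0_iff: "Phi P = 0 \<longleftrightarrow> F dvd P"
begin

lemma Phi_0: "Phi 0 = 0"
  by (simp add: Phi_0_iff)

lemma Phi_uminus: "Phi (- P) = - Phi P"
  using Phi_add[of P "- P"] Phi_0 by (simp add: add_eq_0_iff)

lemma Phi_diff: "Phi (P - Q) = Phi P - Phi Q"
  using Phi_add[of P "- Q"] Phi_uminus by simp

lemma Phi_sum: "Phi (sum f A) = (\<Sum>a\<in>A. Phi (f a))"
  by (induction A rule: infinite_finite_induct) (auto simp: Phi_0 Phi_add)

lemma Phi_power: "Phi (P ^ n) = Phi P ^ n"
  by (induction n) (auto simp: Phi_1 Phi_mult)

lemmas Phi_simps = Phi_0 Phi_1 Phi_add Phi_diff Phi_uminus Phi_mult Phi_power Phi_sum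

lemma Phi_low:
  assumes "homogeneous d P" "d < c"
  shows "Phi P = 0 \<longleftrightarrow> P = 0"
  using hom_dvd_degree[OF F assms(1)] assms(2) Phi_0_iff by fastforce

sublocale K: complex_space "\<lambda>a x. Phi (tconst a) * x"
  by unfold_locales (simp_all add: algebra_simps tconst_add tconst_mult Phi_simps)

lemma kappa_0 [simp]: "Phi (tconst a) = 0 \<longleftrightarrow> a = 0"
  using Phi_low[OF hom_tconst, of a] c2 by simp

lemma Phi_eval:
  assumes "homogeneous d P" "homogeneous d Q" "Phi P = Phi Q" "teval F w = 0"
  shows "teval P w = teval Q w"
proof -
  have "Phi (P - Q) = 0" using assms(3) by (simp add: Phi_diff)
  then obtain R where "P - Q = F * R" using Phi_0_iff by blast
  from arg_cong[OF this, of "\<lambda>P. teval P w"] show ?thesis using assms(4) by simp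
qed

lemma Phi_nz: "teval F w = 0 \<Longrightarrow> teval Q w \<noteq> 0 \<Longrightarrow> Phi Q \<noteq> 0"
  using Phi_0_iff[of Q] by auto

definition Sb :: "nat \<Rightarrow> 'k set" where
  "Sb d = Phi ` {P. homogeneous d P}"

lemma SbI: "homogeneous d P \<Longrightarrow> Phi P \<in> Sb d"
  by (simp add: Sb_def)

lemma subspace_Sb: "K.subspace (Sb d)"
  unfolding K.subspace_def
proof (intro conjI ballI allI)
  show "0 \<in> Sb d" using SbI[of d 0] by (simp add: Phi_0)
  show "x + y \<in> Sb d" if "x \<in> Sb d" "y \<in> Sb d" for x y
    using that hom_add unfolding Sb_def by (auto simp: Phi_add[symmetric])
  show "Phi (tconst a) * x \<in> Sb d" if "x \<in> Sb d" for a x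
    using that hom_tconst_mult unfolding Sb_def by (auto simp: Phi_mult[symmetric])
qed

lemma subspace_scaled: "K.subspace V \<Longrightarrow> K.subspace ((\<lambda>x. a * x) ` V)"
  unfolding K.subspace_def
proof (intro conjI ballI allI)
  assume V: "0 \<in> V \<and> (\<forall>x\<in>V. \<forall>y\<in>V. x + y \<in> V) \<and> (\<forall>b. \<forall>x\<in>V. Phi (tconst b) * x \<in> V)"
  then show "0 \<in> (*) a ` V" by (intro image_eqI[of _ _ 0]) auto
  show "x + y \<in> (*) a ` V" if "x \<in> (*) a ` V" "y \<in> (*) a ` V" for x y
    using that V by (auto simp: distrib_left[symmetric])
  show "Phi (tconst b) * x \<in> (*) a ` V" if "x \<in> (*) a ` V" for b x
    using that V by (auto simp: mult.left_commute)
qed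

sublocale tK: rel_space_pair "\<lambda>c P. tconst c * P" "\<lambda>a x. Phi (tconst a) * x"
  by unfold_locales

sublocale KK: rel_space_pair "\<lambda>a x. Phi (tconst a) * x" "\<lambda>a x. Phi (tconst a) * x"
  by unfold_locales

lemma hdim_scale:
  assumes V: "K.subspace V" and W: "K.subspace W" and a: "a \<noteq> 0"
  shows "K.hdim V W n \<longleftrightarrow> K.hdim ((\<lambda>x. a * x) ` V) ((\<lambda>x. a * x) ` W) n"
proof (rule KK.hdim_transfer[where f = "\<lambda>x. a * x"])
  have "0 \<in> (\<lambda>x. a * x) ` W" using K.subspace_0[OF W] by (intro image_eqI[of _ _ 0]) auto
  then show "\<exists>x\<in>V. y - a * x \<in> (\<lambda>x. a * x) ` W" if "y \<in> (\<lambda>x. a * x) ` V" for y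
    using that by (auto intro!: bexI simp del: mult_cancel_left)
qed (use assms subspace_scaled in \<open>auto simp: distrib_left mult.left_commute\<close>)

text \<open>Forms of degree \<open>d\<close> modulo multiples of \<open>F\<close>. The Hilbert
  polynomial \<open>c * d + (3 * c - c * c) / 2\<close> is doubled and rearranged to stay within the
  natural numbers.\<close>

lemma hdim_Sb:
  assumes "c \<le> d"
  shows "\<exists>n. K.hdim (Sb d) {0} n \<and> 2 * n + c * c = c * (2 * d + 3)"
proof -
  obtain n where n: "2 * n = (d + 1) * (d + 2)" "tp.hdim {P. homogeneous d P} {0} n"
    using hdim_forms by blast
  obtain m where m: "2 * m = (d - c + 1) * (d - c + 2)" "tp.hdim {P. homogeneous (d - c) P} {0} m"
    using hdim_forms by blast
  interpret tt: rel_space_pair "\<lambda>c P. tconst c * P" "\<lambda>c P. tconst c * P" by unfold_locales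
  let ?W = "(\<lambda>P. F * P) ` {P. homogeneous (d - c) P}"
  have W: "tp.subspace ?W" by (rule tp_subspace_scaled[OF subspace_forms])
  have hW: "tp.hdim {P. homogeneous (d - c) P} {0} m \<longleftrightarrow> tp.hdim ?W {0} m"
    by (rule tt.hdim_transfer[where f = "\<lambda>P. F * P"])
      (use F0 subspace_forms in \<open>auto simp: distrib_left mult.left_commute\<close>)
  have sub: "?W \<subseteq> {P. homogeneous d P}" using hom_mult[OF F, of "d - c"] assms by auto
  obtain a b where ab: "tp.hdim {P. homogeneous d P} ?W a" "tp.hdim ?W {0} b" "n = a + b"
    using tp.hdim_split[OF subspace_forms W tp.subspace_single_0 _ sub n(2)] tp.subspace_0[OF W] by blast
  have b: "b = m" using tp.hdim_unique[OF tp.subspace_single_0 ab(2)] hW m(2) by blast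
  have "tp.hdim {P. homogeneous d P} ?W a \<longleftrightarrow> K.hdim (Sb d) {0} a"
  proof (rule tK.hdim_transfer[where f = Phi])
    show "\<exists>x\<in>{P. homogeneous d P}. y - Phi x \<in> {0}" if "y \<in> Sb d" for y
      using that by (auto simp: Sb_def)
    show "Phi P \<in> {0} \<longleftrightarrow> P \<in> ?W" if "P \<in> {P. homogeneous d P}" for P
      using that hom_dvdE[OF F, of d P] assms by (auto simp: Phi_0_iff image_iff)
  qed (use subspace_forms W in \<open>auto simp: Phi_simps SbI\<close>)
  then have "K.hdim (Sb d) {0} a" using ab by blast
  moreover have "2 * a + c * c = c * (2 * d + 3)"
  proof -
    obtain e where d: "d = c + e" using assms le_Suc_ex by blast
    have "2 * a + (e + 1) * (e + 2) = (d + 1) * (d + 2)" using ab(3) n(1) m(1) b d by simp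
    then show ?thesis by (simp add: d algebra_simps)
  qed
  ultimately show ?thesis by blast
qed

text \<open>Bezout's theorem in graded form: multiplication by \<open>Phi Q\<close> is injective,
  and the difference of the two Hilbert polynomials does not depend on \<open>d\<close>.\<close>

lemma hdim_M:
  assumes Q: "homogeneous e Q" "Phi Q \<noteq> 0" and d: "c + e \<le> d"
  shows "K.hdim (Sb d) ((\<lambda>x. Phi Q * x) ` Sb (d - e)) (c * e)"
proof -
  let ?W = "(\<lambda>x. Phi Q * x) ` Sb (d - e)"
  obtain n where n: "K.hdim (Sb d) {0} n" "2 * n + c * c = c * (2 * d + 3)" using hdim_Sb[of d] d by auto
  obtain m where m: "K.hdim (Sb (d - e)) {0} m" "2 * m + c * c = c * (2 * (d - e) + 3)"
    using hdim_Sb[of "d - e"] add_le_imp_le_diff[OF d] by auto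
  have W: "K.subspace ?W" by (rule subspace_scaled[OF subspace_Sb])
  have sub: "?W \<subseteq> Sb d"
    using hom_mult[OF Q(1), of "d - e"] d by (auto simp: Sb_def image_iff Phi_mult[symmetric] intro!: exI)
  obtain a b where ab: "K.hdim (Sb d) ?W a" "K.hdim ?W {0} b" "n = a + b"
    using K.hdim_split[OF subspace_Sb W K.subspace_single_0 _ sub n(1)] K.subspace_0[OF W] by blast
  have "K.hdim ?W {0} m" using hdim_scale[OF subspace_Sb K.subspace_single_0 Q(2)] m(1) by simp
  then have "b = m" using K.hdim_unique[OF K.subspace_single_0 ab(2)] by blast
  then have "a = c * e"
  proof -
    obtain k where k: "d = k + e" using d by (metis add.commute add_leD2 le_Suc_ex)
    have "2 * (a + m) + c * c = c * (2 * d + 3)" using ab(3) n(2) \<open>b = m\<close> by simp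
    then have "2 * a + (2 * m + c * c) = c * (2 * d + 3)" by simp
    then have "2 * a + c * (2 * k + 3) = c * (2 * (k + e) + 3)" using m(2) k by simp
    then show ?thesis by (simp add: algebra_simps)
  qed
  with ab show ?thesis by simp
qed

subsection \<open>A local-global principle\<close>

text \<open>Membership in the ideal generated by \<open>Q\<close> in the homogeneous coordinate
  ring, with the degree of the cofactor recorded.\<close>

definition mem :: "tpoly \<Rightarrow> nat \<Rightarrow> tpoly \<Rightarrow> bool" where
  "mem Q d P \<longleftrightarrow> (\<exists>B. homogeneous d B \<and> Phi P = Phi Q * Phi B)"

lemma mem_mult: "mem Q d P \<Longrightarrow> homogeneous t T \<Longrightarrow> mem Q (t + d) (T * P)"
  unfolding mem_def by (metis Phi_mult hom_mult mult.left_commute)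

lemma mem_add: "mem Q d P \<Longrightarrow> mem Q d P' \<Longrightarrow> mem Q d (P + P')"
  unfolding mem_def by (metis Phi_add distrib_left hom_add)

lemma mem_tconst: "mem Q d P \<Longrightarrow> mem Q d (tconst a * P)"
  using mem_mult[of Q d P 0 "tconst a"] by simp

lemma mem_diff: "mem Q d P \<Longrightarrow> mem Q d P' \<Longrightarrow> mem Q d (P - P')"
  using mem_add[of Q d P "tconst (-1) * P'"] mem_tconst[of Q d P' "-1"] by (simp add: tconst_minus)

text \<open>A binary form splits into linear factors. If the full product with \<open>P\<close> lies
  in the ideal while \<open>P\<close> does not, then one of the factors is responsible for the
  transition; \<open>T\<close> is the product of the factors before it.\<close>

lemma pencil_factor:
  assumes xz: "homogeneous 1 x" "homogeneous 1 z"
  shows "p \<noteq> 0 \<Longrightarrow> Polynomial.degree p \<le> n \<Longrightarrow> mem Q (n + d) (binform x z n p * P) \<Longrightarrow> \<not> mem Q d P \<Longrightarrow>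
    \<exists>t T a b. homogeneous t T \<and> (a \<noteq> 0 \<or> b \<noteq> 0) \<and> \<not> mem Q (t + d) (T * P) \<and>
      mem Q (Suc (t + d)) ((tconst a * x + tconst b * z) * (T * P))"
proof (induction n arbitrary: p)
  case 0
  then have nz: "poly.coeff p 0 \<noteq> 0" by (metis le_0_eq leading_coeff_neq_0)
  have "mem Q d (tconst (1 / poly.coeff p 0) * (tconst (poly.coeff p 0) * P))"
    by (rule mem_tconst) (use 0 in \<open>simp add: binform_0\<close>)
  then have "mem Q d P" using nz by (simp add: mult.assoc[symmetric] tconst_mult[symmetric])
  then show ?case using 0 by blast
next
  case (Suc n)
  obtain p1 a b where p1: "p1 \<noteq> 0" "Polynomial.degree p1 \<le> n" "a \<noteq> 0 \<or> b \<noteq> 0"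
    "binform x z (Suc n) p = (tconst a * x + tconst b * z) * binform x z n p1"
  proof (cases "Polynomial.degree p \<le> n")
    case True
    show ?thesis by (rule that[of p 0 1]) (use Suc True binform_mult_z[OF True, of x z] in simp_all)
  next
    case False
    then have "\<not> constant (poly p)" by (simp add: constant_degree)
    then obtain r where "poly p r = 0" using fundamental_theorem_of_algebra by blast
    then obtain p1 where p1: "p = [:- r, 1:] * p1" using poly_eq_0_iff_dvd by blast
    have "p1 \<noteq> 0" using Suc p1 by auto
    moreover have "Polynomial.degree ([:- r, 1:] * p1) = 1 + Polynomial.degree p1"
      using \<open>p1 \<noteq> 0\<close> by (subst degree_mult_eq) auto
    ultimately have dg: "Polynomial.degree p1 \<le> n" using Suc(3) p1 by simp
    show ?thesis by (rule that[of p1 1 "- r"])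
      (use \<open>p1 \<noteq> 0\<close> dg binform_root[OF dg, of x z r] p1 in \<open>simp_all add: tconst_minus\<close>)
  qed
  let ?T = "binform x z n p1"
  have hT: "homogeneous n ?T" using hom_binform[OF xz] .
  have m: "mem Q (Suc (n + d)) ((tconst a * x + tconst b * z) * (?T * P))"
    using Suc.prems(3) p1(4) by (simp add: mult.assoc)
  show ?case
  proof (cases "mem Q (n + d) (?T * P)")
    case True
    then show ?thesis using Suc.IH[OF p1(1,2)] Suc.prems by blast
  next
    case False
    then show ?thesis using m hT p1(3) by blast
  qed
qed

lemma pencil:
  assumes fr: "frame x y z u v w" and Q: "homogeneous e Q" "Phi Q \<noteq> 0"
    and P: "homogeneous (e + d) P" "\<not> mem Q d P"
  obtains t T a b where "homogeneous t T" "a \<noteq> 0 \<or> b \<noteq> 0" "\<not> mem Q (t + d) (T * P)"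
    "mem Q (Suc (t + d)) ((tconst a * x + tconst b * z) * (T * P))"
proof -
  note fd = frameD[OF fr]
  \<comment> \<open>Large enough for \<open>hdim_M\<close>, and such that the \<open>n + 1\<close>
    monomials in \<open>x\<close> and \<open>z\<close> outnumber \<open>c * e\<close>; hence some
    binary form lies in the ideal of \<open>Q\<close>.\<close>
  define n where "n = c + e + c * e"
  have nn: "c + e \<le> n" "c * e < card {..n}" by (simp_all add: n_def)
  let ?W = "(\<lambda>x. Phi Q * x) ` Sb (n - e)"
  have W: "K.subspace ?W" by (rule subspace_scaled[OF subspace_Sb])
  have f: "Phi (x ^ i * z ^ (n - i)) \<in> Sb n" if "i \<in> {..n}" for i
    using hom_mult[OF hom_power1[OF fd(1), of i] hom_power1[OF fd(3), of "n - i"]] that by (intro SbI) simp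
  obtain r i where r: "i \<in> {..n}" "r i \<noteq> 0" "(\<Sum>i\<in>{..n}. Phi (tconst (r i)) * Phi (x ^ i * z ^ (n - i))) \<in> ?W"
    by (rule K.dependent_family[OF W hdim_M[OF Q nn(1)] finite_atMost nn(2) f])
  define p where "p = (\<Sum>i\<le>n. Polynomial.monom (r i) i)"
  have cp: "poly.coeff p j = (if j \<le> n then r j else 0)" for j
    by (simp add: p_def coeff_sum)
  have p0: "p \<noteq> 0" using cp[of i] r by auto
  have pd: "Polynomial.degree p \<le> n" by (rule degree_le) (simp add: cp)
  have "Phi (binform x z n p) = (\<Sum>i\<in>{..n}. Phi (tconst (r i)) * Phi (x ^ i * z ^ (n - i)))"
    by (simp add: binform_def Phi_sum Phi_mult cp)
  then have "mem Q (n - e) (binform x z n p)" using r(3) unfolding mem_def Sb_def by auto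
  then have "mem Q ((e + d) + (n - e)) (P * binform x z n p)" using mem_mult P(1) by blast
  then have "mem Q (n + d) (binform x z n p * P)" by (simp add: n_def ac_simps)
  then show ?thesis using pencil_factor[OF fd(1,3) p0 pd, of Q d P] P(2) that by blast
qed

text \<open>On the line \<open>x = 0\<close> the right side vanishes while \<open>y\<close>
  restricts to a nonzero polynomial; so \<open>C\<close> vanishes on this line.\<close>

lemma frame_cancel:
  assumes fr: "frame x y z u v w" and C: "homogeneous k C" and eq: "y * C = x * D"
  obtains C' where "homogeneous (k - 1) C'" "C = x * C'"
proof -
  note fr' = frame_swap[OF fr]
  have "lpoly y w v * lpoly C w v = 0"
  proof (rule poly_ext)
    fix s
    have "poly (lpoly y w v * lpoly C w v) s = teval (y * C) (w + s *s v)"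
      using lpoly(3)[OF C] lpoly(3)[OF frameD(2)[OF fr]] by simp
    also have "\<dots> = 0" unfolding eq using frame_eval_line(3)[OF fr', of s] by simp
    finally show "poly (lpoly y w v * lpoly C w v) s = poly 0 s" by simp
  qed
  moreover have "lpoly y w v \<noteq> 0" using lpoly_form1[OF frameD(2)[OF fr]] frameD(11)[OF fr] by simp
  ultimately have "lpoly C w v = 0" by simp
  then show ?thesis using frame_lpoly_0[OF fr' C] that by blast
qed

text \<open>Max Noether's theorem. A counterexample can be multiplied by forms until it still lies
  outside the ideal but every linear form carries it into the ideal. That is impossible, because two
  linear forms without a common zero on the curve are a regular sequence in the coordinate
  ring.\<close>

theorem local_global:
  assumes Q: "homogeneous e Q" "Phi Q \<noteq> 0" and P: "homogeneous (e + d) P"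
    and loc: "\<And>w. w \<noteq> 0 \<Longrightarrow> teval F w = 0 \<Longrightarrow> teval Q w = 0 \<Longrightarrow>
      \<exists>r R. homogeneous r R \<and> teval R w \<noteq> 0 \<and> mem Q (r + d) (R * P)"
  shows "mem Q d P"
proof (rule ccontr)
  assume nP: "\<not> mem Q d P"
  have "axis 3 1 \<noteq> (0 :: complex ^ 3)" by (simp add: axis_eq_0_iff)
  then obtain x0 y0 z0 u0 v0 where fr0: "frame x0 y0 z0 u0 v0 (axis 3 1)" using frame_exists by blast
  note fd0 = frameD[OF fr0]
  obtain t1 T1 a1 b1 where 1: "homogeneous t1 T1" "a1 \<noteq> 0 \<or> b1 \<noteq> 0" "\<not> mem Q (t1 + d) (T1 * P)"
    "mem Q (Suc (t1 + d)) ((tconst a1 * x0 + tconst b1 * z0) * (T1 * P))"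
    using pencil[OF fr0 Q P nP] .
  define l1 where "l1 = tconst a1 * x0 + tconst b1 * z0"
  have l1: "homogeneous 1 l1" unfolding l1_def using fd0 by (intro hom_add hom_tconst_mult)
  have "teval l1 u0 = a1" "teval l1 (axis 3 1) = b1" using fd0 by (simp_all add: l1_def)
  then have l1n: "l1 \<noteq> 0" using 1(2) by auto
  obtain w1 where w1: "w1 \<noteq> 0" "teval l1 w1 = 0" using ex_line_point[OF l1] .
  obtain x z u v where fr: "frame x l1 z u v w1" using frame_exists_line[OF l1 l1n w1] .
  note fd = frameD[OF fr]
  have hP1: "homogeneous (e + (t1 + d)) (T1 * P)" using hom_mult[OF 1(1) P] by (simp add: ac_simps)
  obtain t2 T2 a2 b2 where 2: "homogeneous t2 T2" "a2 \<noteq> 0 \<or> b2 \<noteq> 0" "\<not> mem Q (t2 + (t1 + d)) (T2 * (T1 * P))"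
    "mem Q (Suc (t2 + (t1 + d))) ((tconst a2 * x + tconst b2 * z) * (T2 * (T1 * P)))"
    using pencil[OF fr Q hP1 1(3)] .
  define l2 where "l2 = tconst a2 * x + tconst b2 * z"
  define P2 where "P2 = T2 * (T1 * P)"
  define d2 where "d2 = t2 + (t1 + d)"
  have l2: "homogeneous 1 l2" unfolding l2_def using fd by (intro hom_add hom_tconst_mult)
  have hP2: "homogeneous (e + d2) P2" unfolding P2_def d2_def using hom_mult[OF 2(1) hP1] by (simp add: ac_simps)
  have k1: "mem Q (Suc d2) (l1 * P2)"
    using mem_mult[OF 1(4) 2(1)] unfolding P2_def d2_def l1_def[symmetric] by (simp add: ac_simps)
  have k2: "mem Q (Suc d2) (l2 * P2)" using 2(4) unfolding P2_def d2_def l2_def .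
  have nP2: "\<not> mem Q d2 P2" using 2(3) unfolding P2_def d2_def .
  \<comment> \<open>The common zero of \<open>l1\<close> and \<open>l2\<close>, the one point at
    which the local hypothesis is applied.\<close>
  define w2 where "w2 = b2 *s u - a2 *s w1"
  have t2: "teval l2 w2 = 0" "teval l1 w2 = 0"
    using fd by (simp_all add: w2_def l2_def form1_diff form1_scale)
  have "teval x w2 = b2" "teval z w2 = - a2"
    using fd by (simp_all add: w2_def form1_diff form1_scale)
  then have w2: "w2 \<noteq> 0" using 2(2) teval_scale[OF fd(1), of 0 u] teval_scale[OF fd(3), of 0 u] by auto
  obtain x' z' u' v' where fr': "frame x' l1 z' u' v' w2" using frame_exists_line[OF l1 l1n w2 t2(2)] .
  note fd' = frameD[OF fr']
  have l2eq: "l2 = tconst (teval l2 u') * x' + tconst (teval l2 v') * l1"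
    using frame_form1[OF fr' l2] t2 by simp
  have an: "teval l2 u' \<noteq> 0"
  proof
    assume "teval l2 u' = 0"
    then have "l2 = tconst (teval l2 v') * l1" using l2eq by simp
    then have "teval l2 u = 0" "teval l2 w1 = 0" using fd by (metis mult_zero_right teval_simps(4))+
    then show False using fd 2(2) by (simp add: l2_def)
  qed
  have kx: "mem Q (Suc d2) (x' * P2)"
  proof -
    define a b where "a = teval l2 u'" and "b = teval l2 v'"
    have a0: "a \<noteq> 0" using an by (simp add: a_def)
    have l2': "l2 = tconst a * x' + tconst b * l1" using l2eq by (simp only: a_def b_def)
    have "mem Q (Suc d2) (tconst (1 / a) * (l2 * P2 - tconst b * (l1 * P2)))"
      by (intro mem_tconst mem_diff k1 k2)
    also have "tconst (1 / a) * (l2 * P2 - tconst b * (l1 * P2)) = tconst (1 / a) * ((l2 - tconst b * l1) * P2)"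
      by (simp add: algebra_simps)
    also have "l2 - tconst b * l1 = tconst a * x'" by (subst l2') simp
    also have "tconst (1 / a) * (tconst a * x' * P2) = tconst (1 / a * a) * (x' * P2)"
      by (simp only: tconst_mult mult.assoc)
    finally show ?thesis using a0 by simp
  qed
  \<comment> \<open>If \<open>w2\<close> is not a common zero of \<open>F\<close> and
    \<open>Q\<close>, then whichever of the two does not vanish there takes the place of
    \<open>R\<close>.\<close>
  obtain r R where R: "homogeneous r R" "teval R w2 \<noteq> 0" "mem Q (r + d2) (R * P2)"
  proof (cases "teval F w2 = 0")
    case False
    have "mem Q (c + d2) (F * P2)"
      unfolding mem_def using Phi_0_iff[of F] by (intro exI[of _ 0]) (simp add: Phi_mult Phi_0)
    then show ?thesis using that[OF F False] by blast
  next
    case True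
    show ?thesis
    proof (cases "teval Q w2 = 0")
      case False
      have "mem Q (e + d2) (Q * P2)" unfolding mem_def using hP2 by (intro exI[of _ P2]) (simp add: Phi_mult)
      then show ?thesis using that[OF Q(1) False] by blast
    next
      case Q0: True
      obtain r R where R: "homogeneous r R" "teval R w2 \<noteq> 0" "mem Q (r + d) (R * P)"
        using loc[OF w2 True Q0] by blast
      have "mem Q ((t2 + t1) + (r + d)) ((T2 * T1) * (R * P))"
        by (rule mem_mult[OF R(3) hom_mult[OF 2(1) 1(1)]])
      then have "mem Q (r + d2) (R * P2)" unfolding d2_def P2_def by (simp add: ac_simps)
      then show ?thesis using that R by blast
    qed
  qed
  obtain A B where AB: "homogeneous (r - 1) A" "homogeneous (r - 1) B"
    "R = tconst (teval R w2) * z' ^ r + x' * A + l1 * B"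
    using frame_point[OF fr' R(1)] .
  have zr: "mem Q (r + d2) (z' ^ r * P2)"
  proof (cases "r = 0")
    case True
    then obtain a where "R = tconst a" "a \<noteq> 0" using hom0_const R(1,2) by (metis teval_simps(8))
    then have "mem Q d2 (tconst (1 / a) * (tconst a * P2))" using mem_tconst[of Q d2 "tconst a * P2" "1 / a"] R(3) True by simp
    then show ?thesis using True \<open>a \<noteq> 0\<close> by (simp add: mult.assoc[symmetric] tconst_mult[symmetric])
  next
    case False
    define a where "a = teval R w2"
    have m1: "mem Q (r + d2) (A * (x' * P2))" "mem Q (r + d2) (B * (l1 * P2))"
      using mem_mult[OF kx AB(1)] mem_mult[OF k1 AB(2)] False by simp_all
    have "mem Q (r + d2) (tconst (1 / a) * (R * P2 - A * (x' * P2) - B * (l1 * P2)))"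
      by (intro mem_tconst mem_diff m1 R(3))
    also have "R * P2 - A * (x' * P2) - B * (l1 * P2) = (R - x' * A - l1 * B) * P2"
      by (simp add: algebra_simps)
    also have "R - x' * A - l1 * B = tconst a * z' ^ r" using AB(3) by (simp add: a_def algebra_simps)
    also have "tconst (1 / a) * (tconst a * z' ^ r * P2) = tconst (1 / a * a) * (z' ^ r * P2)"
      by (simp only: tconst_mult mult.assoc)
    finally show ?thesis using R(2) by (simp add: a_def)
  qed
  \<comment> \<open>The last power of \<open>z'\<close> that keeps the product outside the ideal.
    Since \<open>x'\<close>, \<open>l1\<close> and \<open>z'\<close> are a basis of the linear
    forms, all linear forms then carry \<open>P3\<close> into the ideal.\<close>
  obtain j where j: "\<not> mem Q (j + d2) (z' ^ j * P2)" "mem Q (Suc j + d2) (z' ^ Suc j * P2)"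
  proof -
    have "\<exists>j. \<not> mem Q (j + d2) (z' ^ j * P2) \<and> mem Q (Suc j + d2) (z' ^ Suc j * P2)"
    proof (rule ccontr)
      assume n: "\<nexists>j. \<not> mem Q (j + d2) (z' ^ j * P2) \<and> mem Q (Suc j + d2) (z' ^ Suc j * P2)"
      have "\<not> mem Q (j + d2) (z' ^ j * P2)" for j
        using n nP2 by (induction j) auto
      then show False using zr by blast
    qed
    then show ?thesis using that by blast
  qed
  define P3 where "P3 = z' ^ j * P2"
  define d3 where "d3 = j + d2"
  have zj: "homogeneous j (z' ^ j)" using hom_power1[OF fd'(3)] .
  have nP3: "\<not> mem Q d3 P3" using j by (simp add: P3_def d3_def)
  have hP3: "homogeneous (e + d3) P3" unfolding P3_def d3_def using hom_mult[OF zj hP2] by (simp add: ac_simps)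
  have kill: "mem Q (Suc d3) (x' * P3)" "mem Q (Suc d3) (l1 * P3)" "mem Q (Suc d3) (z' * P3)"
    using mem_mult[OF kx zj] mem_mult[OF k1 zj] j(2) unfolding P3_def d3_def by (simp_all add: ac_simps)
  have killall: "mem Q (Suc d3) (l * P3)" if l: "homogeneous 1 l" for l
  proof -
    have "l * P3 = (tconst (teval l u') * x' + tconst (teval l v') * l1 + tconst (teval l w2) * z') * P3"
      by (rule arg_cong[OF frame_form1[OF fr' l]])
    also have "\<dots> = tconst (teval l u') * (x' * P3) + tconst (teval l v') * (l1 * P3) + tconst (teval l w2) * (z' * P3)"
      by (simp add: algebra_simps)
    also have "mem Q (Suc d3) \<dots>" by (intro mem_add mem_tconst kill)
    finally show ?thesis .
  qed
  \<comment> \<open>A point off the curve: \<open>x\<close> and \<open>y\<close> vanish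
    simultaneously only there, hence nowhere on the curve.\<close>
  obtain w where w: "w \<noteq> 0" "teval F w \<noteq> 0" using ex_nonzero_point[OF F F0] .
  obtain x y z u v where fr: "frame x y z u v w" using frame_exists[OF w(1)] .
  note fd = frameD[OF fr]
  obtain B1 where B1: "homogeneous (Suc d3) B1" "Phi (x * P3) = Phi Q * Phi B1"
    using killall[OF fd(1)] unfolding mem_def by blast
  obtain B2 where B2: "homogeneous (Suc d3) B2" "Phi (y * P3) = Phi Q * Phi B2"
    using killall[OF fd(2)] unfolding mem_def by blast
  have "Phi Q * (Phi y * Phi B1 - Phi x * Phi B2) = Phi y * (Phi Q * Phi B1) - Phi x * (Phi Q * Phi B2)"
    by (simp add: algebra_simps)
  also have "\<dots> = 0" unfolding B1(2)[symmetric] B2(2)[symmetric] by (simp add: Phi_mult)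
  finally have "Phi (y * B1 - x * B2) = 0" using Q(2) by (simp add: Phi_simps)
  then have dv: "F dvd y * B1 - x * B2" by (simp add: Phi_0_iff)
  have hd: "homogeneous (Suc (Suc d3)) (y * B1 - x * B2)"
    using hom_diff hom_mult[OF fd(2) B1(1)] hom_mult[OF fd(1) B2(1)] by simp
  obtain C D where CD: "homogeneous (Suc d3) C" "y * C = x * D" "Phi C = Phi B1"
  proof (cases "y * B1 - x * B2 = 0")
    case True
    then show ?thesis using that[OF B1(1), of B2] by simp
  next
    case False
    obtain A where A: "homogeneous (Suc (Suc d3) - c) A" "y * B1 - x * B2 = F * A"
      using hom_dvdE[OF F hd dv hom_dvd_degree[OF F hd dv False]] .
    have A0: "teval A w = 0"
      using arg_cong[OF A(2), of "\<lambda>P. teval P w"] w(2) fd by simp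
    have cd: "c < Suc (Suc d3)"
    proof (rule ccontr)
      assume "\<not> c < Suc (Suc d3)"
      then have "Suc (Suc d3) - c = 0" by simp
      then have "A = 0" using hom0_const[of A] A A0 by (metis tconst_0 teval_simps(8))
      then show False using False A(2) by simp
    qed
    \<comment> \<open>Subtracting a multiple of \<open>F\<close> from \<open>B1\<close> and adding
      one to \<open>B2\<close> turns the congruence modulo \<open>F\<close> into an identity of
      polynomials. This works because the cofactor \<open>A\<close> vanishes at \<open>w\<close> and
      so lies in the ideal of \<open>x\<close> and \<open>y\<close>.\<close>
    obtain A2 A1 where A12: "homogeneous (Suc (Suc d3) - c - 1) A2" "homogeneous (Suc (Suc d3) - c - 1) A1"
      "A = x * A2 + y * A1"
      using frame_point[OF fr A(1)] A0 by auto
    have "homogeneous (c + (Suc (Suc d3) - c - 1)) (F * A1)" by (rule hom_mult[OF F A12(2)])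
    then have "homogeneous (Suc d3) (F * A1)" using cd by (simp add: Suc_diff_le)
    then have "homogeneous (Suc d3) (B1 - F * A1)" using hom_diff B1(1) by blast
    moreover have "y * (B1 - F * A1) = x * (B2 + F * A2)"
      using A(2) unfolding A12(3) by (simp add: algebra_simps)
    moreover have "Phi (B1 - F * A1) = Phi B1" using Phi_0_iff[of F] by (simp add: Phi_simps)
    ultimately show ?thesis using that by blast
  qed
  obtain C' where C': "homogeneous (Suc d3 - 1) C'" "C = x * C'" using frame_cancel[OF fr CD(1,2)] .
  have x0: "Phi x \<noteq> 0"
  proof -
    have "x \<noteq> 0" using fd(7) by auto
    then show ?thesis using Phi_low[OF fd(1)] c2 by simp
  qed
  have "Phi x * Phi P3 = Phi x * (Phi Q * Phi C')"
    using B1(2) CD(3) C'(2) by (simp add: Phi_mult algebra_simps)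
  then have "Phi P3 = Phi Q * Phi C'" using x0 by simp
  then have "mem Q d3 P3" unfolding mem_def using C'(1) by auto
  then show False using nP3 by blast
qed

end

section \<open>Local rings of the curve\<close>

context curve
begin

text \<open>A single construction for the function field and for all local rings, which differ only
  in the admissible denominators.\<close>

definition fracs :: "(tpoly \<Rightarrow> bool) \<Rightarrow> 'k set" where
  "fracs S = {Phi P / Phi Q |P Q d. homogeneous d P \<and> homogeneous d Q \<and> S Q}"

definition Kf :: "'k set" where "Kf = fracs (\<lambda>Q. Phi Q \<noteq> 0)"

definition Ow :: "complex ^ 3 \<Rightarrow> 'k set" where "Ow v = fracs (\<lambda>Q. teval Q v \<noteq> 0)"

lemma fracsI: "homogeneous d P \<Longrightarrow> homogeneous d Q \<Longrightarrow> S Q \<Longrightarrow> Phi P / Phi Q \<in> fracs S"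
  unfolding fracs_def by blast

lemma fracsE:
  assumes "x \<in> fracs S"
  obtains P Q d where "homogeneous d P" "homogeneous d Q" "S Q" "x = Phi P / Phi Q"
  using assms unfolding fracs_def by blast

definition mult_pred :: "(tpoly \<Rightarrow> bool) \<Rightarrow> bool" where
  "mult_pred S \<longleftrightarrow> S 1 \<and> (\<forall>P Q. S P \<longrightarrow> S Q \<longrightarrow> S (P * Q)) \<and> (\<forall>Q. S Q \<longrightarrow> Phi Q \<noteq> 0)"

lemma mult_pred_K: "mult_pred (\<lambda>Q. Phi Q \<noteq> 0)"
  by (simp add: mult_pred_def Phi_simps)

lemma mult_pred_O: "teval F v = 0 \<Longrightarrow> mult_pred (\<lambda>Q. teval Q v \<noteq> 0)"
  using Phi_nz[of v] by (auto simp: mult_pred_def)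

context
  fixes S assumes S: "mult_pred S"
begin

lemma fracs_add: assumes "x \<in> fracs S" "y \<in> fracs S" shows "x + y \<in> fracs S"
proof -
  obtain P Q d where a: "homogeneous d P" "homogeneous d Q" "S Q" "x = Phi P / Phi Q"
    using assms(1) by (rule fracsE)
  obtain R T e where b: "homogeneous e R" "homogeneous e T" "S T" "y = Phi R / Phi T"
    using assms(2) by (rule fracsE)
  have "Phi Q \<noteq> 0" "Phi T \<noteq> 0" "S (Q * T)" using a b S by (auto simp: mult_pred_def)
  moreover have "homogeneous (d + e) (P * T + R * Q)"
    using hom_add[OF hom_mult[OF a(1) b(2)], of "R * Q"] hom_mult[OF b(1) a(2)] by (simp add: add.commute)
  ultimately show ?thesis
    using fracsI[of "d + e" "P * T + R * Q" "Q * T" S] hom_mult[OF a(2) b(2)] a b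
    by (simp add: Phi_simps add_frac_eq)
qed

lemma fracs_mult: assumes "x \<in> fracs S" "y \<in> fracs S" shows "x * y \<in> fracs S"
proof -
  obtain P Q d where a: "homogeneous d P" "homogeneous d Q" "S Q" "x = Phi P / Phi Q"
    using assms(1) by (rule fracsE)
  obtain R T e where b: "homogeneous e R" "homogeneous e T" "S T" "y = Phi R / Phi T"
    using assms(2) by (rule fracsE)
  have "S (Q * T)" using a b S by (auto simp: mult_pred_def)
  then show ?thesis
    using fracsI[of "d + e" "P * R" "Q * T" S] hom_mult[OF a(2) b(2)] hom_mult[OF a(1) b(1)] a b
    by (simp add: Phi_simps)
qed

lemma fracs_const: "Phi (tconst a) \<in> fracs S"
  using fracsI[of 0 "tconst a" 1 S] S by (simp add: mult_pred_def Phi_1)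

lemma fracs_0: "0 \<in> fracs S" and fracs_1: "1 \<in> fracs S"
  using fracs_const[of 0] fracs_const[of 1] by (simp_all add: Phi_simps)

lemma fracs_uminus: "x \<in> fracs S \<Longrightarrow> - x \<in> fracs S"
  using fracs_mult[OF fracs_const[of "-1"], of x] by (simp add: tconst_minus Phi_simps)

lemma fracs_diff: "x \<in> fracs S \<Longrightarrow> y \<in> fracs S \<Longrightarrow> x - y \<in> fracs S"
  using fracs_add[of x "- y"] fracs_uminus by simp

lemma fracs_power: "x \<in> fracs S \<Longrightarrow> x ^ n \<in> fracs S"
  by (induction n) (auto intro: fracs_mult fracs_1)

lemma fracs_sum: "(\<And>i. i \<in> I \<Longrightarrow> f i \<in> fracs S) \<Longrightarrow> sum f I \<in> fracs S"
  by (induction I rule: infinite_finite_induct) (auto intro: fracs_add fracs_0)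

lemma subspace_fracs: "K.subspace (fracs S)"
  unfolding K.subspace_def using fracs_0 fracs_add fracs_mult[OF fracs_const] by blast

lemma fracs_sub_Kf: "fracs S \<subseteq> Kf"
  using S fracsI[of _ _ _ "\<lambda>Q. Phi Q \<noteq> 0"] unfolding Kf_def mult_pred_def
  by (auto elim!: fracsE)

end

lemmas Kf_add = fracs_add[OF mult_pred_K, folded Kf_def]
  and Kf_mult = fracs_mult[OF mult_pred_K, folded Kf_def]
  and Kf_const = fracs_const[OF mult_pred_K, folded Kf_def]
  and Kf_0 = fracs_0[OF mult_pred_K, folded Kf_def]
  and Kf_1 = fracs_1[OF mult_pred_K, folded Kf_def]
  and Kf_uminus = fracs_uminus[OF mult_pred_K, folded Kf_def]
  and Kf_diff = fracs_diff[OF mult_pred_K, folded Kf_def]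
  and Kf_power = fracs_power[OF mult_pred_K, folded Kf_def]
  and Kf_sum = fracs_sum[OF mult_pred_K, folded Kf_def]
  and subspace_Kf = subspace_fracs[OF mult_pred_K, folded Kf_def]

lemmas Ow_add = fracs_add[OF mult_pred_O, folded Ow_def]
  and Ow_mult = fracs_mult[OF mult_pred_O, folded Ow_def]
  and Ow_const = fracs_const[OF mult_pred_O, folded Ow_def]
  and Ow_0 = fracs_0[OF mult_pred_O, folded Ow_def]
  and Ow_1 = fracs_1[OF mult_pred_O, folded Ow_def]
  and Ow_uminus = fracs_uminus[OF mult_pred_O, folded Ow_def]
  and Ow_diff = fracs_diff[OF mult_pred_O, folded Ow_def]
  and Ow_power = fracs_power[OF mult_pred_O, folded Ow_def]
  and Ow_sum = fracs_sum[OF mult_pred_O, folded Ow_def]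
  and subspace_Ow = subspace_fracs[OF mult_pred_O, folded Ow_def]
  and Ow_sub_Kf = fracs_sub_Kf[OF mult_pred_O, folded Ow_def]

lemma OwI: "homogeneous d P \<Longrightarrow> homogeneous d Q \<Longrightarrow> teval Q v \<noteq> 0 \<Longrightarrow> Phi P / Phi Q \<in> Ow v"
  unfolding Ow_def by (rule fracsI)

lemma OwE:
  assumes "x \<in> Ow v"
  obtains P Q d where "homogeneous d P" "homogeneous d Q" "teval Q v \<noteq> 0" "x = Phi P / Phi Q"
  using assms unfolding Ow_def by (rule fracsE)

lemma KfI: "homogeneous d P \<Longrightarrow> homogeneous d Q \<Longrightarrow> Phi Q \<noteq> 0 \<Longrightarrow> Phi P / Phi Q \<in> Kf"
  unfolding Kf_def by (rule fracsI)

lemma KfE: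
  assumes "x \<in> Kf"
  obtains P Q d where "homogeneous d P" "homogeneous d Q" "Phi Q \<noteq> 0" "x = Phi P / Phi Q"
  using assms unfolding Kf_def by (rule fracsE)

lemma Kf_inverse: "x \<in> Kf \<Longrightarrow> inverse x \<in> Kf"
proof (elim KfE)
  fix P Q d assume h: "homogeneous d P" "homogeneous d Q" "Phi Q \<noteq> 0" "x = Phi P / Phi Q"
  then show ?thesis using KfI[OF h(2,1)] Kf_0 by (cases "Phi P = 0") auto
qed

lemma Kf_divide: "x \<in> Kf \<Longrightarrow> y \<in> Kf \<Longrightarrow> x / y \<in> Kf"
  using Kf_mult Kf_inverse by (simp add: divide_inverse)

lemma Ow_scale: "a \<noteq> 0 \<Longrightarrow> Ow (a *s v) = Ow v"
  unfolding Ow_def fracs_def using teval_scale by (metis (no_types, lifting) mult_eq_0_iff power_not_zero)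

text \<open>The numerator \<open>Q * T + P * R\<close> has the same nonzero value at
  \<open>v\<close> as \<open>Q * T\<close>, and may therefore serve as a denominator.\<close>

lemma Ow_1_plus:
  assumes v: "teval F v = 0" and P: "homogeneous d P" "homogeneous d Q" "teval Q v \<noteq> 0" "teval P v = 0"
    and h: "h \<in> Ow v"
  shows "1 + Phi P / Phi Q * h \<noteq> 0 \<and> inverse (1 + Phi P / Phi Q * h) \<in> Ow v"
proof -
  obtain R T e where r: "homogeneous e R" "homogeneous e T" "teval T v \<noteq> 0" "h = Phi R / Phi T"
    using h by (rule OwE)
  have nz: "Phi Q \<noteq> 0" "Phi T \<noteq> 0" using Phi_nz[OF v] P r by auto
  have eq: "1 + Phi P / Phi Q * h = Phi (Q * T + P * R) / Phi (Q * T)"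
    using nz r by (simp add: Phi_simps field_simps)
  have ev: "teval (Q * T + P * R) v \<noteq> 0" using P r by simp
  have "inverse (1 + Phi P / Phi Q * h) = Phi (Q * T) / Phi (Q * T + P * R)" by (simp only: eq inverse_divide)
  also have "\<dots> \<in> Ow v"
    by (intro OwI[of "d + e"] hom_mult hom_add P r ev)
  finally have inv: "inverse (1 + Phi P / Phi Q * h) \<in> Ow v" .
  have "1 + Phi P / Phi Q * h \<noteq> 0"
    unfolding eq using Phi_nz[OF v ev] nz by (simp add: Phi_mult)
  with inv show ?thesis by blast
qed

text \<open>The lower bound \<open>n0\<close> on the degree brings the numerators into the range in
  which \<open>hdim_M\<close> holds.\<close>

lemma common_denom:
  assumes v: "v \<noteq> 0" "teval F v = 0" and T: "finite T" "T \<subseteq> Ow v"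
  shows "\<exists>D d N. n0 \<le> d \<and> homogeneous d D \<and> teval D v \<noteq> 0 \<and>
    (\<forall>t\<in>T. homogeneous d (N t) \<and> t = Phi (N t) / Phi D)"
  using T
proof (induction T rule: finite_induct)
  case empty
  obtain x y z u v' where fr: "frame x y z u v' v" using frame_exists[OF v(1)] .
  then show ?case
    using hom_power1[OF frameD(3)[OF fr], of n0] frameD(15)[OF fr]
    by (intro exI[of _ "z ^ n0"] exI[of _ n0]) auto
next
  case (insert t T)
  then obtain D d N where h: "n0 \<le> d" "homogeneous d D" "teval D v \<noteq> 0"
    "\<And>t. t \<in> T \<Longrightarrow> homogeneous d (N t) \<and> t = Phi (N t) / Phi D"
    using insert.IH insert.prems by (metis insert_subset)
  obtain P Q e where q: "homogeneous e P" "homogeneous e Q" "teval Q v \<noteq> 0" "t = Phi P / Phi Q"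
    using insert.prems by (auto elim: OwE)
  have nz: "Phi D \<noteq> 0" "Phi Q \<noteq> 0" using Phi_nz[OF v(2)] h q by auto
  have "homogeneous (d + e) (P * D)" using hom_mult[OF q(1) h(2)] by (simp add: add.commute)
  moreover have "t = Phi (P * D) / Phi (D * Q)" using nz q by (simp add: Phi_mult)
  moreover have "homogeneous (d + e) (N t' * Q) \<and> t' = Phi (N t' * Q) / Phi (D * Q)" if "t' \<in> T" for t'
    using h(4)[OF that] hom_mult[of d "N t'" e Q] q(2) nz by (simp add: Phi_mult)
  ultimately show ?case
    using h(1,3) q(3) hom_mult[OF h(2) q(2)]
    by (intro exI[of _ "D * Q"] exI[of _ "d + e"] exI[of _ "\<lambda>x. if x = t then P * D else N x * Q"]) auto
qed

lemma Ow_ideal_subspace: "teval F v = 0 \<Longrightarrow> K.subspace ((\<lambda>x. s * x) ` Ow v)"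
  by (rule subspace_scaled[OF subspace_Ow])

text \<open>More than \<open>c * e\<close> germs, written over a common denominator, have numerators
  that are dependent modulo \<open>P\<close> in a graded piece; dividing by the denominator gives a
  relation of the germs.\<close>

lemma hdim_Ow_le:
  assumes v: "v \<noteq> 0" "teval F v = 0"
    and P: "homogeneous e P" "Phi P \<noteq> 0" "homogeneous e Q" "teval Q v \<noteq> 0"
  shows "\<exists>n\<le>c * e. K.hdim (Ow v) ((\<lambda>x. Phi P / Phi Q * x) ` Ow v) n"
proof (rule K.hdim_exists[OF Ow_ideal_subspace[OF v(2)]])
  fix T assume T: "T \<subseteq> Ow v" "K.indm ((\<lambda>x. Phi P / Phi Q * x) ` Ow v) T"
  have fT: "finite T" using T(2) by (simp add: K.indm_def)
  obtain D d N where h: "c + e \<le> d" "homogeneous d D" "teval D v \<noteq> 0"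
    "\<And>t. t \<in> T \<Longrightarrow> homogeneous d (N t) \<and> t = Phi (N t) / Phi D"
    using common_denom[OF v fT T(1), of "c + e"] by blast
  show "card T \<le> c * e"
  proof (rule ccontr)
    assume "\<not> card T \<le> c * e"
    then have card: "c * e < card T" by simp
    have f: "Phi (N t) \<in> Sb d" if "t \<in> T" for t using h(4)[OF that] SbI by blast
    obtain a t where a: "t \<in> T" "a t \<noteq> 0"
      "(\<Sum>t\<in>T. Phi (tconst (a t)) * Phi (N t)) \<in> (\<lambda>x. Phi P * x) ` Sb (d - e)"
      by (rule K.dependent_family[OF subspace_scaled[OF subspace_Sb] hdim_M[OF P(1,2) h(1)] fT card f])
    then obtain B where B: "homogeneous (d - e) B" "(\<Sum>t\<in>T. Phi (tconst (a t)) * Phi (N t)) = Phi P * Phi B"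
      by (auto simp: Sb_def)
    have "(\<Sum>t\<in>T. Phi (tconst (a t)) * t) = (\<Sum>t\<in>T. Phi (tconst (a t)) * (Phi (N t) / Phi D))"
      using h(4) by (intro sum.cong) auto
    also have "\<dots> = (Phi P * Phi B) / Phi D" by (simp add: B(2)[symmetric] sum_divide_distrib)
    also have "\<dots> = Phi P / Phi Q * (Phi (Q * B) / Phi D)"
      using Phi_nz[OF v(2)] P by (simp add: Phi_mult)
    also have "\<dots> \<in> (\<lambda>x. Phi P / Phi Q * x) ` Ow v"
      using hom_mult[OF P(3) B(1)] h by (intro imageI OwI[of d]) auto
    finally have "\<forall>t\<in>T. a t = 0" using T(2) by (simp add: K.indm_def)
    then show False using a by blast
  qed
qed

lemma hdim_Ow_ex:
  assumes v: "v \<noteq> 0" "teval F v = 0" and s: "s \<in> Ow v" "s \<noteq> 0"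
  obtains n where "K.hdim (Ow v) ((\<lambda>x. s * x) ` Ow v) n"
proof -
  obtain P Q d where h: "homogeneous d P" "homogeneous d Q" "teval Q v \<noteq> 0" "s = Phi P / Phi Q"
    using s(1) by (rule OwE)
  then have "Phi P \<noteq> 0" using s by auto
  then show ?thesis using hdim_Ow_le[OF v h(1) _ h(2,3)] h(4) that by blast
qed

text \<open>Isolates the lowest power in a nontrivial relation. \<open>R\<close> is left general
  because the lemma is applied to local rings, where the last factor is a unit, as well as to
  functions regular away from a point.\<close>

lemma lowest_term:
  assumes R: "\<And>x y. x \<in> R \<Longrightarrow> y \<in> R \<Longrightarrow> x + y \<in> R" "\<And>x y. x \<in> R \<Longrightarrow> y \<in> R \<Longrightarrow> x * y \<in> R"
    "\<And>a. Phi (tconst a) \<in> R" and g: "g \<in> R"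
    and a: "i \<le> n" "a i \<noteq> 0"
  shows "\<exists>m b h. b \<noteq> 0 \<and> h \<in> R \<and> (\<Sum>i\<le>n. Phi (tconst (a i)) * g ^ i) = Phi (tconst b) * g ^ m * (1 + g * h)"
  using a
proof (induction n arbitrary: a i)
  case 0
  then show ?case using R(3)[of 0] by (intro exI[of _ 0] exI[of _ "a 0"]) (auto intro!: bexI[of _ 0] exI[of _ 0] simp: Phi_0)
next
  case (Suc n)
  have sp: "(\<Sum>i\<le>Suc n. Phi (tconst (a i)) * g ^ i) =
      Phi (tconst (a 0)) + g * (\<Sum>i\<le>n. Phi (tconst (a (Suc i))) * g ^ i)"
    by (subst sum.atMost_Suc_shift) (simp add: sum_distrib_left algebra_simps)
  show ?case
  proof (cases "a 0 = 0")
    case True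
    with Suc.prems have "i - 1 \<le> n" "a (Suc (i - 1)) \<noteq> 0" by (cases i; simp)+
    then obtain m b h where "b \<noteq> 0" "h \<in> R"
      "(\<Sum>i\<le>n. Phi (tconst (a (Suc i))) * g ^ i) = Phi (tconst b) * g ^ m * (1 + g * h)"
      using Suc.IH[of "i - 1" "\<lambda>i. a (Suc i)"] by blast
    then show ?thesis unfolding sp using True
      by (intro exI[of _ "Suc m"] exI[of _ b] exI[of _ h]) (simp add: Phi_0 ac_simps)
  next
    case False
    let ?h = "Phi (tconst (1 / a 0)) * (\<Sum>i\<le>n. Phi (tconst (a (Suc i))) * g ^ i)"
    have pw: "g ^ j \<in> R" for j using g R(2) R(3)[of 1] by (induction j) (auto simp: Phi_1)
    have sm: "(\<Sum>i\<in>I. Phi (tconst (a (Suc i))) * g ^ i) \<in> R" if "finite I" for I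
      using that R(3)[of 0] by (induction I rule: finite_induct) (auto intro: R pw simp: Phi_0)
    have "Phi (tconst (a 0)) * Phi (tconst (1 / a 0)) = 1"
      using False by (simp add: Phi_mult[symmetric] tconst_mult[symmetric] Phi_1)
    then have "Phi (tconst (a 0)) * g ^ 0 * (1 + g * ?h) =
        Phi (tconst (a 0)) + g * (\<Sum>i\<le>n. Phi (tconst (a (Suc i))) * g ^ i)"
      by (simp add: distrib_left mult.left_commute[of _ g] mult.assoc[symmetric])
    then show ?thesis unfolding sp using False sm[of "{..n}"] R
      by (intro exI[of _ 0] exI[of _ "a 0"] exI[of _ ?h]) auto
  qed
qed

text \<open>The quotient by \<open>s\<close> is finite-dimensional, so the powers of
  \<open>g\<close> are dependent in it; the relation is, up to a unit, its lowest power of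
  \<open>g\<close>.\<close>

lemma power_in_ideal:
  assumes v: "v \<noteq> 0" "teval F v = 0" and s: "s \<in> Ow v" "s \<noteq> 0"
    and P: "homogeneous d P" "homogeneous d Q" "teval Q v \<noteq> 0" "teval P v = 0"
  obtains m where "(Phi P / Phi Q) ^ m \<in> (\<lambda>x. s * x) ` Ow v"
proof -
  define g where "g = Phi P / Phi Q"
  have g: "g \<in> Ow v" unfolding g_def using P by (intro OwI)
  obtain n where n: "K.hdim (Ow v) ((\<lambda>x. s * x) ` Ow v) n" using hdim_Ow_ex[OF v s] .
  obtain a i where a: "i \<in> {..n}" "a i \<noteq> 0" "(\<Sum>i\<in>{..n}. Phi (tconst (a i)) * g ^ i) \<in> (\<lambda>x. s * x) ` Ow v"
    by (rule K.dependent_family[OF Ow_ideal_subspace[OF v(2)] n, of "{..n}" "\<lambda>i. g ^ i"])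
      (use Ow_power[OF v(2) g] in auto)
  obtain m b h where m: "b \<noteq> 0" "h \<in> Ow v"
    "(\<Sum>i\<le>n. Phi (tconst (a i)) * g ^ i) = Phi (tconst b) * g ^ m * (1 + g * h)"
    using lowest_term[of "Ow v" g i n a] a Ow_add[OF v(2)] Ow_mult[OF v(2)] Ow_const[OF v(2)] g by auto
  obtain y where y: "y \<in> Ow v" "Phi (tconst b) * g ^ m * (1 + g * h) = s * y" using a(3) m(3) by auto
  have u: "1 + g * h \<noteq> 0" "inverse (1 + g * h) \<in> Ow v"
    using Ow_1_plus[OF v(2) P m(2)] by (simp_all add: g_def)
  have bb: "Phi (tconst (1 / b)) * Phi (tconst b) = 1"
    using m(1) by (simp add: Phi_mult[symmetric] tconst_mult[symmetric] Phi_1)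
  have "g ^ m = (Phi (tconst (1 / b)) * Phi (tconst b)) * g ^ m * ((1 + g * h) * inverse (1 + g * h))"
    using bb u by simp
  also have "\<dots> = Phi (tconst (1 / b)) * (Phi (tconst b) * g ^ m * (1 + g * h)) * inverse (1 + g * h)"
    by (simp only: ac_simps)
  also have "\<dots> = s * (Phi (tconst (1 / b)) * y * inverse (1 + g * h))"
    unfolding y(2) by (simp only: ac_simps)
  finally show ?thesis using that[of m] Ow_mult[OF v(2)] Ow_const[OF v(2)] y u unfolding g_def by blast
qed

subsection \<open>Polynomials in an element of the function field\<close>

definition peval :: "complex poly \<Rightarrow> 'k \<Rightarrow> 'k" where
  "peval p u = poly (map_poly (\<lambda>a. Phi (tconst a)) p) u"

lemma peval_0 [simp]: "peval 0 u = 0"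
  by (simp add: peval_def)

lemma peval_pCons: "peval (pCons a p) u = Phi (tconst a) + u * peval p u"
  by (simp add: peval_def map_poly_pCons Phi_0)

lemma peval_sum: "peval (\<Sum>i\<le>n. Polynomial.monom (a i) i) u = (\<Sum>i\<le>n. Phi (tconst (a i)) * u ^ i)"
proof -
  have "map_poly (\<lambda>a. Phi (tconst a)) (\<Sum>i\<le>n. Polynomial.monom (a i) i) =
      (\<Sum>i\<le>n. Polynomial.monom (Phi (tconst (a i))) i)"
    by (rule poly_eqI) (simp add: coeff_map_poly coeff_sum Phi_0)
  then show ?thesis by (simp add: peval_def poly_sum poly_monom)
qed

lemma peval_root: "peval ([:- r, 1:] * p) u = (u - Phi (tconst r)) * peval p u"
proof -
  have sm: "peval (Polynomial.smult a q) u = Phi (tconst a) * peval q u" for a q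
    by (induction q) (simp_all add: peval_pCons tconst_mult Phi_mult algebra_simps)
  have ad: "peval (q + q') u = peval q u + peval q' u" for q q'
    unfolding peval_def by (subst poly_add[symmetric]) (rule arg_cong[of _ _ "\<lambda>p. poly p u"],
      rule poly_eqI, simp add: coeff_map_poly Phi_0 tconst_add Phi_add)
  have "[:- r, 1:] * p = pCons 0 p + Polynomial.smult (- r) p" by simp
  then have "peval ([:- r, 1:] * p) u = peval (pCons 0 p) u + peval (Polynomial.smult (- r) p) u"
    by (simp only: ad)
  then show ?thesis unfolding sm by (simp add: peval_pCons tconst_minus Phi_simps algebra_simps)
qed

text \<open>The complex numbers are algebraically closed: \<open>p\<close> splits, and in a field
  one of its linear factors must vanish at \<open>u\<close>.\<close>

lemma algebraic_const:
  assumes "p \<noteq> 0" "peval p u = 0"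
  shows "\<exists>a. u = Phi (tconst a)"
  using assms
proof (induction "Polynomial.degree p" arbitrary: p rule: less_induct)
  case less
  show ?case
  proof (cases "Polynomial.degree p = 0")
    case True
    then obtain a where "p = [:a:]" by (auto elim: degree_eq_zeroE)
    then show ?thesis using less.prems by (simp add: peval_pCons)
  next
    case False
    then have "\<not> constant (poly p)" by (simp add: constant_degree)
    then obtain r where "poly p r = 0" using fundamental_theorem_of_algebra by blast
    then obtain q where q: "p = [:- r, 1:] * q" using poly_eq_0_iff_dvd by blast
    then have q0: "q \<noteq> 0" using less.prems by auto
    have "(u - Phi (tconst r)) * peval q u = 0" using less.prems(2) q peval_root by simp
    moreover have "Polynomial.degree q < Polynomial.degree p"
    proof -
      have "Polynomial.degree ([:- r, 1:] * q) = 1 + Polynomial.degree q"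
        using q0 by (subst degree_mult_eq) auto
      then show ?thesis using q by simp
    qed
    ultimately show ?thesis using less.hyps[of q] q0 by auto
  qed
qed

end

section \<open>A curve meeting another one in a single point\<close>

text \<open>The form \<open>G\<close> becomes the second curve of the theorem. That it vanishes at
  \<open>w\<close> is only added in \<open>curve_pointed\<close>.\<close>

locale curve_point = curve F c Phi for F :: tpoly and c :: nat and Phi :: "tpoly \<Rightarrow> 'k :: field" +
  fixes w :: "complex ^ 3" and G :: tpoly and b :: nat
  assumes w: "w \<noteq> 0" "teval F w = 0"
    and G: "homogeneous b G" "Phi G \<noteq> 0" "b \<ge> 1"
    and only: "\<And>v. v \<noteq> 0 \<Longrightarrow> teval F v = 0 \<Longrightarrow> teval G v = 0 \<Longrightarrow> \<exists>a. v = a *s w"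
begin

abbreviation "Oq \<equiv> Ow w"

definition others :: "(complex ^ 3) set" where
  "others = {v. v \<noteq> 0 \<and> teval F v = 0 \<and> (\<nexists>a. v = a *s w)}"

text \<open>The coordinate ring of the affine curve that is left when \<open>w\<close> is
  removed.\<close>

definition Gam :: "'k set" where
  "Gam = {u \<in> Kf. \<forall>v\<in>others. u \<in> Ow v}"

lemma othersD: "v \<in> others \<Longrightarrow> v \<noteq> 0" "v \<in> others \<Longrightarrow> teval F v = 0" "v \<in> others \<Longrightarrow> teval G v \<noteq> 0"
  using only unfolding others_def by auto

lemma Gam_add: "x \<in> Gam \<Longrightarrow> y \<in> Gam \<Longrightarrow> x + y \<in> Gam"
  and Gam_mult: "x \<in> Gam \<Longrightarrow> y \<in> Gam \<Longrightarrow> x * y \<in> Gam"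
  and Gam_const: "Phi (tconst a) \<in> Gam"
  using Kf_add Kf_mult Kf_const Ow_add Ow_mult Ow_const othersD(2) unfolding Gam_def by auto

lemma Gam_0: "0 \<in> Gam" and Gam_1: "1 \<in> Gam"
  using Gam_const[of 0] Gam_const[of 1] by (simp_all add: Phi_simps)

lemma Gam_power: "x \<in> Gam \<Longrightarrow> x ^ n \<in> Gam"
  by (induction n) (auto intro: Gam_mult Gam_1)

lemma Gam_sum: "(\<And>i. i \<in> I \<Longrightarrow> f i \<in> Gam) \<Longrightarrow> sum f I \<in> Gam"
  by (induction I rule: infinite_finite_induct) (auto intro: Gam_add Gam_0)

lemma Gam_uminus: "x \<in> Gam \<Longrightarrow> - x \<in> Gam"
  using Gam_mult[OF Gam_const[of "-1"], of x] by (simp add: tconst_minus Phi_simps)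

lemma Gam_diff: "x \<in> Gam \<Longrightarrow> y \<in> Gam \<Longrightarrow> x - y \<in> Gam"
  using Gam_add[of x "- y"] Gam_uminus by simp

lemma subspace_Gam: "K.subspace Gam"
  unfolding K.subspace_def using Gam_0 Gam_add Gam_mult[OF Gam_const] by blast

lemma Gam_GI:
  assumes "homogeneous (b * k) P"
  shows "Phi P / Phi G ^ k \<in> Gam"
proof -
  have "Phi P / Phi (G ^ k) \<in> Gam"
    unfolding Gam_def
    using KfI[OF assms hom_power[OF G(1)]] OwI[OF assms hom_power[OF G(1)]] othersD(3) G(2)
    by (auto simp: Phi_power)
  then show ?thesis by (simp add: Phi_power)
qed

lemma point_cases:
  assumes "v \<noteq> 0" "teval F v = 0"
  obtains a where "a \<noteq> 0" "v = a *s w" | "v \<in> others"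
proof (cases "\<exists>a. v = a *s w")
  case True
  then obtain a where a: "v = a *s w" by blast
  then have "a \<noteq> 0" using assms(1) by auto
  then show ?thesis using a that(1) by blast
next
  case False
  then show ?thesis using that(2) assms by (simp add: others_def)
qed

text \<open>Regularity at every point puts the numerator locally into the ideal of the denominator.
  By \<open>local_global\<close> it is a global multiple, with a cofactor of degree 0.\<close>

lemma regular_const:
  assumes "u \<in> Oq" "u \<in> Gam"
  shows "\<exists>a. u = Phi (tconst a)"
proof -
  have "u \<in> Kf" using assms(2) by (simp add: Gam_def)
  then obtain P Q d where h: "homogeneous d P" "homogeneous d Q" "Phi Q \<noteq> 0" "u = Phi P / Phi Q"
    by (rule KfE)
  have "mem Q 0 P"
  proof (rule local_global[OF h(2,3)])
    show "homogeneous (d + 0) P" using h(1) by simp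
    fix v :: "complex ^ 3" assume v: "v \<noteq> 0" "teval F v = 0"
    have "u \<in> Ow v"
      using point_cases[OF v] assms Ow_scale unfolding Gam_def by (metis (mono_tags, lifting) mem_Collect_eq)
    then obtain A R r where r: "homogeneous r A" "homogeneous r R" "teval R v \<noteq> 0" "u = Phi A / Phi R"
      by (rule OwE)
    have "Phi R \<noteq> 0" using Phi_nz[OF v(2) r(3)] .
    then have "Phi (R * P) = Phi Q * Phi A" using r(4) h(3,4) by (simp add: Phi_mult frac_eq_eq mult.commute)
    then have "mem Q (r + 0) (R * P)" unfolding mem_def using r(1) by auto
    then show "\<exists>r R. homogeneous r R \<and> teval R v \<noteq> 0 \<and> mem Q (r + 0) (R * P)" using r by blast
  qed
  then obtain B where B: "homogeneous 0 B" "Phi P = Phi Q * Phi B" unfolding mem_def by blast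
  then have "u = Phi B" using h by simp
  then show ?thesis using hom0_const[OF B(1)] by metis
qed

text \<open>A basis of the forms of degree \<open>c + b\<close> modulo \<open>G\<close> stays
  independent after division by a power of \<open>z\<close>. Indeed, a combination in the ideal of
  \<open>G\<close> at \<open>w\<close> lies in this ideal at all common zeros, as there are no
  others, and so globally by \<open>local_global\<close>.\<close>

lemma hdim_O_ge:
  assumes z: "homogeneous 1 z" "teval z w \<noteq> 0"
    and N: "K.hdim Oq ((\<lambda>x. Phi G / Phi z ^ b * x) ` Oq) N"
  shows "c * b \<le> N"
proof -
  define d where "d = c + b"
  have db: "d = b + c" by (simp add: d_def)
  have zn: "Phi z \<noteq> 0" using Phi_nz[OF w(2) z(2)] .
  obtain S where S: "S \<subseteq> Sb d" "card S = c * b" "K.indm ((\<lambda>x. Phi G * x) ` Sb (d - b)) S"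
    using hdim_M[OF G(1,2), of d] unfolding K.hdim_def by (auto simp: d_def)
  have fS: "finite S" using S(3) by (simp add: K.indm_def)
  let ?f = "\<lambda>x. x / Phi z ^ d"
  have inj: "inj_on ?f S" using zn by (auto simp: inj_on_def)
  have "K.indm ((\<lambda>x. Phi G / Phi z ^ b * x) ` Oq) (?f ` S)"
    unfolding K.indm_def
  proof (intro conjI allI impI)
    show "finite (?f ` S)" using fS by simp
    fix a assume a: "(\<Sum>s\<in>?f ` S. Phi (tconst (a s)) * s) \<in> (\<lambda>x. Phi G / Phi z ^ b * x) ` Oq"
    have sumS: "(\<Sum>s\<in>S. Phi (tconst (a (?f s))) * s) \<in> Sb d"
      using S(1) by (intro K.subspace_sum[OF subspace_Sb] K.subspace_scale[OF subspace_Sb]) auto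
    then obtain P where P: "homogeneous d P" "Phi P = (\<Sum>s\<in>S. Phi (tconst (a (?f s))) * s)"
      by (auto simp: Sb_def)
    have "(\<Sum>s\<in>?f ` S. Phi (tconst (a s)) * s) = Phi P / Phi z ^ d"
      using inj by (simp add: sum.reindex P(2) sum_divide_distrib)
    then obtain y where y: "y \<in> Oq" "Phi P / Phi z ^ d = Phi G / Phi z ^ b * y" using a by auto
    obtain A R r where r: "homogeneous r A" "homogeneous r R" "teval R w \<noteq> 0" "y = Phi A / Phi R"
      using y(1) by (rule OwE)
    have Rn: "Phi R \<noteq> 0" using Phi_nz[OF w(2) r(3)] .
    have "mem G c P"
    proof (rule local_global[OF G(1,2)])
      show "homogeneous (b + c) P" using P(1) by (simp add: d_def add.commute)
      fix v :: "complex ^ 3" assume v: "v \<noteq> 0" "teval F v = 0" "teval G v = 0"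
      obtain a where va: "v = a *s w" using only[OF v] by blast
      then have a0: "a \<noteq> 0" using v(1) by auto
      have "Phi P = Phi G / Phi z ^ b * y * Phi z ^ d" using y(2) zn by (simp add: divide_eq_eq)
      also have "\<dots> = Phi G * (Phi z ^ c * y)" using zn by (simp add: db power_add)
      finally have eq: "Phi (R * P) = Phi G * Phi (z ^ c * A)" using Rn r(4) by (simp add: Phi_mult Phi_power)
      have "homogeneous (r + c) (z ^ c * A)"
        using hom_mult[OF hom_power1[OF z(1), of c] r(1)] by (simp add: add.commute)
      then have "mem G (r + c) (R * P)" unfolding mem_def using eq by blast
      moreover have "teval R v \<noteq> 0" using teval_scale[OF r(2)] r(3) a0 va by simp
      ultimately show "\<exists>r R. homogeneous r R \<and> teval R v \<noteq> 0 \<and> mem G (r + c) (R * P)" using r(2) by blast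
    qed
    then have "Phi P \<in> (\<lambda>x. Phi G * x) ` Sb (d - b)" unfolding mem_def Sb_def by (auto simp: d_def)
    then have "(\<Sum>s\<in>S. Phi (tconst (a (?f s))) * s) \<in> (\<lambda>x. Phi G * x) ` Sb (d - b)" by (simp only: P(2))
    with S(3) have "\<forall>s\<in>S. a (?f s) = 0"
      unfolding K.indm_def by (elim conjE allE[of _ "\<lambda>s. a (?f s)"] impE)
    then show "\<forall>s\<in>?f ` S. a s = 0" by blast
  qed
  moreover have "?f ` S \<subseteq> Oq"
  proof
    fix x assume "x \<in> ?f ` S"
    then obtain P where "homogeneous d P" "x = Phi P / Phi (z ^ d)" using S(1) by (auto simp: Sb_def Phi_power)
    then show "x \<in> Oq" using OwI[OF _ hom_power1[OF z(1)], of d P w] z(2) by simp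
  qed
  ultimately have "card (?f ` S) \<le> N" using K.hdim_bound[OF Ow_ideal_subspace[OF w(2)] N] by blast
  then show ?thesis using card_image[OF inj] S(2) by simp
qed

subsection \<open>Strong approximation away from the point\<close>

text \<open>Powers of \<open>\<psi> = l^b / G\<close> satisfy a linear relation modulo \<open>s\<close>, with lowest term
  \<open>\<psi>^m \<pi>\<close> where \<open>\<pi> - 1\<close> is divisible by \<open>\<psi>\<close>. Then \<open>1 - (1 - \<pi>)^m\<close> is the required element.\<close>

lemma separating:
  assumes S: "homogeneous (b * k) S" "Phi S \<noteq> 0" and l: "homogeneous 1 l"
    and s: "s = Phi S / Phi G ^ k"
  shows "\<exists>e\<in>Gam. \<forall>v\<in>others. (teval l v = 0 \<longrightarrow> (\<exists>y\<in>Ow v. e - 1 = s * y)) \<and>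
    (teval l v \<noteq> 0 \<longrightarrow> (\<exists>y\<in>Ow v. e = s * y))"
proof -
  define \<psi> where "\<psi> = Phi (l ^ b) / Phi G"
  have lb: "homogeneous b (l ^ b)" using hom_power1[OF l] .
  have psiG: "\<psi> \<in> Gam" using Gam_GI[of 1 "l ^ b"] lb by (simp add: \<psi>_def)
  \<comment> \<open>\<open>j\<close> meets three demands: enough powers of \<open>\<psi>\<close> for
    a relation, a degree in which \<open>hdim_M\<close> applies, and
    \<open>k \<le> j\<close>.\<close>
  define j where "j = c + c * (b * k) + k"
  have j1: "c + b * k \<le> b * j"
  proof -
    have "c + b * k \<le> b * c + b * k" using G(3) by (cases b) auto
    also have "\<dots> \<le> b * j" unfolding j_def by (simp add: algebra_simps)
    finally show ?thesis .
  qed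
  have jk: "k \<le> j" by (simp add: j_def)
  have card: "c * (b * k) < card {..j}" by (simp add: j_def)
  have f: "Phi (G ^ (j - i) * (l ^ b) ^ i) \<in> Sb (b * j)" if "i \<in> {..j}" for i
  proof -
    have "homogeneous (b * (j - i) + b * i) (G ^ (j - i) * (l ^ b) ^ i)"
      by (intro hom_mult hom_power G lb)
    moreover have "b * (j - i) + b * i = b * j" using that by (simp add: distrib_left[symmetric])
    ultimately show ?thesis by (simp add: SbI)
  qed
  obtain a i where a: "i \<in> {..j}" "a i \<noteq> 0"
    "(\<Sum>i\<in>{..j}. Phi (tconst (a i)) * Phi (G ^ (j - i) * (l ^ b) ^ i)) \<in> (\<lambda>x. Phi S * x) ` Sb (b * j - b * k)"
    by (rule K.dependent_family[OF subspace_scaled[OF subspace_Sb] hdim_M[OF S j1] finite_atMost card f])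
  then obtain B where B: "homogeneous (b * j - b * k) B"
    "(\<Sum>i\<in>{..j}. Phi (tconst (a i)) * Phi (G ^ (j - i) * (l ^ b) ^ i)) = Phi S * Phi B"
    by (auto simp: Sb_def)
  define \<beta> where "\<beta> = Phi B / Phi G ^ (j - k)"
  have betaG: "\<beta> \<in> Gam" unfolding \<beta>_def using B(1) by (intro Gam_GI) (simp add: diff_mult_distrib2)
  have "(\<Sum>i\<le>j. Phi (tconst (a i)) * \<psi> ^ i) =
      (\<Sum>i\<in>{..j}. Phi (tconst (a i)) * Phi (G ^ (j - i) * (l ^ b) ^ i)) / Phi G ^ j"
    unfolding sum_divide_distrib
  proof (rule sum.cong[OF refl])
    fix i assume "i \<in> {..j}"
    then have "Phi G ^ j = Phi G ^ (j - i) * Phi G ^ i" by (simp add: power_add[symmetric])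
    then show "Phi (tconst (a i)) * \<psi> ^ i = Phi (tconst (a i)) * Phi (G ^ (j - i) * (l ^ b) ^ i) / Phi G ^ j"
      using G(2) by (simp add: \<psi>_def Phi_mult Phi_power power_divide)
  qed
  also have "\<dots> = s * \<beta>"
  proof -
    have "Phi G ^ j = Phi G ^ k * Phi G ^ (j - k)" using jk by (simp add: power_add[symmetric])
    then show ?thesis unfolding B(2) s \<beta>_def by simp
  qed
  finally have rel: "(\<Sum>i\<le>j. Phi (tconst (a i)) * \<psi> ^ i) = s * \<beta>" .
  obtain m a' h where m: "a' \<noteq> 0" "h \<in> Gam"
    "(\<Sum>i\<le>j. Phi (tconst (a i)) * \<psi> ^ i) = Phi (tconst a') * \<psi> ^ m * (1 + \<psi> * h)"
    using lowest_term[of Gam \<psi> i j a] a Gam_add Gam_mult Gam_const psiG by auto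
  define \<pi> where "\<pi> = 1 + \<psi> * h"
  define \<gamma> where "\<gamma> = Phi (tconst (1 / a')) * \<beta>"
  have inv: "Phi (tconst (1 / a')) * Phi (tconst a') = 1"
    using m(1) by (simp add: Phi_mult[symmetric] tconst_mult[symmetric] Phi_1)
  have piG: "\<pi> \<in> Gam" unfolding \<pi>_def by (intro Gam_add Gam_1 Gam_mult psiG m)
  have gamG: "\<gamma> \<in> Gam" unfolding \<gamma>_def by (intro Gam_mult Gam_const betaG)
  have key: "\<psi> ^ m * \<pi> = s * \<gamma>"
  proof -
    have "\<psi> ^ m * \<pi> = (Phi (tconst (1 / a')) * Phi (tconst a')) * \<psi> ^ m * \<pi>" by (simp only: inv mult_1_left)
    also have "\<dots> = Phi (tconst (1 / a')) * (Phi (tconst a') * \<psi> ^ m * \<pi>)" by (simp only: mult.assoc)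
    also have "\<dots> = Phi (tconst (1 / a')) * (s * \<beta>)" by (simp only: rel[symmetric] m(3) \<pi>_def)
    finally show ?thesis by (simp add: \<gamma>_def mult.left_commute)
  qed
  \<comment> \<open>Where \<open>\<psi>\<close> vanishes, \<open>\<pi>\<close> is a unit, so
    \<open>\<psi> ^ m\<close> is a multiple of \<open>s\<close>, and \<open>(1 - \<pi>) ^ m\<close>
    is a multiple of \<open>\<psi> ^ m\<close>. Where \<open>\<psi>\<close> is a unit,
    \<open>\<pi>\<close> itself is a multiple of \<open>s\<close> and divides
    \<open>e\<close>.\<close>
  define e where "e = 1 - (1 - \<pi>) ^ m"
  have e2: "e = \<pi> * (\<Sum>i<m. (1 - \<pi>) ^ i)" using one_diff_power_eq[of "1 - \<pi>" m] by (simp add: e_def)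
  show ?thesis
  proof (rule bexI[of _ e], intro ballI conjI impI)
    show "e \<in> Gam" unfolding e_def by (intro Gam_diff Gam_power Gam_1 piG)
  next
    fix v assume v: "v \<in> others" "teval l v = 0"
    note vF = othersD(2)[OF v(1)]
    have inO: "x \<in> Ow v" if "x \<in> Gam" for x using that v(1) by (simp add: Gam_def)
    show "\<exists>y\<in>Ow v. e - 1 = s * y"
    proof (cases "m = 0")
      \<comment> \<open>Here the relation says that \<open>s\<close> divides the unit
        \<open>\<pi>\<close>. So \<open>s\<close> is invertible at \<open>v\<close>, and the
        congruence modulo \<open>s\<close> is no condition.\<close>
      case True
      then show ?thesis using key inO[OF gamG] inO[OF piG]
        unfolding e_def \<pi>_def
      proof -
        have "teval (l ^ b) v = 0" using v(2) G(3) by simp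
        then have u: "1 + \<psi> * h \<noteq> 0" "inverse (1 + \<psi> * h) \<in> Ow v"
          using Ow_1_plus[OF vF lb G(1) othersD(3)[OF v(1)] _ inO[OF m(2)]] by (simp_all add: \<psi>_def)
        have "\<pi> = s * \<gamma>" using key True by simp
        have "s * (\<gamma> * inverse (1 + \<psi> * h)) = \<pi> * inverse (1 + \<psi> * h)"
          by (simp only: \<open>\<pi> = s * \<gamma>\<close> mult.assoc)
        also have "\<dots> = 1" using u(1) by (simp add: \<pi>_def)
        finally have "s * (\<gamma> * inverse (1 + \<psi> * h)) = 1" .
        then have "1 - (1 - (1 + \<psi> * h)) ^ m - 1 = s * (- (\<gamma> * inverse (1 + \<psi> * h)))" using True by simp
        moreover have "- (\<gamma> * inverse (1 + \<psi> * h)) \<in> Ow v"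
          by (intro Ow_uminus[OF vF] Ow_mult[OF vF] inO[OF gamG] u)
        ultimately show "\<exists>y\<in>Ow v. 1 - (1 - (1 + \<psi> * h)) ^ m - 1 = s * y" by blast
      qed
    next
      case False
      have "teval (l ^ b) v = 0" using v(2) G(3) by simp
      then have u: "1 + \<psi> * h \<noteq> 0" "inverse (1 + \<psi> * h) \<in> Ow v"
        using Ow_1_plus[OF vF lb G(1) othersD(3)[OF v(1)] _ inO[OF m(2)]] by (simp_all add: \<psi>_def)
      have "\<psi> ^ m = \<psi> ^ m * \<pi> * inverse \<pi>" using u by (simp add: \<pi>_def)
      also have "\<dots> = s * (\<gamma> * inverse \<pi>)" by (simp only: key mult.assoc)
      finally have pm: "\<psi> ^ m = s * (\<gamma> * inverse \<pi>)" .
      have "e - 1 = - ((- (\<psi> * h)) ^ m)" by (simp add: e_def \<pi>_def)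
      also have "(- (\<psi> * h)) ^ m = \<psi> ^ m * (- h) ^ m" by (simp flip: power_mult_distrib)
      also have "- (\<psi> ^ m * (- h) ^ m) = s * (- (\<gamma> * inverse \<pi> * (- h) ^ m))" by (simp add: pm mult.assoc)
      finally have "e - 1 = s * (- (\<gamma> * inverse \<pi> * (- h) ^ m))" .
      moreover have "- (\<gamma> * inverse \<pi> * (- h) ^ m) \<in> Ow v"
        using u inO m(2) gamG unfolding \<pi>_def
        by (intro Ow_uminus[OF vF] Ow_mult[OF vF] Ow_power[OF vF]) auto
      ultimately show ?thesis by blast
    qed
  next
    fix v assume v: "v \<in> others" "teval l v \<noteq> 0"
    note vF = othersD(2)[OF v(1)]
    have inO: "x \<in> Ow v" if "x \<in> Gam" for x using that v(1) by (simp add: Gam_def)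
    have lv: "teval (l ^ b) v \<noteq> 0" using v(2) by simp
    have ip: "inverse \<psi> \<in> Ow v" "\<psi> \<noteq> 0"
      using OwI[OF G(1) lb lv] Phi_nz[OF vF lv] G(2) by (simp_all add: \<psi>_def)
    have "\<pi> = \<psi> ^ m * \<pi> * inverse \<psi> ^ m" using ip(2) by (simp add: field_simps)
    also have "\<dots> = s * (\<gamma> * inverse \<psi> ^ m)" by (simp only: key mult.assoc)
    finally have "\<pi> = s * (\<gamma> * inverse \<psi> ^ m)" .
    then have "e = s * (\<gamma> * inverse \<psi> ^ m * (\<Sum>i<m. (1 - \<pi>) ^ i))" by (subst e2) (simp add: mult.assoc)
    moreover have "\<gamma> * inverse \<psi> ^ m * (\<Sum>i<m. (1 - \<pi>) ^ i) \<in> Ow v"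
      using inO ip gamG Gam_1 piG by (intro Ow_mult[OF vF] Ow_power[OF vF] Ow_sum[OF vF] Ow_diff[OF vF]) auto
    ultimately show "\<exists>y\<in>Ow v. e = s * y" by blast
  qed
qed

text \<open>Write \<open>r = a / s\<close> with \<open>a\<close> and \<open>s\<close> regular away
  from \<open>w\<close>, and take two lines meeting exactly in \<open>v1\<close>. The product of
  their separating functions is 1 modulo \<open>s\<close> at \<open>v1\<close> and 0 modulo
  \<open>s\<close> at each other point, so multiplying \<open>r\<close> by it keeps the polar part
  at \<open>v1\<close> and removes all others.\<close>

lemma strong_approx:
  assumes v1: "v1 \<in> others" and r: "r \<in> Kf"
  obtains f where "f \<in> Kf" "f - r \<in> Ow v1"
    "\<And>v. v \<in> others \<Longrightarrow> (\<nexists>a. v = a *s v1) \<Longrightarrow> f \<in> Ow v"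
proof -
  obtain P Q d where h: "homogeneous d P" "homogeneous d Q" "Phi Q \<noteq> 0" "r = Phi P / Phi Q"
    using r by (rule KfE)
  \<comment> \<open>The power \<open>b\<close> makes the degree of \<open>S\<close> a multiple of
    \<open>b\<close>, so that it can be divided by a power of \<open>G\<close>.\<close>
  define S where "S = Q ^ b"
  define a where "a = Phi (P * Q ^ (b - 1)) / Phi G ^ d"
  define s where "s = Phi S / Phi G ^ d"
  have S: "homogeneous (b * d) S" "Phi S \<noteq> 0"
    using hom_power[OF h(2), of b] h(3) by (simp_all add: S_def Phi_power mult.commute)
  have "homogeneous (d + d * (b - 1)) (P * Q ^ (b - 1))" by (intro hom_mult hom_power h)
  moreover have "d + d * (b - 1) = b * d" using G(3) by (cases b) auto
  ultimately have aG: "a \<in> Gam" unfolding a_def by (intro Gam_GI) simp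
  have sG: "s \<in> Gam" unfolding s_def by (rule Gam_GI[OF S(1)])
  have s0: "s \<noteq> 0" using S G by (simp add: s_def)
  have ras: "r = a / s"
  proof -
    have "Phi Q ^ b = Phi Q * Phi Q ^ (b - 1)" using G(3) by (cases b) auto
    then show ?thesis using h(3) G(2) by (simp add: a_def s_def S_def h(4) Phi_mult Phi_power)
  qed
  obtain x y z u v where fr: "frame x y z u v v1" using frame_exists othersD(1)[OF v1] by blast
  note fd = frameD[OF fr]
  obtain e1 where e1: "e1 \<in> Gam" "\<And>v. v \<in> others \<Longrightarrow> teval x v = 0 \<Longrightarrow> \<exists>y\<in>Ow v. e1 - 1 = s * y"
    "\<And>v. v \<in> others \<Longrightarrow> teval x v \<noteq> 0 \<Longrightarrow> \<exists>y\<in>Ow v. e1 = s * y"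
    using separating[OF S fd(1) s_def] by blast
  obtain e2 where e2: "e2 \<in> Gam" "\<And>v. v \<in> others \<Longrightarrow> teval y v = 0 \<Longrightarrow> \<exists>y\<in>Ow v. e2 - 1 = s * y"
    "\<And>v. v \<in> others \<Longrightarrow> teval y v \<noteq> 0 \<Longrightarrow> \<exists>y\<in>Ow v. e2 = s * y"
    using separating[OF S fd(2) s_def] by blast
  have inO: "x \<in> Ow v" if "x \<in> Gam" "v \<in> others" for x v using that by (simp add: Gam_def)
  have inK: "x \<in> Kf" if "x \<in> Gam" for x using that by (simp add: Gam_def)
  define f where "f = a * (e1 * e2) / s"
  show ?thesis
  proof (rule that)
    show "f \<in> Kf" unfolding f_def by (intro Kf_divide Kf_mult inK aG e1 e2 sG)
    note vF = othersD(2)[OF v1]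
    obtain y1 y2 where y: "y1 \<in> Ow v1" "e1 - 1 = s * y1" "y2 \<in> Ow v1" "e2 - 1 = s * y2"
      using e1(2)[OF v1 fd(9)] e2(2)[OF v1 fd(12)] by blast
    have "e1 * e2 - 1 = e1 * (e2 - 1) + (e1 - 1)" by (simp add: algebra_simps)
    also have "\<dots> = s * (e1 * y2 + y1)" by (simp only: y(2,4)) (simp add: algebra_simps)
    finally have ee: "e1 * e2 - 1 = s * (e1 * y2 + y1)" .
    have "f - r = a * (e1 * e2 - 1) / s" by (simp add: f_def ras diff_divide_distrib algebra_simps)
    also have "\<dots> = a * (e1 * y2 + y1)" using s0 by (simp add: ee)
    finally show "f - r \<in> Ow v1"
      using y inO[OF aG v1] inO[OF e1(1) v1] by (auto intro!: Ow_mult[OF vF] Ow_add[OF vF])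
  next
    fix v' assume v': "v' \<in> others" "\<nexists>a. v' = a *s v1"
    note vF = othersD(2)[OF v'(1)]
    have "teval x v' \<noteq> 0 \<or> teval y v' \<noteq> 0"
      using v'(2) fd(16)[of v'] by auto
    then have "\<exists>y\<in>Ow v'. e1 * e2 = s * y"
    proof
      assume "teval x v' \<noteq> 0"
      then obtain y where "y \<in> Ow v'" "e1 = s * y" using e1(3)[OF v'(1)] by blast
      then show ?thesis using Ow_mult[OF vF _ inO[OF e2(1) v'(1)], of y] by (intro bexI[of _ "y * e2"]) auto
    next
      assume "teval y v' \<noteq> 0"
      then obtain y where "y \<in> Ow v'" "e2 = s * y" using e2(3)[OF v'(1)] by blast
      then show ?thesis using Ow_mult[OF vF inO[OF e1(1) v'(1)], of y]
        by (intro bexI[of _ "e1 * y"]) (auto simp: ac_simps)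
    qed
    then obtain y where y: "y \<in> Ow v'" "e1 * e2 = s * y" by blast
    then have "f = a * y" using s0 by (simp add: f_def)
    then show "f \<in> Ow v'" using Ow_mult[OF vF inO[OF aG v'(1)] y(1)] by simp
  qed
qed

subsection \<open>Finiteness\<close>

definition OG :: "'k set" where "OG = {x + y |x y. x \<in> Oq \<and> y \<in> Gam}"

lemma subspace_OG: "K.subspace OG"
  unfolding OG_def by (rule K.subspace_set_plus[OF subspace_Ow[OF w(2)] subspace_Gam])

text \<open>By \<open>power_in_ideal\<close>, a power of the local equation of \<open>G\<close> is a
  multiple of the denominator of \<open>t\<close>.\<close>

lemma Kf_pole:
  assumes t: "t \<in> Kf" and z: "homogeneous 1 z" "teval z w \<noteq> 0" and Gw: "teval G w = 0"
  obtains k where "(Phi G / Phi z ^ b) ^ k * t \<in> Oq"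
proof -
  obtain P Q d where h: "homogeneous d P" "homogeneous d Q" "Phi Q \<noteq> 0" "t = Phi P / Phi Q"
    using t by (rule KfE)
  have zn: "Phi z \<noteq> 0" using Phi_nz[OF w(2) z(2)] .
  have s: "Phi Q / Phi (z ^ d) \<in> Oq" "Phi Q / Phi (z ^ d) \<noteq> 0"
    using OwI[OF h(2) hom_power1[OF z(1)], of w] z(2) h(3) zn by (simp_all add: Phi_power)
  obtain m where "(Phi G / Phi (z ^ b)) ^ m \<in> (\<lambda>x. Phi Q / Phi (z ^ d) * x) ` Oq"
    using power_in_ideal[OF w s G(1) hom_power1[OF z(1)]] z(2) Gw by auto
  then obtain y where y: "y \<in> Oq" "(Phi G / Phi (z ^ b)) ^ m = Phi Q / Phi (z ^ d) * y" by blast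
  have "(Phi G / Phi z ^ b) ^ m * t = Phi P / Phi (z ^ d) * y"
    using y(2) h(3,4) by (simp add: Phi_power)
  also have "\<dots> \<in> Oq"
    using OwI[OF h(1) hom_power1[OF z(1)], of w] z(2) y(1) by (intro Ow_mult[OF w(2)]) auto
  finally show ?thesis by (rule that)
qed

text \<open>Riemann's inequality by counting. Functions with denominator \<open>g ^ k\<close> have
  dimension at most \<open>c * b * k\<close> modulo regular ones, and forms of degree
  \<open>b * k\<close> over \<open>G ^ k\<close>, all regular away from \<open>w\<close>, supply as
  many up to a bounded error.\<close>

lemma hdim_Kf_OG: assumes Gw: "teval G w = 0" obtains n where "K.hdim Kf OG n"
proof -
  obtain x y z u v where fr: "frame x y z u v w" using frame_exists[OF w(1)] .
  have z: "homogeneous 1 z" "teval z w \<noteq> 0" using frameD[OF fr] by simp_all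
  have zn: "Phi z \<noteq> 0" using Phi_nz[OF w(2) z(2)] .
  define g where "g = Phi G / Phi z ^ b"
  have g0: "g \<noteq> 0" using G zn by (simp add: g_def)
  have gO: "g \<in> Oq" unfolding g_def
    using OwI[OF G(1) hom_power1[OF z(1)], of w] z(2) by (simp add: Phi_power)
  have "\<exists>n\<le>c * c. K.hdim Kf OG n"
  proof (rule K.hdim_exists[OF subspace_OG])
    fix T assume T: "T \<subseteq> Kf" "K.indm OG T"
    have fT: "finite T" using T(2) by (simp add: K.indm_def)
    have "\<forall>t\<in>T. \<exists>k. g ^ k * t \<in> Oq" using Kf_pole[OF _ z Gw] T(1) unfolding g_def by (metis subsetD)
    then obtain kk where kk: "\<And>t. t \<in> T \<Longrightarrow> g ^ kk t * t \<in> Oq" by metis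
    \<comment> \<open>The sum makes one power of \<open>g\<close> serve all of \<open>T\<close>; the
      summand \<open>c\<close> brings the degree \<open>b * k\<close> into the range of
      \<open>hdim_Sb\<close>.\<close>
    define k where "k = c + (\<Sum>t\<in>T. kk t)"
    have kT: "g ^ k * t \<in> Oq" if "t \<in> T" for t
    proof -
      have "kk t \<le> k" using member_le_sum[of t T kk] fT that by (simp add: k_def)
      then have "g ^ k * t = g ^ (k - kk t) * (g ^ kk t * t)"
        by (simp add: mult.assoc[symmetric] power_add[symmetric])
      also have "\<dots> \<in> Oq" using kk[OF that] Ow_power[OF w(2) gO] Ow_mult[OF w(2)] by blast
      finally show ?thesis .
    qed
    define U where "U = (\<lambda>x. inverse (g ^ k) * x) ` Oq"
    have U: "K.subspace U" unfolding U_def by (rule Ow_ideal_subspace[OF w(2)])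
    have TU: "T \<subseteq> U"
    proof
      fix t assume "t \<in> T"
      then show "t \<in> U" unfolding U_def using kT[of t] g0 by (intro image_eqI[of _ _ "g ^ k * t"]) auto
    qed
    have OU: "Oq \<subseteq> U"
    proof
      fix x assume "x \<in> Oq"
      then have "g ^ k * x \<in> Oq" using Ow_mult[OF w(2) Ow_power[OF w(2) gO]] by blast
      then show "x \<in> U" unfolding U_def using g0 by (intro image_eqI[of _ _ "g ^ k * x"]) auto
    qed
    obtain m where m: "m \<le> c * (b * k)" "K.hdim Oq ((\<lambda>x. g ^ k * x) ` Oq) m"
    proof -
      have e: "g ^ k = Phi (G ^ k) / Phi (z ^ (b * k))"
        by (simp add: g_def Phi_power power_divide power_mult)
      show ?thesis unfolding e
        using hdim_Ow_le[OF w hom_power[OF G(1), of k] _ hom_power1[OF z(1)]] G(2) z(2) that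
        by (auto simp: Phi_power e)
    qed
    have UO: "K.hdim U Oq m"
    proof -
      have "K.hdim U ((\<lambda>x. inverse (g ^ k) * x) ` (\<lambda>x. g ^ k * x) ` Oq) m"
        unfolding U_def using m(2) hdim_scale[OF subspace_Ow[OF w(2)] Ow_ideal_subspace[OF w(2)], of "inverse (g ^ k)"] g0
        by simp
      then show ?thesis using g0 by (simp add: image_image mult.assoc[symmetric])
    qed
    define A where "A = (\<lambda>x. inverse (Phi G ^ k) * x) ` Sb (b * k)"
    have A: "K.subspace A" unfolding A_def by (rule subspace_scaled[OF subspace_Sb])
    have AG: "A \<subseteq> Gam"
      unfolding A_def Sb_def using Gam_GI[of k] by (auto simp: divide_inverse mult.commute)
    have AU: "A \<subseteq> U"
    proof
      fix x assume "x \<in> A"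
      then obtain P where P: "homogeneous (b * k) P" "x = inverse (Phi G ^ k) * Phi P" by (auto simp: A_def Sb_def)
      have "x = inverse (g ^ k) * (Phi P / Phi (z ^ (b * k)))"
        using zn by (simp add: P(2) g_def Phi_power power_divide power_mult field_simps)
      moreover have "Phi P / Phi (z ^ (b * k)) \<in> Oq"
        using OwI[OF P(1) hom_power1[OF z(1)], of w] z(2) by simp
      ultimately show "x \<in> U" unfolding U_def by (rule image_eqI)
    qed
    define XX where "XX = {p + r |p r. p \<in> Oq \<and> r \<in> A}"
    have XX: "K.subspace XX" unfolding XX_def by (rule K.subspace_set_plus[OF subspace_Ow[OF w(2)] A])
    have XU: "XX \<subseteq> U" unfolding XX_def using OU AU K.subspace_add[OF U] by blast
    have OX: "Oq \<subseteq> XX"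
    proof
      fix x assume "x \<in> Oq"
      then show "x \<in> XX" unfolding XX_def using K.subspace_0[OF A] by force
    qed
    have XOG: "XX \<subseteq> OG" unfolding XX_def OG_def using AG by blast
    obtain a1 a2 where a12: "K.hdim U XX a1" "K.hdim XX Oq a2" "m = a1 + a2"
      using K.hdim_split[OF U XX subspace_Ow[OF w(2)] OX XU UO] .
    have AO: "K.subspace (A \<inter> Oq)" using K.subspace_inter[OF A subspace_Ow[OF w(2)]] .
    have tr: "K.hdim A (A \<inter> Oq) a2 \<longleftrightarrow> K.hdim XX Oq a2"
    proof (rule KK.hdim_transfer[OF A AO subspace_Ow[OF w(2)], where f = "\<lambda>x. x"])
      show "x \<in> XX" if "x \<in> A" for x
        unfolding XX_def using that Ow_0[OF w(2)] by (intro CollectI exI[of _ 0] exI[of _ x]) simp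
      show "\<exists>x\<in>A. y - x \<in> Oq" if "y \<in> XX" for y
        using that unfolding XX_def by (auto intro!: bexI)
    qed auto
    \<comment> \<open>A function in the intersection is regular at every point, hence
      constant.\<close>
    have "\<exists>a3\<le>card {1 :: 'k}. K.hdim (A \<inter> Oq) {0} a3"
    proof (rule K.hdim_exists_span[OF K.subspace_single_0])
      fix x assume "x \<in> A \<inter> Oq"
      then obtain a where "x = Phi (tconst a)" using regular_const AG by blast
      then have "x - (\<Sum>s\<in>{1 :: 'k}. Phi (tconst a) * s) \<in> {0}" by simp
      then show "K.spnm {0} {1} x" by (rule K.spnmI)
    qed simp
    then obtain a3 where a3: "a3 \<le> 1" "K.hdim (A \<inter> Oq) {0} a3" by auto
    have hA: "K.hdim A {0} (a2 + a3)"
      using K.hdim_add[OF A AO K.subspace_single_0 _ _ _ a3(2)] tr a12(2) K.subspace_0[OF AO] by auto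
    have ck: "c \<le> b * k" using G(3) by (cases b) (auto simp: k_def)
    obtain n where n: "K.hdim (Sb (b * k)) {0} n" "2 * n + c * c = c * (2 * (b * k) + 3)"
      using hdim_Sb[OF ck] by blast
    have "K.hdim A {0} n"
      unfolding A_def using hdim_scale[OF subspace_Sb K.subspace_single_0, of "inverse (Phi G ^ k)"] n(1) G(2) by simp
    then have na: "n = a2 + a3" using K.hdim_unique[OF K.subspace_single_0 hA] by simp
    \<comment> \<open>The count gives \<open>a1 \<le> (c - 1) * (c - 2) / 2\<close>, the genus of a
      plane curve of degree \<open>c\<close>; the cruder bound \<open>c * c\<close> suffices for
      finiteness.\<close>
    have "card T \<le> a1"
      using K.hdim_bound[OF XX a12(1) TU K.indm_mono[OF T(2) XOG]] .
    moreover have "2 * a1 + 2 * a2 \<le> c * (2 * (b * k))" using a12(3) m(1) by simp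
    moreover have "2 * a2 + 2 + c * c \<ge> c * (2 * (b * k)) + 3 * c" using n(2) na a3(1) by (simp add: algebra_simps)
    ultimately show "card T \<le> c * c" using c2 by simp
  qed
  then show ?thesis using that by blast
qed

subsection \<open>The integral closure of the local ring\<close>

text \<open>Almost integral elements; since \<open>Oq\<close> modulo a nonzero ideal is finite-dimensional, these are
  the elements integral over \<open>Oq\<close>.\<close>

definition AA :: "'k set" where
  "AA = {u \<in> Kf. \<exists>s\<in>Oq. s \<noteq> 0 \<and> (\<forall>i. s * u ^ i \<in> Oq)}"

lemma O_sub_AA: "Oq \<subseteq> AA"
  unfolding AA_def using Ow_sub_Kf[OF w(2)] Ow_1[OF w(2)] Ow_power[OF w(2)] by (auto intro!: bexI[of _ 1])

lemma AA_mult: assumes "u \<in> AA" "v \<in> AA" shows "u * v \<in> AA"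
proof -
  obtain s t where st: "u \<in> Kf" "v \<in> Kf" "s \<in> Oq" "s \<noteq> 0" "\<And>i. s * u ^ i \<in> Oq" "t \<in> Oq" "t \<noteq> 0" "\<And>i. t * v ^ i \<in> Oq"
    using assms unfolding AA_def by blast
  have e: "(s * t) * (u * v) ^ i = (s * u ^ i) * (t * v ^ i)" for i
    by (simp add: power_mult_distrib ac_simps)
  have "\<forall>i. (s * t) * (u * v) ^ i \<in> Oq" unfolding e using Ow_mult[OF w(2)] st by blast
  moreover have "s * t \<in> Oq" "s * t \<noteq> 0" "u * v \<in> Kf" using Ow_mult[OF w(2)] Kf_mult st by simp_all
  ultimately show ?thesis unfolding AA_def by blast
qed

lemma AA_add: assumes "u \<in> AA" "v \<in> AA" shows "u + v \<in> AA"
proof -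
  obtain s t where st: "u \<in> Kf" "v \<in> Kf" "s \<in> Oq" "s \<noteq> 0" "\<And>i. s * u ^ i \<in> Oq" "t \<in> Oq" "t \<noteq> 0" "\<And>i. t * v ^ i \<in> Oq"
    using assms unfolding AA_def by blast
  have "(s * t) * (u + v) ^ n \<in> Oq" for n
  proof -
    have "(s * t) * (u + v) ^ n = (\<Sum>k\<le>n. Phi (tconst (of_nat (n choose k))) * ((s * u ^ k) * (t * v ^ (n - k))))"
      unfolding binomial_ring sum_distrib_left
    proof (rule sum.cong[OF refl])
      fix k
      have "Phi (tconst (of_nat j)) = of_nat j" for j
        by (induction j) (auto simp: tconst_add Phi_simps)
      then show "s * t * (of_nat (n choose k) * u ^ k * v ^ (n - k)) =
        Phi (tconst (of_nat (n choose k))) * ((s * u ^ k) * (t * v ^ (n - k)))" by (simp add: ac_simps)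
    qed
    also have "\<dots> \<in> Oq" by (intro Ow_sum[OF w(2)] Ow_mult[OF w(2)] Ow_const[OF w(2)] st)
    finally show ?thesis .
  qed
  moreover have "s * t \<in> Oq" using Ow_mult[OF w(2)] st by blast
  ultimately show ?thesis unfolding AA_def using st Kf_add by (auto intro!: bexI[of _ "s * t"])
qed

lemma AA_const: "Phi (tconst a) \<in> AA"
  using O_sub_AA Ow_const[OF w(2)] by blast

lemma AA_0: "0 \<in> AA" and AA_1: "1 \<in> AA"
  using AA_const[of 0] AA_const[of 1] by (simp_all add: Phi_simps)

lemma AA_uminus: "x \<in> AA \<Longrightarrow> - x \<in> AA"
  using AA_mult[OF AA_const[of "-1"], of x] by (simp add: tconst_minus Phi_simps)

lemma AA_diff: "x \<in> AA \<Longrightarrow> y \<in> AA \<Longrightarrow> x - y \<in> AA"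
  using AA_add[of x "- y"] AA_uminus by simp

lemma AA_power: "x \<in> AA \<Longrightarrow> x ^ n \<in> AA"
  by (induction n) (auto intro: AA_mult AA_1)

lemma AA_sub_Kf: "AA \<subseteq> Kf"
  by (auto simp: AA_def)

lemma subspace_AA: "K.subspace AA"
  unfolding K.subspace_def using AA_0 AA_add AA_mult[OF AA_const] by blast

text \<open>The elements \<open>s * u ^ i\<close> are dependent modulo \<open>s\<close>. Cancelling
  \<open>s\<close> and normalizing the highest coefficient gives an integral equation in which all
  coefficients but the last are constants.\<close>

lemma AA_relation:
  assumes u: "u \<in> AA"
  obtains n a h where "n \<ge> 1" "h \<in> Oq" "u ^ n = (\<Sum>i\<in>{1..<n}. Phi (tconst (a i)) * u ^ i) + h"
proof -
  obtain s where s: "s \<in> Oq" "s \<noteq> 0" "\<And>i. s * u ^ i \<in> Oq" using u unfolding AA_def by blast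
  obtain D where D: "K.hdim Oq ((\<lambda>x. s * x) ` Oq) D" using hdim_Ow_ex[OF w s(1,2)] .
  obtain a i where a: "i \<in> {1..D + 1}" "a i \<noteq> 0"
    "(\<Sum>i\<in>{1..D + 1}. Phi (tconst (a i)) * (s * u ^ i)) \<in> (\<lambda>x. s * x) ` Oq"
    by (rule K.dependent_family[OF Ow_ideal_subspace[OF w(2)] D, of "{1..D + 1}" "\<lambda>i. s * u ^ i"])
      (use s in auto)
  then obtain h where h: "h \<in> Oq" "(\<Sum>i\<in>{1..D + 1}. Phi (tconst (a i)) * (s * u ^ i)) = s * h" by blast
  have "(\<Sum>i\<in>{1..D + 1}. Phi (tconst (a i)) * (s * u ^ i)) = s * (\<Sum>i\<in>{1..D + 1}. Phi (tconst (a i)) * u ^ i)"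
    unfolding sum_distrib_left by (intro sum.cong refl) (simp only: ac_simps)
  then have rel: "(\<Sum>i\<in>{1..D + 1}. Phi (tconst (a i)) * u ^ i) = h" using h(2) s(2) by simp
  define n where "n = Max {i \<in> {1..D + 1}. a i \<noteq> 0}"
  have fin: "finite {i \<in> {1..D + 1}. a i \<noteq> 0}" by simp
  have nin: "n \<in> {i \<in> {1..D + 1}. a i \<noteq> 0}" unfolding n_def using a by (intro Max_in) auto
  have big: "a j = 0" if "j \<in> {1..D + 1}" "n < j" for j
    using Max_ge[OF fin, of j] that unfolding n_def by fastforce
  have "h = (\<Sum>i\<in>{1..n}. Phi (tconst (a i)) * u ^ i)"
    unfolding rel[symmetric] using nin big by (intro sum.mono_neutral_right) (auto simp: Phi_0 not_le)
  also have "{1..n} = insert n {1..<n}" using nin by auto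
  also have "(\<Sum>i\<in>insert n {1..<n}. Phi (tconst (a i)) * u ^ i) =
      Phi (tconst (a n)) * u ^ n + (\<Sum>i\<in>{1..<n}. Phi (tconst (a i)) * u ^ i)" by simp
  finally have hn: "h = Phi (tconst (a n)) * u ^ n + (\<Sum>i\<in>{1..<n}. Phi (tconst (a i)) * u ^ i)" .
  have inv: "Phi (tconst (1 / a n)) * Phi (tconst (a n)) = 1"
    using nin by (simp add: Phi_mult[symmetric] tconst_mult[symmetric] Phi_1)
  have "u ^ n = Phi (tconst (1 / a n)) * Phi (tconst (a n)) * u ^ n" by (simp only: inv mult_1_left)
  also have "\<dots> = Phi (tconst (1 / a n)) * (h - (\<Sum>i\<in>{1..<n}. Phi (tconst (a i)) * u ^ i))"
    by (simp add: hn mult.assoc)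
  also have "\<dots> = (\<Sum>i\<in>{1..<n}. Phi (tconst (- 1 / a n * a i)) * u ^ i) + Phi (tconst (1 / a n)) * h"
    by (simp add: right_diff_distrib sum_distrib_left tconst_mult Phi_mult mult.assoc tconst_minus Phi_uminus sum_negf)
  finally have "u ^ n = (\<Sum>i\<in>{1..<n}. Phi (tconst (- 1 / a n * a i)) * u ^ i) + Phi (tconst (1 / a n)) * h" .
  moreover have "Phi (tconst (1 / a n)) * h \<in> Oq" using Ow_mult[OF w(2) Ow_const[OF w(2)] h(1)] .
  ultimately show ?thesis using that[of n _ "\<lambda>i. - 1 / a n * a i"] nin by auto
qed

text \<open>In the special relation, \<open>h\<close> is a polynomial in \<open>u\<close> and so
  also regular away from \<open>w\<close>, hence constant; then \<open>u\<close> is algebraic over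
  the constants. This says that the partial normalization has only constant global
  functions.\<close>

lemma AA_Gam_const:
  assumes "u \<in> AA" "u \<in> Gam"
  shows "\<exists>a. u = Phi (tconst a)"
proof -
  obtain n a h where n: "n \<ge> 1" "h \<in> Oq" "u ^ n = (\<Sum>i\<in>{1..<n}. Phi (tconst (a i)) * u ^ i) + h"
    using AA_relation[OF assms(1)] .
  have "h = u ^ n - (\<Sum>i\<in>{1..<n}. Phi (tconst (a i)) * u ^ i)" using n(3) by simp
  also have "\<dots> \<in> Gam" by (intro Gam_diff Gam_power Gam_sum Gam_mult Gam_const assms)
  finally obtain a0 where a0: "h = Phi (tconst a0)" using regular_const n(2) by blast
  define c' where "c' = (\<lambda>i. if i = n then 1 else if i = 0 then - a0 else - a i)"
  define p where "p = (\<Sum>i\<le>n. Polynomial.monom (c' i) i)"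
  have "poly.coeff p n = 1" by (simp add: p_def coeff_sum c'_def)
  then have "p \<noteq> 0" by auto
  moreover have "peval p u = 0"
  proof -
    have "{..n} = insert n (insert 0 {1..<n})" using n(1) by auto
    then have "peval p u = u ^ n - h - (\<Sum>i\<in>{1..<n}. Phi (tconst (a i)) * u ^ i)"
      using n(1) unfolding p_def peval_sum
      by (simp add: c'_def a0 Phi_1 tconst_minus Phi_uminus sum_negf)
    then show ?thesis using n(3) by simp
  qed
  ultimately show ?thesis by (rule algebraic_const)
qed

definition AG :: "'k set" where "AG = {x + y |x y. x \<in> AA \<and> y \<in> Gam}"

lemma subspace_AG: "K.subspace AG"
  unfolding AG_def by (rule K.subspace_set_plus[OF subspace_AA subspace_Gam])

text \<open>\<open>AG\<close> modulo \<open>OG\<close> is \<open>AA\<close> modulo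
  \<open>Oq\<close>, since \<open>AA \<inter> Gam\<close> consists of constants and these lie in
  \<open>Oq\<close>. Finiteness of \<open>AA\<close> modulo \<open>Oq\<close> comes with it.\<close>

lemma h1_difference:
  assumes Gw: "teval G w = 0"
  obtains n a \<delta> where "K.hdim Kf OG n" "K.hdim Kf AG a" "K.hdim AA Oq \<delta>" "n = a + \<delta>"
proof -
  obtain n where n: "K.hdim Kf OG n" using hdim_Kf_OG[OF Gw] .
  have sub: "OG \<subseteq> AG" "AG \<subseteq> Kf"
    using O_sub_AA AA_sub_Kf Kf_add unfolding OG_def AG_def Gam_def by blast+
  obtain a \<delta> where ad: "K.hdim Kf AG a" "K.hdim AG OG \<delta>" "n = a + \<delta>"
    using K.hdim_split[OF subspace_Kf subspace_AG subspace_OG sub n] .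
  have "K.hdim AA Oq \<delta> \<longleftrightarrow> K.hdim AG OG \<delta>"
  proof (rule KK.hdim_transfer[OF subspace_AA subspace_Ow[OF w(2)] subspace_OG, where f = "\<lambda>x. x"])
    show "x \<in> AG" if "x \<in> AA" for x unfolding AG_def using that Gam_0 by force
    show "\<exists>x\<in>AA. y - x \<in> OG" if yA: "y \<in> AG" for y
    proof -
      obtain x g where "x \<in> AA" "g \<in> Gam" "y = x + g" using yA unfolding AG_def by blast
      moreover from this have "y - x \<in> OG" unfolding OG_def using Ow_0[OF w(2)] by force
      ultimately show ?thesis by blast
    qed
    show "x \<in> OG \<longleftrightarrow> x \<in> Oq" if "x \<in> AA" for x
    proof
      assume "x \<in> OG"
      then obtain y g where y: "y \<in> Oq" "g \<in> Gam" "x = y + g" unfolding OG_def by blast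
      have "g = x - y" using y by simp
      then have "g \<in> AA" using AA_diff[OF that] y(1) O_sub_AA by blast
      then obtain a where "g = Phi (tconst a)" using AA_Gam_const y(2) by blast
      then show "x \<in> Oq" using y Ow_add[OF w(2) _ Ow_const[OF w(2)]] by blast
    next
      assume "x \<in> Oq"
      then show "x \<in> OG" unfolding OG_def using Gam_0 by force
    qed
  qed auto
  then show ?thesis using that n ad by blast
qed

end

section \<open>The unibranch case\<close>

locale curve_pointed = curve_point F c Phi w G b
  for F :: tpoly and c :: nat and Phi :: "tpoly \<Rightarrow> 'k :: field" and w :: "complex ^ 3" and G :: tpoly and b :: nat +
  assumes Gw: "teval G w = 0"
begin

lemma subspace_sAA: "K.subspace ((\<lambda>x. s * x) ` AA)"
  by (rule subspace_scaled[OF subspace_AA])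

lemma sAA_sub: "s \<in> AA \<Longrightarrow> (\<lambda>x. s * x) ` AA \<subseteq> AA"
  using AA_mult by blast

lemma hdim_AA_Oq: obtains \<delta> where "K.hdim AA Oq \<delta>"
  using h1_difference[OF Gw] by blast

text \<open>\<open>AA\<close> modulo \<open>s * Oq\<close> is measured through \<open>Oq\<close> and
  through \<open>s * AA\<close>. The steps from \<open>AA\<close> to \<open>Oq\<close> and from
  \<open>s * AA\<close> to \<open>s * Oq\<close> have the same finite dimension and cancel.\<close>

lemma hdim_AA_of_Oq:
  assumes s: "s \<in> Oq" "s \<noteq> 0" and n: "K.hdim Oq ((\<lambda>x. s * x) ` Oq) n"
  shows "K.hdim AA ((\<lambda>x. s * x) ` AA) n"
proof -
  obtain \<delta> where d: "K.hdim AA Oq \<delta>" by (rule hdim_AA_Oq)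
  let ?sO = "(\<lambda>x. s * x) ` Oq" and ?sA = "(\<lambda>x. s * x) ` AA"
  note sub = subspace_AA subspace_Ow[OF w(2)] Ow_ideal_subspace[OF w(2), of s] subspace_sAA[of s]
  have i1: "?sO \<subseteq> Oq" using Ow_mult[OF w(2) s(1)] by blast
  have i2: "?sO \<subseteq> ?sA" using O_sub_AA by blast
  have sA: "s \<in> AA" using s O_sub_AA by blast
  have tot: "K.hdim AA ?sO (\<delta> + n)" by (rule K.hdim_add[OF sub(1,2,3) i1 O_sub_AA d n])
  obtain a e where ae: "K.hdim AA ?sA a" "K.hdim ?sA ?sO e" "\<delta> + n = a + e"
    using K.hdim_split[OF sub(1,4,3) i2 sAA_sub[OF sA] tot] .
  have "K.hdim ?sA ?sO \<delta>" using hdim_scale[OF sub(1,2) s(2)] d by simp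
  then have "e = \<delta>" using K.hdim_unique[OF sub(3) ae(2)] by simp
  then show ?thesis using ae by simp
qed

lemma hdim_AA_ex:
  assumes s: "s \<in> AA" "s \<noteq> 0"
  obtains n where "K.hdim AA ((\<lambda>x. s * x) ` AA) n"
proof -
  obtain r where r: "r \<in> Oq" "r \<noteq> 0" "\<And>i. r * s ^ i \<in> Oq" using s(1) unfolding AA_def by blast
  have rs: "r * s \<in> Oq" "r * s \<noteq> 0" using r(3)[of 1] r(2) s(2) by simp_all
  obtain n where n: "K.hdim Oq ((\<lambda>x. r * s * x) ` Oq) n" using hdim_Ow_ex[OF w rs] .
  have n': "K.hdim AA ((\<lambda>x. r * s * x) ` AA) n" by (rule hdim_AA_of_Oq[OF rs n])
  have "(\<lambda>x. r * s * x) ` AA \<subseteq> (\<lambda>x. s * x) ` AA"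
  proof
    fix y assume "y \<in> (\<lambda>x. r * s * x) ` AA"
    then obtain x where "x \<in> AA" "y = s * (r * x)" by (auto simp: ac_simps)
    then show "y \<in> (\<lambda>x. s * x) ` AA" using AA_mult r(1) O_sub_AA by blast
  qed
  then show ?thesis
    using K.hdim_split[OF subspace_AA subspace_sAA subspace_sAA _ sAA_sub[OF s(1)] n'] that by blast
qed

end

text \<open>The assumption is the usual criterion for \<open>AA\<close> to be a local ring, in a
  form that mentions no ideals.\<close>

locale curve_unibranch = curve_pointed F c Phi w G b
  for F :: tpoly and c :: nat and Phi :: "tpoly \<Rightarrow> 'k :: field" and w :: "complex ^ 3" and G :: tpoly and b :: nat +
  assumes local_AA: "\<And>a. a \<in> AA \<Longrightarrow> (a \<noteq> 0 \<and> inverse a \<in> AA) \<or> (1 - a \<noteq> 0 \<and> inverse (1 - a) \<in> AA)"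
begin

definition unitA :: "'k \<Rightarrow> bool" where
  "unitA a \<longleftrightarrow> a \<in> AA \<and> a \<noteq> 0 \<and> inverse a \<in> AA"

lemma unitA_mult: "unitA a \<Longrightarrow> unitA e \<Longrightarrow> unitA (a * e)"
  unfolding unitA_def using AA_mult by (simp add: inverse_mult_distrib)

lemma unitA_power: "unitA e \<Longrightarrow> unitA (e ^ l)"
proof (induction l)
  case 0
  then show ?case by (simp add: unitA_def AA_1)
qed (simp add: unitA_mult)

lemma unitA_factor: assumes "a \<in> AA" "e \<in> AA" "unitA (a * e)" shows "unitA a"
proof -
  have "inverse a = e * inverse (a * e)" "a \<noteq> 0" using assms(3) by (auto simp: unitA_def field_simps)
  then show ?thesis using assms AA_mult unfolding unitA_def by metis
qed

lemma nonunit_1_minus: "a \<in> AA \<Longrightarrow> \<not> unitA a \<Longrightarrow> unitA (1 - a)"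
  using local_AA[of a] AA_diff[OF AA_1] unfolding unitA_def by blast

lemma unitA_plus_nonunit:
  assumes "unitA e" "a \<in> AA" "\<not> unitA a"
  shows "unitA (e + a)"
proof -
  have i: "unitA (inverse e)" "e \<in> AA" "e \<noteq> 0" using assms(1) by (auto simp: unitA_def)
  have "\<not> unitA (- (a * inverse e))"
  proof
    assume "unitA (- (a * inverse e))"
    then have "unitA (a * - inverse e)" by simp
    then have "unitA a" using unitA_factor[OF assms(2), of "- inverse e"] i AA_uminus by (auto simp: unitA_def)
    then show False using assms(3) by simp
  qed
  moreover have "- (a * inverse e) \<in> AA" using i assms(2) by (auto simp: unitA_def intro: AA_uminus AA_mult)
  ultimately have "unitA (1 - - (a * inverse e))" using nonunit_1_minus by blast
  then have "unitA (e * (1 - - (a * inverse e)))" using unitA_mult assms(1) by blast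
  moreover have "e * (1 - - (a * inverse e)) = e + a" using i(3) by (simp add: field_simps)
  ultimately show ?thesis by simp
qed

lemma unitA_image: "unitA e \<Longrightarrow> (\<lambda>x. s * e * x) ` AA = (\<lambda>x. s * x) ` AA"
proof (intro equalityI subsetI)
  assume e: "unitA e"
  fix y assume "y \<in> (\<lambda>x. s * x) ` AA"
  then obtain x where "x \<in> AA" "y = s * x" by blast
  then have "y = s * e * (inverse e * x)" "inverse e * x \<in> AA"
    using e AA_mult by (auto simp: unitA_def)
  then show "y \<in> (\<lambda>x. s * e * x) ` AA" by blast
next
  assume e: "unitA e"
  fix y assume "y \<in> (\<lambda>x. s * e * x) ` AA"
  then obtain x where "x \<in> AA" "y = s * (e * x)" by (auto simp: mult.assoc)
  then show "y \<in> (\<lambda>x. s * x) ` AA" using e AA_mult by (auto simp: unitA_def)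
qed

text \<open>Finitely many elements span \<open>AA\<close> modulo \<open>Oq\<close>, and the product
  of their denominators clears all of \<open>AA\<close>.\<close>

lemma conductor: obtains \<sigma> where "\<sigma> \<in> Oq" "\<sigma> \<noteq> 0" "\<forall>a\<in>AA. \<sigma> * a \<in> Oq"
proof -
  obtain \<delta> where d: "K.hdim AA Oq \<delta>" by (rule hdim_AA_Oq)
  then obtain S where S: "S \<subseteq> AA" "finite S" "\<forall>v\<in>AA. K.spnm Oq S v"
    unfolding K.hdim_def K.indm_def by blast
  have "\<forall>s\<in>S. \<exists>r\<in>Oq. r \<noteq> 0 \<and> r * s \<in> Oq"
  proof
    fix s assume "s \<in> S"
    then obtain r where "r \<in> Oq" "r \<noteq> 0" "\<forall>i. r * s ^ i \<in> Oq" using S(1) unfolding AA_def by blast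
    then show "\<exists>r\<in>Oq. r \<noteq> 0 \<and> r * s \<in> Oq" by (metis power_one_right)
  qed
  then obtain r where r: "\<And>s. s \<in> S \<Longrightarrow> r s \<in> Oq \<and> r s \<noteq> 0 \<and> r s * s \<in> Oq" by metis
  define \<sigma> where "\<sigma> = (\<Prod>s\<in>S. r s)"
  have prodO: "(\<Prod>s\<in>T. r s) \<in> Oq" if "T \<subseteq> S" for T
    using finite_subset[OF that S(2)] that
    by (induction T rule: finite_induct) (auto intro: Ow_1[OF w(2)] Ow_mult[OF w(2)] dest: r)
  have sS: "\<sigma> * s \<in> Oq" if "s \<in> S" for s
  proof -
    have "\<sigma> * s = (\<Prod>s\<in>S - {s}. r s) * (r s * s)"
      using S(2) that by (simp add: \<sigma>_def prod.remove[of S s])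
    also have "\<dots> \<in> Oq" by (rule Ow_mult[OF w(2)]) (use prodO[of "S - {s}"] r[OF that] in auto)
    finally show ?thesis .
  qed
  show ?thesis
  proof (rule that)
    show sO: "\<sigma> \<in> Oq" and "\<sigma> \<noteq> 0" using prodO[of S] r S(2) by (auto simp: \<sigma>_def)
    show "\<forall>a\<in>AA. \<sigma> * a \<in> Oq"
    proof
    fix a assume "a \<in> AA"
    then obtain k where k: "a - (\<Sum>s\<in>S. Phi (tconst (k s)) * s) \<in> Oq" using S(3) by (auto simp: K.spnm_def)
    have "\<sigma> * a = \<sigma> * (a - (\<Sum>s\<in>S. Phi (tconst (k s)) * s)) + (\<Sum>s\<in>S. Phi (tconst (k s)) * (\<sigma> * s))"
      by (simp add: right_diff_distrib sum_distrib_left mult.left_commute)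
    also have "\<dots> \<in> Oq"
    proof (rule Ow_add[OF w(2)])
      show "\<sigma> * (a - (\<Sum>s\<in>S. Phi (tconst (k s)) * s)) \<in> Oq" by (rule Ow_mult[OF w(2) sO k])
      show "(\<Sum>s\<in>S. Phi (tconst (k s)) * (\<sigma> * s)) \<in> Oq"
        by (rule Ow_sum[OF w(2)], rule Ow_mult[OF w(2) Ow_const[OF w(2)]], rule sS)
    qed
    finally show "\<sigma> * a \<in> Oq" .
    qed
  qed
qed

text \<open>\<open>AA\<close> is completely integrally closed: multiplication by the conductor
  element moves the powers of \<open>u\<close> from \<open>AA\<close> back into
  \<open>Oq\<close>.\<close>

lemma power_bounded:
  assumes u: "u \<in> Kf" and t: "t \<noteq> 0" "\<And>i. t * u ^ i \<in> AA"
  shows "u \<in> AA"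
proof -
  obtain \<sigma> where s: "\<sigma> \<in> Oq" "\<sigma> \<noteq> 0" "\<forall>a\<in>AA. \<sigma> * a \<in> Oq" using conductor .
  have "t \<in> AA" using t(2)[of 0] by simp
  then have "\<sigma> * t \<in> Oq" using s by blast
  moreover have "\<sigma> * t * u ^ i \<in> Oq" for i using bspec[OF s(3) t(2)[of i]] by (simp add: mult.assoc)
  ultimately show ?thesis unfolding AA_def using u s(2) t(1) by (auto intro!: bexI[of _ "\<sigma> * t"])
qed

definition zf :: tpoly where
  "zf = (SOME z. homogeneous 1 z \<and> teval z w \<noteq> 0)"

lemma zf: "homogeneous 1 zf" "teval zf w \<noteq> 0"
proof -
  obtain x y z u v where fr: "frame x y z u v w" using frame_exists[OF w(1)] .
  then have "\<exists>z. homogeneous 1 z \<and> teval z w \<noteq> 0" using frameD[OF fr] by (intro exI[of _ z]) simp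
  then have "homogeneous 1 zf \<and> teval zf w \<noteq> 0" unfolding zf_def by (rule someI_ex)
  then show "homogeneous 1 zf" "teval zf w \<noteq> 0" by simp_all
qed

lemma unitA_iff_hdim0:
  assumes s: "s \<in> AA" and n: "K.hdim AA ((\<lambda>x. s * x) ` AA) n"
  shows "n = 0 \<longleftrightarrow> unitA s"
proof
  assume "n = 0"
  then have "AA \<subseteq> (\<lambda>x. s * x) ` AA" using n K.hdim_0_imp by blast
  then obtain x where x: "x \<in> AA" "1 = s * x" using AA_1 by blast
  then have "s \<noteq> 0" by auto
  then have "inverse s = x" using x(2) by (metis inverse_unique)
  then show "unitA s" unfolding unitA_def using s x \<open>s \<noteq> 0\<close> by simp
next
  assume "unitA s"
  then have "(\<lambda>x. s * x) ` AA = AA" using unitA_image[of s 1] by simp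
  then show "n = 0" using n K.hdim_self[OF subspace_AA] K.hdim_unique[OF subspace_AA] by metis
qed

text \<open>The classical argument for a one-dimensional normal local domain, with dimensions
  instead of chain conditions: find \<open>u\<close> outside \<open>AA\<close> that multiplies every
  nonunit into \<open>AA\<close>. It cannot send all nonunits to nonunits, so it sends one to a
  unit, and \<open>inverse u\<close> generates the nonunits.\<close>

lemma uniformizer:
  obtains t where "t \<in> AA" "t \<noteq> 0" "\<not> unitA t" "\<And>m. m \<in> AA \<Longrightarrow> \<not> unitA m \<Longrightarrow> \<exists>y\<in>AA. m = t * y"
proof -
  define s where "s = Phi G / Phi zf ^ b"
  have zn: "Phi zf \<noteq> 0" using Phi_nz[OF w(2) zf(2)] .
  have sO: "s \<in> Oq" "s \<noteq> 0" unfolding s_def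
    using OwI[OF G(1) hom_power1[OF zf(1)], of w] zf(2) zn G(2) by (auto simp: Phi_power)
  have sA: "s \<in> AA" using sO O_sub_AA by blast
  obtain N where N: "K.hdim Oq ((\<lambda>x. s * x) ` Oq) N" using hdim_Ow_ex[OF w sO] .
  have "c * b \<le> N" using hdim_O_ge[OF zf] N by (simp add: s_def)
  then have N0: "N \<noteq> 0" using mult_le_mono[OF c2 G(3)] by linarith
  have NA: "K.hdim AA ((\<lambda>x. s * x) ` AA) N" by (rule hdim_AA_of_Oq[OF sO N])
  have snu: "\<not> unitA s" using unitA_iff_hdim0[OF sA NA] N0 by simp
  let ?sA = "(\<lambda>x. s * x) ` AA"
  let ?J = "\<lambda>a. {x + y |x y. x \<in> (\<lambda>x. a * x) ` AA \<and> y \<in> ?sA}"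
  have J: "K.subspace (?J a)" for a by (rule K.subspace_set_plus[OF subspace_sAA subspace_sAA])
  have JA: "?J a \<subseteq> AA" if "a \<in> AA" for a using that sA AA_mult AA_add by blast
  have sJ: "?sA \<subseteq> ?J a" for a
  proof
    fix y assume "y \<in> ?sA"
    moreover have "0 \<in> (\<lambda>x. a * x) ` AA" using K.subspace_0[OF subspace_sAA] .
    ultimately show "y \<in> ?J a" by (intro CollectI exI[of _ 0] exI[of _ y]) simp
  qed
  have ex: "\<exists>e. K.hdim (?J a) ?sA e" if "a \<in> AA" for a
    using K.hdim_split[OF subspace_AA J subspace_sAA sJ JA[OF that] NA] by blast
  \<comment> \<open>An element \<open>a\<close> outside \<open>s * AA\<close> for which
    \<open>a * AA + s * AA\<close> is as small as possible modulo \<open>s * AA\<close> generates a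
    simple submodule there, which every nonunit annihilates.\<close>
  let ?P = "\<lambda>e. \<exists>a\<in>AA. a \<notin> ?sA \<and> K.hdim (?J a) ?sA e"
  have one: "1 \<notin> ?sA"
  proof
    assume "1 \<in> ?sA"
    then obtain x where x: "x \<in> AA" "1 = s * x" by blast
    then have "inverse s = x" using sO by (metis inverse_unique)
    then show False using snu x sA sO by (simp add: unitA_def)
  qed
  have "\<exists>e. ?P e" using one ex[OF AA_1] AA_1 by blast
  then have P: "?P (LEAST e. ?P e)" by (rule LeastI_ex)
  define e where "e = (LEAST e. ?P e)"
  obtain a where a: "a \<in> AA" "a \<notin> ?sA" "K.hdim (?J a) ?sA e" using P unfolding e_def by blast
  have min: "e \<le> e'" if "?P e'" for e' unfolding e_def using that by (rule Least_le)
  have soc: "r * a \<in> ?sA" if r: "r \<in> AA" "\<not> unitA r" for r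
  proof (rule ccontr)
    assume ra: "r * a \<notin> ?sA"
    have raA: "r * a \<in> AA" using AA_mult r a by blast
    have sub: "?J (r * a) \<subseteq> ?J a"
    proof
      fix x assume "x \<in> ?J (r * a)"
      then obtain p' z where pz: "p' \<in> (\<lambda>x. r * a * x) ` AA" "z \<in> ?sA" "x = p' + z"
        by (elim CollectE exE conjE)
      obtain y where y: "p' = r * a * y" "y \<in> AA" using pz(1) by (rule imageE)
      have yz: "y \<in> AA" "z \<in> ?sA" "x = r * a * y + z" using y pz(2,3) by simp_all
      have "r * a * y = a * (r * y)" by (simp add: ac_simps)
      then have "r * a * y \<in> (\<lambda>x. a * x) ` AA" using AA_mult[OF r(1) yz(1)] by (rule image_eqI)
      then show "x \<in> ?J a" using yz(2,3) by (intro CollectI exI conjI)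
    qed
    obtain p q where pq: "K.hdim (?J a) (?J (r * a)) p" "K.hdim (?J (r * a)) ?sA q" "e = p + q"
      using K.hdim_split[OF J J subspace_sAA sJ sub a(3)] .
    have "e \<le> q" using min[of q] raA ra pq(2) by blast
    then have "p = 0" using pq(3) by simp
    then have "?J a \<subseteq> ?J (r * a)" using pq(1) K.hdim_0_imp by blast
    moreover have "a \<in> ?J a"
    proof (intro CollectI exI conjI)
      show "a = a + 0" by simp
      show "a \<in> (\<lambda>x. a * x) ` AA" using AA_1 by (intro image_eqI[of _ _ 1]) simp_all
      show "0 \<in> ?sA" by (rule K.subspace_0[OF subspace_sAA])
    qed
    ultimately have "a \<in> ?J (r * a)" by (rule subsetD)
    then obtain p' q' where pq': "p' \<in> (\<lambda>x. r * a * x) ` AA" "q' \<in> ?sA" "a = p' + q'"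
      by (elim CollectE exE conjE)
    obtain y where y: "p' = r * a * y" "y \<in> AA" using pq'(1) by (rule imageE)
    obtain z where z: "q' = s * z" "z \<in> AA" using pq'(2) by (rule imageE)
    have yz: "y \<in> AA" "z \<in> AA" "a = r * a * y + s * z" using y z pq'(3) by simp_all
    \<comment> \<open>Nakayama's argument: \<open>a * (1 - r * y)\<close> is a multiple of
      \<open>s\<close>, and \<open>1 - r * y\<close> is a unit.\<close>
    have "\<not> unitA (r * y)" using unitA_factor[OF r(1) yz(1)] r(2) by blast
    then have un: "unitA (1 - r * y)" using nonunit_1_minus AA_mult r yz by blast
    have "a * (1 - r * y) = s * z" using yz(3) by (simp add: algebra_simps)
    then have "a = s * z / (1 - r * y)" using un unfolding unitA_def by (subst eq_divide_eq) auto
    then have "a = s * (z * inverse (1 - r * y))" by (simp only: divide_inverse mult.assoc)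
    moreover have "z * inverse (1 - r * y) \<in> AA" using un yz(2) AA_mult by (simp add: unitA_def)
    ultimately have "a \<in> ?sA" by (rule image_eqI)
    then show False using a(2) by contradiction
  qed
  define u where "u = a / s"
  have uK: "u \<in> Kf" unfolding u_def using a(1) sA AA_sub_Kf Kf_divide by blast
  have unA: "u \<notin> AA"
  proof
    assume "u \<in> AA"
    then have "a \<in> ?sA" using sO(2) by (auto simp: u_def intro!: image_eqI[of _ _ "a / s"])
    then show False using a by simp
  qed
  have um: "u * r \<in> AA" if rA: "r \<in> AA" "\<not> unitA r" for r
  proof -
    obtain y where "y \<in> AA" "r * a = s * y" using soc[OF rA] by blast
    then have "u * r = y" using sO(2) by (simp add: u_def field_simps)
    then show ?thesis using \<open>y \<in> AA\<close> by simp
  qed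
  \<comment> \<open>Otherwise all \<open>s * u ^ i\<close> would remain in \<open>AA\<close>, and
    \<open>power_bounded\<close> would put \<open>u\<close> into \<open>AA\<close>.\<close>
  have "\<exists>r. r \<in> AA \<and> \<not> unitA r \<and> unitA (u * r)"
  proof (rule ccontr)
    assume n: "\<nexists>r. r \<in> AA \<and> \<not> unitA r \<and> unitA (u * r)"
    have "s * u ^ i \<in> AA \<and> \<not> unitA (s * u ^ i)" for i
    proof (induction i)
      case 0
      then show ?case using sA snu by simp
    next
      case (Suc i)
      have "s * u ^ Suc i = u * (s * u ^ i)" by (simp add: ac_simps)
      then show ?case using um n Suc by metis
    qed
    then have "u \<in> AA" using power_bounded[OF uK sO(2)] by blast
    then show False using unA by blast
  qed
  then obtain r where r: "r \<in> AA" "\<not> unitA r" "unitA (u * r)" by blast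
  define t where "t = r * inverse (u * r)"
  have u0: "u \<noteq> 0" "r \<noteq> 0" using r(3) by (auto simp: unitA_def)
  have tu: "t * u = 1" using u0 by (simp add: t_def field_simps)
  have tA: "t \<in> AA" using r AA_mult by (auto simp: t_def unitA_def)
  show ?thesis
  proof (rule that[OF tA])
    show "t \<noteq> 0" using tu by auto
    show "\<not> unitA t"
    proof
      assume "unitA t"
      then have "inverse t \<in> AA" by (simp add: unitA_def)
      moreover have "inverse t = u" using tu by (metis inverse_unique)
      ultimately show False using unA by simp
    qed
    fix m assume m: "m \<in> AA" "\<not> unitA m"
    have "m = t * (u * m)" using tu by (simp add: mult.assoc[symmetric])
    then show "\<exists>y\<in>AA. m = t * y" using um[OF m] by blast
  qed
qed

text \<open>Induction on the dimension of \<open>AA\<close> modulo \<open>a\<close>, which drops by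
  \<open>f\<close> with each factor \<open>t\<close> split off. Here \<open>f\<close> is the
  dimension of the residue field; its value does not enter later comparisons.\<close>

lemma valuation:
  obtains t f where "t \<in> AA" "t \<noteq> 0" "\<not> unitA t" "f > 0"
    "\<forall>a\<in>AA. a \<noteq> 0 \<longrightarrow> (\<exists>k e. unitA e \<and> a = t ^ k * e)"
    "\<forall>k e. unitA e \<longrightarrow> K.hdim AA ((\<lambda>x. t ^ k * e * x) ` AA) (k * f)"
proof -
  obtain t where t: "t \<in> AA" "t \<noteq> 0" "\<not> unitA t" "\<And>m. m \<in> AA \<Longrightarrow> \<not> unitA m \<Longrightarrow> \<exists>y\<in>AA. m = t * y"
    using uniformizer by blast
  obtain f where f: "K.hdim AA ((\<lambda>x. t * x) ` AA) f" using hdim_AA_ex[OF t(1,2)] .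
  have f0: "f > 0" using unitA_iff_hdim0[OF t(1) f] t(3) by simp
  have step: "K.hdim AA ((\<lambda>x. a * t * x) ` AA) (n + f)"
    if a: "a \<in> AA" "a \<noteq> 0" and n: "K.hdim AA ((\<lambda>x. a * x) ` AA) n" for a n
  proof -
    have "(\<lambda>x. a * x) ` (\<lambda>x. t * x) ` AA = (\<lambda>x. a * t * x) ` AA" by (simp add: image_image mult.assoc)
    then have "K.hdim ((\<lambda>x. a * x) ` AA) ((\<lambda>x. a * t * x) ` AA) f"
      using hdim_scale[OF subspace_AA subspace_sAA a(2)] f by metis
    moreover have "(\<lambda>x. a * t * x) ` AA \<subseteq> (\<lambda>x. a * x) ` AA"
      using AA_mult[OF t(1)] by (auto simp: mult.assoc)
    ultimately show ?thesis
      using K.hdim_add[OF subspace_AA subspace_sAA subspace_sAA _ sAA_sub[OF a(1)] n] by blast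
  qed
  show ?thesis
  proof (rule that[OF t(1,2,3) f0]; intro ballI allI impI)
    fix a assume a: "a \<in> AA" "a \<noteq> 0"
    obtain n where "K.hdim AA ((\<lambda>x. a * x) ` AA) n" using hdim_AA_ex[OF a] .
    then show "\<exists>k e. unitA e \<and> a = t ^ k * e"
      using a
    proof (induction n arbitrary: a rule: less_induct)
      case (less n)
      show ?case
      proof (cases "unitA a")
        case True
        then show ?thesis by (intro exI[of _ 0] exI[of _ a]) simp
      next
        case False
        then obtain y where y: "y \<in> AA" "a = t * y" using t(4) less.prems by blast
        have y0: "y \<noteq> 0" using y less.prems by auto
        obtain n' where n': "K.hdim AA ((\<lambda>x. y * x) ` AA) n'" using hdim_AA_ex[OF y(1) y0] .
        have "K.hdim AA ((\<lambda>x. a * x) ` AA) (n' + f)" using step[OF y(1) y0 n'] y(2) by (simp add: mult.commute)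
        then have "n = n' + f" using K.hdim_unique[OF subspace_sAA less.prems(1)] by blast
        then obtain k e where "unitA e" "y = t ^ k * e" using less.IH[OF _ n' y(1) y0] f0 by auto
        then show ?thesis using y(2) by (intro exI[of _ "Suc k"] exI[of _ e]) simp
      qed
    qed
  next
    fix k e assume e: "unitA e"
    have "K.hdim AA ((\<lambda>x. t ^ k * x) ` AA) (k * f)"
    proof (induction k)
      case 0
      then show ?case using K.hdim_self[OF subspace_AA] by simp
    next
      case (Suc k)
      then show ?case using step[OF AA_power[OF t(1)] _ Suc] t(2) by (simp add: ac_simps)
    qed
    then show "K.hdim AA ((\<lambda>x. t ^ k * e * x) ` AA) (k * f)" by (simp only: unitA_image[OF e])
  qed
qed

text \<open>The order of \<open>g\<close> exceeds that of \<open>y * e2\<close>, so the remaining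
  term \<open>x ^ l * e1\<close> has the order of \<open>y\<close>.\<close>

lemma order_relation:
  assumes x: "x \<in> Oq" "x \<noteq> 0" "K.hdim Oq ((\<lambda>r. x * r) ` Oq) m"
    and y: "y \<in> Oq" "y \<noteq> 0" "K.hdim Oq ((\<lambda>r. y * r) ` Oq) n"
    and g: "g \<in> Oq" "g \<noteq> 0" "K.hdim Oq ((\<lambda>r. g * r) ` Oq) N" "n < N"
    and rel: "g = x ^ l * e1 + y * e2" "e1 \<in> Oq" "e1 \<noteq> 0" "inverse e1 \<in> Oq" "e2 \<in> Oq" "e2 \<noteq> 0" "inverse e2 \<in> Oq"
  shows "n = l * m"
proof -
  obtain t f where tf: "t \<in> AA" "t \<noteq> 0" "\<not> unitA t" "f > 0"
    "\<forall>a\<in>AA. a \<noteq> 0 \<longrightarrow> (\<exists>k e. unitA e \<and> a = t ^ k * e)"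
    "\<forall>k e. unitA e \<longrightarrow> K.hdim AA ((\<lambda>x. t ^ k * e * x) ` AA) (k * f)"
    using valuation .
  note tf5 = tf(5)[rule_format] and tf6 = tf(6)[rule_format]
  have val: "\<exists>k e. unitA e \<and> a = t ^ k * e \<and> n = k * f"
    if a: "a \<in> Oq" "a \<noteq> 0" "K.hdim Oq ((\<lambda>r. a * r) ` Oq) n" for a n
  proof -
    obtain k e where ke: "unitA e" "a = t ^ k * e" using tf5 a O_sub_AA by blast
    have "n = k * f"
      using K.hdim_unique[OF subspace_sAA hdim_AA_of_Oq[OF a]] tf6[OF ke(1), of k] ke(2) by simp
    then show ?thesis using ke by blast
  qed
  have uniq: "k = k'" if "unitA e" "unitA e'" "t ^ k * e = t ^ k' * e'" for k k' e e'
  proof -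
    have "k * f = k' * f"
      using K.hdim_unique[OF subspace_sAA tf6[OF that(1), of k]] tf6[OF that(2), of k'] that(3) by simp
    then show ?thesis using tf(4) by simp
  qed
  obtain kx ex where vx: "unitA ex" "x = t ^ kx * ex" "m = kx * f" using val[OF x] by blast
  obtain ky ey where vy: "unitA ey" "y = t ^ ky * ey" "n = ky * f" using val[OF y] by blast
  obtain kg eg where vg: "unitA eg" "g = t ^ kg * eg" "N = kg * f" using val[OF g(1-3)] by blast
  have kk: "ky < kg" using g(4) vy(3) vg(3) by simp
  have u: "unitA e1" "unitA e2" using rel O_sub_AA by (auto simp: unitA_def)
  have pow: "unitA (ex ^ l)" using unitA_power[OF vx(1)] .
  have split: "kg = ky + Suc (kg - ky - 1)" using kk by simp
  have "t ^ (kx * l) * (ex ^ l * e1) = x ^ l * e1" by (simp add: vx(2) power_mult_distrib power_mult mult.assoc)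
  also have "\<dots> = g - y * e2" using rel(1) by simp
  also have "\<dots> = t ^ ky * (- (ey * e2) + t * (t ^ (kg - ky - 1) * eg))"
    unfolding vy(2) vg(2) by (subst split, simp only: power_add power_Suc) (simp add: algebra_simps)
  finally have eq: "t ^ (kx * l) * (ex ^ l * e1) = t ^ ky * (- (ey * e2) + t * (t ^ (kg - ky - 1) * eg))" .
  have "unitA (- (ey * e2) + t * (t ^ (kg - ky - 1) * eg))"
  proof (rule unitA_plus_nonunit)
    have "unitA (ey * e2)" using unitA_mult vy(1) u(2) by blast
    then show "unitA (- (ey * e2))" using AA_uminus by (auto simp: unitA_def)
    have A: "t ^ (kg - ky - 1) * eg \<in> AA" using AA_mult AA_power tf(1) vg(1) by (auto simp: unitA_def)
    then show "t * (t ^ (kg - ky - 1) * eg) \<in> AA" using AA_mult tf(1) by blast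
    show "\<not> unitA (t * (t ^ (kg - ky - 1) * eg))" using unitA_factor[OF tf(1) A] tf(3) by blast
  qed
  then have "kx * l = ky" using uniq[OF unitA_mult[OF pow u(1)] _ eq] by blast
  then show ?thesis using vx(3) vy(3) by auto
qed

text \<open>\<open>AA\<close> has dimension \<open>M * m\<close> modulo \<open>x ^ M * AA\<close>,
  while \<open>Oq\<close> covers at most as many dimensions as there are monomials
  \<open>x ^ i * y ^ j\<close> with \<open>j < m\<close> and \<open>i * m + j * N < M * m\<close>.
  The deficit is charged to \<open>\<delta>\<close>.\<close>

lemma delta_bound:
  assumes x: "x \<in> Oq" "x \<noteq> 0" "K.hdim Oq ((\<lambda>r. x * r) ` Oq) m"
    and y: "y \<in> Oq" "y \<noteq> 0" "K.hdim Oq ((\<lambda>r. y * r) ` Oq) N"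
    and span: "\<And>h. h \<in> Oq \<Longrightarrow> \<exists>a h'. h' \<in> Oq \<and> h = (\<Sum>j<m. Phi (tconst (a j)) * y ^ j) + x * h'"
    and \<delta>: "K.hdim AA Oq \<delta>" and m: "m > 0"
  shows "(\<Sum>j<m. (j * N) div m) \<le> \<delta>"
proof -
  obtain t f where tf: "t \<in> AA" "t \<noteq> 0" "\<not> unitA t" "f > 0"
    "\<forall>a\<in>AA. a \<noteq> 0 \<longrightarrow> (\<exists>k e. unitA e \<and> a = t ^ k * e)"
    "\<forall>k e. unitA e \<longrightarrow> K.hdim AA ((\<lambda>x. t ^ k * e * x) ` AA) (k * f)"
    using valuation .
  note tf5 = tf(5)[rule_format] and tf6 = tf(6)[rule_format]
  have val: "\<exists>k e. unitA e \<and> a = t ^ k * e \<and> n = k * f"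
    if a: "a \<in> Oq" "a \<noteq> 0" "K.hdim Oq ((\<lambda>r. a * r) ` Oq) n" for a n
  proof -
    obtain k e where ke: "unitA e" "a = t ^ k * e" using tf5 a O_sub_AA by blast
    have "n = k * f"
      using K.hdim_unique[OF subspace_sAA hdim_AA_of_Oq[OF a]] tf6[OF ke(1), of k] ke(2) by simp
    then show ?thesis using ke by blast
  qed
  obtain kx ex where vx: "unitA ex" "x = t ^ kx * ex" "m = kx * f" using val[OF x] by blast
  obtain ky ey where vy: "unitA ey" "y = t ^ ky * ey" "N = ky * f" using val[OF y] by blast
  note pow = unitA_power
  \<comment> \<open>With this choice \<open>(j * N) div m \<le> M\<close> for all
    \<open>j < m\<close>, so that the truncated subtraction in \<open>I\<close> is exact.\<close>
  define M where "M = N"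
  \<comment> \<open>A truncated \<open>x\<close>-adic expansion: \<open>span\<close> is applied
    again to its own remainder.\<close>
  have exp: "\<exists>a h'. h' \<in> Oq \<and> h = (\<Sum>i<M'. \<Sum>j<m. Phi (tconst (a i j)) * (x ^ i * y ^ j)) + x ^ M' * h'"
    if "h \<in> Oq" for h M'
    using that
  proof (induction M' arbitrary: h)
    case 0
    then show ?case by (intro exI[of _ "\<lambda>_ _. 0"] exI[of _ h]) simp
  next
    case (Suc M')
    obtain a h' where a: "h' \<in> Oq" "h = (\<Sum>i<M'. \<Sum>j<m. Phi (tconst (a i j)) * (x ^ i * y ^ j)) + x ^ M' * h'"
      using Suc by blast
    obtain a' h'' where a': "h'' \<in> Oq" "h' = (\<Sum>j<m. Phi (tconst (a' j)) * y ^ j) + x * h''"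
      using span[OF a(1)] by blast
    let ?a = "\<lambda>i. if i = M' then a' else a i"
    have "x ^ M' * h' = (\<Sum>j<m. Phi (tconst (a' j)) * (x ^ M' * y ^ j)) + x ^ Suc M' * h''"
      by (subst a'(2)) (simp add: distrib_left sum_distrib_left ac_simps)
    then have "h = (\<Sum>i<Suc M'. \<Sum>j<m. Phi (tconst (?a i j)) * (x ^ i * y ^ j)) + x ^ Suc M' * h''"
      by (subst a(2)) simp
    with a'(1) show ?case by (intro exI[of _ ?a] exI[of _ h''] conjI)
  qed
  define W where "W = (\<lambda>r. x ^ M * r) ` AA"
  have W: "K.subspace W" unfolding W_def by (rule subspace_sAA)
  have xMA: "x ^ M \<in> AA" using AA_power x(1) O_sub_AA by blast
  have WA: "W \<subseteq> AA" unfolding W_def using sAA_sub[OF xMA] .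
  have hW: "K.hdim AA W (M * m)"
  proof -
    have xM: "x ^ M = t ^ (kx * M) * ex ^ M" by (simp add: vx(2) power_mult_distrib power_mult)
    have kM: "kx * M * f = M * m" by (simp add: vx(3))
    show ?thesis unfolding W_def xM using tf6[OF pow[OF vx(1)], of "kx * M" M] by (simp only: kM)
  qed
  define I where "I = Sigma {..<m} (\<lambda>j. {..<M - (j * N) div m})"
  define f' where "f' = (\<lambda>(j, i). x ^ i * y ^ j)"
  \<comment> \<open>Outside \<open>I\<close> the order of the monomial is at least that of
    \<open>x ^ M\<close>, so it is absorbed by \<open>W\<close>.\<close>
  have high: "x ^ i * y ^ j \<in> W" if "j < m" "i < M" "(j, i) \<notin> I" for i j
  proof -
    have "M \<le> i + (j * N) div m" using that by (auto simp: I_def)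
    then have "M * m \<le> i * m + (j * N) div m * m" by (metis add_mult_distrib mult_le_mono1)
    also have "\<dots> \<le> i * m + j * N" by (simp add: div_times_less_eq_dividend)
    finally have "f * (M * kx) \<le> f * (i * kx + j * ky)"
      unfolding vx(3) vy(3) by (simp add: algebra_simps)
    then have le: "M * kx \<le> i * kx + j * ky" using tf(4) by simp
    define r where "r = i * kx + j * ky - M * kx"
    have "x ^ i * y ^ j = t ^ (i * kx + j * ky) * (ex ^ i * ey ^ j)"
      by (simp add: vx(2) vy(2) power_mult_distrib power_mult[symmetric] power_add ac_simps)
    also have "i * kx + j * ky = M * kx + r" using le by (simp add: r_def)
    also have "t ^ (M * kx + r) * (ex ^ i * ey ^ j) =
        x ^ M * (t ^ r * inverse (ex ^ M) * (ex ^ i * ey ^ j))"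
    proof -
      have "ex ^ M \<noteq> 0" using pow[OF vx(1)] by (simp add: unitA_def)
      moreover have "x ^ M = t ^ (M * kx) * ex ^ M" by (simp add: vx(2) power_mult_distrib power_mult[symmetric] mult.commute)
      ultimately show ?thesis by (simp add: power_add)
    qed
    also have "\<dots> \<in> W"
      unfolding W_def using pow[OF vx(1)] pow[OF vy(1)]
      by (intro imageI AA_mult AA_power[OF tf(1)]) (auto simp: unitA_def)
    finally show ?thesis .
  qed
  define XX where "XX = {p + r |p r. p \<in> Oq \<and> r \<in> W}"
  have XX: "K.subspace XX" unfolding XX_def by (rule K.subspace_set_plus[OF subspace_Ow[OF w(2)] W])
  have XA: "XX \<subseteq> AA" unfolding XX_def using O_sub_AA WA AA_add by blast
  have WX: "W \<subseteq> XX"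
  proof
    fix r assume "r \<in> W"
    then show "r \<in> XX" unfolding XX_def using Ow_0[OF w(2)] by (intro CollectI exI[of _ 0] exI[of _ r]) simp
  qed
  have OX: "Oq \<subseteq> XX"
  proof
    fix r assume "r \<in> Oq"
    then show "r \<in> XX" unfolding XX_def using K.subspace_0[OF W] by (intro CollectI exI[of _ r] exI[of _ 0]) simp
  qed
  have fI: "finite I" by (simp add: I_def)
  have "\<exists>e\<le>card (f' ` I). K.hdim XX W e"
  proof (rule K.hdim_exists_span[OF W])
    show fin: "finite (f' ` I)" using fI by simp
    fix v assume "v \<in> XX"
    then obtain h r where hr: "h \<in> Oq" "r \<in> W" "v = h + r" unfolding XX_def by blast
    obtain a h' where a: "h' \<in> Oq" "h = (\<Sum>i<M. \<Sum>j<m. Phi (tconst (a i j)) * (x ^ i * y ^ j)) + x ^ M * h'"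
      using exp[OF hr(1)] by blast
    have sub: "K.subspace {v. K.spnm W (f' ` I) v}"
      unfolding K.subspace_def
    proof (intro conjI ballI allI)
      show "0 \<in> {v. K.spnm W (f' ` I) v}"
        using K.spnmI[of 0 "\<lambda>_. 0" "f' ` I" W] K.subspace_0[OF W] by (simp add: Phi_0)
    next
      fix p q assume "p \<in> {v. K.spnm W (f' ` I) v}" "q \<in> {v. K.spnm W (f' ` I) v}"
      then obtain k l where "p - (\<Sum>s\<in>f' ` I. Phi (tconst (k s)) * s) \<in> W"
        "q - (\<Sum>s\<in>f' ` I. Phi (tconst (l s)) * s) \<in> W" by (auto simp: K.spnm_def)
      from K.subspace_add[OF W this]
      have W': "(p + q) - ((\<Sum>s\<in>f' ` I. Phi (tconst (k s)) * s) + (\<Sum>s\<in>f' ` I. Phi (tconst (l s)) * s)) \<in> W"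
        by (simp only: add_diff_add)
      have "(p + q) - (\<Sum>s\<in>f' ` I. Phi (tconst (k s + l s)) * s) \<in> W"
        using W' unfolding K.lincomb_add .
      then show "p + q \<in> {v. K.spnm W (f' ` I) v}" using K.spnmI[of "p + q" "\<lambda>s. k s + l s" "f' ` I" W] by simp
    next
      fix e p assume "p \<in> {v. K.spnm W (f' ` I) v}"
      then obtain k where "p - (\<Sum>s\<in>f' ` I. Phi (tconst (k s)) * s) \<in> W" by (auto simp: K.spnm_def)
      from K.subspace_scale[OF W this, of e]
      have "Phi (tconst e) * p - (\<Sum>s\<in>f' ` I. Phi (tconst (e * k s)) * s) \<in> W"
        unfolding right_diff_distrib K.lincomb_scale .
      then show "Phi (tconst e) * p \<in> {v. K.spnm W (f' ` I) v}"
        using K.spnmI[of "Phi (tconst e) * p" "\<lambda>s. e * k s" "f' ` I" W] by simp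
    qed
    have inW: "K.spnm W (f' ` I) r" if "r \<in> W" for r
      using K.spnmI[of r "\<lambda>_. 0" "f' ` I" W] that by (simp add: Phi_0)
    have mono: "K.spnm W (f' ` I) (x ^ i * y ^ j)" if "i < M" "j < m" for i j
    proof (cases "(j, i) \<in> I")
      case True
      then have "x ^ i * y ^ j \<in> f' ` I" by (auto simp: f'_def intro!: image_eqI[of _ _ "(j, i)"])
      then show ?thesis using K.spnm_base[OF W fin] by blast
    next
      case False
      then show ?thesis using inW high[OF that(2,1)] by blast
    qed
    have "x ^ M * h' \<in> W" unfolding W_def using a(1) O_sub_AA by blast
    then have "v \<in> {v. K.spnm W (f' ` I) v}"
      unfolding hr(3) a(2) using mono inW hr(2)
      by (intro K.subspace_add[OF sub] K.subspace_sum[OF sub] K.subspace_scale[OF sub]) auto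
    then show "K.spnm W (f' ` I) v" by simp
  qed
  then obtain e where e: "e \<le> card (f' ` I)" "K.hdim XX W e" by blast
  have eI: "e \<le> card I" using e(1) card_image_le[OF fI, of f'] by linarith
  \<comment> \<open>\<open>W\<close> and \<open>Oq\<close> need not be nested; the two dimensions of
    \<open>AA\<close> are compared through their sum \<open>XX\<close>.\<close>
  obtain p q where pq: "K.hdim AA XX p" "K.hdim XX W q" "M * m = p + q"
    using K.hdim_split[OF subspace_AA XX W WX XA hW] .
  have qe: "q = e" using K.hdim_unique[OF W pq(2) e(2)] .
  obtain p' q' where pq': "K.hdim AA XX p'" "K.hdim XX Oq q'" "\<delta> = p' + q'"
    using K.hdim_split[OF subspace_AA XX subspace_Ow[OF w(2)] OX XA \<delta>] .
  have "p = p'" using K.hdim_unique[OF XX pq(1) pq'(1)] .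
  then have "M * m \<le> \<delta> + card I" using pq(3) pq'(3) qe eI by linarith
  moreover have "card I + (\<Sum>j<m. (j * N) div m) = M * m"
  proof -
    have q: "(j * N) div m \<le> M" if "j < m" for j
    proof -
      have "j * N \<le> m * N" using that by simp
      then have "(j * N) div m \<le> (m * N) div m" by (rule div_le_mono)
      then show ?thesis using m by (simp add: M_def)
    qed
    have "card I = (\<Sum>j<m. M - (j * N) div m)" by (simp add: I_def)
    then have "card I + (\<Sum>j<m. (j * N) div m) = (\<Sum>j<m. M - (j * N) div m + (j * N) div m)"
      by (simp add: sum.distrib)
    also have "\<dots> = (\<Sum>j<m. M)" using q by (intro sum.cong) auto
    finally show ?thesis by simp
  qed
  ultimately show ?thesis by linarith
qed

end

text \<open>Each rounding loses at most \<open>(m - 1) / m\<close>, and none is lost at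
  \<open>j = 0\<close>. The slack \<open>m * (m - 1) / 2\<close> in the bound absorbs the total loss
  \<open>(m - 1) * (m - 1) / m\<close>, whatever the common divisor of \<open>m\<close> and
  \<open>N\<close>.\<close>

lemma floor_sum_bound:
  fixes m N :: nat
  assumes "m > 0"
  shows "(real m - 1) * (real N - real m) / 2 \<le> real (\<Sum>j<m. (j * N) div m)"
proof -
  have each: "real j * real N - (if j = 0 then 0 else real m - 1) \<le> real m * real ((j * N) div m)" if "j < m" for j
  proof (cases "j = 0")
    case False
    have "(j * N) mod m \<le> m - 1" using assms by (simp add: less_eq_Suc_le[symmetric] Suc_diff_le mod_less_divisor less_Suc_eq_le[symmetric])
    moreover have "j * N = m * ((j * N) div m) + (j * N) mod m" by simp
    ultimately have "j * N \<le> m * ((j * N) div m) + (m - 1)" by linarith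
    then have "real (j * N) \<le> real (m * ((j * N) div m) + (m - 1))" by (simp only: of_nat_le_iff)
    then show ?thesis using False assms by (simp add: of_nat_diff)
  qed simp
  have s1: "(\<Sum>j<m. real j) = real m * (real m - 1) / 2"
    by (induction m) (auto simp: field_simps)
  have s2: "(\<Sum>j<m. if j = 0 then 0 else real m - 1) = (real m - 1) * (real m - 1)"
  proof -
    have "(\<Sum>j<m. if j = 0 then 0 else real m - 1) = (\<Sum>j\<in>{..<m} - {0}. real m - 1)"
      by (rule sum.mono_neutral_cong_right) auto
    then show ?thesis using assms by (simp add: of_nat_diff)
  qed
  have "(\<Sum>j<m. real j * real N - (if j = 0 then 0 else real m - 1)) \<le> (\<Sum>j<m. real m * real ((j * N) div m))"
    using each by (intro sum_mono) auto
  then have "real m * (real m - 1) / 2 * real N - (real m - 1) * (real m - 1) \<le> real m * real (\<Sum>j<m. (j * N) div m)"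
    by (simp add: sum_subtractf sum_distrib_left[symmetric] sum_distrib_right[symmetric] s1 s2)
  moreover have "real m * ((real m - 1) * (real N - real m) / 2) \<le>
      real m * (real m - 1) / 2 * real N - (real m - 1) * (real m - 1)"
  proof -
    \<comment> \<open>Twice the difference of the two sides, in factored form.\<close>
    have "0 \<le> (real m - 1) * ((real m - 1) * (real m - 1) + 1)" using assms by (intro mult_nonneg_nonneg) auto
    also have "\<dots> = 2 * (real m * (real m - 1) / 2 * real N - (real m - 1) * (real m - 1) -
        real m * ((real m - 1) * (real N - real m) / 2))"
      by (simp add: field_simps)
    finally show ?thesis by simp
  qed
  ultimately have "real m * ((real m - 1) * (real N - real m) / 2) \<le> real m * real (\<Sum>j<m. (j * N) div m)" by linarith
  then show ?thesis using assms by simp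
qed

section \<open>The function field record\<close>

context curve
begin

abbreviation "KF \<equiv> function_field F"

text \<open>The residue class in \<open>generic_ring F\<close> that corresponds to \<open>u\<close>.
  It identifies the record \<open>function_field F\<close>, whose elements are cosets, with the
  subfield \<open>Kf\<close>, so that the computations above apply to the record.\<close>

definition fib :: "'k \<Rightarrow> tpoly fract set" where
  "fib u = {Fract P Q |P Q d. homogeneous d P \<and> homogeneous d Q \<and> \<not> F dvd Q \<and> Phi P / Phi Q = u}"

lemma fibI: "homogeneous d P \<Longrightarrow> homogeneous d Q \<Longrightarrow> Phi Q \<noteq> 0 \<Longrightarrow> Fract P Q \<in> fib (Phi P / Phi Q)"
  unfolding fib_def using Phi_0_iff by blast

lemma fibE:
  assumes "x \<in> fib u"
  obtains P Q d where "homogeneous d P" "homogeneous d Q" "Phi Q \<noteq> 0" "Q \<noteq> 0" "u = Phi P / Phi Q" "x = Fract P Q"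
proof -
  obtain P Q d where h: "homogeneous d P" "homogeneous d Q" "\<not> F dvd Q" "Phi P / Phi Q = u" "x = Fract P Q"
    using assms unfolding fib_def by blast
  then have "Phi Q \<noteq> 0" "Q \<noteq> 0" using Phi_0_iff by auto
  with h that show ?thesis by blast
qed

lemma fib_unique: assumes "x \<in> fib u" "x \<in> fib v" shows "u = v"
proof -
  obtain P Q d where a: "homogeneous d P" "homogeneous d Q" "Phi Q \<noteq> 0" "Q \<noteq> 0" "u = Phi P / Phi Q" "x = Fract P Q"
    using assms(1) by (rule fibE)
  obtain R S e where b: "homogeneous e R" "homogeneous e S" "Phi S \<noteq> 0" "S \<noteq> 0" "v = Phi R / Phi S" "x = Fract R S"
    using assms(2) by (rule fibE)
  have "P * S = R * Q" using a(6) b(6) a(4) b(4) by (simp add: eq_fract)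
  then have "Phi P * Phi S = Phi R * Phi Q" by (metis Phi_mult)
  then show ?thesis using a b by (simp add: frac_eq_eq)
qed

lemma fib_add: assumes "x \<in> fib u" "y \<in> fib v" shows "x + y \<in> fib (u + v)"
proof -
  obtain P Q d where a: "homogeneous d P" "homogeneous d Q" "Phi Q \<noteq> 0" "Q \<noteq> 0" "u = Phi P / Phi Q" "x = Fract P Q"
    using assms(1) by (rule fibE)
  obtain R S e where b: "homogeneous e R" "homogeneous e S" "Phi S \<noteq> 0" "S \<noteq> 0" "v = Phi R / Phi S" "y = Fract R S"
    using assms(2) by (rule fibE)
  have "homogeneous (d + e) (P * S + R * Q)"
    using hom_add[OF hom_mult[OF a(1) b(2)], of "R * Q"] hom_mult[OF b(1) a(2)] by (simp add: add.commute)
  from fibI[OF this hom_mult[OF a(2) b(2)]] have "Fract (P * S + R * Q) (Q * S) \<in> fib (Phi (P * S + R * Q) / Phi (Q * S))"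
    using a b by (simp add: Phi_mult)
  moreover have "Phi (P * S + R * Q) / Phi (Q * S) = u + v" using a b by (simp add: Phi_simps add_frac_eq)
  moreover have "Fract (P * S + R * Q) (Q * S) = x + y" using a b by simp
  ultimately show ?thesis by simp
qed

lemma fib_mult: assumes "x \<in> fib u" "y \<in> fib v" shows "x * y \<in> fib (u * v)"
proof -
  obtain P Q d where a: "homogeneous d P" "homogeneous d Q" "Phi Q \<noteq> 0" "Q \<noteq> 0" "u = Phi P / Phi Q" "x = Fract P Q"
    using assms(1) by (rule fibE)
  obtain R S e where b: "homogeneous e R" "homogeneous e S" "Phi S \<noteq> 0" "S \<noteq> 0" "v = Phi R / Phi S" "y = Fract R S"
    using assms(2) by (rule fibE)
  from fibI[OF hom_mult[OF a(1) b(1)] hom_mult[OF a(2) b(2)]] show ?thesis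
    using a b by (simp add: Phi_mult)
qed

lemma fib_const: "Fract (tconst a) 1 \<in> fib (Phi (tconst a))"
  using fibI[of 0 "tconst a" 1] by (simp add: Phi_1)

lemma fib_uminus: "x \<in> fib u \<Longrightarrow> - x \<in> fib (- u)"
  using fib_mult[OF fib_const[of "-1"], of x u]
  by (simp add: tconst_minus Phi_uminus Phi_1 minus_fract[symmetric] One_fract_def[symmetric] del: minus_fract)

lemma fib_diff: "x \<in> fib u \<Longrightarrow> y \<in> fib v \<Longrightarrow> x - y \<in> fib (u - v)"
  using fib_add[of x u "- y" "- v"] fib_uminus by simp

lemma fib_ne: "u \<in> Kf \<Longrightarrow> \<exists>x. x \<in> fib u"
  by (elim KfE) (use fibI in blast)

lemma inj_fib: "inj_on fib Kf"
  by (rule inj_onI) (metis fib_ne fib_unique)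

lemma fib_eq_iff [simp]: "u \<in> Kf \<Longrightarrow> v \<in> Kf \<Longrightarrow> fib u = fib v \<longleftrightarrow> u = v"
  using inj_fib by (auto dest: inj_onD)

lemma carrier_generic: "carrier (generic_ring F) = (\<Union>u\<in>Kf. fib u)"
proof (intro equalityI subsetI)
  fix x assume "x \<in> carrier (generic_ring F)"
  then obtain P Q d where h: "homogeneous d P" "homogeneous d Q" "\<not> F dvd Q" "x = Fract P Q"
    unfolding generic_ring_def by auto
  then show "x \<in> (\<Union>u\<in>Kf. fib u)" using fibI[OF h(1,2)] KfI[OF h(1,2)] Phi_0_iff by blast
next
  fix x assume "x \<in> (\<Union>u\<in>Kf. fib u)"
  then show "x \<in> carrier (generic_ring F)"
    unfolding generic_ring_def fractions_def fib_def by auto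
qed

lemma generic_ops [simp]:
  "add (generic_ring F) = (+)" "zero (generic_ring F) = 0" "mult (generic_ring F) = (*)" "one (generic_ring F) = 1"
  "module.smult (generic_ring F) = (\<lambda>c x. Fract (tconst c) 1 * x)"
  by (simp_all add: generic_ring_def fractions_def)

lemma generic_ideal_eq: "generic_ideal F = fib 0"
proof (intro equalityI subsetI)
  fix x assume "x \<in> generic_ideal F"
  then obtain P Q d where h: "homogeneous d P" "homogeneous d Q" "\<not> F dvd Q" "F dvd P" "x = Fract P Q"
    unfolding generic_ideal_def by blast
  have "Phi P = 0" "Phi Q \<noteq> 0" using h(3,4) Phi_0_iff by auto
  then show "x \<in> fib 0" using fibI[OF h(1,2)] h(5) by simp
next
  fix x assume "x \<in> fib 0"
  then show "x \<in> generic_ideal F"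
    by (elim fibE) (use Phi_0_iff in \<open>auto simp: generic_ideal_def\<close>)
qed

lemma coset_fib:
  assumes "x \<in> fib u"
  shows "generic_ideal F +>\<^bsub>generic_ring F\<^esub> x = fib u"
  unfolding a_r_coset_def' generic_ideal_eq generic_ops
proof (intro equalityI subsetI)
  fix y assume "y \<in> (\<Union>h\<in>fib 0. {h + x})"
  then show "y \<in> fib u" using fib_add[OF _ assms, of _ 0] by auto
next
  fix y assume "y \<in> fib u"
  then have "y - x \<in> fib 0" using fib_diff[OF _ assms, of y u] by simp
  then show "y \<in> (\<Union>h\<in>fib 0. {h + x})" by (intro UN_I[of "y - x"]) auto
qed

lemma carrier_KF: "carrier KF = fib ` Kf"
proof -
  have "carrier KF = (\<Union>x\<in>carrier (generic_ring F). {generic_ideal F +>\<^bsub>generic_ring F\<^esub> x})"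
    by (simp add: function_field_def Let_def FactRing_def A_RCOSETS_def')
  also have "\<dots> = fib ` Kf"
    unfolding carrier_generic using coset_fib fib_ne by fastforce
  finally show ?thesis .
qed

lemma KF_mult: assumes "u \<in> Kf" "v \<in> Kf" shows "fib u \<otimes>\<^bsub>KF\<^esub> fib v = fib (u * v)"
proof -
  have "fib u \<otimes>\<^bsub>KF\<^esub> fib v = (\<Union>a\<in>fib u. \<Union>b\<in>fib v. generic_ideal F +>\<^bsub>generic_ring F\<^esub> (a * b))"
    by (simp add: function_field_def Let_def FactRing_def rcoset_mult_def)
  also have "\<dots> = (\<Union>a\<in>fib u. \<Union>b\<in>fib v. fib (u * v))"
    using coset_fib[OF fib_mult] by simp
  also have "\<dots> = fib (u * v)" using fib_ne assms by fastforce
  finally show ?thesis .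
qed

lemma KF_add: assumes "u \<in> Kf" "v \<in> Kf" shows "fib u \<oplus>\<^bsub>KF\<^esub> fib v = fib (u + v)"
proof -
  have "fib u \<oplus>\<^bsub>KF\<^esub> fib v = (\<Union>a\<in>fib u. \<Union>b\<in>fib v. {a + b})"
    by (simp add: function_field_def Let_def FactRing_def set_add_def')
  also have "\<dots> = fib (u + v)"
  proof (intro equalityI subsetI)
    fix y assume y: "y \<in> fib (u + v)"
    obtain a where a: "a \<in> fib u" using fib_ne assms by blast
    have "y - a \<in> fib v" using fib_diff[OF y a] by simp
    then show "y \<in> (\<Union>a\<in>fib u. \<Union>b\<in>fib v. {a + b})" using a by (intro UN_I[of a] UN_I[of "y - a"]) auto
  qed (use fib_add in auto)
  finally show ?thesis .
qed

lemma KF_zero: "\<zero>\<^bsub>KF\<^esub> = fib 0"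
  by (simp add: function_field_def Let_def FactRing_def generic_ideal_eq)

lemma KF_one: "\<one>\<^bsub>KF\<^esub> = fib 1"
proof -
  have "1 \<in> fib 1" using fib_const[of 1] by (simp add: Phi_1 One_fract_def)
  then show ?thesis by (simp add: function_field_def Let_def FactRing_def coset_fib)
qed

lemma KF_smult: assumes "u \<in> Kf" shows "a \<odot>\<^bsub>KF\<^esub> fib u = fib (Phi (tconst a) * u)"
proof -
  have "a \<odot>\<^bsub>KF\<^esub> fib u = (generic_ideal F +>\<^bsub>generic_ring F\<^esub> Fract (tconst a) 1) \<otimes>\<^bsub>KF\<^esub> fib u"
    by (simp add: function_field_def Let_def FactRing_def)
  also have "\<dots> = fib (Phi (tconst a)) \<otimes>\<^bsub>KF\<^esub> fib u" by (simp only: coset_fib[OF fib_const])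
  also have "\<dots> = fib (Phi (tconst a) * u)" by (rule KF_mult[OF Kf_const assms])
  finally show ?thesis .
qed

definition subring :: "'k set \<Rightarrow> bool" where
  "subring V \<longleftrightarrow> V \<subseteq> Kf \<and> (\<forall>a. Phi (tconst a) \<in> V) \<and> (\<forall>x\<in>V. \<forall>y\<in>V. x + y \<in> V \<and> x * y \<in> V)"

lemma subringD:
  assumes "subring V"
  shows "x \<in> V \<Longrightarrow> x \<in> Kf" "Phi (tconst a) \<in> V" "x \<in> V \<Longrightarrow> y \<in> V \<Longrightarrow> x + y \<in> V"
    "x \<in> V \<Longrightarrow> y \<in> V \<Longrightarrow> x * y \<in> V" "0 \<in> V" "1 \<in> V" "x \<in> V \<Longrightarrow> - x \<in> V" "x \<in> V \<Longrightarrow> y \<in> V \<Longrightarrow> x - y \<in> V"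
proof -
  show *: "x \<in> V \<Longrightarrow> x \<in> Kf" "Phi (tconst a) \<in> V" "x \<in> V \<Longrightarrow> y \<in> V \<Longrightarrow> x + y \<in> V"
    "x \<in> V \<Longrightarrow> y \<in> V \<Longrightarrow> x * y \<in> V" for x y a
    using assms unfolding subring_def by auto
  show "0 \<in> V" "1 \<in> V" using *(2)[of 0] *(2)[of 1] by (simp_all add: Phi_simps)
  have neg: "- x \<in> V" if "x \<in> V" for x
    using *(4)[OF *(2)[of "-1"] that] by (simp add: tconst_minus Phi_simps)
  show "x \<in> V \<Longrightarrow> - x \<in> V" by (rule neg)
  show "x \<in> V \<Longrightarrow> y \<in> V \<Longrightarrow> x - y \<in> V" using *(3)[OF _ neg, of x y] by simp
qed

lemma subspace_subring: "subring V \<Longrightarrow> K.subspace V"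
  unfolding K.subspace_def using subringD[of V] by blast

lemma subring_Kf: "subring Kf"
  unfolding subring_def using Kf_const Kf_add Kf_mult by blast

lemma subring_Ow: "teval F v = 0 \<Longrightarrow> subring (Ow v)"
  unfolding subring_def using Ow_sub_Kf Ow_const Ow_add Ow_mult by blast

lemma cring_fib:
  assumes V: "subring V"
  shows "cring (KF\<lparr>carrier := fib ` V\<rparr>)"
proof (rule cringI)
  note d = subringD[OF V]
  show "abelian_group (KF\<lparr>carrier := fib ` V\<rparr>)"
  proof (rule abelian_groupI)
    fix x assume "x \<in> carrier (KF\<lparr>carrier := fib ` V\<rparr>)"
    then obtain u where "u \<in> V" "x = fib u" by auto
    then show "\<exists>y\<in>carrier (KF\<lparr>carrier := fib ` V\<rparr>). y \<oplus>\<^bsub>KF\<lparr>carrier := fib ` V\<rparr>\<^esub> x = \<zero>\<^bsub>KF\<lparr>carrier := fib ` V\<rparr>\<^esub>"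
      using d by (intro bexI[of _ "fib (- u)"]) (auto simp: KF_add KF_zero)
  qed (use d in \<open>auto simp: KF_add KF_zero algebra_simps\<close>)
  show "Group.comm_monoid (KF\<lparr>carrier := fib ` V\<rparr>)"
    by (rule comm_monoidI) (use d in \<open>auto simp: KF_mult KF_one algebra_simps\<close>)
qed (use subringD[OF V] in \<open>auto simp: KF_add KF_mult algebra_simps\<close>)

lemma cring_KF: "cring KF"
  using cring_fib[OF subring_Kf] by (simp add: carrier_KF[symmetric])

lemma KF_inv: assumes "u \<in> Kf" "u \<noteq> 0" shows "inv\<^bsub>KF\<^esub> fib u = fib (inverse u)"
proof -
  interpret cring KF by (rule cring_KF)
  show ?thesis
    by (rule comm_inv_char) (use assms Kf_inverse in \<open>auto simp: carrier_KF KF_mult KF_one\<close>)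
qed

lemma KF_a_inv: assumes "u \<in> Kf" shows "\<ominus>\<^bsub>KF\<^esub> fib u = fib (- u)"
proof -
  interpret cring KF by (rule cring_KF)
  show ?thesis
    by (rule minus_equality) (use assms Kf_uminus in \<open>auto simp: carrier_KF KF_add KF_zero\<close>)
qed

lemma KF_minus: "u \<in> Kf \<Longrightarrow> v \<in> Kf \<Longrightarrow> fib u \<ominus>\<^bsub>KF\<^esub> fib v = fib (u - v)"
  using Kf_uminus by (simp add: a_minus_def KF_a_inv KF_add)

lemma KF_pow: assumes "u \<in> Kf" shows "fib u [^]\<^bsub>KF\<^esub> (n :: nat) = fib (u ^ n)"
proof -
  interpret cring KF by (rule cring_KF)
  show ?thesis
    by (induction n) (use assms Kf_power in \<open>auto simp: KF_one KF_mult mult.commute\<close>)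
qed

lemma stalk_eq:
  assumes "teval F (vec_of p) = 0"
  shows "stalk F p = fib ` Ow (vec_of p)"
proof -
  have "stalk F p = (\<lambda>x. generic_ideal F +>\<^bsub>generic_ring F\<^esub> x) ` loc (vec_of p)"
    by (simp add: stalk_def carrier_local_ring)
  also have "\<dots> = fib ` Ow (vec_of p)"
  proof (intro equalityI subsetI)
    fix y assume "y \<in> (\<lambda>x. generic_ideal F +>\<^bsub>generic_ring F\<^esub> x) ` loc (vec_of p)"
    then obtain P Q d where h: "homogeneous d P" "homogeneous d Q" "teval Q (vec_of p) \<noteq> 0"
      "y = generic_ideal F +>\<^bsub>generic_ring F\<^esub> Fract P Q" unfolding loc_def by blast
    have "y = fib (Phi P / Phi Q)" using coset_fib[OF fibI[OF h(1,2) Phi_nz[OF assms h(3)]]] h(4) by simp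
    then show "y \<in> fib ` Ow (vec_of p)" using OwI[OF h(1-3)] by blast
  next
    fix y assume "y \<in> fib ` Ow (vec_of p)"
    then obtain P Q d where h: "homogeneous d P" "homogeneous d Q" "teval Q (vec_of p) \<noteq> 0" "y = fib (Phi P / Phi Q)"
      by (auto elim: OwE)
    have "y = generic_ideal F +>\<^bsub>generic_ring F\<^esub> Fract P Q"
      using coset_fib[OF fibI[OF h(1,2) Phi_nz[OF assms h(3)]]] h(4) by simp
    then show "y \<in> (\<lambda>x. generic_ideal F +>\<^bsub>generic_ring F\<^esub> x) ` loc (vec_of p)"
      using locI[OF h(1-3)] by blast
  qed
  finally show ?thesis .
qed

text \<open>Mirrors \<open>ring.eval\<close>: the leading coefficient stands at the head of the
  list.\<close>

fun ev :: "'k list \<Rightarrow> 'k \<Rightarrow> 'k" where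
  "ev [] u = 0"
| "ev (a # as) u = a * u ^ length as + ev as u"

lemma ev_Kf: "set as \<subseteq> Kf \<Longrightarrow> u \<in> Kf \<Longrightarrow> ev as u \<in> Kf"
  by (induction as) (auto intro: Kf_0 Kf_add Kf_mult Kf_power)

lemma eval_fib: "set as \<subseteq> Kf \<Longrightarrow> u \<in> Kf \<Longrightarrow> ring.eval KF (map fib as) (fib u) = fib (ev as u)"
proof (induction as)
  case Nil
  interpret cring KF by (rule cring_KF)
  show ?case by (simp add: KF_zero)
next
  case (Cons a as)
  interpret cring KF by (rule cring_KF)
  show ?case using Cons by (simp add: KF_pow KF_mult KF_add Kf_power Kf_mult ev_Kf)
qed

lemma ev_rev_upt: "ev (map g (rev [0..<n])) u = (\<Sum>k<n. g k * u ^ k)"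
  by (induction n) (auto simp: add.commute)

end

section \<open>The normalization fibre and the arithmetic genus\<close>

locale curve_at = curve_pointed F c Phi "vec_of q" G b
  for F :: tpoly and c :: nat and Phi :: "tpoly \<Rightarrow> 'k :: field" and q :: proj_plane and G :: tpoly and b :: nat
begin

abbreviation "RA \<equiv> KF\<lparr>carrier := fib ` AA\<rparr>"

lemma subring_AA: "subring AA"
  unfolding subring_def using AA_sub_Kf AA_const AA_add AA_mult by blast

lemma stalk_q: "stalk F q = fib ` Oq"
  by (rule stalk_eq[OF w(2)])

lemma ev_shift:
  assumes "set as \<subseteq> Oq" "\<And>k. k < length as \<Longrightarrow> t * u ^ (k + j) \<in> Oq"
  shows "t * u ^ j * ev as u \<in> Oq"
  using assms
proof (induction as)
  case Nil
  then show ?case by (simp add: Ow_0[OF w(2)])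
next
  case (Cons a as)
  have "a * (t * u ^ (length as + j)) + t * u ^ j * ev as u \<in> Oq"
  proof (rule Ow_add[OF w(2)])
    show "a * (t * u ^ (length as + j)) \<in> Oq" by (rule Ow_mult[OF w(2)]) (use Cons.prems in auto)
    show "t * u ^ j * ev as u \<in> Oq" by (rule Cons.IH) (use Cons.prems in auto)
  qed
  then show ?case by (simp add: power_add algebra_simps)
qed

text \<open>If \<open>s * u \<in> Oq\<close> and \<open>u\<close> satisfies a monic equation of
  degree \<open>n\<close>, then \<open>s ^ n\<close> is a common denominator of all powers of
  \<open>u\<close>: low powers by counting factors, high ones by the equation.\<close>

lemma integral_imp_AA:
  assumes u: "u \<in> Kf" and as: "set as \<subseteq> Oq" and e: "u ^ length as + ev as u = 0"
  shows "u \<in> AA"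
proof -
  obtain P Q d where h: "homogeneous d P" "homogeneous d Q" "Phi Q \<noteq> 0" "u = Phi P / Phi Q"
    using u by (rule KfE)
  obtain x y z u' v' where fr: "frame x y z u' v' (vec_of q)" using frame_exists[OF w(1)] .
  note fd = frameD[OF fr]
  have zd: "homogeneous d (z ^ d)" "teval (z ^ d) (vec_of q) \<noteq> 0" "Phi (z ^ d) \<noteq> 0"
    using hom_power1[OF fd(3)] fd(15) Phi_nz[OF w(2), of "z ^ d"] by (auto simp: teval_simps)
  define s where "s = Phi Q / Phi (z ^ d)"
  have s: "s \<in> Oq" "s \<noteq> 0" using OwI[OF h(2) zd(1,2)] h(3) zd(3) by (simp_all add: s_def)
  have su: "s * u \<in> Oq" using OwI[OF h(1) zd(1,2)] h(3) by (simp add: s_def h(4))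
  define n where "n = length as"
  have "s ^ n * u ^ i \<in> Oq" for i
  proof (induction i rule: less_induct)
    case (less i)
    show ?case
    proof (cases "i < n")
      case True
      have "s ^ n * u ^ i = s ^ (n - i) * (s * u) ^ i"
        using True by (simp add: power_mult_distrib power_add[symmetric] mult.assoc[symmetric])
      then show ?thesis using Ow_mult[OF w(2) Ow_power[OF w(2) s(1)] Ow_power[OF w(2) su]] by simp
    next
      case False
      have "s ^ n * u ^ (i - n) * ev as u \<in> Oq"
        using False less by (intro ev_shift as) (auto simp: n_def)
      moreover have "s ^ n * u ^ i = - (s ^ n * u ^ (i - n) * ev as u)"
      proof -
        have "ev as u = - (u ^ n)" using e by (simp add: n_def add_eq_0_iff)
        then show ?thesis using False by (simp add: power_add[symmetric] mult.assoc)
      qed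
      ultimately show ?thesis using Ow_uminus[OF w(2)] by simp
    qed
  qed
  then show ?thesis unfolding AA_def using u s Ow_power[OF w(2) s(1)] by (intro CollectI conjI bexI[of _ "s ^ n"]) auto
qed

text \<open>Integral and almost integral elements coincide here; for the second inclusion the monic
  equation is the one of \<open>AA_relation\<close>, written as a coefficient list.\<close>

lemma closure_eq: "integral_closure KF (stalk F q) = fib ` AA"
proof (intro equalityI subsetI)
  fix x assume "x \<in> integral_closure KF (stalk F q)"
  then obtain p where p: "x \<in> carrier KF" "polynomial\<^bsub>KF\<^esub> (stalk F q) p" "p \<noteq> []"
    "hd p = \<one>\<^bsub>KF\<^esub>" "ring.eval KF p x = \<zero>\<^bsub>KF\<^esub>" unfolding integral_closure_def by blast
  obtain u where u: "u \<in> Kf" "x = fib u" using p(1) carrier_KF by blast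
  have "set p \<subseteq> fib ` Oq" using p(2,3) stalk_q by (simp add: polynomial_def)
  then have "p \<in> map fib ` lists Oq" by (simp add: lists_image[symmetric] in_lists_conv_set subset_iff)
  then obtain cs where cs: "p = map fib cs" "set cs \<subseteq> Oq" by (auto simp: in_lists_conv_set)
  have csK: "set cs \<subseteq> Kf" using cs(2) Ow_sub_Kf[OF w(2)] by blast
  obtain a as where as: "cs = a # as" using p(3) cs(1) by (cases cs) auto
  have "fib a = fib 1" using p(4) by (simp add: cs(1) as KF_one)
  then have a1: "a = 1" using csK subringD(6)[OF subring_Kf] by (simp add: as)
  have "fib (ev cs u) = fib 0" using p(5) eval_fib[OF csK u(1)] by (simp add: cs(1) u(2) KF_zero)
  then have "ev cs u = 0" using ev_Kf[OF csK u(1)] Kf_0 by simp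
  then have "u ^ length as + ev as u = 0" by (simp add: as a1)
  then have "u \<in> AA" using integral_imp_AA[OF u(1), of as] cs(2) by (simp add: as)
  then show "x \<in> fib ` AA" by (simp add: u(2))
next
  fix x assume "x \<in> fib ` AA"
  then obtain u where u: "u \<in> AA" "x = fib u" by blast
  have uK: "u \<in> Kf" using AA_sub_Kf u(1) by blast
  obtain n a h where r: "n \<ge> 1" "h \<in> Oq" "u ^ n = (\<Sum>i\<in>{1..<n}. Phi (tconst (a i)) * u ^ i) + h"
    using AA_relation[OF u(1)] .
  define g where "g = (\<lambda>k. if k = 0 then - h else - Phi (tconst (a k)))"
  define cs where "cs = 1 # map g (rev [0..<n])"
  have gO: "g k \<in> Oq" for k using r(2) Ow_uminus[OF w(2)] Ow_const[OF w(2)] by (simp add: g_def)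
  have cs: "set cs \<subseteq> Oq" using gO Ow_1[OF w(2)] by (auto simp: cs_def)
  have csK: "set cs \<subseteq> Kf" using cs Ow_sub_Kf[OF w(2)] by blast
  have "(\<Sum>k<n. g k * u ^ k) = g 0 + (\<Sum>k\<in>{1..<n}. g k * u ^ k)"
    using r(1) by (simp add: lessThan_atLeast0 sum.atLeast_Suc_lessThan)
  also have "(\<Sum>k\<in>{1..<n}. g k * u ^ k) = (\<Sum>k\<in>{1..<n}. - (Phi (tconst (a k)) * u ^ k))"
    by (rule sum.cong) (auto simp: g_def)
  also have "g 0 + \<dots> = - (u ^ n)" by (simp add: g_def r(3) sum_negf)
  finally have "ev cs u = 0" by (simp add: cs_def ev_rev_upt)
  then have e: "ring.eval KF (map fib cs) x = \<zero>\<^bsub>KF\<^esub>" using eval_fib[OF csK uK] by (simp add: u(2) KF_zero)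
  have "fib 1 \<noteq> fib 0" using subringD(5,6)[OF subring_Kf] by simp
  then have "polynomial\<^bsub>KF\<^esub> (stalk F q) (map fib cs)"
    using cs by (auto simp: polynomial_def stalk_q cs_def KF_zero)
  moreover have "map fib cs \<noteq> []" "hd (map fib cs) = \<one>\<^bsub>KF\<^esub>" by (simp_all add: cs_def KF_one)
  moreover have "x \<in> carrier KF" using uK carrier_KF u(2) by blast
  ultimately show "x \<in> integral_closure KF (stalk F q)"
    unfolding integral_closure_def using e by blast
qed

lemma normalization_fibre_eq:
  "normalization_fibre F q = {localization KF (fib ` AA) M |M. maximalideal M RA}"
  by (simp add: normalization_fibre_def Let_def closure_eq)

section \<open>Maximal ideals of the integral closure and the branches at \<open>q\<close>\<close>

definition idl :: "'k set \<Rightarrow> bool" where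
  "idl J \<longleftrightarrow> J \<subseteq> AA \<and> 0 \<in> J \<and> (\<forall>x\<in>J. \<forall>y\<in>J. x + y \<in> J) \<and> (\<forall>a\<in>AA. \<forall>x\<in>J. a * x \<in> J)"

lemma subspace_idl: "idl J \<Longrightarrow> K.subspace J"
  unfolding K.subspace_def idl_def using AA_const by blast

lemma AA_Kf: "x \<in> AA \<Longrightarrow> x \<in> Kf" using AA_sub_Kf by blast

lemma idl_ideal: assumes J: "idl J" shows "ideal (fib ` J) RA"
proof -
  interpret cring RA by (rule cring_fib[OF subring_AA])
  have JA: "x \<in> AA" "x \<in> Kf" if "x \<in> J" for x using J that AA_Kf unfolding idl_def by blast+
  have neg: "- x \<in> J" if "x \<in> J" for x
  proof -
    have "(- 1) * x \<in> J" using J that AA_uminus[OF AA_1] unfolding idl_def by blast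
    then show ?thesis by simp
  qed
  show ?thesis
  proof (rule idealI)
    show "ring RA" by (rule ring_axioms)
    show "subgroup (fib ` J) (add_monoid RA)"
    proof (rule add.subgroupI)
      show "fib ` J \<subseteq> carrier RA" using JA by auto
      show "fib ` J \<noteq> {}" using J unfolding idl_def by blast
      fix x y assume "x \<in> fib ` J" "y \<in> fib ` J"
      then obtain u v where uv: "u \<in> J" "v \<in> J" "x = fib u" "y = fib v" by blast
      have "u + v \<in> J" using J uv unfolding idl_def by blast
      then show "x \<oplus>\<^bsub>RA\<^esub> y \<in> fib ` J" using uv JA by (simp add: KF_add)
    next
      fix x assume "x \<in> fib ` J"
      then obtain u where u: "u \<in> J" "x = fib u" by blast
      have "\<ominus>\<^bsub>RA\<^esub> x = fib (- u)"
        by (rule minus_equality) (use u JA AA_uminus in \<open>auto simp: KF_add KF_zero Kf_uminus\<close>)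
      then show "\<ominus>\<^bsub>RA\<^esub> x \<in> fib ` J" using neg[OF u(1)] by simp
    qed
    fix x a assume "a \<in> fib ` J" "x \<in> carrier RA"
    then obtain u v where uv: "u \<in> J" "v \<in> AA" "a = fib u" "x = fib v" by auto
    have "v * u \<in> J" using J uv unfolding idl_def by blast
    then show "x \<otimes>\<^bsub>RA\<^esub> a \<in> fib ` J" "a \<otimes>\<^bsub>RA\<^esub> x \<in> fib ` J"
      using uv JA AA_Kf by (simp_all add: KF_mult mult.commute)
  qed
qed

lemma idealD:
  assumes "ideal I RA"
  shows "fib 0 \<in> I" "x \<in> I \<Longrightarrow> y \<in> I \<Longrightarrow> x \<oplus>\<^bsub>KF\<^esub> y \<in> I"
  using additive_subgroup.zero_closed[OF ideal.axioms(1)[OF assms]]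
    additive_subgroup.a_closed[OF ideal.axioms(1)[OF assms]] by (simp_all add: KF_zero)

lemma ideal_idl:
  assumes I: "ideal I RA"
  obtains J where "idl J" "I = fib ` J"
proof
  interpret ideal I RA by (rule I)
  define J where "J = {u \<in> AA. fib u \<in> I}"
  have sub: "I \<subseteq> fib ` AA" using a_subset by simp
  then show "I = fib ` J" unfolding J_def by blast
  have "0 \<in> J" using AA_0 idealD(1)[OF I] by (simp add: J_def)
  moreover have "x + y \<in> J" if "x \<in> J" "y \<in> J" for x y
  proof -
    have "fib x \<oplus>\<^bsub>KF\<^esub> fib y \<in> I" using that by (intro idealD(2)[OF I]) (auto simp: J_def)
    then show ?thesis using that AA_Kf AA_add by (simp add: J_def KF_add)
  qed
  moreover have "a * x \<in> J" if "a \<in> AA" "x \<in> J" for a x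
  proof -
    have "fib a \<otimes>\<^bsub>RA\<^esub> fib x \<in> I" using that by (intro I_l_closed) (auto simp: J_def)
    then show ?thesis using that AA_Kf AA_mult by (simp add: J_def KF_mult)
  qed
  ultimately show "idl J" unfolding idl_def by (auto simp: J_def)
qed

lemma fib_image_mem: "u \<in> Kf \<Longrightarrow> S \<subseteq> Kf \<Longrightarrow> fib u \<in> fib ` S \<longleftrightarrow> u \<in> S"
  using fib_eq_iff by blast

lemma idl_sub: "idl J \<Longrightarrow> J \<subseteq> Kf" using AA_sub_Kf unfolding idl_def by blast

lemma fib_image_sub: "idl I \<Longrightarrow> idl J \<Longrightarrow> fib ` I \<subseteq> fib ` J \<longleftrightarrow> I \<subseteq> J"
  using fib_image_mem idl_sub by blast

text \<open>In place of Zorn's lemma: ideals containing \<open>a\<close> have finite codimension,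
  and a proper one of least codimension is maximal.\<close>

lemma ex_maximal:
  assumes a: "a \<in> AA" "a \<noteq> 0" "inverse a \<notin> AA"
  obtains M where "maximalideal M RA" "fib a \<in> M"
proof -
  let ?P = "\<lambda>J. idl J \<and> a \<in> J \<and> 1 \<notin> J"
  have dimex: "\<exists>n. K.hdim AA J n" if J: "idl J" "a \<in> J" for J
  proof -
    obtain n where n: "K.hdim AA ((\<lambda>x. a * x) ` AA) n" using hdim_AA_ex[OF a(1,2)] .
    have s: "(\<lambda>x. a * x) ` AA \<subseteq> J" using J unfolding idl_def by (auto simp: mult.commute)
    have "J \<subseteq> AA" using J(1) unfolding idl_def by blast
    then show ?thesis using K.hdim_split[OF subspace_AA subspace_idl[OF J(1)] subspace_sAA s _ n] by metis
  qed
  have P0: "?P ((\<lambda>x. a * x) ` AA)"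
  proof -
    have "a * x + a * y \<in> (\<lambda>x. a * x) ` AA" if "x \<in> AA" "y \<in> AA" for x y
      using AA_add[OF that] by (intro image_eqI[of _ _ "x + y"]) (auto simp: distrib_left)
    moreover have "r * (a * x) \<in> (\<lambda>x. a * x) ` AA" if "r \<in> AA" "x \<in> AA" for r x
      using AA_mult[OF that] by (intro image_eqI[of _ _ "r * x"]) auto
    moreover have "0 \<in> (\<lambda>x. a * x) ` AA" using AA_0 by (intro image_eqI[of _ _ 0]) auto
    ultimately have "idl ((\<lambda>x. a * x) ` AA)" unfolding idl_def using sAA_sub[OF a(1)] by auto
    moreover have "a \<in> (\<lambda>x. a * x) ` AA" using AA_1 by (intro image_eqI[of _ _ 1]) auto
    moreover have "1 \<notin> (\<lambda>x. a * x) ` AA"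
    proof
      assume "1 \<in> (\<lambda>x. a * x) ` AA"
      then obtain x where "x \<in> AA" "a * x = 1" by auto
      then show False using a(3) inverse_unique by metis
    qed
    ultimately show ?thesis by blast
  qed
  define k where "k = (LEAST k. \<exists>J. ?P J \<and> K.hdim AA J k)"
  have "\<exists>k J. ?P J \<and> K.hdim AA J k" using P0 dimex by blast
  from LeastI_ex[OF this] obtain J where J: "idl J" "a \<in> J" "1 \<notin> J" "K.hdim AA J k"
    unfolding k_def by blast
  have least: "k \<le> k'" if "?P J'" "K.hdim AA J' k'" for J' k'
    unfolding k_def by (rule Least_le) (use that in blast)
  have JA: "J \<subseteq> AA" using J(1) unfolding idl_def by blast
  have "maximalideal (fib ` J) RA"
  proof (rule maximalidealI)
    show "ideal (fib ` J) RA" by (rule idl_ideal[OF J(1)])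
    have "fib 1 \<notin> fib ` J"
      using fib_image_mem[OF _ idl_sub[OF J(1)], of 1] J(3) subringD(6)[OF subring_Kf] by blast
    then show "carrier RA \<noteq> fib ` J" using AA_1 by auto
    fix I assume I: "ideal I RA" "fib ` J \<subseteq> I" "I \<subseteq> carrier RA"
    obtain J' where J': "idl J'" "I = fib ` J'" using ideal_idl[OF I(1)] .
    have sub: "J \<subseteq> J'" using I(2) fib_image_sub[OF J(1) J'(1)] unfolding J'(2) by simp
    have J'A: "J' \<subseteq> AA" using J'(1) unfolding idl_def by blast
    show "I = fib ` J \<or> I = carrier RA"
    proof (cases "1 \<in> J'")
      case True
      have "x \<in> J'" if "x \<in> AA" for x
      proof -
        have "x * 1 \<in> J'" using J'(1) that True unfolding idl_def by blast
        then show ?thesis by simp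
      qed
      then have "J' = AA" using J'A by blast
      then show ?thesis using J'(2) by simp
    next
      case False
      obtain d e where de: "K.hdim AA J' d" "K.hdim J' J e" "k = d + e"
        using K.hdim_split[OF subspace_AA subspace_idl[OF J'(1)] subspace_idl[OF J(1)] sub J'A J(4)] .
      have "k \<le> d" using least[OF _ de(1)] J'(1) False sub J(2) by blast
      then have "e = 0" using de(3) by simp
      then have "J' \<subseteq> J" using K.hdim_0_imp de(2) by blast
      then show ?thesis using sub J'(2) by blast
    qed
  qed
  then show ?thesis using that J(2) by blast
qed

text \<open>\<open>inverse s\<close> lies in the first ring; in the second it would make a
  denominator outside \<open>M2\<close> a multiple of \<open>s\<close>, which lies in
  \<open>M2\<close>.\<close>

lemma localization_distinct:
  assumes s: "s \<in> AA" "s \<noteq> 0" "fib s \<notin> M1" "fib s \<in> M2" and M2: "ideal M2 RA"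
  shows "localization KF (fib ` AA) M1 \<noteq> localization KF (fib ` AA) M2"
proof
  interpret ideal M2 RA by (rule M2)
  assume e: "localization KF (fib ` AA) M1 = localization KF (fib ` AA) M2"
  have iK: "inverse s \<in> Kf" using Kf_inverse AA_Kf[OF s(1)] by blast
  have one: "1 \<in> Kf" using subringD(6)[OF subring_Kf] .
  have "fib 1 \<otimes>\<^bsub>KF\<^esub> inv\<^bsub>KF\<^esub> (fib s) \<in> localization KF (fib ` AA) M1"
    unfolding localization_def using s AA_1 by blast
  then have "fib (inverse s) \<in> localization KF (fib ` AA) M2"
    using e KF_inv[OF AA_Kf[OF s(1)] s(2)] KF_mult[OF one iK] by simp
  then obtain a t where at: "a \<in> AA" "t \<in> AA" "fib t \<notin> M2" "fib (inverse s) = fib a \<otimes>\<^bsub>KF\<^esub> inv\<^bsub>KF\<^esub> (fib t)"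
    unfolding localization_def by blast
  have t0: "t \<noteq> 0" using at(3) idealD(1)[OF M2] by (cases "t = 0") auto
  have tK: "inverse t \<in> Kf" using Kf_inverse AA_Kf[OF at(2)] by blast
  have "fib (inverse s) = fib (a * inverse t)"
    using at(4) KF_inv[OF AA_Kf[OF at(2)] t0] KF_mult[OF AA_Kf[OF at(1)] tK] by simp
  then have "inverse s = a * inverse t" using iK tK Kf_mult[OF AA_Kf[OF at(1)] tK] by simp
  then have "t = a * s" using s(2) t0 by (simp add: field_simps)
  then have "fib t = fib a \<otimes>\<^bsub>RA\<^esub> fib s" using KF_mult AA_Kf at(1) s(1) by simp
  then show False using I_l_closed[OF s(4), of "fib a"] at(1,3) by simp
qed

lemma one_not_maximal: assumes "maximalideal M RA" shows "fib 1 \<notin> M"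
proof
  interpret maximalideal M RA by (rule assms)
  assume "fib 1 \<in> M"
  then have "\<one>\<^bsub>RA\<^esub> \<in> M" by (simp add: KF_one)
  then have "M = carrier RA" by (rule one_imp_carrier)
  then show False using I_notcarr by simp
qed

text \<open>If \<open>a\<close> and \<open>1 - a\<close> were both nonunits, each would lie in a
  maximal ideal, and no proper ideal contains both; the two localizations would be two points over
  \<open>q\<close>.\<close>

lemma unibranch_local:
  assumes ub: "unibranch F q" and a: "a \<in> AA"
  shows "(a \<noteq> 0 \<and> inverse a \<in> AA) \<or> (1 - a \<noteq> 0 \<and> inverse (1 - a) \<in> AA)"
proof (rule ccontr)
  assume H: "\<not> ?thesis"
  have a0: "a \<noteq> 0" and a1: "1 - a \<noteq> 0" using H AA_1 by auto
  have a': "1 - a \<in> AA" using AA_diff[OF AA_1 a] .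
  obtain M1 where M1: "maximalideal M1 RA" "fib (1 - a) \<in> M1" using ex_maximal[OF a' a1] H a1 by blast
  obtain M2 where M2: "maximalideal M2 RA" "fib a \<in> M2" using ex_maximal[OF a a0] H a0 by blast
  interpret M1: maximalideal M1 RA by (rule M1(1))
  interpret M2: maximalideal M2 RA by (rule M2(1))
  have "fib a \<notin> M1"
  proof
    assume "fib a \<in> M1"
    then have "fib a \<oplus>\<^bsub>KF\<^esub> fib (1 - a) \<in> M1" using M1(2) by (rule idealD(2)[OF M1.is_ideal])
    then show False using one_not_maximal[OF M1(1)] KF_add AA_Kf a a' by simp
  qed
  then have "localization KF (fib ` AA) M1 \<noteq> localization KF (fib ` AA) M2"
    using localization_distinct[OF a a0 _ M2(2) M2.is_ideal] by blast
  moreover obtain L where "normalization_fibre F q = {L}"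
    using ub unfolding unibranch_def by (auto simp: card_1_singleton_iff)
  ultimately show False using M1(1) M2(1) unfolding normalization_fibre_eq by blast
qed

text \<open>Localizing at the maximal ideal changes nothing: a noninvertible element outside it
  would lie in another maximal ideal and so produce a second localization.\<close>

lemma unibranch_fibre:
  assumes ub: "unibranch F q"
  shows "normalization_fibre F q = {fib ` AA}"
proof -
  obtain L where L: "normalization_fibre F q = {L}"
    using ub unfolding unibranch_def by (auto simp: card_1_singleton_iff)
  have LM: "localization KF (fib ` AA) M = L" if "maximalideal M RA" for M
    using L that unfolding normalization_fibre_eq by blast
  have "L \<in> normalization_fibre F q" using L by simp
  then obtain M where M: "maximalideal M RA" unfolding normalization_fibre_eq by blast
  interpret M: maximalideal M RA by (rule M)
  have one: "1 \<in> Kf" using subringD(6)[OF subring_Kf] .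
  have "localization KF (fib ` AA) M = fib ` AA"
  proof (intro equalityI subsetI)
    fix x assume "x \<in> localization KF (fib ` AA) M"
    then obtain a s where h: "a \<in> AA" "s \<in> AA" "fib s \<notin> M" "x = fib a \<otimes>\<^bsub>KF\<^esub> inv\<^bsub>KF\<^esub> (fib s)"
      unfolding localization_def by blast
    have s0: "s \<noteq> 0" using h(3) idealD(1)[OF M.is_ideal] by (cases "s = 0") auto
    have iA: "inverse s \<in> AA"
    proof (rule ccontr)
      assume "inverse s \<notin> AA"
      then obtain M' where M': "maximalideal M' RA" "fib s \<in> M'" using ex_maximal[OF h(2) s0] by blast
      interpret M': maximalideal M' RA by (rule M'(1))
      show False using localization_distinct[OF h(2) s0 h(3) M'(2) M'.is_ideal] LM M M'(1) by simp
    qed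
    have "x = fib (a * inverse s)"
      using h(4) KF_inv[OF AA_Kf[OF h(2)] s0] KF_mult[OF AA_Kf[OF h(1)] AA_Kf[OF iA]] by simp
    then show "x \<in> fib ` AA" using AA_mult[OF h(1) iA] by blast
  next
    fix x assume "x \<in> fib ` AA"
    then obtain a where a: "a \<in> AA" "x = fib a" by blast
    have "x = fib a \<otimes>\<^bsub>KF\<^esub> inv\<^bsub>KF\<^esub> (fib 1)"
      using KF_inv[OF one] KF_mult[OF AA_Kf[OF a(1)] one] a(2) by simp
    then show "x \<in> localization KF (fib ` AA) M"
      unfolding localization_def using a(1) AA_1 one_not_maximal[OF M] by blast
  qed
  then show ?thesis using L LM[OF M] by simp
qed

end

section \<open>The local rings at the points other than \<open>q\<close>\<close>

context curve_at
begin

definition T0 :: "tpoly fract set set set" where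
  "T0 = stalk F ` (points F - {q})"

lemma T0_eq: "T0 = (\<lambda>v. fib ` Ow v) ` others"
proof (intro equalityI subsetI)
  fix A assume "A \<in> T0"
  then obtain p where p: "p \<in> points F" "p \<noteq> q" "A = stalk F p" unfolding T0_def by blast
  have e: "teval F (vec_of p) = 0" using p(1) vanishes_iff[OF F] by (simp add: points_def)
  have "vec_of p \<in> others" unfolding others_def using e vec_of(2)[of p] point_eqI p(2) by blast
  then show "A \<in> (\<lambda>v. fib ` Ow v) ` others" using p(3) stalk_eq[OF e] by blast
next
  fix A assume "A \<in> (\<lambda>v. fib ` Ow v) ` others"
  then obtain v where v: "v \<in> others" "A = fib ` Ow v" by blast
  obtain p a where p: "v = a *s vec_of p" "a \<noteq> 0" using ex_point[OF othersD(1)[OF v(1)]] .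
  have e: "teval F (vec_of p) = 0" using othersD(2)[OF v(1)] teval_scale[OF F, of a "vec_of p"] p by simp
  have "p \<noteq> q" using v(1) p(1) unfolding others_def by blast
  moreover have "p \<in> points F" using e vanishes_iff[OF F] by (simp add: points_def)
  moreover have "A = stalk F p" using v(2) p Ow_scale stalk_eq[OF e] by simp
  ultimately show "A \<in> T0" unfolding T0_def by blast
qed

text \<open>Curve models are sets of local rings, so the ring placed at \<open>q\<close> has to
  differ from those at other points. A quotient of linear forms vanishing at \<open>q\<close> but
  not at \<open>v\<close> separates them: an integral equation for its inverse would make it a unit
  at \<open>q\<close>.\<close>

lemma one_neq_Ow:
  assumes v: "v \<in> others"
  obtains u where "u \<in> Ow (vec_of q)" "u \<noteq> 0" "inverse u \<in> Ow v" "inverse u \<notin> AA"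
proof -
  let ?w = "vec_of q"
  obtain x y z u' v' where fr: "frame x y z u' v' ?w" using frame_exists[OF w(1)] .
  note fd = frameD[OF fr]
  have "teval x v \<noteq> 0 \<or> teval y v \<noteq> 0"
  proof (rule ccontr)
    assume "\<not> ?thesis"
    moreover have "v = teval x v *s u' + teval y v *s v' + teval z v *s ?w" using fr unfolding frame_def by blast
    ultimately have "v = teval z v *s ?w" by simp
    then show False using v unfolding others_def by blast
  qed
  then obtain l where l: "homogeneous 1 l" "teval l ?w = 0" "teval l v \<noteq> 0" using fd by blast
  \<comment> \<open>A denominator that vanishes neither at \<open>q\<close> nor at
    \<open>v\<close>.\<close>
  define l2 where "l2 = (if teval z v \<noteq> 0 then z else z + l)"
  have l2: "homogeneous 1 l2" "teval l2 ?w \<noteq> 0" "teval l2 v \<noteq> 0"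
    using fd l hom_add[OF fd(3) l(1)] by (auto simp: l2_def teval_simps)
  have vF: "teval F v = 0" using othersD(2)[OF v] .
  have nz: "Phi l \<noteq> 0" "Phi l2 \<noteq> 0" using Phi_nz[OF vF] l l2 by auto
  define u where "u = Phi l / Phi l2"
  have u: "u \<in> Oq" "u \<noteq> 0" "inverse u \<in> Ow v"
    using OwI[OF l(1) l2(1,2)] OwI[OF l2(1) l(1,3)] nz by (simp_all add: u_def)
  have "inverse u \<notin> AA"
  proof
    assume "inverse u \<in> AA"
    then obtain n a h where r: "n \<ge> 1" "h \<in> Oq"
      "inverse u ^ n = (\<Sum>i\<in>{1..<n}. Phi (tconst (a i)) * inverse u ^ i) + h"
      by (rule AA_relation)
    \<comment> \<open>Multiplying the integral equation of \<open>inverse u\<close> by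
      \<open>u ^ n\<close> leaves \<open>1 = u * y0\<close>.\<close>
    define y0 where "y0 = (\<Sum>i\<in>{1..<n}. Phi (tconst (a i)) * u ^ (n - i - 1)) + h * u ^ (n - 1)"
    have yO: "y0 \<in> Oq" unfolding y0_def
      by (intro Ow_add[OF w(2)] Ow_sum[OF w(2)] Ow_mult[OF w(2)] Ow_const[OF w(2)] Ow_power[OF w(2)] r u)
    have "1 = u ^ n * inverse u ^ n" using u(2) by (simp add: power_mult_distrib[symmetric])
    also have "\<dots> = (\<Sum>i\<in>{1..<n}. u ^ n * (Phi (tconst (a i)) * inverse u ^ i)) + u ^ n * h"
      by (simp add: r(3) distrib_left sum_distrib_left)
    also have "(\<Sum>i\<in>{1..<n}. u ^ n * (Phi (tconst (a i)) * inverse u ^ i))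
        = (\<Sum>i\<in>{1..<n}. u * (Phi (tconst (a i)) * u ^ (n - i - 1)))"
    proof (rule sum.cong)
      fix i assume "i \<in> {1..<n}"
      then have "n = Suc (n - i - 1) + i" by auto
      then have "u ^ n * inverse u ^ i = u * u ^ (n - i - 1) * (u ^ i * inverse u ^ i)"
        by (metis mult.assoc power_Suc power_add)
      then have "u ^ n * inverse u ^ i = u * u ^ (n - i - 1)"
        using u(2) by (simp add: power_mult_distrib[symmetric])
      then show "u ^ n * (Phi (tconst (a i)) * inverse u ^ i) = u * (Phi (tconst (a i)) * u ^ (n - i - 1))"
        by (metis mult.left_commute)
    qed simp
    also have "u ^ n * h = u * (h * u ^ (n - 1))" using r(1) by (cases n) (auto simp: ac_simps)
    finally have one: "u * y0 = 1" by (simp add: y0_def distrib_left sum_distrib_left)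
    obtain P Q d where PQ: "homogeneous d P" "homogeneous d Q" "teval Q ?w \<noteq> 0" "y0 = Phi P / Phi Q"
      using yO by (rule OwE)
    have "Phi Q \<noteq> 0" using Phi_nz[OF w(2) PQ(3)] .
    then have "Phi (l * P) = Phi (l2 * Q)" using one nz by (simp add: u_def PQ(4) Phi_mult field_simps)
    then have "teval (l * P) ?w = teval (l2 * Q) ?w"
      by (rule Phi_eval[OF hom_mult[OF l(1) PQ(1)] hom_mult[OF l2(1) PQ(2)] _ w(2)])
    then show False using l(2) l2(2) PQ(3) by (simp add: teval_simps)
  qed
  then show ?thesis using that u by blast
qed

lemma constants_dim: "K.hdim (range (\<lambda>a. Phi (tconst a))) {0} 1"
  unfolding K.hdim_def
proof (intro exI[of _ "{1}"] conjI)
  show "{1} \<subseteq> range (\<lambda>a. Phi (tconst a))" using Phi_1 by (auto intro!: image_eqI[of _ _ 1])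
  show "K.indm {0} {1}" unfolding K.indm_def using Phi_nz[OF w(2)] by (auto simp: teval_simps)
  show "\<forall>v\<in>range (\<lambda>a. Phi (tconst a)). K.spnm {0} {1} v" unfolding K.spnm_def by auto
qed simp

lemma subspace_constants: "K.subspace (range (\<lambda>a. Phi (tconst a)))"
  unfolding K.subspace_def
proof (intro conjI ballI allI)
  show "0 \<in> range (\<lambda>a. Phi (tconst a))" by (rule image_eqI[of _ _ 0]) (simp_all add: Phi_simps)
  fix x y assume "x \<in> range (\<lambda>a. Phi (tconst a))" "y \<in> range (\<lambda>a. Phi (tconst a))"
  then obtain a b' where "x = Phi (tconst a)" "y = Phi (tconst b')" by blast
  then show "x + y \<in> range (\<lambda>a. Phi (tconst a))" by (intro image_eqI[of _ _ "a + b'"]) (simp_all add: Phi_simps tconst_add)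
next
  fix e x assume "x \<in> range (\<lambda>a. Phi (tconst a))"
  then obtain a where "x = Phi (tconst a)" by blast
  then show "Phi (tconst e) * x \<in> range (\<lambda>a. Phi (tconst a))" by (intro image_eqI[of _ _ "e * a"]) (simp_all add: Phi_simps tconst_mult)
qed

lemma fib_subset: "subring V \<Longrightarrow> fib ` V \<subseteq> carrier KF"
  using subringD(1) carrier_KF by blast

lemma fib_diff_mem: "subring V \<Longrightarrow> u \<in> Kf \<Longrightarrow> v \<in> Kf \<Longrightarrow> fib u \<ominus>\<^bsub>KF\<^esub> fib v \<in> fib ` V \<longleftrightarrow> u - v \<in> V"
  using KF_minus[of u v] subringD(8)[OF subring_Kf, of u v] fib_image_mem[of "u - v" V] subringD(1) by auto

section \<open>The genus computation, with \<open>B\<close> either the local ring at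
  \<open>q\<close> or its integral closure\<close>

context
  fixes B :: "'k set"
  assumes B: "subring B" "Oq \<subseteq> B" "B \<subseteq> AA"
begin

abbreviation "T \<equiv> insert (fib ` B) T0"
abbreviation "MT \<equiv> repartitions KF T"

lemma B_notin: "fib ` B \<notin> T0"
proof
  assume "fib ` B \<in> T0"
  then obtain v where v: "v \<in> others" "fib ` B = fib ` Ow v" unfolding T0_eq by blast
  obtain u where u: "inverse u \<in> Ow v" "inverse u \<notin> AA" using one_neq_Ow[OF v(1)] by metis
  have vs: "subring (Ow v)" using subring_Ow[OF othersD(2)[OF v(1)]] .
  have "fib (inverse u) \<in> fib ` B" unfolding v(2) using u(1) by blast
  then have "inverse u \<in> B"
    using fib_image_mem[of "inverse u" B] subringD(1)[OF vs u(1)] subringD(1)[OF B(1)] by blast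
  then show False using u(2) B(3) by blast
qed

lemma T_ex: assumes "A \<in> T" obtains V where "subring V" "A = fib ` V" "A = fib ` B \<and> V = B \<or> (\<exists>v\<in>others. V = Ow v)"
  using assms B(1) subring_Ow othersD(2) unfolding T0_eq by blast

text \<open>A function in all local rings lies in \<open>AA\<close> and in \<open>Gam\<close>, so it
  is constant; thus the genus is \<open>h1\<close> for both curves.\<close>

lemma h0_T: "h0 KF T = 1"
proof -
  let ?C = "range (\<lambda>a. Phi (tconst a))"
  have int: "carrier KF \<inter> \<Inter>T = fib ` ?C"
  proof (intro equalityI subsetI)
    fix x assume x: "x \<in> carrier KF \<inter> \<Inter>T"
    then obtain u where u: "u \<in> Kf" "x = fib u" using carrier_KF by blast
    have "fib u \<in> fib ` B" using x u(2) by simp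
    then have "u \<in> AA" using fib_image_mem[OF u(1)] subringD(1)[OF B(1)] B(3) by blast
    moreover have "u \<in> Gam"
      unfolding Gam_def
    proof (intro CollectI conjI ballI u(1))
      fix v assume v: "v \<in> others"
      have "fib u \<in> fib ` Ow v" using x u(2) v unfolding T0_eq by blast
      then show "u \<in> Ow v" using fib_image_mem[OF u(1)] Ow_sub_Kf[OF othersD(2)[OF v]] by blast
    qed
    ultimately show "x \<in> fib ` ?C" using AA_Gam_const u(2) by blast
  next
    fix x assume "x \<in> fib ` ?C"
    then obtain a where a: "x = fib (Phi (tconst a))" by blast
    have "x \<in> A" if A: "A \<in> T" for A
      using A by (rule T_ex) (use a subringD(2) in blast)
    then show "x \<in> carrier KF \<inter> \<Inter>T" using a carrier_KF Kf_const by blast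
  qed
  have sC: "subring ?C"
    unfolding subring_def
  proof (intro conjI ballI allI)
    fix x y assume "x \<in> ?C" "y \<in> ?C"
    then obtain a b' where ab: "x = Phi (tconst a)" "y = Phi (tconst b')" by blast
    show "x + y \<in> ?C" using ab by (intro image_eqI[of _ _ "a + b'"]) (simp_all add: Phi_simps tconst_add)
    show "x * y \<in> ?C" using ab by (intro image_eqI[of _ _ "a * b'"]) (simp_all add: Phi_simps tconst_mult)
  qed (use Kf_const in auto)
  note d = subringD[OF sC]
  let ?M = "KF\<lparr>carrier := fib ` ?C\<rparr>"
  have "quotient_dim ?M {\<zero>\<^bsub>KF\<^esub>} = 1"
  proof (rule K.quotient_dim_eqI[where j = fib and V = ?C and W' = "{0}"])
    interpret cring ?M by (rule cring_fib[OF sC])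
    show "abelian_group ?M" by (rule abelian_group_axioms)
    show "K.subspace ?C" by (rule subspace_constants)
    show "K.subspace {0}" by (rule K.subspace_single_0)
    show "K.hdim ?C {0} 1" by (rule constants_dim)
    show "{\<zero>\<^bsub>KF\<^esub>} \<subseteq> carrier ?M" using zero_closed by simp
    show "a \<oplus>\<^bsub>?M\<^esub> e \<in> {\<zero>\<^bsub>KF\<^esub>}" if "a \<in> {\<zero>\<^bsub>KF\<^esub>}" "e \<in> {\<zero>\<^bsub>KF\<^esub>}" for a e
      using that Kf_0 by (simp add: KF_zero KF_add)
    show "\<ominus>\<^bsub>?M\<^esub> a \<in> {\<zero>\<^bsub>KF\<^esub>}" if "a \<in> {\<zero>\<^bsub>KF\<^esub>}" for a
      using that minus_zero by simp
    show "\<exists>v\<in>?C. r \<ominus>\<^bsub>?M\<^esub> fib v \<in> {\<zero>\<^bsub>KF\<^esub>}" if r: "r \<in> carrier ?M" for r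
    proof -
      obtain v where v: "v \<in> ?C" "r = fib v" using r by auto
      have "r \<ominus>\<^bsub>?M\<^esub> fib v = \<zero>\<^bsub>KF\<^esub>" using r_neg[OF r] v(2) by (simp add: a_minus_def)
      then show ?thesis using v(1) by blast
    qed
    show "fib v \<in> {\<zero>\<^bsub>KF\<^esub>} \<longleftrightarrow> v \<in> {0}" if "v \<in> ?C" for v
      using d(1)[OF that] Kf_0 by (simp add: KF_zero)
  qed (use d Kf_0 Kf_const KF_smult KF_add in \<open>auto simp: KF_zero distrib_left tconst_mult Phi_simps\<close>)
  then show ?thesis unfolding h0_def int .
qed

lemma T_sub: assumes "A \<in> T" shows "A \<subseteq> carrier KF"
  using assms by (rule T_ex) (simp only: fib_subset)

lemma T_closed:
  assumes A: "A \<in> T"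
  shows "\<zero>\<^bsub>KF\<^esub> \<in> A" "x \<in> A \<Longrightarrow> y \<in> A \<Longrightarrow> x \<oplus>\<^bsub>KF\<^esub> y \<in> A" "x \<in> A \<Longrightarrow> \<ominus>\<^bsub>KF\<^esub> x \<in> A"
    "x \<in> A \<Longrightarrow> a \<odot>\<^bsub>KF\<^esub> x \<in> A"
proof -
  obtain V where V: "subring V" "A = fib ` V" using A by (rule T_ex)
  note d = subringD[OF V(1)]
  show "\<zero>\<^bsub>KF\<^esub> \<in> A" using d(5) by (simp add: KF_zero V(2))
  show "x \<oplus>\<^bsub>KF\<^esub> y \<in> A" if "x \<in> A" "y \<in> A"
    using that d(1,3) unfolding V(2) by (auto simp: KF_add)
  show "\<ominus>\<^bsub>KF\<^esub> x \<in> A" if "x \<in> A"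
    using that d(1,7) unfolding V(2) by (auto simp: KF_a_inv)
  show "a \<odot>\<^bsub>KF\<^esub> x \<in> A" if "x \<in> A"
    using that d(1,2,4) unfolding V(2) by (auto simp: KF_smult)
qed

lemma KF_smult_closed: "x \<in> carrier KF \<Longrightarrow> a \<odot>\<^bsub>KF\<^esub> x \<in> carrier KF"
  using Kf_const Kf_mult by (auto simp: carrier_KF KF_smult)

lemma KF_smult_add:
  "x \<in> carrier KF \<Longrightarrow> y \<in> carrier KF \<Longrightarrow> a \<odot>\<^bsub>KF\<^esub> (x \<oplus>\<^bsub>KF\<^esub> y) = a \<odot>\<^bsub>KF\<^esub> x \<oplus>\<^bsub>KF\<^esub> a \<odot>\<^bsub>KF\<^esub> y"
  using Kf_const Kf_mult Kf_add by (auto simp: carrier_KF KF_smult KF_add distrib_left)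

lemma MT_carrier: "r \<in> carrier MT \<longleftrightarrow> r \<in> T \<rightarrow>\<^sub>E carrier KF \<and> finite {A \<in> T. r A \<notin> A}"
  by (simp add: repartitions_def)

lemma MT_D: "r \<in> carrier MT \<Longrightarrow> A \<in> T \<Longrightarrow> r A \<in> carrier KF" "r \<in> carrier MT \<Longrightarrow> finite {A \<in> T. r A \<notin> A}"
  unfolding MT_carrier by auto

lemma MT_ext: "r \<in> carrier MT \<Longrightarrow> s \<in> carrier MT \<Longrightarrow> (\<And>A. A \<in> T \<Longrightarrow> r A = s A) \<Longrightarrow> r = s"
  unfolding MT_carrier using PiE_ext[of r T "\<lambda>_. carrier KF" s] by simp

lemma MT_I:
  assumes "\<And>A. A \<in> T \<Longrightarrow> g A \<in> carrier KF" "finite S" "\<And>A. A \<in> T \<Longrightarrow> A \<notin> S \<Longrightarrow> g A \<in> A"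
  shows "(\<lambda>A\<in>T. g A) \<in> carrier MT"
proof -
  have "{A \<in> T. (\<lambda>A\<in>T. g A) A \<notin> A} \<subseteq> S" using assms(3) by auto
  then have "finite {A \<in> T. (\<lambda>A\<in>T. g A) A \<notin> A}" using assms(2) finite_subset by blast
  moreover have "(\<lambda>A\<in>T. g A) \<in> T \<rightarrow>\<^sub>E carrier KF" using assms(1) by auto
  ultimately show ?thesis unfolding MT_carrier by blast
qed

lemma MT_simps:
  "add MT = (\<lambda>r s. \<lambda>A\<in>T. r A \<oplus>\<^bsub>KF\<^esub> s A)" "zero MT = (\<lambda>A\<in>T. \<zero>\<^bsub>KF\<^esub>)"
  "module.smult MT = (\<lambda>c r. \<lambda>A\<in>T. c \<odot>\<^bsub>KF\<^esub> r A)"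
  by (simp_all add: repartitions_def)

lemma MT_zero_mem: "(\<lambda>A\<in>T. \<zero>\<^bsub>KF\<^esub>) \<in> carrier MT"
proof (rule MT_I[of _ "{}"])
  fix A assume A: "A \<in> T"
  show "\<zero>\<^bsub>KF\<^esub> \<in> A" by (rule T_closed(1)[OF A])
  then show "\<zero>\<^bsub>KF\<^esub> \<in> carrier KF" using T_sub[OF A] by blast
qed simp

lemma MT_add_mem: assumes "r \<in> carrier MT" "s \<in> carrier MT" shows "(\<lambda>A\<in>T. r A \<oplus>\<^bsub>KF\<^esub> s A) \<in> carrier MT"
proof (rule MT_I[of _ "{A \<in> T. r A \<notin> A} \<union> {A \<in> T. s A \<notin> A}"])
  interpret K': cring KF by (rule cring_KF)
  show "r A \<oplus>\<^bsub>KF\<^esub> s A \<in> carrier KF" if "A \<in> T" for A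
    using MT_D(1)[OF assms(1) that] MT_D(1)[OF assms(2) that] by (rule K'.a_closed)
  show "r A \<oplus>\<^bsub>KF\<^esub> s A \<in> A" if "A \<in> T" "A \<notin> {A \<in> T. r A \<notin> A} \<union> {A \<in> T. s A \<notin> A}" for A
    using that T_closed(2)[OF that(1)] by blast
qed (use MT_D(2) assms in blast)

lemma MT_neg_mem: assumes "r \<in> carrier MT" shows "(\<lambda>A\<in>T. \<ominus>\<^bsub>KF\<^esub> r A) \<in> carrier MT"
proof (rule MT_I[of _ "{A \<in> T. r A \<notin> A}"])
  interpret K': cring KF by (rule cring_KF)
  show "\<ominus>\<^bsub>KF\<^esub> r A \<in> carrier KF" if "A \<in> T" for A
    using MT_D(1)[OF assms(1) that] by (rule K'.a_inv_closed)
  show "\<ominus>\<^bsub>KF\<^esub> r A \<in> A" if "A \<in> T" "A \<notin> {A \<in> T. r A \<notin> A}" for A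
    using that T_closed(3)[OF that(1)] by blast
qed (use MT_D(2) assms in blast)

lemma MT_smult_mem: assumes "r \<in> carrier MT" shows "(\<lambda>A\<in>T. c' \<odot>\<^bsub>KF\<^esub> r A) \<in> carrier MT"
proof (rule MT_I[of _ "{A \<in> T. r A \<notin> A}"])
  show "c' \<odot>\<^bsub>KF\<^esub> r A \<in> carrier KF" if "A \<in> T" for A
    using MT_D(1)[OF assms(1) that] by (rule KF_smult_closed)
  show "c' \<odot>\<^bsub>KF\<^esub> r A \<in> A" if "A \<in> T" "A \<notin> {A \<in> T. r A \<notin> A}" for A
    using that T_closed(4)[OF that(1)] by blast
qed (use MT_D(2) assms in blast)

lemma MT_abelian: "abelian_group MT"
proof (rule abelian_groupI)
  interpret K': cring KF by (rule cring_KF)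
  fix x y z assume x: "x \<in> carrier MT" and y: "y \<in> carrier MT" and z: "z \<in> carrier MT"
  note D = MT_D(1)
  show xy: "x \<oplus>\<^bsub>MT\<^esub> y \<in> carrier MT" unfolding MT_simps by (rule MT_add_mem[OF x y])
  have yx: "y \<oplus>\<^bsub>MT\<^esub> x \<in> carrier MT" and yz: "y \<oplus>\<^bsub>MT\<^esub> z \<in> carrier MT"
    unfolding MT_simps by (rule MT_add_mem[OF y x], rule MT_add_mem[OF y z])
  show "x \<oplus>\<^bsub>MT\<^esub> y = y \<oplus>\<^bsub>MT\<^esub> x"
    by (rule MT_ext[OF xy yx]) (simp only: MT_simps restrict_apply' K'.a_comm[OF D[OF x] D[OF y]])
  show "x \<oplus>\<^bsub>MT\<^esub> y \<oplus>\<^bsub>MT\<^esub> z = x \<oplus>\<^bsub>MT\<^esub> (y \<oplus>\<^bsub>MT\<^esub> z)"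
  proof (rule MT_ext)
    show "x \<oplus>\<^bsub>MT\<^esub> y \<oplus>\<^bsub>MT\<^esub> z \<in> carrier MT" "x \<oplus>\<^bsub>MT\<^esub> (y \<oplus>\<^bsub>MT\<^esub> z) \<in> carrier MT"
      using MT_add_mem[OF xy z] MT_add_mem[OF x yz] unfolding MT_simps .
    show "(x \<oplus>\<^bsub>MT\<^esub> y \<oplus>\<^bsub>MT\<^esub> z) A = (x \<oplus>\<^bsub>MT\<^esub> (y \<oplus>\<^bsub>MT\<^esub> z)) A" if "A \<in> T" for A
      unfolding MT_simps restrict_apply'[OF that] by (rule K'.a_assoc[OF D[OF x that] D[OF y that] D[OF z that]])
  qed
next
  interpret K': cring KF by (rule cring_KF)
  show z: "\<zero>\<^bsub>MT\<^esub> \<in> carrier MT" unfolding MT_simps by (rule MT_zero_mem)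
  fix x assume x: "x \<in> carrier MT"
  have "\<zero>\<^bsub>MT\<^esub> \<oplus>\<^bsub>MT\<^esub> x \<in> carrier MT" using MT_add_mem[OF z x] unfolding MT_simps .
  from MT_ext[OF this x] show "\<zero>\<^bsub>MT\<^esub> \<oplus>\<^bsub>MT\<^esub> x = x"
    using K'.l_zero[OF MT_D(1)[OF x]] unfolding MT_simps by (simp only: restrict_apply')
  let ?y = "\<lambda>A\<in>T. \<ominus>\<^bsub>KF\<^esub> x A"
  have y: "?y \<in> carrier MT" by (rule MT_neg_mem[OF x])
  have yx: "?y \<oplus>\<^bsub>MT\<^esub> x \<in> carrier MT" using MT_add_mem[OF y x] unfolding MT_simps .
  have "?y \<oplus>\<^bsub>MT\<^esub> x = \<zero>\<^bsub>MT\<^esub>"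
    by (rule MT_ext[OF yx z]) (simp only: MT_simps restrict_apply' K'.l_neg[OF MT_D(1)[OF x]])
  then show "\<exists>y\<in>carrier MT. y \<oplus>\<^bsub>MT\<^esub> x = \<zero>\<^bsub>MT\<^esub>" using y by blast
qed

lemma MT_uminus: assumes "x \<in> carrier MT" shows "\<ominus>\<^bsub>MT\<^esub> x = (\<lambda>A\<in>T. \<ominus>\<^bsub>KF\<^esub> x A)"
proof -
  interpret K': cring KF by (rule cring_KF)
  interpret M': abelian_group MT by (rule MT_abelian)
  let ?y = "\<lambda>A\<in>T. \<ominus>\<^bsub>KF\<^esub> x A"
  have y: "?y \<in> carrier MT" by (rule MT_neg_mem[OF assms])
  have "?y \<oplus>\<^bsub>MT\<^esub> x = \<zero>\<^bsub>MT\<^esub>"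
    by (rule MT_ext[OF M'.a_closed[OF y assms] M'.zero_closed])
      (simp only: MT_simps restrict_apply' K'.l_neg[OF MT_D(1)[OF assms]])
  then show ?thesis using M'.minus_equality[OF _ assms y] by simp
qed

lemma MT_minus:
  assumes "x \<in> carrier MT" "y \<in> carrier MT" "A \<in> T"
  shows "(x \<ominus>\<^bsub>MT\<^esub> y) A = x A \<ominus>\<^bsub>KF\<^esub> y A"
  unfolding a_minus_def MT_uminus[OF assms(2)] using assms(3) by (simp only: MT_simps restrict_apply')

text \<open>The repartition concentrated at \<open>q\<close>. Modulo regular and constant
  repartitions these represent every class.\<close>

definition jT :: "'k \<Rightarrow> tpoly fract set set \<Rightarrow> tpoly fract set" where
  "jT u = (\<lambda>A\<in>T. if A = fib ` B then fib u else fib 0)"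

lemma jT_B: "jT u (fib ` B) = fib u" by (simp add: jT_def)

lemma jT_T0: "A \<in> T0 \<Longrightarrow> jT u A = fib 0" using B_notin by (auto simp: jT_def)

lemma jT_mem: assumes "u \<in> Kf" shows "jT u \<in> carrier MT"
  unfolding jT_def
proof (rule MT_I[of _ "{fib ` B}"])
  show "(if A = fib ` B then fib u else fib 0) \<in> carrier KF" for A
    using assms Kf_0 carrier_KF by auto
  show "(if A = fib ` B then fib u else fib 0) \<in> A" if "A \<in> T" "A \<notin> {fib ` B}" for A
    using that T_closed(1)[OF that(1)] by (auto simp: KF_zero)
qed simp

text \<open>Strong approximation one point at a time: the correction for a new point is regular at
  all others and so preserves what has been achieved.\<close>

lemma approx:
  assumes r: "\<And>A. A \<in> T0 \<Longrightarrow> r A \<in> carrier KF" and S: "finite S" "S \<subseteq> T0"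
  shows "\<exists>f\<in>Kf. (\<forall>A\<in>S. r A \<ominus>\<^bsub>KF\<^esub> fib f \<in> A) \<and> (\<forall>A\<in>T0 - S. fib f \<in> A)"
  using S
proof (induction S rule: finite_induct)
  case empty
  have "\<forall>A\<in>T0. fib 0 \<in> A" using T_closed(1) by (auto simp: KF_zero)
  then show ?case using Kf_0 by blast
next
  case (insert A0 S)
  obtain f where f: "f \<in> Kf" "\<forall>A\<in>S. r A \<ominus>\<^bsub>KF\<^esub> fib f \<in> A" "\<forall>A\<in>T0 - S. fib f \<in> A"
    using insert by blast
  obtain v1 where v1: "v1 \<in> others" "A0 = fib ` Ow v1" using insert.prems unfolding T0_eq by blast
  obtain \<rho> where \<rho>: "\<rho> \<in> Kf" "r A0 = fib \<rho>" using r[of A0] insert.prems carrier_KF by auto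
  obtain g where g: "g \<in> Kf" "g - (\<rho> - f) \<in> Ow v1" "\<And>v. v \<in> others \<Longrightarrow> (\<nexists>a. v = a *s v1) \<Longrightarrow> g \<in> Ow v"
    using strong_approx[OF v1(1) Kf_diff[OF \<rho>(1) f(1)]] by metis
  have gA: "fib g \<in> A" if A: "A \<in> T0" "A \<noteq> A0" for A
  proof -
    obtain v where v: "v \<in> others" "A = fib ` Ow v" using A(1) unfolding T0_eq by blast
    have "\<nexists>a. v = a *s v1"
    proof
      assume "\<exists>a. v = a *s v1"
      then obtain a where a: "v = a *s v1" by blast
      have "a \<noteq> 0" using a othersD(1)[OF v(1)] by auto
      then show False using A(2) a v(2) v1(2) Ow_scale by simp
    qed
    then show ?thesis using g(3)[OF v(1)] v(2) by blast
  qed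
  have fg: "f + g \<in> Kf" using Kf_add f(1) g(1) by blast
  have "r A \<ominus>\<^bsub>KF\<^esub> fib (f + g) \<in> A" if A: "A \<in> insert A0 S" for A
  proof (cases "A = A0")
    case True
    have sV: "subring (Ow v1)" by (rule subring_Ow[OF othersD(2)[OF v1(1)]])
    have "\<rho> - (f + g) = - (g - (\<rho> - f))" by simp
    then have "\<rho> - (f + g) \<in> Ow v1" using subringD(7)[OF sV g(2)] by (simp only:)
    then have "fib \<rho> \<ominus>\<^bsub>KF\<^esub> fib (f + g) \<in> fib ` Ow v1" using fib_diff_mem[OF sV \<rho>(1) fg] by blast
    then show ?thesis by (simp only: True \<rho>(2)) (simp only: v1(2))
  next
    case False
    then have AS: "A \<in> S" using A by blast
    then have AT: "A \<in> T0" using insert.prems by blast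
    obtain v where v: "v \<in> others" "A = fib ` Ow v" using AT unfolding T0_eq by blast
    have sV: "subring (Ow v)" by (rule subring_Ow[OF othersD(2)[OF v(1)]])
    obtain \<sigma> where \<sigma>: "\<sigma> \<in> Kf" "r A = fib \<sigma>" using r[OF AT] carrier_KF by auto
    have 1: "\<sigma> - f \<in> Ow v" using f(2) AS fib_diff_mem[OF sV \<sigma>(1) f(1)] \<sigma>(2) v(2) by auto
    have 2: "g \<in> Ow v" using gA[OF AT False] fib_image_mem[OF g(1), of "Ow v"] v(2) subringD(1)[OF sV] by blast
    have "\<sigma> - (f + g) = \<sigma> - f - g" by simp
    then have "\<sigma> - (f + g) \<in> Ow v" using subringD(8)[OF sV 1 2] by (simp only:)
    then show ?thesis using fib_diff_mem[OF sV \<sigma>(1) fg] \<sigma>(2) v(2) by simp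
  qed
  moreover have "fib (f + g) \<in> A" if A: "A \<in> T0 - insert A0 S" for A
  proof -
    have AT: "A \<in> T" using A by blast
    have "fib f \<oplus>\<^bsub>KF\<^esub> fib g \<in> A" using A f(3) gA by (intro T_closed(2)[OF AT]) blast+
    then show ?thesis using KF_add[OF f(1) g(1)] by simp
  qed
  ultimately show ?case using fg by blast
qed

definition BG :: "'k set" where "BG = {x + y |x y. x \<in> B \<and> y \<in> Gam}"

lemma subspace_BG: "K.subspace BG"
  unfolding BG_def by (rule K.subspace_set_plus[OF subspace_subring[OF B(1)] subspace_Gam])

definition WT where "WT = {r \<in> carrier MT. \<exists>f \<in> carrier KF. \<forall>A \<in> T. r A \<ominus>\<^bsub>KF\<^esub> f \<in> A}"

lemma WT_I: "r \<in> carrier MT \<Longrightarrow> f \<in> Kf \<Longrightarrow> (\<And>A. A \<in> T \<Longrightarrow> r A \<ominus>\<^bsub>KF\<^esub> fib f \<in> A) \<Longrightarrow> r \<in> WT"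
  unfolding WT_def carrier_KF by blast

lemma WT_E: assumes "r \<in> WT" obtains f where "r \<in> carrier MT" "f \<in> Kf" "\<And>A. A \<in> T \<Longrightarrow> r A \<ominus>\<^bsub>KF\<^esub> fib f \<in> A"
  using assms unfolding WT_def carrier_KF by blast

text \<open>At the points other than \<open>q\<close> the repartition is zero, so the constant
  repartition that trivializes it is a function regular there, that is, an element of
  \<open>Gam\<close>.\<close>

lemma jT_WT: assumes u: "u \<in> Kf" shows "jT u \<in> WT \<longleftrightarrow> u \<in> BG"
proof
  assume "jT u \<in> WT"
  then obtain f where f: "f \<in> Kf" "\<And>A. A \<in> T \<Longrightarrow> jT u A \<ominus>\<^bsub>KF\<^esub> fib f \<in> A" by (rule WT_E) blast
  have 1: "u - f \<in> B" using f(2)[of "fib ` B"] fib_diff_mem[OF B(1) u f(1)] by (simp add: jT_B)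
  have "f \<in> Gam"
    unfolding Gam_def
  proof (intro CollectI conjI ballI f(1))
    fix v assume v: "v \<in> others"
    have sV: "subring (Ow v)" by (rule subring_Ow[OF othersD(2)[OF v]])
    have A: "fib ` Ow v \<in> T0" unfolding T0_eq using v by blast
    have "0 - f \<in> Ow v" using f(2)[of "fib ` Ow v"] A jT_T0[OF A] fib_diff_mem[OF sV Kf_0 f(1)] by simp
    from subringD(7)[OF sV this] show "f \<in> Ow v" by simp
  qed
  then show "u \<in> BG" unfolding BG_def using 1 by (intro CollectI exI[of _ "u - f"] exI[of _ f]) simp
next
  assume "u \<in> BG"
  then obtain x f where xf: "u = x + f" "x \<in> B" "f \<in> Gam" unfolding BG_def by blast
  have fK: "f \<in> Kf" using xf(3) unfolding Gam_def by blast
  show "jT u \<in> WT"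
  proof (rule WT_I[OF jT_mem[OF u] fK])
    fix A assume A: "A \<in> T"
    show "jT u A \<ominus>\<^bsub>KF\<^esub> fib f \<in> A"
    proof (cases "A = fib ` B")
      case True
      then show ?thesis using fib_diff_mem[OF B(1) u fK] xf by (simp add: jT_B)
    next
      case False
      then have A0: "A \<in> T0" using A by blast
      obtain v where v: "v \<in> others" "A = fib ` Ow v" using A0 unfolding T0_eq by blast
      have sV: "subring (Ow v)" by (rule subring_Ow[OF othersD(2)[OF v(1)]])
      have "f \<in> Ow v" using xf(3) v(1) unfolding Gam_def by blast
      then show ?thesis using fib_diff_mem[OF sV Kf_0 fK] subringD(7)[OF sV] jT_T0[OF A0] v(2) by simp
    qed
  qed
qed

text \<open>Subtracting a global function that approximates a repartition away from \<open>q\<close>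
  moves its class to \<open>q\<close>. This identifies the cohomology with \<open>Kf\<close> modulo
  \<open>B + Gam\<close>.\<close>

lemma h1_T:
  assumes n: "K.hdim Kf BG n"
  shows "h1 KF T = n"
  unfolding h1_def WT_def[symmetric]
proof (rule K.quotient_dim_eqI[where j = jT and V = Kf and W' = BG])
  interpret K': cring KF by (rule cring_KF)
  show "abelian_group MT" by (rule MT_abelian)
  show "K.subspace Kf" by (rule subspace_Kf)
  show "K.subspace BG" by (rule subspace_BG)
  show "K.hdim Kf BG n" by (rule n)
  show "jT u \<in> carrier MT" if "u \<in> Kf" for u by (rule jT_mem[OF that])
  show "jT u \<in> WT \<longleftrightarrow> u \<in> BG" if "u \<in> Kf" for u by (rule jT_WT[OF that])
  show "WT \<subseteq> carrier MT" unfolding WT_def by blast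
  show "jT (x + y) = jT x \<oplus>\<^bsub>MT\<^esub> jT y" if "x \<in> Kf" "y \<in> Kf" for x y
    unfolding MT_simps jT_def using that Kf_0 by (intro restrict_ext) (simp add: KF_add)
  show "jT (Phi (tconst a) * x) = a \<odot>\<^bsub>MT\<^esub> jT x" if "x \<in> Kf" for a x
    unfolding MT_simps jT_def using that Kf_0 by (intro restrict_ext) (simp add: KF_smult)
  show sm: "a \<odot>\<^bsub>MT\<^esub> r \<in> carrier MT" if "r \<in> carrier MT" for a r
    unfolding MT_simps by (rule MT_smult_mem[OF that])
  interpret M': abelian_group MT by (rule MT_abelian)
  show "a \<odot>\<^bsub>MT\<^esub> (r \<oplus>\<^bsub>MT\<^esub> s) = a \<odot>\<^bsub>MT\<^esub> r \<oplus>\<^bsub>MT\<^esub> a \<odot>\<^bsub>MT\<^esub> s"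
    if "r \<in> carrier MT" "s \<in> carrier MT" for a r s
    by (rule MT_ext[OF sm[OF M'.a_closed[OF that]] M'.a_closed[OF sm[OF that(1)] sm[OF that(2)]]])
      (simp only: MT_simps restrict_apply' KF_smult_add[OF MT_D(1)[OF that(1)] MT_D(1)[OF that(2)]])
  show "r \<oplus>\<^bsub>MT\<^esub> s \<in> WT" if rW: "r \<in> WT" and sW: "s \<in> WT" for r s
  proof -
    obtain f where f: "r \<in> carrier MT" "f \<in> Kf" "\<And>A. A \<in> T \<Longrightarrow> r A \<ominus>\<^bsub>KF\<^esub> fib f \<in> A" using WT_E[OF rW] by blast
    obtain g where g: "s \<in> carrier MT" "g \<in> Kf" "\<And>A. A \<in> T \<Longrightarrow> s A \<ominus>\<^bsub>KF\<^esub> fib g \<in> A" using WT_E[OF sW] by blast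
    show ?thesis
    proof (rule WT_I[OF M'.a_closed[OF f(1) g(1)] Kf_add[OF f(2) g(2)]])
      fix A assume A: "A \<in> T"
      obtain \<rho> \<sigma> where rs: "\<rho> \<in> Kf" "r A = fib \<rho>" "\<sigma> \<in> Kf" "s A = fib \<sigma>"
        using MT_D(1)[OF f(1) A] MT_D(1)[OF g(1) A] carrier_KF by auto
      have "(r A \<ominus>\<^bsub>KF\<^esub> fib f) \<oplus>\<^bsub>KF\<^esub> (s A \<ominus>\<^bsub>KF\<^esub> fib g) \<in> A" by (rule T_closed(2)[OF A f(3)[OF A] g(3)[OF A]])
      moreover have "(\<rho> - f) + (\<sigma> - g) = (\<rho> + \<sigma>) - (f + g)" by simp
      moreover have "(r \<oplus>\<^bsub>MT\<^esub> s) A = r A \<oplus>\<^bsub>KF\<^esub> s A" by (simp only: MT_simps restrict_apply'[OF A])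
      ultimately show "(r \<oplus>\<^bsub>MT\<^esub> s) A \<ominus>\<^bsub>KF\<^esub> fib (f + g) \<in> A"
        using rs f(2) g(2) Kf_add Kf_diff by (simp add: KF_minus KF_add)
    qed
  qed
  show "\<ominus>\<^bsub>MT\<^esub> r \<in> WT" if rW: "r \<in> WT" for r
  proof -
    obtain f where f: "r \<in> carrier MT" "f \<in> Kf" "\<And>A. A \<in> T \<Longrightarrow> r A \<ominus>\<^bsub>KF\<^esub> fib f \<in> A" using WT_E[OF rW] by blast
    show ?thesis
    proof (rule WT_I[OF M'.a_inv_closed[OF f(1)] Kf_uminus[OF f(2)]])
      fix A assume A: "A \<in> T"
      obtain \<rho> where rs: "\<rho> \<in> Kf" "r A = fib \<rho>"
        using MT_D(1)[OF f(1) A] carrier_KF by auto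
      have "\<ominus>\<^bsub>KF\<^esub> (r A \<ominus>\<^bsub>KF\<^esub> fib f) \<in> A" by (rule T_closed(3)[OF A f(3)[OF A]])
      moreover have "(\<ominus>\<^bsub>MT\<^esub> r) A = \<ominus>\<^bsub>KF\<^esub> r A" by (simp only: MT_uminus[OF f(1)] restrict_apply'[OF A])
      ultimately show "(\<ominus>\<^bsub>MT\<^esub> r) A \<ominus>\<^bsub>KF\<^esub> fib (- f) \<in> A"
        using rs f(2) Kf_uminus Kf_diff by (simp add: KF_minus KF_a_inv)
    qed
  qed
  show "a \<odot>\<^bsub>MT\<^esub> r \<in> WT" if rW: "r \<in> WT" for a r
  proof -
    obtain f where f: "r \<in> carrier MT" "f \<in> Kf" "\<And>A. A \<in> T \<Longrightarrow> r A \<ominus>\<^bsub>KF\<^esub> fib f \<in> A" using WT_E[OF rW] by blast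
    show ?thesis
    proof (rule WT_I[OF sm[OF f(1)] Kf_mult[OF Kf_const[of a] f(2)]])
      fix A assume A: "A \<in> T"
      obtain \<rho> where rs: "\<rho> \<in> Kf" "r A = fib \<rho>"
        using MT_D(1)[OF f(1) A] carrier_KF by auto
      have "a \<odot>\<^bsub>KF\<^esub> (r A \<ominus>\<^bsub>KF\<^esub> fib f) \<in> A" by (rule T_closed(4)[OF A f(3)[OF A]])
      moreover have "Phi (tconst a) * (\<rho> - f) = Phi (tconst a) * \<rho> - Phi (tconst a) * f" by (rule right_diff_distrib)
      moreover have "(a \<odot>\<^bsub>MT\<^esub> r) A = a \<odot>\<^bsub>KF\<^esub> r A" by (simp only: MT_simps restrict_apply'[OF A])
      ultimately show "(a \<odot>\<^bsub>MT\<^esub> r) A \<ominus>\<^bsub>KF\<^esub> fib (Phi (tconst a) * f) \<in> A"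
        using rs f(2) Kf_mult Kf_const Kf_diff by (simp add: KF_minus KF_smult)
    qed
  qed
  show "\<exists>v\<in>Kf. r \<ominus>\<^bsub>MT\<^esub> jT v \<in> WT" if r: "r \<in> carrier MT" for r
  proof -
    let ?S = "{A \<in> T0. r A \<notin> A}"
    have "?S \<subseteq> {A \<in> T. r A \<notin> A}" by blast
    then have fS: "finite ?S" using MT_D(2)[OF r] finite_subset by blast
    obtain f where f: "f \<in> Kf" "\<forall>A\<in>?S. r A \<ominus>\<^bsub>KF\<^esub> fib f \<in> A" "\<forall>A\<in>T0 - ?S. fib f \<in> A"
      using approx[of r ?S] fS MT_D(1)[OF r] by blast
    obtain \<rho> where \<rho>: "\<rho> \<in> Kf" "r (fib ` B) = fib \<rho>" using MT_D(1)[OF r, of "fib ` B"] carrier_KF by auto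
    have v: "\<rho> - f \<in> Kf" using Kf_diff[OF \<rho>(1) f(1)] .
    \<comment> \<open>The constant repartition \<open>f\<close> accounts for all points other than
      \<open>q\<close>; the discrepancy left at \<open>q\<close> is
      \<open>\<rho> - f\<close>.\<close>
    have "r \<ominus>\<^bsub>MT\<^esub> jT (\<rho> - f) \<in> WT"
    proof (rule WT_I[OF M'.minus_closed[OF r jT_mem[OF v]] f(1)])
      fix A assume A: "A \<in> T"
      have e: "(r \<ominus>\<^bsub>MT\<^esub> jT (\<rho> - f)) A = r A \<ominus>\<^bsub>KF\<^esub> jT (\<rho> - f) A" by (rule MT_minus[OF r jT_mem[OF v] A])
      obtain \<sigma> where \<sigma>: "\<sigma> \<in> Kf" "r A = fib \<sigma>" using MT_D(1)[OF r A] carrier_KF by auto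
      show "(r \<ominus>\<^bsub>MT\<^esub> jT (\<rho> - f)) A \<ominus>\<^bsub>KF\<^esub> fib f \<in> A"
      proof (cases "A = fib ` B")
        case True
        have "(r \<ominus>\<^bsub>MT\<^esub> jT (\<rho> - f)) A = fib \<rho> \<ominus>\<^bsub>KF\<^esub> fib (\<rho> - f)"
          using e by (simp only: True jT_B \<rho>(2))
        also have "\<dots> = fib (\<rho> - (\<rho> - f))" by (rule KF_minus[OF \<rho>(1) v])
        finally have "(r \<ominus>\<^bsub>MT\<^esub> jT (\<rho> - f)) A \<ominus>\<^bsub>KF\<^esub> fib f = fib (\<rho> - (\<rho> - f) - f)"
          using KF_minus[OF Kf_diff[OF \<rho>(1) v] f(1)] by (simp only:)
        also have "\<dots> = fib 0" by simp
        finally show ?thesis using T_closed(1)[OF A] by (simp add: KF_zero)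
      next
        case False
        then have A0: "A \<in> T0" using A by blast
        have "(r \<ominus>\<^bsub>MT\<^esub> jT (\<rho> - f)) A = fib (\<sigma> - 0)"
          unfolding e jT_T0[OF A0] \<sigma>(2) by (rule KF_minus[OF \<sigma>(1) Kf_0])
        then have rA: "(r \<ominus>\<^bsub>MT\<^esub> jT (\<rho> - f)) A = r A" by (simp add: \<sigma>(2))
        show ?thesis
        proof (cases "r A \<in> A")
          case True
          then have "fib f \<in> A" using f(3) A0 by blast
          then have "r A \<oplus>\<^bsub>KF\<^esub> \<ominus>\<^bsub>KF\<^esub> fib f \<in> A" using T_closed(2,3)[OF A] True by blast
          then show ?thesis unfolding rA unfolding a_minus_def .
        next
          case False
          then show ?thesis unfolding rA using f(2) A0 by blast
        qed
      qed
    qed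
    then show ?thesis using v by blast
  qed
qed

lemma genus_T: "K.hdim Kf BG n \<Longrightarrow> arithmetic_genus KF T = int n"
  unfolding arithmetic_genus_def h0_T h1_T by simp

end

theorem delta_invariant_eq:
  assumes ub: "unibranch F q" and \<delta>: "K.hdim AA Oq \<delta>"
  shows "delta_invariant F q = int \<delta>"
proof -
  obtain n a d where na: "K.hdim Kf OG n" "K.hdim Kf AG a" "K.hdim AA Oq d" "n = a + d"
    using h1_difference[OF Gw] .
  have d: "d = \<delta>" using K.hdim_unique[OF subspace_Ow[OF w(2)] na(3) \<delta>] .
  have qF: "q \<in> points F" using w(2) vanishes_iff[OF F] by (simp add: points_def)
  have "curve_model F = insert (fib ` Oq) T0"
    unfolding curve_model_def T0_def stalk_q[symmetric] using qF by blast
  moreover have "arithmetic_genus KF (insert (fib ` Oq) T0) = int n"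
    by (rule genus_T[OF subring_Ow[OF w(2)] subset_refl O_sub_AA])
      (use na(1) in \<open>simp add: BG_def[OF subring_Ow[OF w(2)] subset_refl O_sub_AA] OG_def\<close>)
  moreover have "partial_normalization F q = insert (fib ` AA) T0"
    unfolding partial_normalization_def T0_def unibranch_fibre[OF ub] by blast
  moreover have "arithmetic_genus KF (insert (fib ` AA) T0) = int a"
    by (rule genus_T[OF subring_AA O_sub_AA subset_refl])
      (use na(2) in \<open>simp add: BG_def[OF subring_AA O_sub_AA subset_refl] AG_def\<close>)
  ultimately show ?thesis unfolding delta_invariant_def using na(4) d by simp
qed

end

section \<open>Local expansions along a line\<close>

lemma fps_power_prefix:
  fixes g :: "complex fps"
  assumes "fps_nth g 0 = 0" "i < k"
  shows "fps_nth (g ^ k) i = 0"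
  using startsby_zero_power_prefix[of g k] assms by simp

text \<open>A series of order one is a parameter: its powers are triangular with respect to the
  coefficients, with diagonal entries \<open>fps_nth g 1 ^ j\<close>.\<close>

lemma fps_adic_indep:
  fixes g :: "complex fps"
  assumes g: "fps_nth g 0 = 0" "fps_nth g 1 \<noteq> 0"
    and z: "\<And>i. i < n \<Longrightarrow> fps_nth (\<Sum>j<n. fps_const (e j) * g ^ j) i = 0"
    and j: "j < n"
  shows "e j = 0"
  using j
proof (induction j rule: less_induct)
  case (less j)
  have "0 = fps_nth (\<Sum>k<n. fps_const (e k) * g ^ k) j" using z less.prems by simp
  also have "\<dots> = (\<Sum>k<n. e k * fps_nth (g ^ k) j)" by (simp add: fps_sum_nth)
  also have "\<dots> = (\<Sum>k\<in>{j}. e k * fps_nth (g ^ k) j)"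
  proof (rule sum.mono_neutral_right)
    show "\<forall>k\<in>{..<n} - {j}. e k * fps_nth (g ^ k) j = 0"
    proof
      fix k assume k: "k \<in> {..<n} - {j}"
      then consider "k < j" | "j < k" by force
      then show "e k * fps_nth (g ^ k) j = 0"
      proof cases
        case 1
        then show ?thesis using less.IH[of k] k by simp
      next
        case 2
        then show ?thesis using fps_power_prefix[OF g(1)] by simp
      qed
    qed
  qed (use less.prems in auto)
  finally show ?case using g startsby_zero_power_nth_same[OF g(1), of j] by simp
qed

lemma fps_adic_ex:
  fixes g s :: "complex fps"
  assumes g: "fps_nth g 0 = 0" "fps_nth g 1 \<noteq> 0"
  shows "\<exists>e. \<forall>i<n. fps_nth (s - (\<Sum>j<n. fps_const (e j) * g ^ j)) i = 0"
proof (induction n)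
  case (Suc n)
  then obtain e where e: "\<forall>i<n. fps_nth (s - (\<Sum>j<n. fps_const (e j) * g ^ j)) i = 0" by blast
  define a where "a = fps_nth (s - (\<Sum>j<n. fps_const (e j) * g ^ j)) n / fps_nth g 1 ^ n"
  have "(\<Sum>j<Suc n. fps_const ((e(n := a)) j) * g ^ j) = (\<Sum>j<n. fps_const (e j) * g ^ j) + fps_const a * g ^ n"
    by simp
  then have *: "s - (\<Sum>j<Suc n. fps_const ((e(n := a)) j) * g ^ j)
      = (s - (\<Sum>j<n. fps_const (e j) * g ^ j)) - fps_const a * g ^ n" by simp
  have "fps_nth (s - (\<Sum>j<Suc n. fps_const ((e(n := a)) j) * g ^ j)) i = 0" if "i < Suc n" for i
  proof (cases "i = n")
    case True
    have "fps_nth (g ^ n) n = fps_nth g 1 ^ n" using startsby_zero_power_nth_same[OF g(1)] by simp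
    then show ?thesis unfolding * True using g(2) by (simp add: a_def)
  next
    case False
    then show ?thesis unfolding * using e that fps_power_prefix[OF g(1), of i n] by simp
  qed
  then show ?case by blast
qed simp

context curve
begin

text \<open>Membership is a congruence \<open>P * z * S = y * R * Q\<close> modulo \<open>F\<close>.
  Restricted to the line \<open>y = 0\<close> only a multiple of \<open>F\<close> remains, which
  vanishes to order \<open>n\<close>. The converse is \<open>line_division\<close>.\<close>

lemma line_ideal_iff:
  assumes fr: "frame x y z u v w" and wF: "teval F w = 0"
    and n: "vord F w u n" "poly.coeff (lpoly F w u) n \<noteq> 0"
    and P: "homogeneous d P" and Q: "homogeneous d Q" "teval Q w \<noteq> 0"
  shows "Phi P / Phi Q \<in> (\<lambda>h. Phi y / Phi z * h) ` Ow w \<longleftrightarrow> vord P w u n"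
proof -
  note fd = frameD[OF fr]
  have zw: "teval z w \<noteq> 0" using fd by simp
  have nz: "Phi Q \<noteq> 0" "Phi z \<noteq> 0" using Phi_nz[OF wF] Q zw by auto
  have y0: "y \<noteq> 0" using fd by auto
  show ?thesis
  proof
    assume "Phi P / Phi Q \<in> (\<lambda>h. Phi y / Phi z * h) ` Ow w"
    then obtain h where h: "h \<in> Ow w" "Phi P / Phi Q = Phi y / Phi z * h" by blast
    obtain R S e where RS: "homogeneous e R" "homogeneous e S" "teval S w \<noteq> 0" "h = Phi R / Phi S"
      using h(1) by (rule OwE)
    have nS: "Phi S \<noteq> 0" using Phi_nz[OF wF RS(3)] .
    have "Phi (P * (z * S) - y * (R * Q)) = 0"
      using h(2) nz nS by (simp add: RS(4) Phi_mult Phi_diff field_simps)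
    then have dv: "F dvd P * (z * S) - y * (R * Q)" using Phi_0_iff by blast
    have hz: "homogeneous (d + (1 + e)) (P * (z * S))" by (intro hom_mult P fd RS)
    have hy: "homogeneous (1 + (e + d)) (y * (R * Q))" by (intro hom_mult fd RS Q)
    have "homogeneous (d + (1 + e)) (P * (z * S) - y * (R * Q))"
      using hom_diff[OF hz, of "y * (R * Q)"] hy by (simp add: ac_simps)
    moreover have "c \<le> d + (1 + e)" if "P * (z * S) - y * (R * Q) \<noteq> 0"
      using hom_dvd_degree[OF F calculation dv that] .
    ultimately obtain A a where A: "homogeneous a A" "P * (z * S) - y * (R * Q) = F * A"
      using hom_dvdE[OF F _ dv] by (metis hom_0 mult_zero_right)
    have "vord (P * (z * S) - y * (R * Q)) w u n" unfolding A(2) by (rule vord_mult[OF F A(1) n(1)])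
    moreover have "lpoly (P * (z * S) - y * (R * Q)) w u = lpoly (P * (z * S)) w u"
    proof (rule lpoly_eqI)
      show "poly (lpoly (P * (z * S)) w u) s = teval (P * (z * S) - y * (R * Q)) (w + s *s u)" for s
        unfolding lpoly(3)[OF hz] using frame_eval_line(3)[OF fr, of s] by (simp add: teval_simps)
    qed
    ultimately have "vord (P * (z * S)) w u n" by (simp add: vord_def)
    then have "\<forall>i<n. fps_nth (flp w u P * flp w u (z * S)) i = 0"
      unfolding flp_mult[OF P hom_mult[OF fd(3) RS(2)], symmetric] by (simp add: vord_def flp_def fps_of_poly_nth)
    moreover have "fps_nth (flp w u (z * S)) 0 \<noteq> 0"
      using flp_0[OF hom_mult[OF fd(3) RS(2)]] zw RS(3) by (simp add: teval_simps)
    ultimately have "\<forall>i<n. fps_nth (flp w u P) i = 0" using fps_low_unit by blast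
    then show "vord P w u n" by (simp add: vord_def flp_def fps_of_poly_nth)
  next
    assume "vord P w u n"
    then obtain F1 P1 R where D: "homogeneous (c - n) F1" "teval F1 w \<noteq> 0" "P * F1 = F * P1 + y * R"
      "homogeneous (d + (c - n)) (y * R)" using line_division[OF fr F P n] by metis
    have nF1: "Phi F1 \<noteq> 0" using Phi_nz[OF wF D(2)] .
    have PF: "Phi P * Phi F1 = Phi y * Phi R"
    proof -
      have "Phi (P * F1) = Phi (F * P1) + Phi (y * R)" using D(3) Phi_add by simp
      moreover have "Phi (F * P1) = 0" using Phi_0_iff by simp
      ultimately show ?thesis by (simp add: Phi_mult)
    qed
    \<comment> \<open>The degree of \<open>R\<close> is read off from \<open>y * R\<close>, so that
      the factor \<open>y\<close> may be exchanged for \<open>z\<close>.\<close>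
    have e: "homogeneous (d + (c - n)) (z * R)"
    proof (cases "y * R = 0")
      case True
      then show ?thesis using y0 by simp
    next
      case False
      have le: "1 \<le> d + (c - n)" using hom_dvd_degree[OF fd(2) D(4) _ False] by simp
      obtain R' where R': "homogeneous (d + (c - n) - 1) R'" "y * R = y * R'"
        using hom_dvdE[OF fd(2) D(4) _ le] by (metis dvd_triv_left)
      then have "R' = R" using y0 by simp
      moreover have "1 + (d + (c - n) - 1) = d + (c - n)" using le by simp
      ultimately show ?thesis using hom_mult[OF fd(3) R'(1)] by (simp only:)
    qed
    have "homogeneous (d + (c - n)) (Q * F1)" by (rule hom_mult[OF Q(1) D(1)])
    then have "Phi (z * R) / Phi (Q * F1) \<in> Ow w" using e Q(2) D(2) by (intro OwI) (auto simp: teval_simps)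
    moreover have "Phi P / Phi Q = Phi y / Phi z * (Phi (z * R) / Phi (Q * F1))"
      using nz nF1 PF by (simp add: Phi_mult field_simps)
    ultimately show "Phi P / Phi Q \<in> (\<lambda>h. Phi y / Phi z * h) ` Ow w" by blast
  qed
qed

text \<open>Clearing denominators turns the combination into one fraction
  \<open>Phi M / Phi D\<close>, to which \<open>line_ideal_iff\<close> applies; on the line,
  \<open>M\<close> is the corresponding combination of series times the invertible series of
  \<open>Q\<close>.\<close>

lemma line_combo:
  assumes fr: "frame x y z u v w" and wF: "teval F w = 0"
    and n: "vord F w u n" "poly.coeff (lpoly F w u) n \<noteq> 0"
    and P: "homogeneous d P" and Q: "homogeneous d Q" "teval Q w \<noteq> 0"
    and G: "homogeneous b G"
  shows "Phi P / Phi Q - (\<Sum>j<n. Phi (tconst (e j)) * (Phi G / Phi z ^ b) ^ j) \<in> (\<lambda>h. Phi y / Phi z * h) ` Ow w \<longleftrightarrow>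
    (\<forall>i<n. fps_nth (flp w u P * inverse (flp w u Q) - (\<Sum>j<n. fps_const (e j) * flp w u G ^ j)) i = 0)"
proof -
  note fd = frameD[OF fr]
  have zw: "teval z w \<noteq> 0" using fd by simp
  have nz: "Phi Q \<noteq> 0" "Phi z \<noteq> 0" using Phi_nz[OF wF] Q zw by auto
  define M where "M = P * z ^ (b * n) - (\<Sum>j<n. tconst (e j) * (G ^ j * z ^ (b * (n - j)))) * Q"
  define D where "D = Q * z ^ (b * n)"
  have zh: "homogeneous k (z ^ k)" for k by (rule hom_power1[OF fd(3)])
  have gh: "homogeneous (b * n) (\<Sum>j<n. tconst (e j) * (G ^ j * z ^ (b * (n - j))))"
  proof (rule hom_sum)
    fix j assume "j \<in> {..<n}"
    then have "b * j + b * (n - j) = b * n" by (simp add: distrib_left[symmetric])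
    then show "homogeneous (b * n) (tconst (e j) * (G ^ j * z ^ (b * (n - j))))"
      using hom_mult[OF hom_power[OF G, of j] zh[of "b * (n - j)"]] hom_tconst_mult by (metis mult.commute)
  qed
  have Mh: "homogeneous (d + b * n) M"
    unfolding M_def using hom_diff[OF hom_mult[OF P zh[of "b * n"]]] hom_mult[OF gh Q(1)] by (simp add: add.commute)
  have Dh: "homogeneous (d + b * n) D" unfolding D_def by (rule hom_mult[OF Q(1) zh])
  have Dw: "teval D w \<noteq> 0" using Q(2) zw by (simp add: D_def teval_simps)
  have trm: "(Phi G / Phi z ^ b) ^ j = Phi (G ^ j * z ^ (b * (n - j))) / Phi z ^ (b * n)" if "j < n" for j
  proof -
    have "Phi z ^ (b * n) = Phi z ^ (b * j) * Phi z ^ (b * (n - j))"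
      using that by (simp add: power_add[symmetric] distrib_left[symmetric])
    then show ?thesis using nz by (simp add: Phi_simps power_divide power_mult)
  qed
  have "Phi P / Phi Q - (\<Sum>j<n. Phi (tconst (e j)) * (Phi G / Phi z ^ b) ^ j)
      = Phi P / Phi Q - (\<Sum>j<n. Phi (tconst (e j) * (G ^ j * z ^ (b * (n - j)))) / Phi z ^ (b * n))"
    using trm by (simp add: Phi_mult)
  also have "\<dots> = Phi P / Phi Q - Phi (\<Sum>j<n. tconst (e j) * (G ^ j * z ^ (b * (n - j)))) / Phi z ^ (b * n)"
    by (simp only: Phi_sum sum_divide_distrib)
  also have "\<dots> = Phi M / Phi D"
    unfolding M_def D_def Phi_diff Phi_mult[of _ Q] Phi_mult[of Q] Phi_mult[of P] Phi_power using nz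
    by (simp only: diff_frac_eq[of "Phi Q" "Phi z ^ (b * n)"] power_not_zero not_False_eq_True)
  finally have 1: "Phi P / Phi Q - (\<Sum>j<n. Phi (tconst (e j)) * (Phi G / Phi z ^ b) ^ j) = Phi M / Phi D" .
  have "lpoly M w u = lpoly P w u - (\<Sum>j<n. Polynomial.smult (e j) (lpoly G w u ^ j)) * lpoly Q w u"
  proof (rule lpoly_eqI)
    show "poly (lpoly P w u - (\<Sum>j<n. Polynomial.smult (e j) (lpoly G w u ^ j)) * lpoly Q w u) s = teval M (w + s *s u)" for s
      unfolding M_def using frame_eval_line(1)[OF fr, of s]
      by (simp add: teval_simps lpoly(3)[OF P] lpoly(3)[OF G] lpoly(3)[OF Q(1)] poly_sum poly_power teval_sum)
  qed
  then have fM: "flp w u M = flp w u P - (\<Sum>j<n. fps_const (e j) * flp w u G ^ j) * flp w u Q"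
    by (simp add: flp_def fps_of_poly_diff fps_of_poly_mult fps_of_poly_sum fps_of_poly_smult fps_of_poly_power)
  have q0: "fps_nth (flp w u Q) 0 \<noteq> 0" using flp_0[OF Q(1)] Q(2) by simp
  define A where "A = flp w u P * inverse (flp w u Q) - (\<Sum>j<n. fps_const (e j) * flp w u G ^ j)"
  have "A * flp w u Q = flp w u M"
    unfolding fM A_def using inverse_mult_eq_1[OF q0] by (simp add: left_diff_distrib mult.assoc)
  then have "(\<forall>i<n. fps_nth A i = 0) \<longleftrightarrow> (\<forall>i<n. fps_nth (flp w u M) i = 0)"
    using fps_low_unit[OF q0, of n A] by (simp only:)
  also have "\<dots> \<longleftrightarrow> vord M w u n" by (simp add: vord_def flp_def fps_of_poly_nth)
  finally show ?thesis unfolding 1 line_ideal_iff[OF fr wF n Mh Dh Dw] A_def by blast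
qed

text \<open>Carries the basis of powers of a parameter over from truncated power series. Both
  \<open>x / z\<close> and the equation of a curve crossing the line transversally serve as the
  parameter.\<close>

lemma line_fdim:
  assumes fr: "frame x y z u v w" and wF: "teval F w = 0"
    and n: "vord F w u n" "poly.coeff (lpoly F w u) n \<noteq> 0"
    and G: "homogeneous b G" "teval G w = 0" "poly.coeff (lpoly G w u) 1 \<noteq> 0"
  shows "h \<in> Ow w \<Longrightarrow> \<exists>!e. e \<in> {..<n} \<rightarrow>\<^sub>E UNIV \<and>
    h - (\<Sum>j<n. Phi (tconst (e j)) * (Phi G / Phi z ^ b) ^ j) \<in> (\<lambda>h. Phi y / Phi z * h) ` Ow w"
proof -
  assume "h \<in> Ow w"
  then obtain P Q d where P: "homogeneous d P" and Q: "homogeneous d Q" "teval Q w \<noteq> 0" and h: "h = Phi P / Phi Q"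
    by (rule OwE)
  have g: "fps_nth (flp w u G) 0 = 0" "fps_nth (flp w u G) 1 \<noteq> 0"
    using G flp_0[OF G(1)] by (simp_all add: flp_def fps_of_poly_nth)
  let ?s = "flp w u P * inverse (flp w u Q)"
  show ?thesis
    unfolding h line_combo[OF fr wF n P Q G(1)]
  proof (rule ex_ex1I)
    obtain e where e: "\<forall>i<n. fps_nth (?s - (\<Sum>j<n. fps_const (e j) * flp w u G ^ j)) i = 0"
      using fps_adic_ex[OF g] by blast
    have "(\<Sum>j<n. fps_const (restrict e {..<n} j) * flp w u G ^ j) = (\<Sum>j<n. fps_const (e j) * flp w u G ^ j)"
      by (rule sum.cong) auto
    then show "\<exists>e. e \<in> {..<n} \<rightarrow>\<^sub>E UNIV \<and> (\<forall>i<n. fps_nth (?s - (\<Sum>j<n. fps_const (e j) * flp w u G ^ j)) i = 0)"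
      using e by (intro exI[of _ "restrict e {..<n}"]) auto
  next
    fix e e'
    assume e: "e \<in> {..<n} \<rightarrow>\<^sub>E UNIV \<and> (\<forall>i<n. fps_nth (?s - (\<Sum>j<n. fps_const (e j) * flp w u G ^ j)) i = 0)"
      and e': "e' \<in> {..<n} \<rightarrow>\<^sub>E UNIV \<and> (\<forall>i<n. fps_nth (?s - (\<Sum>j<n. fps_const (e' j) * flp w u G ^ j)) i = 0)"
    have "(\<Sum>j<n. fps_const (e j - e' j) * flp w u G ^ j)
        = (?s - (\<Sum>j<n. fps_const (e' j) * flp w u G ^ j)) - (?s - (\<Sum>j<n. fps_const (e j) * flp w u G ^ j))"
      by (simp add: sum_subtractf[symmetric] left_diff_distrib[symmetric])
    then have "fps_nth (\<Sum>j<n. fps_const (e j - e' j) * flp w u G ^ j) i = 0" if "i < n" for i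
      using e e' that by simp
    then have "e j - e' j = 0" if "j < n" for j using fps_adic_indep[OF g, of n "\<lambda>j. e j - e' j"] that by blast
    then show "e = e'" using e e' by (intro PiE_ext[of _ "{..<n}" "\<lambda>_. UNIV"]) auto
  qed
qed

lemma subspace_line_ideal: "teval F w = 0 \<Longrightarrow> K.subspace ((\<lambda>h. Phi y / Phi z * h) ` Ow w)"
  by (rule subspace_scaled[OF subspace_Ow])

lemma line_hdim:
  assumes fr: "frame x y z u v w" and wF: "teval F w = 0"
    and n: "vord F w u n" "poly.coeff (lpoly F w u) n \<noteq> 0"
  shows "K.hdim (Ow w) ((\<lambda>h. Phi y / Phi z * h) ` Ow w) n"
  unfolding K.hdim_iff_fdim[OF subspace_Ow[OF wF] subspace_line_ideal[OF wF]] K.fdim_def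
proof (rule bexI[of _ "\<lambda>j. (Phi x / Phi z ^ 1) ^ j"])
  note fd = frameD[OF fr]
  have x1: "poly.coeff (lpoly x w u) 1 \<noteq> 0" using fd by (simp add: lpoly_form1[OF fd(1)])
  show "\<forall>h\<in>Ow w. \<exists>!e. e \<in> {..<n} \<rightarrow>\<^sub>E UNIV \<and>
    h - (\<Sum>j<n. Phi (tconst (e j)) * (Phi x / Phi z ^ 1) ^ j) \<in> (\<lambda>h. Phi y / Phi z * h) ` Ow w"
    using line_fdim[OF fr wF n fd(1) fd(9) x1] by blast
  have "Phi x / Phi z ^ 1 \<in> Ow w" using OwI[OF fd(1,3)] fd by simp
  then show "(\<lambda>j. (Phi x / Phi z ^ 1) ^ j) \<in> {..<n} \<rightarrow> Ow w" using Ow_power[OF wF] by blast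
qed

end

section \<open>A field containing the coordinate ring of an irreducible curve\<close>

lemma poly_map_to_ac:
  fixes p q :: "'a :: field poly"
  shows "poly (map_poly to_ac (p + q)) e = poly (map_poly to_ac p) e + poly (map_poly to_ac q) e"
    "poly (map_poly to_ac (p * q)) e = poly (map_poly to_ac p) e * poly (map_poly to_ac q) e"
proof -
  have "map_poly to_ac (p + q) = map_poly to_ac p + map_poly to_ac q"
    by (intro poly_eqI) (simp add: coeff_map_poly)
  then show "poly (map_poly to_ac (p + q)) e = poly (map_poly to_ac p) e + poly (map_poly to_ac q) e" by simp
  have "map_poly to_ac (p * q) = map_poly to_ac p * map_poly to_ac q"
    by (intro poly_eqI) (simp add: coeff_map_poly coeff_mult to_ac_sum)
  then show "poly (map_poly to_ac (p * q)) e = poly (map_poly to_ac p) e * poly (map_poly to_ac q) e" by simp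
qed

text \<open>A nonzero polynomial of least degree vanishing at \<open>e\<close> divides all others
  with this root; by irreducibility it is associated to \<open>f\<close>.\<close>

lemma irreducible_root_dvd:
  fixes f p :: "'a :: field poly"
  assumes f: "Factorial_Ring.irreducible f" and e: "poly (map_poly to_ac f) e = 0" "poly (map_poly to_ac p) e = 0"
  shows "f dvd p"
proof -
  let ?ev = "\<lambda>q. poly (map_poly to_ac q) e"
  have f0: "f \<noteq> 0" using f by auto
  obtain g where g: "g \<noteq> 0" "?ev g = 0" and least: "\<And>q. q \<noteq> 0 \<Longrightarrow> ?ev q = 0 \<Longrightarrow> Polynomial.degree g \<le> Polynomial.degree q"
    using ex_has_least_nat[of "\<lambda>q. q \<noteq> 0 \<and> ?ev q = 0" f Polynomial.degree] f0 e(1) by blast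
  have dvd: "g dvd q" if "?ev q = 0" for q
  proof -
    have "?ev q = ?ev (q div g) * ?ev g + ?ev (q mod g)"
      unfolding poly_map_to_ac[symmetric] by simp
    then have "?ev (q mod g) = 0" using that g(2) by simp
    then have "q mod g = 0" using least[of "q mod g"] degree_mod_less[OF g(1), of q] by force
    then show ?thesis by (simp add: mod_eq_0_iff_dvd)
  qed
  obtain h where h: "f = g * h" using dvd[OF e(1)] by blast
  have "\<not> is_unit g"
  proof
    assume "is_unit g"
    then obtain c where c: "g = [:c:]" by (auto simp: is_unit_poly_iff)
    then have "c \<noteq> 0" using g(1) by simp
    then show False using g(2) by (simp add: c map_poly_pCons)
  qed
  then have "is_unit h" using f h Factorial_Ring.irreducibleD by blast
  then have "f dvd g" using h by (simp add: mult_unit_dvd_iff)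
  then show ?thesis using dvd[OF e(2)] dvd_trans by blast
qed

lemma linear_form_not_unit: "homogeneous 1 l \<Longrightarrow> \<not> is_unit l"
  using hom_dvd_degree[of 1 l 0 1] hom0_const by (metis hom_tconst one_neq_zero not_one_le_zero tconst_1)

lemma form_root:
  assumes "homogeneous d P" "d \<ge> 1"
  shows "teval P v = 0 \<or> (\<exists>s. teval P (u + s *s v) = 0)"
proof (cases "teval P v = 0")
  case False
  then have "Polynomial.degree (lpoly P u v) \<noteq> 0"
    using lpoly(2)[OF assms(1), of u v] assms(2) le_degree[of "lpoly P u v" d] by simp
  then obtain s where "poly (lpoly P u v) s = 0"
    using alg_closed_imp_poly_has_root[of "lpoly P u v"] by blast
  then show ?thesis using lpoly(3)[OF assms(1)] by auto
qed simp

lemma irreducible_not_line: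
  assumes F: "Factorial_Ring.irreducible F" "homogeneous c F" "c \<ge> 2" and fr: "frame x y z u v w"
  shows "lpoly F w u \<noteq> 0"
proof
  assume "lpoly F w u = 0"
  then obtain A where A: "homogeneous (c - 1) A" "F = y * A" using frame_lpoly_0[OF fr F(2)] by blast
  have "\<not> is_unit y" using linear_form_not_unit[OF frameD(2)[OF fr]] .
  then have "A dvd 1" using Factorial_Ring.irreducibleD[OF F(1) A(2)] by blast
  moreover have "homogeneous 0 (1 :: tpoly)" using hom_tconst[of 1] by simp
  ultimately have "c - 1 \<le> 0" using hom_dvd_degree[OF A(1), of 0 1] by simp
  then show False using F(3) by simp
qed

text \<open>If the outermost variable did not occur, the curve would be a cone with vertex
  \<open>(1, 0, 0)\<close>, and joining the vertex to another zero would give a line contained in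
  the curve.\<close>

lemma irreducible_degree:
  assumes F: "Factorial_Ring.irreducible F" "homogeneous c F" "c \<ge> 2"
  shows "Polynomial.degree F \<noteq> 0"
proof
  assume "Polynomial.degree F = 0"
  then obtain f0 where f0: "F = [:f0:]" using degree_eq_zeroE by blast
  let ?w = "axis 1 1 :: complex ^ 3"
  have inv: "teval F (?w + s *s v) = teval F (s *s v)" for s v
    by (simp add: f0 teval_def axis_def)
  obtain x y z u v where fr: "frame x y z u v ?w" by (rule frame_exists[of ?w]) (simp add: axis_eq_0_iff)
  note fd = frameD[OF fr]
  have "\<exists>x' l z' v0 v'. frame x' l z' v0 v' ?w \<and> teval F v0 = 0"
  proof (cases "teval F v = 0")
    case True
    then show ?thesis using frame_swap[OF fr] by blast
  next
    case False
    then obtain s where s: "teval F (u + s *s v) = 0" using form_root[OF F(2)] F(3) by force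
    define l where "l = y - tconst s * x"
    have l: "homogeneous 1 l" "teval l ?w = 0" "teval l v = 1" "teval l u = - s"
      using hom_diff[OF fd(2) hom_tconst_mult[OF fd(1)]] fd by (simp_all add: l_def)
    have "frame x l z (u - (teval l u / teval l v) *s v) ((1 / teval l v) *s v) ?w"
      by (rule frame_change_aux[OF fr l(1,2)]) (simp add: l(3))
    moreover have "u - (teval l u / teval l v) *s v = u + s *s v" by (simp add: l vec_eq_iff)
    ultimately have "frame x l z (u + s *s v) ((1 / teval l v) *s v) ?w" by (simp only:)
    then show ?thesis using s by blast
  qed
  then obtain x' l z' v0 v' where fr': "frame x' l z' v0 v' ?w" "teval F v0 = 0" by blast
  have "lpoly F ?w v0 = 0"
    by (rule lpoly_eqI) (simp add: inv teval_scale[OF F(2)] fr'(2))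
  then show False using irreducible_not_line[OF F fr'(1)] by blast
qed

text \<open>\<open>F\<close> is read as a polynomial in the outermost variable over the field of
  fractions of the polynomials in the other two, and \<open>Phi\<close> is evaluation at one of its
  roots. Since \<open>F\<close> has content 1, Gauss' lemma brings divisibility over that field back
  to the polynomials.\<close>

theorem ex_curve:
  assumes F: "Factorial_Ring.irreducible F" "homogeneous c F" "c \<ge> 2"
  obtains Phi :: "tpoly \<Rightarrow> complex poly poly fract alg_closure" where "curve F c Phi"
proof -
  have irr: "Factorial_Ring.irreducible (fract_poly F)" "content F = 1"
    using nonconst_poly_irreducible_iff[OF irreducible_degree[OF F]] F(1) by auto
  have "Polynomial.degree (map_poly to_ac (fract_poly F)) = Polynomial.degree F"
    by (simp add: degree_map_poly)
  then obtain e where e: "poly (map_poly to_ac (fract_poly F)) e = 0"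
    using alg_closed_imp_poly_has_root[of "map_poly to_ac (fract_poly F)"] irreducible_degree[OF F] by auto
  define Phi where "Phi P = poly (map_poly to_ac (fract_poly P)) e" for P :: tpoly
  have "curve F c Phi"
  proof
    show "homogeneous c F" "2 \<le> c" "F \<noteq> 0" using F by auto
    show "Phi (P + Q) = Phi P + Phi Q" "Phi (P * Q) = Phi P * Phi Q" for P Q
      by (simp_all add: Phi_def poly_map_to_ac)
    show "Phi 1 = 1" by (simp add: Phi_def)
    show "Phi P = 0 \<longleftrightarrow> F dvd P" for P
    proof
      assume "Phi P = 0"
      then have "fract_poly F dvd fract_poly P"
        using irreducible_root_dvd[OF irr(1) e] by (simp add: Phi_def)
      then show "F dvd P" using fract_poly_dvdD irr(2) by blast
    next
      assume "F dvd P"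
      then show "Phi P = 0" using e by (auto simp: Phi_def poly_map_to_ac)
    qed
  qed
  then show ?thesis using that by blast
qed

section \<open>Orders along lines\<close>

lemma lcoeff_lin:
  assumes "homogeneous 1 l" "homogeneous d A"
  shows "poly.coeff (lpoly (l * A) w e) i =
    teval l w * poly.coeff (lpoly A w e) i + teval l e * (case i of 0 \<Rightarrow> 0 | Suc j \<Rightarrow> poly.coeff (lpoly A w e) j)"
  unfolding lpoly_mult[OF assms] lpoly_form1[OF assms(1)] by (simp add: coeff_pCons split: nat.split)

lemma lcoeff_scale:
  assumes "homogeneous d P"
  shows "poly.coeff (lpoly P w (a *s u)) i = a ^ i * poly.coeff (lpoly P w u) i"
proof -
  have "lpoly P w (a *s u) = pcompose (lpoly P w u) [:0, a:]"
    by (rule lpoly_eqI) (simp add: poly_pcompose lpoly(3)[OF assms] mult.commute)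
  then show ?thesis by (simp add: coeff_pcompose_linear)
qed

text \<open>Polynomial dependence on the direction allows finitely many exceptional directions to be
  avoided.\<close>

lemma lcoeff_poly:
  assumes "homogeneous d P"
  shows "\<exists>p. \<forall>t. poly.coeff (lpoly P w (u + t *s v)) i = poly p t"
  using assms
proof (induction arbitrary: i rule: form_induct)
  case (const a)
  show ?case by (intro exI[of _ "[:poly.coeff [:a:] i:]"]) (simp add: lpoly_tconst)
next
  case (step d A B C)
  have *: "\<exists>p. \<forall>t. poly.coeff (lpoly (l * A) w (u + t *s v)) i = poly p t"
    if l: "homogeneous 1 l" and A: "homogeneous d A"
      and IH: "\<And>i. \<exists>p. \<forall>t. poly.coeff (lpoly A w (u + t *s v)) i = poly p t" for l A
  proof -
    obtain p where p: "\<And>i t. poly.coeff (lpoly A w (u + t *s v)) i = poly (p i) t" using IH by metis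
    show ?thesis
      unfolding lcoeff_lin[OF l A] p form1_add[OF l] form1_scale[OF l]
      by (intro exI[of _ "Polynomial.smult (teval l w) (p i) +
          [:teval l u, teval l v:] * (case i of 0 \<Rightarrow> 0 | Suc j \<Rightarrow> p j)"])
        (simp add: algebra_simps split: nat.split)
  qed
  have h: "homogeneous 1 X1" "homogeneous 1 X2" "homogeneous 1 X3" by simp_all
  note hd = hom_mult[OF h(1) step(1)] hom_mult[OF h(2) step(2)] hom_mult[OF h(3) step(3)]
  obtain p1 p2 p3 where p: "\<forall>t. poly.coeff (lpoly (X1 * A) w (u + t *s v)) i = poly p1 t"
    "\<forall>t. poly.coeff (lpoly (X2 * B) w (u + t *s v)) i = poly p2 t"
    "\<forall>t. poly.coeff (lpoly (X3 * C) w (u + t *s v)) i = poly p3 t"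
    using *[OF h(1) step(1,4)] *[OF h(2) step(2,5)] *[OF h(3) step(3,6)] by blast
  show ?case
    by (rule exI[of _ "p1 + p2 + p3"]) (simp add: lpoly_add[OF hom_add[OF hd(1,2)] hd(3)] lpoly_add[OF hd(1,2)] p)
qed

text \<open>Restricted to \<open>w + s(u + aw) = (1 + as)w + su\<close>, a form of degree \<open>d\<close> is obtained from its
  restriction to \<open>w + su\<close> by homogenizing.\<close>

lemma vord_shift:
  assumes P: "homogeneous d P" and v: "vord P w u r"
  shows "vord P w (u + a *s w) r"
proof -
  define c where "c i = poly.coeff (lpoly P w u) i" for i
  define p where "p = (\<Sum>i\<le>d. Polynomial.smult (c i) (Polynomial.monom 1 i * [:1, a:] ^ (d - i)))"
  have ev: "poly p s = poly (lpoly P w (u + a *s w)) s" if "1 + a * s \<noteq> 0" for s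
  proof -
    let ?k = "1 + a * s"
    have "w + s *s (u + a *s w) = ?k *s (w + (s / ?k) *s u)"
      using that by (simp add: vec_eq_iff distrib_left distrib_right mult.assoc mult.commute)
        (simp add: field_simps)
    then have "poly (lpoly P w (u + a *s w)) s = ?k ^ d * poly (lpoly P w u) (s / ?k)"
      using teval_scale[OF P] by (simp add: lpoly(3)[OF P])
    also have "poly (lpoly P w u) (s / ?k) = (\<Sum>i\<le>d. c i * (s / ?k) ^ i)"
      unfolding c_def poly_altdef using lpoly(1)[OF P, of w u]
      by (intro sum.mono_neutral_left) (auto simp: coeff_eq_0)
    also have "?k ^ d * \<dots> = (\<Sum>i\<le>d. c i * (s ^ i * ?k ^ (d - i)))"
      unfolding sum_distrib_left
    proof (rule sum.cong)
      fix i assume "i \<in> {..d}"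
      then have "?k ^ d = ?k ^ i * ?k ^ (d - i)" by (simp add: power_add[symmetric])
      then show "?k ^ d * (c i * (s / ?k) ^ i) = c i * (s ^ i * ?k ^ (d - i))"
        using that by (simp add: power_divide)
    qed simp
    finally show ?thesis by (simp add: p_def poly_sum poly_monom mult.commute)
  qed
  \<comment> \<open>The identity is known except where \<open>1 + a * s = 0\<close>; the additional
    factor vanishes at that parameter.\<close>
  have "(p - lpoly P w (u + a *s w)) * [:1, a:] = 0"
  proof (rule poly_ext)
    show "poly ((p - lpoly P w (u + a *s w)) * [:1, a:]) s = poly 0 s" for s
    proof (cases "1 + a * s = 0")
      case True
      then have "poly [:1, a:] s = 0" by (simp add: mult.commute)
      then show ?thesis by (simp only: poly_mult mult_zero_right poly_0)
    next
      case False
      then show ?thesis using ev[of s] by simp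
    qed
  qed
  then have "p - lpoly P w (u + a *s w) = 0 \<or> [:1, a:] = 0" by (simp only: mult_eq_0_iff)
  then have e: "lpoly P w (u + a *s w) = p" by simp
  have "poly.coeff p i = 0" if "i < r" for i
    unfolding p_def coeff_sum
  proof (rule sum.neutral, rule ballI)
    fix j assume "j \<in> {..d}"
    show "poly.coeff (Polynomial.smult (c j) (Polynomial.monom 1 j * [:1, a:] ^ (d - j))) i = 0"
    proof (cases "j < r")
      case True
      then show ?thesis using v by (simp add: vord_def c_def)
    next
      case False
      then show ?thesis using that by (simp add: coeff_monom_mult)
    qed
  qed
  then show ?thesis by (simp add: vord_def e)
qed

text \<open>A direction of contact exactly \<open>m\<close> is, up to a multiple of
  \<open>w\<close>, a combination of \<open>u\<close> and \<open>v\<close>. Moving it along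
  \<open>v\<close> preserves the contact for all but finitely many values, so its component along
  \<open>v\<close> can be made nonzero and then rescaled to 1.\<close>

lemma ex_direction:
  assumes fr: "frame x L z u v w" and F: "homogeneous d F"
    and m: "\<And>e. vord F w e m" "\<not> vord F w e0 (Suc m)"
  obtains a where "poly.coeff (lpoly F w (a *s u + v)) m \<noteq> 0"
proof -
  define \<alpha> \<beta> \<gamma> where "\<alpha> = teval x e0" and "\<beta> = teval L e0" and "\<gamma> = teval z e0"
  have e0: "e0 = (\<alpha> *s u + \<beta> *s v) + \<gamma> *s w" using fr unfolding frame_def \<alpha>_def \<beta>_def \<gamma>_def by blast
  have "\<not> vord F w (\<alpha> *s u + \<beta> *s v) (Suc m)" using vord_shift[OF F] m(2) e0 by metis
  then have c0: "poly.coeff (lpoly F w (\<alpha> *s u + \<beta> *s v)) m \<noteq> 0"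
    using m(1) by (auto simp: vord_def less_Suc_eq)
  obtain p where p: "\<And>t. poly.coeff (lpoly F w ((\<alpha> *s u + \<beta> *s v) + t *s v)) m = poly p t"
    using lcoeff_poly[OF F] by blast
  have "poly p 0 \<noteq> 0" using p[of 0] c0 by simp
  then have "finite {t. poly p t = 0}" by (intro poly_roots_finite) auto
  then have "finite (insert (- \<beta>) {t. poly p t = 0})" by simp
  then obtain t where t: "t \<noteq> - \<beta>" "poly p t \<noteq> 0"
    using ex_new_if_finite[OF infinite_UNIV_char_0] by (metis (mono_tags, lifting) insert_iff mem_Collect_eq)
  define k where "k = \<beta> + t"
  have k: "k \<noteq> 0" using t(1) by (simp add: k_def add_eq_0_iff)
  have "(\<alpha> *s u + \<beta> *s v) + t *s v = k *s ((\<alpha> / k) *s u + v)"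
    using k by (simp add: vec_eq_iff distrib_left) (simp add: k_def distrib_right)
  then have "k ^ m * poly.coeff (lpoly F w ((\<alpha> / k) *s u + v)) m \<noteq> 0"
    using p[of t] t(2) lcoeff_scale[OF F] by metis
  then show ?thesis using that[of "\<alpha> / k"] by simp
qed

text \<open>Only the second line changes: \<open>x'\<close> is the equation of the line with
  direction \<open>a *s u + v\<close>, while \<open>L\<close> and its direction \<open>u\<close>
  remain.\<close>

lemma frame_change_direction:
  assumes fr: "frame x L z u v w"
  obtains x' where "frame x' L z u (a *s u + v) w"
proof -
  note fd = frameD[OF fr]
  let ?x = "x - tconst a * L"
  have x: "homogeneous 1 ?x" by (intro hom_diff hom_tconst_mult fd)
  have t: "teval ?x u = 1" "teval ?x v = - a" "teval ?x w = 0" using fd by simp_all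
  have "frame L ?x z (v - (teval ?x v / teval ?x u) *s u) ((1 / teval ?x u) *s u) w"
    by (rule frame_change_aux[OF frame_swap[OF fr] x t(3)]) (simp only: t one_neq_zero not_False_eq_True)
  moreover have "v - (teval ?x v / teval ?x u) *s u = a *s u + v" "(1 / teval ?x u) *s u = u"
    unfolding t by (simp_all add: vec_eq_iff)
  ultimately have "frame L ?x z (a *s u + v) u w" by (simp only:)
  then show ?thesis using frame_swap that by blast
qed

text \<open>Splits \<open>x ^ l\<close> off the restriction of \<open>B\<close> to the line
  \<open>L\<close>; the value of \<open>G1\<close> at \<open>w\<close> is the lowest
  coefficient.\<close>

lemma line_expansion:
  assumes fr: "frame x L z u v w" and B: "homogeneous b B" and l: "vord B w u l" "poly.coeff (lpoly B w u) l \<noteq> 0"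
  obtains G1 A where "l \<le> b" "homogeneous (b - l) G1" "homogeneous (b - 1) A" "B = x ^ l * G1 + L * A" "teval G1 w \<noteq> 0"
proof -
  note fd = frameD[OF fr]
  define c where "c i = poly.coeff (lpoly B w u) i" for i
  obtain A where A: "homogeneous (b - 1) A" "B = binform x z b (lpoly B w u) + L * A" using frame_line[OF fr B] .
  have lb: "l \<le> b" using l(2) lpoly(1)[OF B, of w u] le_degree le_trans by blast
  define G1 where "G1 = (\<Sum>i\<in>{l..b}. tconst (c i) * (x ^ (i - l) * z ^ (b - i)))"
  have hG: "homogeneous (b - l) G1"
    unfolding G1_def
  proof (intro hom_sum hom_tconst_mult)
    fix i assume "i \<in> {l..b}"
    then have "(i - l) + (b - i) = b - l" by auto
    then show "homogeneous (b - l) (x ^ (i - l) * z ^ (b - i))"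
      using hom_mult[OF hom_power1[OF fd(1), of "i - l"] hom_power1[OF fd(3), of "b - i"]] by (simp only:)
  qed
  have "binform x z b (lpoly B w u) = (\<Sum>i\<in>{l..b}. tconst (c i) * (x ^ i * z ^ (b - i)))"
    unfolding binform_def c_def using l(1) by (intro sum.mono_neutral_right) (auto simp: vord_def)
  also have "\<dots> = x ^ l * G1"
    unfolding G1_def sum_distrib_left
  proof (rule sum.cong)
    fix i assume "i \<in> {l..b}"
    then have "x ^ i = x ^ l * x ^ (i - l)" by (simp add: power_add[symmetric])
    then show "tconst (c i) * (x ^ i * z ^ (b - i)) = x ^ l * (tconst (c i) * (x ^ (i - l) * z ^ (b - i)))"
      by (simp only: ac_simps)
  qed simp
  finally have B': "B = x ^ l * G1 + L * A" using A(2) by simp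
  have "teval G1 w = (\<Sum>i\<in>{l..b}. if i = l then c l else 0)"
    unfolding G1_def teval_sum by (rule sum.cong) (use fd in \<open>auto simp: power_0_left\<close>)
  then have "teval G1 w \<noteq> 0" using lb l(2) by (simp add: c_def)
  then show ?thesis using that lb hG A(1) B' by blast
qed

text \<open>As \<open>l \<ge> 2\<close>, the linear part of \<open>B\<close> at \<open>w\<close> is
  \<open>teval A w\<close> times \<open>L\<close>. The direction \<open>d\<close> shows that it is
  nonzero, and \<open>L\<close> does not vanish on \<open>v\<close>.\<close>

lemma tangent_coeff:
  assumes fr: "frame x L z u v w" and B: "homogeneous b B" "2 \<le> l" "b \<ge> 1"
    and e: "homogeneous (b - l) G1" "homogeneous (b - 1) A" "B = x ^ l * G1 + L * A" "l \<le> b"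
    and d: "\<not> vord B w d 2"
  shows "teval A w \<noteq> 0" "poly.coeff (lpoly B w v) 1 \<noteq> 0"
proof -
  note fd = frameD[OF fr]
  have x: "homogeneous (b - 1) (x ^ (l - 1) * G1)"
    using hom_mult[OF hom_power1[OF fd(1), of "l - 1"] e(1)] B(2) e(4) by simp
  have xx: "x ^ l * G1 = x * (x ^ (l - 1) * G1)" using B(2) by (cases l) (auto simp: mult.assoc)
  have xw: "teval (x ^ (l - 1) * G1) w = 0" using fd B(2) by (simp add: power_0_left)
  have "1 + (b - 1) = b" using B(3) by simp
  then have hh: "homogeneous b (x * (x ^ (l - 1) * G1))" "homogeneous b (L * A)"
    using hom_mult[OF fd(1) x] hom_mult[OF fd(2) e(2)] by (simp_all only:)
  have c1: "poly.coeff (lpoly B w d) 1 = teval L d * teval A w" for d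
    unfolding e(3) xx lpoly_add[OF hh] coeff_add lcoeff_lin[OF fd(1) x] lcoeff_lin[OF fd(2) e(2)]
    using fd lpoly_coeff0[OF x, of w d] lpoly_coeff0[OF e(2), of w d] xw by simp
  have c0: "poly.coeff (lpoly B w d) 0 = 0" for d
    using lpoly_coeff0[OF B(1)] fd B(2) by (simp add: e(3) power_0_left)
  have "poly.coeff (lpoly B w d) 1 \<noteq> 0" using d c0[of d] by (auto simp: vord_def less_2_cases_iff)
  then show A: "teval A w \<noteq> 0" using c1 by auto
  then show "poly.coeff (lpoly B w v) 1 \<noteq> 0" using c1[of v] fd by simp
qed

section \<open>The contact orders and the bound at a unibranch point\<close>

context curve_unibranch
begin

context
  fixes x L z u e l n k d
  assumes fr: "frame x L z u e w" and b2: "b \<ge> 2"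
    and l: "vord G w u l" "poly.coeff (lpoly G w u) l \<noteq> 0" "l \<ge> 2" and d: "\<not> vord G w d 2"
    and n: "vord F w u n" "poly.coeff (lpoly F w u) n \<noteq> 0"
    and k: "vord F w e k" "poly.coeff (lpoly F w e) k \<noteq> 0"
begin

text \<open>In this context \<open>n\<close> and \<open>k\<close> are the contact orders of the
  curve with the lines \<open>L\<close> and \<open>x\<close>, \<open>l\<close> is that of
  \<open>G\<close> with \<open>L\<close>, and \<open>d\<close> witnesses that \<open>G\<close> is
  smooth at \<open>w\<close>.\<close>

lemma quotients:
  shows "Phi x / Phi z \<in> Oq" "Phi x / Phi z \<noteq> 0" "K.hdim Oq ((\<lambda>r. Phi x / Phi z * r) ` Oq) k"
    "Phi L / Phi z \<in> Oq" "Phi L / Phi z \<noteq> 0" "K.hdim Oq ((\<lambda>r. Phi L / Phi z * r) ` Oq) n"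
    "Phi G / Phi z ^ b \<in> Oq" "Phi G / Phi z ^ b \<noteq> 0" "Phi z \<noteq> 0"
proof -
  note fd = frameD[OF fr]
  have zw: "teval z w \<noteq> 0" using fd by simp
  show z0: "Phi z \<noteq> 0" by (rule Phi_nz[OF w(2) zw])
  have nz: "Phi y \<noteq> 0" if "homogeneous 1 y" "y \<noteq> 0" for y using Phi_low[OF that(1)] that(2) c2 by simp
  have ne: "x \<noteq> 0" "L \<noteq> 0" using fd by auto
  show "Phi x / Phi z \<in> Oq" "Phi L / Phi z \<in> Oq" using OwI[OF fd(1,3) zw] OwI[OF fd(2,3) zw] .
  show "Phi x / Phi z \<noteq> 0" "Phi L / Phi z \<noteq> 0" using nz fd(1,2) ne z0 by simp_all
  show "K.hdim Oq ((\<lambda>r. Phi x / Phi z * r) ` Oq) k" by (rule line_hdim[OF frame_swap[OF fr] w(2) k])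
  show "K.hdim Oq ((\<lambda>r. Phi L / Phi z * r) ` Oq) n" by (rule line_hdim[OF fr w(2) n])
  show "Phi G / Phi z ^ b \<in> Oq"
    using OwI[OF G(1) hom_power1[OF fd(3)]] zw by (simp add: Phi_power)
  show "Phi G / Phi z ^ b \<noteq> 0" using G(2) z0 by simp
qed

lemma line_orders: "n = l * k"
proof -
  note fd = frameD[OF fr]
  have zw: "teval z w \<noteq> 0" using fd by simp
  obtain G1 A where e: "l \<le> b" "homogeneous (b - l) G1" "homogeneous (b - 1) A" "G = x ^ l * G1 + L * A" "teval G1 w \<noteq> 0"
    using line_expansion[OF fr G(1) l(1,2)] .
  have Aw: "teval A w \<noteq> 0" by (rule tangent_coeff(1)[OF fr G(1) l(3) G(3) e(2-4,1) d])
  have unit: "Phi P / Phi z ^ i \<in> Oq \<and> Phi P / Phi z ^ i \<noteq> 0 \<and> inverse (Phi P / Phi z ^ i) \<in> Oq"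
    if P: "homogeneous i P" "teval P w \<noteq> 0" for P i
  proof -
    have zi: "homogeneous i (z ^ i)" "teval (z ^ i) w \<noteq> 0" using hom_power1[OF fd(3)] zw by simp_all
    show ?thesis
      using OwI[OF P(1) zi] OwI[OF zi(1) P] Phi_nz[OF w(2) P(2)] quotients(9) by (simp add: Phi_power)
  qed
  note u1 = unit[OF e(2,5)] and u2 = unit[OF e(3) Aw]
  have "Phi z ^ b = Phi z ^ l * Phi z ^ (b - l)" "Phi z ^ b = Phi z * Phi z ^ (b - 1)"
    using e(1) G(3) by (simp_all add: power_add[symmetric] power_Suc[symmetric])
  then have rel: "Phi G / Phi z ^ b = (Phi x / Phi z) ^ l * (Phi G1 / Phi z ^ (b - l)) + Phi L / Phi z * (Phi A / Phi z ^ (b - 1))"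
    unfolding e(4) Phi_add Phi_mult Phi_power by (simp add: add_divide_distrib power_divide)
  obtain N where N: "K.hdim Oq ((\<lambda>r. Phi G / Phi z ^ b * r) ` Oq) N"
    using hdim_Ow_ex[OF w quotients(7,8)] .
  \<comment> \<open>A line has contact at most \<open>c\<close> with the curve, whereas
    \<open>N \<ge> 2 * c\<close> by Bezout; this is the strict inequality that
    \<open>order_relation\<close> requires, and the reason why \<open>b \<ge> 2\<close> is
    assumed.\<close>
  have "c * b \<le> N" using hdim_O_ge[OF fd(3) zw] N by blast
  moreover have "n \<le> c" using n(2) lpoly(1)[OF F, of w u] le_degree le_trans by blast
  moreover have "c * 2 \<le> c * b" using b2 by simp
  ultimately have "n < N" using c2 by linarith
  then show ?thesis
    using order_relation[OF quotients(1-3) quotients(4-6) quotients(7,8) N _ rel] u1 u2 by blast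
qed

text \<open>\<open>G\<close> crosses the line \<open>x\<close> transversally, so its powers span the
  local ring modulo \<open>x\<close>; \<open>delta_bound\<close> is applied to \<open>x\<close> and
  \<open>G\<close>.\<close>

lemma delta_ge:
  assumes \<delta>: "K.hdim AA Oq \<delta>" and k0: "k > 0"
  shows "(real k - 1) * (real b * real c - real k) / 2 \<le> real \<delta>"
proof -
  note fd = frameD[OF fr]
  have zw: "teval z w \<noteq> 0" using fd by simp
  obtain G1 A where e: "l \<le> b" "homogeneous (b - l) G1" "homogeneous (b - 1) A" "G = x ^ l * G1 + L * A" "teval G1 w \<noteq> 0"
    using line_expansion[OF fr G(1) l(1,2)] .
  have c1: "poly.coeff (lpoly G w e) 1 \<noteq> 0" by (rule tangent_coeff(2)[OF fr G(1) l(3) G(3) e(2-4,1) d])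
  obtain N where N: "K.hdim Oq ((\<lambda>r. Phi G / Phi z ^ b * r) ` Oq) N"
    using hdim_Ow_ex[OF w quotients(7,8)] .
  have cb: "c * b \<le> N" using hdim_O_ge[OF fd(3) zw] N by blast
  have span: "\<exists>a h'. h' \<in> Oq \<and> h = (\<Sum>j<k. Phi (tconst (a j)) * (Phi G / Phi z ^ b) ^ j) + Phi x / Phi z * h'"
    if h: "h \<in> Oq" for h
  proof -
    obtain a where "h - (\<Sum>j<k. Phi (tconst (a j)) * (Phi G / Phi z ^ b) ^ j) \<in> (\<lambda>h. Phi x / Phi z * h) ` Oq"
      using line_fdim[OF frame_swap[OF fr] w(2) k G(1) Gw c1 h] by blast
    then obtain h' where h': "h' \<in> Oq" "h - (\<Sum>j<k. Phi (tconst (a j)) * (Phi G / Phi z ^ b) ^ j) = Phi x / Phi z * h'"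
      by (rule imageE) blast
    then have "h = (\<Sum>j<k. Phi (tconst (a j)) * (Phi G / Phi z ^ b) ^ j) + Phi x / Phi z * h'"
      by (simp add: diff_eq_eq add.commute)
    then show ?thesis using h'(1) by blast
  qed
  have "(\<Sum>j<k. (j * N) div k) \<le> \<delta>"
    by (rule delta_bound[OF quotients(1-3) quotients(7,8) N span \<delta> k0])
  then have "(real k - 1) * (real N - real k) / 2 \<le> real \<delta>"
    using floor_sum_bound[OF k0, of N] by linarith
  moreover have "(real k - 1) * (real b * real c - real k) \<le> (real k - 1) * (real N - real k)"
  proof (rule mult_left_mono)
    have "real (c * b) \<le> real N" using cb by (simp only: of_nat_le_iff)
    then show "real b * real c - real k \<le> real N - real k" by (simp add: mult.commute)
  qed (use k0 in simp)
  ultimately show ?thesis by linarith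
qed

end

end

lemma ex_order:
  assumes F: "Factorial_Ring.irreducible F" "homogeneous c F" "c \<ge> 2" and fr: "frame x y z u v w"
  obtains n where "vord F w u n" "poly.coeff (lpoly F w u) n \<noteq> 0"
proof -
  have "\<exists>n. poly.coeff (lpoly F w u) n \<noteq> 0"
    using irreducible_not_line[OF F fr] by (auto simp: poly_eq_iff)
  then obtain n where n: "poly.coeff (lpoly F w u) n \<noteq> 0" "\<forall>i. poly.coeff (lpoly F w u) i \<noteq> 0 \<longrightarrow> n \<le> i"
    using ex_has_least_nat[of "\<lambda>n. poly.coeff (lpoly F w u) n \<noteq> 0" _ "\<lambda>n. n"] by auto
  then have "vord F w u n" unfolding vord_def by (meson linorder_not_less)
  then show ?thesis using that n(1) by blast
qed

lemma vord_le: "vord F w u r \<Longrightarrow> poly.coeff (lpoly F w u) n \<noteq> 0 \<Longrightarrow> r \<le> n"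
  unfolding vord_def by (meson linorder_not_less)

text \<open>Otherwise every point of \<open>C\<close> would be common to both curves, but
  \<open>C\<close> also has a point on the line \<open>z = 0\<close>, which does not pass through
  \<open>q\<close>.\<close>

lemma not_component:
  assumes B: "Factorial_Ring.irreducible B" "homogeneous b B" "b \<ge> 2"
    and C: "Factorial_Ring.irreducible C" "homogeneous c C" "c \<ge> 2"
    and q: "points B \<inter> points C = {q}"
  shows "\<not> C dvd B"
proof
  assume "C dvd B"
  obtain x y z u v where fr: "frame x y z u v (vec_of q)" using frame_exists[OF vec_of(2)] .
  note fd = frameD[OF fr]
  have "\<exists>p. p \<noteq> 0 \<and> teval z p = 0 \<and> teval C p = 0"
  proof (cases "teval C v = 0")
    case True
    moreover have "v \<noteq> 0" using fd(11) form1_scale[OF fd(2), of 0 0] by auto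
    ultimately show ?thesis using fd by (intro exI[of _ v]) auto
  next
    case False
    then obtain s where s: "teval C (u + s *s v) = 0" using form_root[OF C(2)] C(3) by force
    have "teval x (u + s *s v) = 1" "teval z (u + s *s v) = 0" using fd by (simp_all add: form1_add form1_scale)
    moreover have "teval x 0 = 0" using form1_scale[OF fd(1), of 0 0] by simp
    ultimately show ?thesis using s by (intro exI[of _ "u + s *s v"]) auto
  qed
  then obtain p where p: "p \<noteq> 0" "teval z p = 0" "teval C p = 0" by blast
  obtain p' a where p': "p = a *s vec_of p'" "a \<noteq> 0" using ex_point[OF p(1)] .
  have Cp: "teval C (vec_of p') = 0" using p(3) teval_scale[OF C(2)] p' by simp
  obtain R where R: "B = C * R" using \<open>C dvd B\<close> by blast
  have "teval B (vec_of p') = 0" using R Cp by simp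
  then have "p' \<in> points B \<inter> points C" using Cp vanishes_iff[OF B(2)] vanishes_iff[OF C(2)] by (simp add: points_def)
  then have "p' = q" using q by blast
  then have "teval z p = a" using p'(1) fd form1_scale[OF fd(3)] by simp
  then show False using p(2) p'(2) by simp
qed

theorem theorem2p2p1:
  fixes B C :: tpoly and q :: proj_plane and deg_B deg_C l m n :: nat
  assumes "integral_plane_curve deg_B B" and "deg_B \<ge> 2"
    and "integral_plane_curve deg_C C" and "deg_C \<ge> 2"
    and "points B \<inter> points C = {q}"
    and "mn_point B q 1 l"
    and "mn_point C q m n"
  shows "n = l * m \<and>
    real_of_int (delta_invariant C q) \<ge> (real m - 1) * (real deg_B * real deg_C - real m) / 2"
proof -
  let ?w = "vec_of q"
  have B: "Factorial_Ring.irreducible B" "homogeneous deg_B B" "deg_B \<ge> 2"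
    and C: "Factorial_Ring.irreducible C" "homogeneous deg_C C" "deg_C \<ge> 2"
    using assms(1-4) by (auto simp: integral_plane_curve_def)
  have nz: "B \<noteq> 0" "C \<noteq> 0" using B(1) C(1) by auto
  obtain L where Bq: "curve_mult B q = 1" "tangent_line B q L" "l = int_mult B L q"
    using assms(6) by (auto simp: mn_point_def)
  obtain L' where Cq: "unibranch C q" "m = curve_mult C q" "tangent_line C q L'" "n = int_mult C L' q"
    using assms(7) by (auto simp: mn_point_def)
  have van: "vanishes B q" "vanishes C q" using assms(5) by (auto simp: points_def)
  have w0: "teval B ?w = 0" "teval C ?w = 0" using van vanishes_iff[OF B(2)] vanishes_iff[OF C(2)] by auto
  have L: "homogeneous 1 L" "L \<noteq> 0" "teval L ?w = 0" and L': "homogeneous 1 L'" "L' \<noteq> 0" "teval L' ?w = 0"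
    using Bq(2) Cq(3) vanishes_iff by (auto simp: tangent_line_def)
  obtain Phi :: "tpoly \<Rightarrow> complex poly poly fract alg_closure" where Phi: "curve C deg_C Phi" using ex_curve[OF C] .
  \<comment> \<open>All local rings are those of \<open>C\<close>; the curve \<open>B\<close> enters
    only as the form \<open>G\<close>.\<close>
  interpret curve_at C deg_C Phi q B deg_B
  proof (intro curve_at.intro curve_pointed.intro curve_point.intro Phi curve_point_axioms.intro curve_pointed_axioms.intro)
    show "?w \<noteq> 0" by (rule vec_of(2))
    show "teval C ?w = 0" "teval B ?w = 0" by (rule w0)+
    show "homogeneous deg_B B" by (rule B(2))
    show "Phi B \<noteq> 0" using not_component[OF B C assms(5)] curve.Phi_0_iff[OF Phi] by blast
    show "1 \<le> deg_B" using B(3) by simp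
    fix v assume v: "v \<noteq> 0" "teval C v = 0" "teval B v = 0"
    obtain p a where p: "v = a *s vec_of p" "a \<noteq> 0" using ex_point[OF v(1)] .
    have "teval C (vec_of p) = 0" "teval B (vec_of p) = 0"
      using v(2,3) teval_scale[OF B(2)] teval_scale[OF C(2)] p by auto
    then have "p \<in> points B \<inter> points C" using vanishes_iff[OF B(2)] vanishes_iff[OF C(2)] by (simp add: points_def)
    then have "p = q" using assms(5) by blast
    then show "\<exists>a. v = a *s ?w" using p(1) by blast
  qed
  interpret U: curve_unibranch C deg_C Phi ?w B deg_B
    by (intro curve_unibranch.intro curve_pointed_axioms curve_unibranch_axioms.intro unibranch_local[OF Cq(1)])
  obtain \<delta> where \<delta>: "K.hdim AA Oq \<delta>" using hdim_AA_Oq .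
  have \<delta>': "delta_invariant C q = int \<delta>" by (rule delta_invariant_eq[OF Cq(1) \<delta>])
  obtain d where d: "\<not> vord B ?w d 2" using curve_mult(2)[OF B(2) nz(1), of q] Bq(1) by (auto simp: numeral_2_eq_2)
  have tangent: "vord B ?w u l \<and> poly.coeff (lpoly B ?w u) l \<noteq> 0 \<and> l \<ge> 2" if fr: "frame x L z u v ?w" for x z u v
  proof -
    obtain i where i: "vord B ?w u i" "poly.coeff (lpoly B ?w u) i \<noteq> 0" using ex_order[OF B fr] .
    have "i = l" using int_mult_line[OF fr B(2) i] Bq(3) by simp
    moreover have "vord B ?w u 2"
      using tangent_vord[OF B(2) nz(1) van(1) Bq(2) fr] Bq(1) by (simp add: numeral_2_eq_2)
    ultimately show ?thesis using i vord_le by blast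
  qed
  have orders: "int_mult C L q = l * k"
    if fr: "frame x L z u e ?w" and k: "vord C ?w e k" "poly.coeff (lpoly C ?w e) k \<noteq> 0" for x z u e k
  proof -
    obtain i where i: "vord C ?w u i" "poly.coeff (lpoly C ?w u) i \<noteq> 0" using ex_order[OF C fr] .
    have "i = l * k" using U.line_orders[OF fr B(3) _ _ _ d i k] tangent[OF fr] by blast
    then show ?thesis using int_mult_line[OF fr C(2) i] by simp
  qed
  have m: "vord C ?w u m" for u using curve_mult(1)[OF C(2) nz(2)] Cq(2) by simp
  obtain e0 where e0: "\<not> vord C ?w e0 (Suc m)" using curve_mult(2)[OF C(2) nz(2)] Cq(2) by blast
  have m0: "m > 0" using curve_mult_pos[OF C(2) nz(2) van(2)] Cq(2) by simp
  obtain x0 z u v where fr0: "frame x0 L z u v ?w" using frame_exists_line[OF L(1,2) vec_of(2) L(3)] .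
  \<comment> \<open>A direction away from \<open>L\<close> in which the contact of \<open>C\<close>
    is exactly its multiplicity; it gives \<open>int_mult C L q = l * m\<close>.\<close>
  obtain a where a: "poly.coeff (lpoly C ?w (a *s u + v)) m \<noteq> 0" using ex_direction[OF fr0 C(2) m e0] .
  obtain x where fr: "frame x L z u (a *s u + v) ?w" using frame_change_direction[OF fr0] .
  have om: "int_mult C L q = l * m" by (rule orders[OF fr m a])
  have "n = l * m"
  proof -
    obtain x' z' u' v' where fr': "frame x' L' z' u' v' ?w" using frame_exists_line[OF L'(1,2) vec_of(2) L'(3)] .
    obtain i where i: "vord C ?w u' i" "poly.coeff (lpoly C ?w u') i \<noteq> 0" using ex_order[OF C fr'] .
    have n: "n = i" using int_mult_line[OF fr' C(2) i] Cq(4) by simp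
    have "vord C ?w u' (Suc m)" using tangent_vord[OF C(2) nz(2) van(2) Cq(3) fr'] Cq(2) by simp
    then have im: "Suc m \<le> i" using vord_le i(2) by blast
    \<comment> \<open>If the tangent \<open>L'\<close> of \<open>C\<close> were a line other than
      \<open>L\<close>, its contact \<open>i\<close> would give
      \<open>int_mult C L q = l * i\<close> as well, contrary to \<open>i > m\<close>. So
      \<open>L'\<close> and \<open>L\<close> are the same line.\<close>
    show ?thesis
    proof (cases "teval L u' = 0")
      case True
      have "teval L v' \<noteq> 0"
      proof
        assume "teval L v' = 0"
        then have "L = 0" using frame_form1[OF fr' L(1)] True L(3) by simp
        then show False using L(2) by simp
      qed
      then have "frame x' L z' (u' - (teval L u' / teval L v') *s v') ((1 / teval L v') *s v') ?w"
        by (rule frame_change_aux[OF fr' L(1,3)])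
      then have "frame x' L z' u' ((1 / teval L v') *s v') ?w" by (simp add: True)
      then have "int_mult C L q = i" using int_mult_line[OF _ C(2) i] by blast
      then show ?thesis using om n by simp
    next
      case False
      define e where "e = (1 / teval L u') *s u'"
      have "frame L' L z' (v' - (teval L v' / teval L u') *s u') e ?w"
        unfolding e_def by (rule frame_change_aux[OF frame_swap[OF fr'] L(1,3) False])
      moreover have "vord C ?w e i" "poly.coeff (lpoly C ?w e) i \<noteq> 0"
        using i False by (simp_all add: e_def vord_def lcoeff_scale[OF C(2)])
      ultimately have "int_mult C L q = l * i" by (rule orders)
      moreover have "l \<ge> 2" using tangent[OF fr0] by blast
      ultimately show ?thesis using om im by simp
    qed
  qed
  moreover have "(real m - 1) * (real deg_B * real deg_C - real m) / 2 \<le> real \<delta>"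
  proof -
    obtain i where i: "vord C ?w u i" "poly.coeff (lpoly C ?w u) i \<noteq> 0" using ex_order[OF C fr] .
    show ?thesis using U.delta_ge[OF fr B(3) _ _ _ d i m a \<delta> m0] tangent[OF fr] by blast
  qed
  ultimately show ?thesis by (simp add: \<delta>')
qed

end
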